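(* For every $n\geq 1$ and all nonnegative integers $a,b$ with $a+b=n$, Schnyder labelings with $n$ inner faces, $a+2$ white vertices and $b+2$ black vertices, and whose two outer vertices labeled $G$ are non-isolated, are in bijection with $S$-transverse bipolar orientations with $n+4$ vertices, among which $a+2$ are white and $b+2$ are black.
   Context: Maps. A planar map is a connected multigraph embedded on the oriented sphere, considered up to orientation-preserving homeomorphism. It is rooted by marking a corner; the face incident to that corner is the outer face, and its vertex is the root-vertex. Vertices and edges incident to the outer face are called outer, the others inner; the faces other than the outer face are inner. Schnyder labelings. A $(6,4)$-dissection is a rooted planar map whose outer face contour is a simple cycle of length 6 and whose inner faces all have degree 4. It is bipartite, and its vertices are bicolored black/white so that the root-vertex is white. Its outer vertices are labeled $R,G,B,R,G,B$ in counterclockwise order around the outer face, starting with the root-vertex. An outer vertex is called isolated if it has degree 2 (i.e., it is not incident to an inner edge). A Schnyder labeling is a $(6,4)$-dissection endowed with a coloring of its inner edges in blue, green, red such that: (SL1) all inner edges incident to an outer vertex labeled $R$ (resp. $G$, $B$) are red (resp. green, blue); (SL2) the edges at each inner vertex form, in clockwise order, three non-empty groups of red, green and blue edges, respectively. Plane bipolar orientations. A plane bipolar orientation is a planar map with a distinguished outer face, endowed with an acyclic orientation having a unique source $S$ and a unique sink $N$, both incident to the outer face. The contour of each inner face $f$ is then partitioned into a left lateral path (the one having $f$ on its right) and a right lateral path (the one having $f$ on its left), both directed from the bottom vertex of $f$ to the top vertex of $f$; the interior of a lateral path is the path without its two extremities. The orientation has outer type $(2,2)$ if the two directed outer paths from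 $S$ to $N$ (one with the outer face on its left, the other with the outer face on its right) both have length 3. $S$-transverse bipolar orientations. An $S$-transverse bipolar orientation is a $(6,4)$-dissection $D$ whose edges are partitioned into plain edges, which are directed, and transversal edges, which are undirected, such that: (ST1) the plain edges span all vertices of $D$ and form a (bipartite) plane bipolar orientation $X$ of outer type $(2,2)$ with at least one inner face, the sink $N$ of $X$ being the (white) root-vertex of $D$; (ST2) each transversal edge is within an inner face $f$ of $X$ and connects a black vertex in the interior of the left lateral path of $f$ to a white vertex in the interior of the right lateral path of $f$; moreover, in every inner face $f$ of $X$, every black (resp. white) vertex in the interior of the left (resp. right) lateral path of $f$ is incident to at least one transversal edge within $f$. *)

theory Defs
  imports "HOL-Combinatorics.Orbits" "HOL-Combinatorics.Permutations"
begin

section \<open>Planar maps\<close>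

text \<open>
  A map is encoded combinatorially by its darts (half-edges, each thought of as leaving its
  origin). \<open>rot\<close> sends a dart to the next one in counterclockwise order around its origin, and
  \<open>opp\<close> to the other half of the same edge. Vertices and faces are orbits of darts: the vertex of
  a dart is its origin, and the face of a dart is the face on its right.
  Both permutations are the identity outside the darts. The one-vertex map, which has no dart,
  is not represented; none of the maps below can be reduced to a vertex.
\<close>

record 'd cmap =
  darts :: "'d set"
  rot :: "'d \<Rightarrow> 'd"
  opp :: "'d \<Rightarrow> 'd"

definition vertex_of :: "('d, 'x) cmap_scheme \<Rightarrow> 'd \<Rightarrow> 'd set" where
  "vertex_of M d = orbit (rot M) d"

definition target_of :: "('d, 'x) cmap_scheme \<Rightarrow> 'd \<Rightarrow> 'd set" where
  "target_of M d = vertex_of M (opp M d)"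

text \<open>
  The dart following \<open>d\<close> on the contour of the face on its right. The corner of that face at the
  origin of \<open>d\<close> lies between \<open>d\<close> and its clockwise successor, so darts also stand for corners.
\<close>

definition face_next :: "('d, 'x) cmap_scheme \<Rightarrow> 'd \<Rightarrow> 'd" where
  "face_next M d = rot M (opp M d)"

definition face_of :: "('d, 'x) cmap_scheme \<Rightarrow> 'd \<Rightarrow> 'd set" where
  "face_of M d = orbit (face_next M) d"

definition vertices :: "('d, 'x) cmap_scheme \<Rightarrow> 'd set set" where
  "vertices M = vertex_of M ` darts M"

definition edges :: "('d, 'x) cmap_scheme \<Rightarrow> 'd set set" where
  "edges M = (\<lambda>d. {d, opp M d}) ` darts M"

definition faces :: "('d, 'x) cmap_scheme \<Rightarrow> 'd set set" where
  "faces M = face_of M ` darts M"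

definition connected_map :: "('d, 'x) cmap_scheme \<Rightarrow> bool" where
  "connected_map M \<longleftrightarrow>
     (\<forall>d\<in>darts M. \<forall>e\<in>darts M.
        (d, e) \<in> ({(x, rot M x) | x. x \<in> darts M} \<union> {(x, opp M x) | x. x \<in> darts M})\<^sup>*)"

text \<open>Being embedded on the sphere is Euler's formula.\<close>

definition planar_map :: "('d, 'x) cmap_scheme \<Rightarrow> bool" where
  "planar_map M \<longleftrightarrow>
     finite (darts M) \<and> darts M \<noteq> {} \<and>
     rot M permutes darts M \<and> opp M permutes darts M \<and>
     (\<forall>d\<in>darts M. opp M d \<noteq> d \<and> opp M (opp M d) = d) \<and>
     connected_map M \<and>
     card (vertices M) + card (faces M) = card (edges M) + 2"


section \<open>(6,4)-dissections\<close>

text \<open>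
  The marked corner is the one between \<open>root\<close> and its clockwise successor, so the outer face is the
  face on the right of \<open>root\<close>. The bicoloring is recorded by its set of white vertices; by
  connectedness it is determined by the map and the root.
\<close>

record 'd dissection = "'d cmap" +
  root :: 'd
  white :: "'d set set"

definition outer_face :: "('d, 'x) dissection_scheme \<Rightarrow> 'd set" where
  "outer_face D = face_of D (root D)"

definition inner_faces :: "('d, 'x) dissection_scheme \<Rightarrow> 'd set set" where
  "inner_faces D = faces D - {outer_face D}"

definition black :: "('d, 'x) dissection_scheme \<Rightarrow> 'd set set" where
  "black D = vertices D - white D"

definition dissection64 :: "('d, 'x) dissection_scheme \<Rightarrow> bool" where
  "dissection64 D \<longleftrightarrow>
     planar_map D \<and> root D \<in> darts D \<and>
     card (outer_face D) = 6 \<and> inj_on (vertex_of D) (outer_face D) \<and>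
     (\<forall>f\<in>inner_faces D. card f = 4) \<and>
     white D \<subseteq> vertices D \<and>
     (\<forall>d\<in>darts D. vertex_of D d \<in> white D \<longleftrightarrow> target_of D d \<notin> white D) \<and>
     vertex_of D (root D) \<in> white D"

definition inner_darts :: "('d, 'x) dissection_scheme \<Rightarrow> 'd set" where
  "inner_darts D = {d \<in> darts D. d \<notin> outer_face D \<and> opp D d \<notin> outer_face D}"

definition inner_vertices :: "('d, 'x) dissection_scheme \<Rightarrow> 'd set set" where
  "inner_vertices D = {v \<in> vertices D. v \<inter> outer_face D = {}}"

text \<open>
  The outer face is on the right of the darts of its contour: with the outer face drawn as the
  unbounded one, following them turns counterclockwise around the hexagon.
\<close>

definition outer_vertex :: "('d, 'x) dissection_scheme \<Rightarrow> nat \<Rightarrow> 'd set" where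
  "outer_vertex D i = vertex_of D ((face_next D ^^ i) (root D))"

datatype colour = Red | Green | Blue

definition outer_label :: "nat \<Rightarrow> colour" where
  "outer_label i = [Red, Green, Blue, Red, Green, Blue] ! i"

definition isolated :: "('d, 'x) dissection_scheme \<Rightarrow> 'd set \<Rightarrow> bool" where
  "isolated D v \<longleftrightarrow> card v = 2"

text \<open>
  Homeomorphisms are encoded by dart bijections. Commuting with \<open>rot\<close>, as opposed to exchanging it
  with its inverse, is what makes the homeomorphism orientation-preserving.
\<close>

definition dissection_iso ::
    "('d \<Rightarrow> 'e) \<Rightarrow> 'd dissection \<Rightarrow> 'e dissection \<Rightarrow> bool" where
  "dissection_iso h D D' \<longleftrightarrow>
     bij_betw h (darts D) (darts D') \<and>
     (\<forall>d\<in>darts D. h (rot D d) = rot D' (h d) \<and> h (opp D d) = opp D' (h d)) \<and>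
     h (root D) = root D' \<and>
     (\<lambda>v. h ` v) ` white D = white D'"


section \<open>Schnyder labelings\<close>

definition clockwise_colours ::
    "('d, 'x) dissection_scheme \<Rightarrow> ('d \<Rightarrow> colour option) \<Rightarrow> 'd \<Rightarrow> colour option list" where
  "clockwise_colours D c d =
     map (\<lambda>k. c ((inv (rot D) ^^ k) d)) [0..<card (vertex_of D d)]"

definition schnyder_labeling ::
    "('d, 'x) dissection_scheme \<Rightarrow> ('d \<Rightarrow> colour option) \<Rightarrow> bool" where
  "schnyder_labeling D c \<longleftrightarrow>
     dissection64 D \<and>
     dom c = inner_darts D \<and> (\<forall>d\<in>inner_darts D. c (opp D d) = c d) \<and>
     (\<forall>i<6. \<forall>d\<in>outer_vertex D i \<inter> inner_darts D. c d = Some (outer_label i)) \<and>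
     (\<forall>v\<in>inner_vertices D. \<exists>d\<in>v. \<exists>i>0. \<exists>j>0. \<exists>k>0.
        clockwise_colours D c d =
          replicate i (Some Red) @ replicate j (Some Green) @ replicate k (Some Blue))"

definition schnyder_iso_rel ::
    "(('d dissection \<times> ('d \<Rightarrow> colour option)) \<times> ('d dissection \<times> ('d \<Rightarrow> colour option))) set" where
  "schnyder_iso_rel =
     {((D, c), (D', c')). schnyder_labeling D c \<and> schnyder_labeling D' c' \<and>
        (\<exists>h. dissection_iso h D D' \<and> (\<forall>d\<in>darts D. c' (h d) = c d))}"

text \<open>
  Isomorphism classes; every finite map has a copy whose darts are natural numbers. The outer
  vertices labeled \<open>Green\<close> are those at positions 1 and 4.
\<close>

definition schnyder_labelings ::
    "nat \<Rightarrow> nat \<Rightarrow> nat \<Rightarrow> (nat dissection \<times> (nat \<Rightarrow> colour option)) set set" where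
  "schnyder_labelings n p q =
     {(D, c). schnyder_labeling D c \<and> card (inner_faces D) = n \<and>
        card (white D) = p \<and> card (black D) = q \<and>
        (\<forall>i<6. outer_label i = Green \<longrightarrow> \<not> isolated D (outer_vertex D i))} // schnyder_iso_rel"


section \<open>Plane bipolar orientations\<close>

text \<open>
  An orientation is given by the set \<open>Or\<close> of the darts that point in the direction of their edge.
\<close>

definition orientation :: "('d, 'x) cmap_scheme \<Rightarrow> 'd set \<Rightarrow> bool" where
  "orientation M Or \<longleftrightarrow> Or \<subseteq> darts M \<and> (\<forall>d\<in>darts M. d \<in> Or \<longleftrightarrow> opp M d \<notin> Or)"

definition sources :: "('d, 'x) cmap_scheme \<Rightarrow> 'd set \<Rightarrow> 'd set set" where
  "sources M Or = {v \<in> vertices M. \<forall>d\<in>Or. target_of M d \<noteq> v}"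

definition sinks :: "('d, 'x) cmap_scheme \<Rightarrow> 'd set \<Rightarrow> 'd set set" where
  "sinks M Or = {v \<in> vertices M. \<forall>d\<in>Or. vertex_of M d \<noteq> v}"

definition plane_bipolar ::
    "('d, 'x) cmap_scheme \<Rightarrow> 'd set \<Rightarrow> 'd set \<Rightarrow> 'd set \<Rightarrow> 'd set \<Rightarrow> bool" where
  "plane_bipolar M f0 Or S N \<longleftrightarrow>
     planar_map M \<and> f0 \<in> faces M \<and> orientation M Or \<and>
     acyclic {(vertex_of M d, target_of M d) | d. d \<in> Or} \<and>
     sources M Or = {S} \<and> sinks M Or = {N} \<and>
     S \<in> vertex_of M ` f0 \<and> N \<in> vertex_of M ` f0"

definition directed_path ::
    "('d, 'x) cmap_scheme \<Rightarrow> 'd set \<Rightarrow> 'd set \<Rightarrow> 'd list \<Rightarrow> 'd set \<Rightarrow> bool" where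
  "directed_path M Or u p v \<longleftrightarrow>
     p \<noteq> [] \<and> set p \<subseteq> Or \<and> distinct p \<and>
     successively (\<lambda>d e. target_of M d = vertex_of M e) p \<and>
     vertex_of M (hd p) = u \<and> target_of M (last p) = v"

text \<open>
  The contour of the face \<open>f\<close> consists of a directed path \<open>p\<close> having \<open>f\<close> on its right and a directed
  path \<open>q\<close> having \<open>f\<close> on its left, both from \<open>u\<close> to \<open>v\<close>. For an inner face, \<open>p\<close> is the left and
  \<open>q\<close> the right lateral path.
\<close>

definition contour_paths ::
    "('d, 'x) cmap_scheme \<Rightarrow> 'd set \<Rightarrow> 'd set \<Rightarrow> 'd set \<Rightarrow> 'd set \<Rightarrow> 'd list \<Rightarrow> 'd list \<Rightarrow> bool" where
  "contour_paths M Or f u v p q \<longleftrightarrow>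
     directed_path M Or u p v \<and> set p = {d \<in> Or. d \<in> f} \<and>
     directed_path M Or u q v \<and> set q = {d \<in> Or. opp M d \<in> f}"

definition outer_type_2_2 ::
    "('d, 'x) cmap_scheme \<Rightarrow> 'd set \<Rightarrow> 'd set \<Rightarrow> 'd set \<Rightarrow> 'd set \<Rightarrow> bool" where
  "outer_type_2_2 M f0 Or S N \<longleftrightarrow>
     (\<exists>p q. contour_paths M Or f0 S N p q \<and> length p = 3 \<and> length q = 3)"

definition path_interior :: "('d, 'x) cmap_scheme \<Rightarrow> 'd list \<Rightarrow> 'd set set" where
  "path_interior M p = vertex_of M ` set (tl p)"


section \<open>S-transverse bipolar orientations\<close>

text \<open>
  The submap with set of darts \<open>P\<close>. For \<open>d \<in> P\<close>, \<open>next_in M P d = d\<close>; otherwise it is the first dart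
  of \<open>P\<close> met when turning counterclockwise from \<open>d\<close>, so that the corner of \<open>M\<close> at \<open>d\<close>, as well as
  \<open>d\<close> itself if not in \<open>P\<close>, lies within the corner \<open>next_in M P d\<close> of the submap.
\<close>

definition next_in :: "('d, 'x) cmap_scheme \<Rightarrow> 'd set \<Rightarrow> 'd \<Rightarrow> 'd" where
  "next_in M P d = (rot M ^^ (LEAST k. (rot M ^^ k) d \<in> P)) d"

definition submap :: "('d, 'x) cmap_scheme \<Rightarrow> 'd set \<Rightarrow> 'd cmap" where
  "submap M P =
     \<lparr>darts = P,
      rot = (\<lambda>d. if d \<in> P then next_in M P (rot M d) else d),
      opp = (\<lambda>d. if d \<in> P then opp M d else d)\<rparr>"

definition edge_within :: "('d, 'x) cmap_scheme \<Rightarrow> 'd set \<Rightarrow> 'd \<Rightarrow> 'd set \<Rightarrow> bool" where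
  "edge_within M P t f \<longleftrightarrow> next_in M P t \<in> f \<and> next_in M P (opp M t) \<in> f"

text \<open>
  The decoration of the edges is given by the set \<open>Or\<close> of the directed darts of the plain edges; the
  edges without a dart in \<open>Or\<close> are the transversal ones. A vertex of \<open>plain_map\<close> is a vertex of the
  dissection intersected with the plain darts.
\<close>

definition plain_darts :: "('d, 'x) cmap_scheme \<Rightarrow> 'd set \<Rightarrow> 'd set" where
  "plain_darts D Or = Or \<union> opp D ` Or"

definition transversal_darts :: "('d, 'x) cmap_scheme \<Rightarrow> 'd set \<Rightarrow> 'd set" where
  "transversal_darts D Or = darts D - plain_darts D Or"

definition plain_map :: "('d, 'x) cmap_scheme \<Rightarrow> 'd set \<Rightarrow> 'd cmap" where
  "plain_map D Or = submap D (plain_darts D Or)"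

definition plain_outer_face :: "('d, 'x) dissection_scheme \<Rightarrow> 'd set \<Rightarrow> 'd set" where
  "plain_outer_face D Or = face_of (plain_map D Or) (next_in D (plain_darts D Or) (root D))"

definition plain_inner_faces :: "('d, 'x) dissection_scheme \<Rightarrow> 'd set \<Rightarrow> 'd set set" where
  "plain_inner_faces D Or = faces (plain_map D Or) - {plain_outer_face D Or}"

definition ST1 :: "('d, 'x) dissection_scheme \<Rightarrow> 'd set \<Rightarrow> bool" where
  "ST1 D Or \<longleftrightarrow>
     (\<forall>v\<in>vertices D. v \<inter> plain_darts D Or \<noteq> {}) \<and>
     (\<exists>S N. plane_bipolar (plain_map D Or) (plain_outer_face D Or) Or S N \<and>
        outer_type_2_2 (plain_map D Or) (plain_outer_face D Or) Or S N \<and>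
        N = vertex_of D (root D) \<inter> plain_darts D Or) \<and>
     plain_inner_faces D Or \<noteq> {}"

definition ST2 :: "('d, 'x) dissection_scheme \<Rightarrow> 'd set \<Rightarrow> bool" where
  "ST2 D Or \<longleftrightarrow>
     (\<forall>t\<in>transversal_darts D Or. \<exists>f\<in>plain_inner_faces D Or.
        edge_within D (plain_darts D Or) t f) \<and>
     (\<forall>f\<in>plain_inner_faces D Or. \<exists>u v p q.
        contour_paths (plain_map D Or) Or f u v p q \<and>
        (\<forall>t\<in>transversal_darts D Or. edge_within D (plain_darts D Or) t f \<longrightarrow>
           (\<exists>x y. {vertex_of D t, target_of D t} = {x, y} \<and>
              x \<in> black D \<and> x \<in> path_interior D p \<and>
              y \<in> white D \<and> y \<in> path_interior D q)) \<and>
        (\<forall>x \<in> (black D \<inter> path_interior D p) \<union> (white D \<inter> path_interior D q).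
           \<exists>t\<in>transversal_darts D Or. edge_within D (plain_darts D Or) t f \<and> vertex_of D t = x))"

definition s_transverse :: "('d, 'x) dissection_scheme \<Rightarrow> 'd set \<Rightarrow> bool" where
  "s_transverse D Or \<longleftrightarrow>
     dissection64 D \<and> Or \<subseteq> darts D \<and> (\<forall>d\<in>Or. opp D d \<notin> Or) \<and> ST1 D Or \<and> ST2 D Or"

definition s_transverse_iso_rel ::
    "(('d dissection \<times> 'd set) \<times> ('d dissection \<times> 'd set)) set" where
  "s_transverse_iso_rel =
     {((D, Or), (D', Or')). s_transverse D Or \<and> s_transverse D' Or' \<and>
        (\<exists>h. dissection_iso h D D' \<and> h ` Or = Or')}"

definition s_transverse_orientations ::
    "nat \<Rightarrow> nat \<Rightarrow> nat \<Rightarrow> (nat dissection \<times> nat set) set set" where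
  "s_transverse_orientations m p q =
     {(D, Or). s_transverse D Or \<and> card (vertices D) = m \<and>
        card (white D) = p \<and> card (black D) = q} // s_transverse_iso_rel"

end

theory Submission
  imports Defs
begin

text \<open>
  The bijection keeps the dissection: green edges become transversal, and a red (resp. blue) edge is
  oriented from its black to its white (resp. white to its black) end. Everything reduces to counting
  with Euler's formula.

  Given a labeling, Euler's formula forces the contour of each inner face to show every colour change
  exactly once. If the orientation had a directed cycle, consider the region of the outer face cut out
  by that cycle: discharging along the colour changes gives it Euler characteristic 2, whereas the
  tree-cotree argument bounds it by 1. Acyclicity and another count of corners show that the plain
  edges form a bipolar orientation whose faces are the unions of the quadrangles linked by green edges.

  Given a transverse orientation, counting corners shows that each vertex other than the poles has one
  lateral corner on either side. They lie in different faces, by the tree-cotree bound in the dual map,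
  so the transversal edges at a black (resp. white) vertex are exactly in its right (resp. left)
  lateral corner. Since the faces of a dissection have degree 4, each inner face of the bipolar
  orientation contains a transversal edge, which determines the orientation around the outer vertices.
\<close>

section \<open>Finite permutations\<close>

text \<open>Planarity is available only as Euler's formula on dart permutations, and that a closed
  curve separates the sphere is never shown. Both arguments of that kind use one inequality on
  \<open>region\<close> instead, which holds whether or not the cut separates, and refute it by a
  count that is too large by one. In the same spirit, the planarity of the plain map and the
  identification of its faces are not obtained geometrically: three inequalities between numbers of
  vertices, edges and faces meet, and equality in each carries the information.

  The constants come from the balance of a labeling: n quadrangles, n - 2 inner vertices with one
  round of colours each, and two further rounds from the outer labels. A red-blue change has weight
  2, as much as the two changes through green, so that vertices and quadrangles have weight 4 and a
  red and a blue half-edge cut a vertex into sectors of weight 2.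

  The outer vertices escape the local rule of inner vertices and are treated one by one. The corner
  inside the hexagon at a green one must carry a transversal edge, which is where non-isolation
  enters.\<close>

locale finite_perm =
  fixes p :: "'a \<Rightarrow> 'a" and A :: "'a set"
  assumes permutes: "p permutes A" and finite: "finite A"
begin

lemma permutation: "permutation p"
  using permutes finite by (auto simp: permutation_permutes)

lemma self_in_orbit: "x \<in> orbit p x"
  by (rule permutation_self_in_orbit[OF permutation])

lemma orbit_eq: "y \<in> orbit p x \<Longrightarrow> orbit p y = orbit p x"
  using orbit_cyclic_eq3[OF cyclic_on_orbit[OF permutes finite]] by blast

lemma orbit_eq_iff: "orbit p y = orbit p x \<longleftrightarrow> y \<in> orbit p x"
  using orbit_eq self_in_orbit by blast

lemma orbit_subset: "x \<in> A \<Longrightarrow> orbit p x \<subseteq> A"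
  by (rule permutes_orbit_subset[OF permutes])

lemma inj: "inj p"
  using permutes by (rule permutes_inj)

lemma orbit_step: "orbit p (p x) = orbit p x"
  by (rule permutation_orbit_step[OF permutation])

lemma step_in_orbit_iff: "p y \<in> orbit p x \<longleftrightarrow> y \<in> orbit p x"
  using orbit_eq_iff orbit_step by metis

lemma finite_orbit: "finite (orbit p x)"
  by (rule Orbits.finite_orbit[OF self_in_orbit])

lemma bij_betw_orbit: "bij_betw p (orbit p x) (orbit p x)"
proof -
  have "p ` orbit p x \<subseteq> orbit p x" by (auto simp: step_in_orbit_iff)
  moreover have inj_on: "inj_on p (orbit p x)" by (rule inj_on_subset[OF inj]) simp
  ultimately have "p ` orbit p x = orbit p x"
    by (intro endo_inj_surj[OF finite_orbit])
  then show ?thesis using inj_on unfolding bij_betw_def by (intro conjI)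
qed

lemma orbits_disjoint:
  assumes "O1 \<in> orbit p ` A" "O2 \<in> orbit p ` A" "x \<in> O1" "x \<in> O2" shows "O1 = O2"
proof -
  obtain y z where "O1 = orbit p y" "O2 = orbit p z" using assms by blast
  then show ?thesis using assms orbit_eq[of x y] orbit_eq[of x z] by simp
qed

lemma sum_orbit_shift: "(\<Sum>y\<in>orbit p x. g (p y)) = (\<Sum>y\<in>orbit p x. g y)"
  using sum.reindex_bij_betw[OF bij_betw_orbit] by blast

lemma sum_Union_orbits:
  assumes "P \<subseteq> orbit p ` A"
  shows "(\<Sum>y\<in>\<Union>P. g y) = (\<Sum>c\<in>P. \<Sum>y\<in>c. g y)"
proof (rule sum.Union_disjoint[unfolded comp_def])
  show "\<forall>c\<in>P. finite c" using assms finite_orbit by blast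
  show "\<forall>O1\<in>P. \<forall>O2\<in>P. O1 \<noteq> O2 \<longrightarrow> O1 \<inter> O2 = {}"
  proof (intro ballI impI)
    fix O1 O2 assume "O1 \<in> P" "O2 \<in> P" "O1 \<noteq> O2"
    then show "O1 \<inter> O2 = {}" using assms orbits_disjoint[of O1 O2] by blast
  qed
qed

lemma Union_orbits: "\<Union> (orbit p ` A) = A"
  using orbit_subset self_in_orbit by blast

lemma sum_orbits: "(\<Sum>y\<in>A. g y) = (\<Sum>c\<in>orbit p ` A. \<Sum>y\<in>c. g y)"
  using sum_Union_orbits[of "orbit p ` A"] Union_orbits by simp

text \<open>The indicator of \<open>Q\<close> has the same sum over the orbit before and after a
  shift by \<open>p\<close>: a cyclic sequence leaves \<open>Q\<close> as often as it enters
  it.\<close>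

lemma card_changes:
  "card {y \<in> orbit p x. Q y \<and> \<not> Q (p y)} = card {y \<in> orbit p x. \<not> Q y \<and> Q (p y)}"
proof -
  have "(\<Sum>y\<in>orbit p x. of_bool (Q (p y)) :: nat) = (\<Sum>y\<in>orbit p x. of_bool (Q y))"
    by (rule sum_orbit_shift)
  moreover have "(\<Sum>y\<in>orbit p x. of_bool (R y) :: nat) = card {y \<in> orbit p x. R y}" for R
    using finite_orbit by (simp add: of_bool_def sum.If_cases Int_def)
  ultimately have "card {y \<in> orbit p x. Q (p y)} = card {y \<in> orbit p x. Q y}" by simp
  moreover have "card {y \<in> orbit p x. Q y} =
      card {y \<in> orbit p x. Q y \<and> \<not> Q (p y)} + card {y \<in> orbit p x. Q y \<and> Q (p y)}"
    using finite_orbit by (subst card_Un_disjoint[symmetric]) (auto intro!: arg_cong[where f=card])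
  moreover have "card {y \<in> orbit p x. Q (p y)} =
      card {y \<in> orbit p x. \<not> Q y \<and> Q (p y)} + card {y \<in> orbit p x. Q y \<and> Q (p y)}"
    using finite_orbit by (subst card_Un_disjoint[symmetric]) (auto intro!: arg_cong[where f=card])
  ultimately show ?thesis by linarith
qed

text \<open>The inductive definition of \<open>orbit\<close> starts at \<open>p x\<close>, not at
  \<open>x\<close>; this rule lets an invariant start at \<open>x\<close> itself and gives it
  membership in the orbit at each step.\<close>

lemma orbit_invariant:
  assumes "y \<in> orbit p x" "Q x" "\<And>z. z \<in> orbit p x \<Longrightarrow> Q z \<Longrightarrow> Q (p z)"
  shows "Q y"
  using assms(1)
proof induct
  case base then show ?case using assms self_in_orbit by blast
next
  case (step y) then show ?case using assms by blast
qed

lemma exists_change: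
  assumes "y \<in> orbit p x" "z \<in> orbit p x" "Q y" "\<not> Q z"
  shows "\<exists>w\<in>orbit p x. Q w \<and> \<not> Q (p w)"
proof (rule ccontr)
  assume "\<not> ?thesis"
  moreover have "orbit p y = orbit p x" using assms orbit_eq by blast
  ultimately have "Q z" using orbit_invariant[of z y Q] assms by metis
  then show False using assms by blast
qed

end

section \<open>Maps given by darts\<close>

text \<open>Connectedness and Euler's formula are left out on purpose: submaps and duals have to be
  handled as maps before these two properties are known for them.\<close>

locale dart_map =
  fixes M :: "('d, 'x) cmap_scheme"
  assumes finite_darts: "finite (darts M)"
    and rot_permutes: "rot M permutes darts M"
    and opp_permutes: "opp M permutes darts M"
    and opp_neq: "d \<in> darts M \<Longrightarrow> opp M d \<noteq> d"
    and opp_opp: "d \<in> darts M \<Longrightarrow> opp M (opp M d) = d"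
begin

lemma face_next_permutes: "face_next M permutes darts M"
proof -
  have "face_next M = rot M \<circ> opp M" by (auto simp: face_next_def)
  then show ?thesis using permutes_compose[OF opp_permutes rot_permutes] by simp
qed

sublocale rot: finite_perm "rot M" "darts M"
  by unfold_locales (rule rot_permutes, rule finite_darts)

sublocale face: finite_perm "face_next M" "darts M"
  by unfold_locales (rule face_next_permutes, rule finite_darts)

lemma opp_in_iff: "opp M d \<in> darts M \<longleftrightarrow> d \<in> darts M"
  using permutes_in_image[OF opp_permutes] .

lemma rot_in_iff: "rot M d \<in> darts M \<longleftrightarrow> d \<in> darts M"
  using permutes_in_image[OF rot_permutes] .

lemma face_next_in_iff: "face_next M d \<in> darts M \<longleftrightarrow> d \<in> darts M"
  using permutes_in_image[OF face_next_permutes] .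

lemma opp_inj: "opp M d = opp M e \<longleftrightarrow> d = e"
  using permutes_inj[OF opp_permutes] by (auto dest: injD)

lemma rot_inj: "rot M d = rot M e \<longleftrightarrow> d = e"
  using rot.inj by (auto dest: injD)

lemma face_next_inj: "face_next M d = face_next M e \<longleftrightarrow> d = e"
  using face.inj by (auto dest: injD)

lemma face_next_opp: "d \<in> darts M \<Longrightarrow> face_next M (opp M d) = rot M d"
  by (simp add: face_next_def opp_opp)

lemma vertex_of_self: "d \<in> vertex_of M d"
  unfolding vertex_of_def by (rule rot.self_in_orbit)

lemma vertex_of_eq: "e \<in> vertex_of M d \<Longrightarrow> vertex_of M e = vertex_of M d"
  unfolding vertex_of_def by (rule rot.orbit_eq)

lemma vertex_of_subset: "d \<in> darts M \<Longrightarrow> vertex_of M d \<subseteq> darts M"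
  unfolding vertex_of_def by (rule rot.orbit_subset)

lemma vertex_of_rot: "vertex_of M (rot M d) = vertex_of M d"
  unfolding vertex_of_def by (rule rot.orbit_step)

lemma finite_vertex_of: "finite (vertex_of M d)"
  unfolding vertex_of_def by (rule rot.finite_orbit)

lemma vertices_eq: "vertices M = orbit (rot M) ` darts M"
  by (simp add: vertices_def vertex_of_def)

lemma faces_eq: "faces M = orbit (face_next M) ` darts M"
  by (simp add: faces_def face_of_def)

lemma finite_vertices: "finite (vertices M)" and finite_faces: "finite (faces M)"
  using finite_darts by (auto simp: vertices_def faces_def)

lemma vertex_in_vertices: "d \<in> darts M \<Longrightarrow> vertex_of M d \<in> vertices M"
  by (simp add: vertices_def)

lemma target_in_vertices: "d \<in> darts M \<Longrightarrow> target_of M d \<in> vertices M"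
  by (simp add: vertices_def target_of_def opp_in_iff)

lemma in_verticesD:
  assumes "v \<in> vertices M" "d \<in> v" shows "d \<in> darts M \<and> vertex_of M d = v"
proof -
  obtain x where x: "x \<in> darts M" "v = vertex_of M x" using assms by (auto simp: vertices_def)
  then show ?thesis using assms vertex_of_eq[of d x] vertex_of_subset[of x] by auto
qed

lemma vertices_nonempty: "v \<in> vertices M \<Longrightarrow> v \<noteq> {}"
  using vertex_of_self by (auto simp: vertices_def)

lemma rot_in_vertex_iff: "v \<in> vertices M \<Longrightarrow> rot M d \<in> v \<longleftrightarrow> d \<in> v"
  by (auto simp: vertices_def vertex_of_def rot.step_in_orbit_iff)

lemma face_of_self: "d \<in> face_of M d"
  unfolding face_of_def by (rule face.self_in_orbit)

lemma face_of_eq: "e \<in> face_of M d \<Longrightarrow> face_of M e = face_of M d"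
  unfolding face_of_def by (rule face.orbit_eq)

lemma face_of_subset: "d \<in> darts M \<Longrightarrow> face_of M d \<subseteq> darts M"
  unfolding face_of_def by (rule face.orbit_subset)

lemma face_of_face_next: "face_of M (face_next M d) = face_of M d"
  unfolding face_of_def by (rule face.orbit_step)

lemma face_in_faces: "d \<in> darts M \<Longrightarrow> face_of M d \<in> faces M"
  by (simp add: faces_def)

lemma in_facesD:
  assumes "f \<in> faces M" "d \<in> f" shows "d \<in> darts M \<and> face_of M d = f"
proof -
  obtain x where x: "x \<in> darts M" "f = face_of M x" using assms by (auto simp: faces_def)
  then show ?thesis using assms face_of_eq[of d x] face_of_subset[of x] by auto
qed

lemma faces_nonempty: "f \<in> faces M \<Longrightarrow> f \<noteq> {}"
  using face_of_self by (auto simp: faces_def)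

lemma face_next_in_face_iff: "f \<in> faces M \<Longrightarrow> face_next M d \<in> f \<longleftrightarrow> d \<in> f"
  by (auto simp: faces_def face_of_def face.step_in_orbit_iff)

lemma face_of_rot: "d \<in> darts M \<Longrightarrow> face_of M (rot M d) = face_of M (opp M d)"
  using face_of_face_next[of "opp M d"] face_next_opp by simp

lemma vertex_of_face_next: "vertex_of M (face_next M d) = target_of M d"
  by (simp add: face_next_def target_of_def vertex_of_rot)

lemma target_of_opp: "d \<in> darts M \<Longrightarrow> target_of M (opp M d) = vertex_of M d"
  by (simp add: target_of_def opp_opp)

lemma card_edges: "2 * card (edges M) = card (darts M)"
proof -
  have "card (darts M) = (\<Sum>e\<in>edges M. card e)"
  proof -
    have "\<Union> (edges M) = darts M" using opp_in_iff by (auto simp: edges_def)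
    moreover have "card (\<Union> (edges M)) = (\<Sum>e\<in>edges M. card e)"
    proof (rule card_Union_disjoint)
      show "pairwise disjnt (edges M)"
        using opp_opp by (auto simp: pairwise_def disjnt_def edges_def opp_inj)
      show "\<And>A. A \<in> edges M \<Longrightarrow> finite A" by (auto simp: edges_def)
    qed
    ultimately show ?thesis by simp
  qed
  also have "\<dots> = (\<Sum>e\<in>edges M. 2)"
  proof (rule sum.cong[OF refl])
    fix e assume "e \<in> edges M"
    then obtain d where "d \<in> darts M" "e = {d, opp M d}" by (auto simp: edges_def)
    then show "card e = 2" using opp_neq[of d] by (auto simp: card_insert_if)
  qed
  finally show ?thesis by simp
qed

lemma connected_closed:
  assumes "connected_map M" "d \<in> darts M" "d \<in> Z"
    and "\<And>x. x \<in> Z \<Longrightarrow> x \<in> darts M \<Longrightarrow> rot M x \<in> Z"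
    and "\<And>x. x \<in> Z \<Longrightarrow> x \<in> darts M \<Longrightarrow> opp M x \<in> Z"
  shows "darts M \<subseteq> Z"
proof
  fix e assume "e \<in> darts M"
  then have "(d, e) \<in> ({(x, rot M x) | x. x \<in> darts M} \<union> {(x, opp M x) | x. x \<in> darts M})\<^sup>*"
    using assms unfolding connected_map_def by blast
  then show "e \<in> Z" by (induction) (use assms in auto)
qed

text \<open>The darts reachable from \<open>d\<close> form a set closed under forward steps, so it
  is enough to know such sets.\<close>

lemma connectedI:
  assumes "\<And>Z d. d \<in> darts M \<Longrightarrow> d \<in> Z \<Longrightarrow> Z \<subseteq> darts M \<Longrightarrow> (\<And>x. x \<in> Z \<Longrightarrow> rot M x \<in> Z) \<Longrightarrow>
     (\<And>x. x \<in> Z \<Longrightarrow> opp M x \<in> Z) \<Longrightarrow> Z = darts M"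
  shows "connected_map M"
  unfolding connected_map_def
proof (intro ballI)
  fix d e assume d: "d \<in> darts M" and e: "e \<in> darts M"
  let ?R = "{(x, rot M x) | x. x \<in> darts M} \<union> {(x, opp M x) | x. x \<in> darts M}"
  have sub: "{y. (d, y) \<in> ?R\<^sup>*} \<subseteq> darts M"
  proof
    fix y assume "y \<in> {y. (d, y) \<in> ?R\<^sup>*}"
    then have "(d, y) \<in> ?R\<^sup>*" by simp
    then show "y \<in> darts M" by induction (use d rot_in_iff opp_in_iff in auto)
  qed
  have "{y. (d, y) \<in> ?R\<^sup>*} = darts M"
  proof (rule assms[OF d])
    fix x assume x: "x \<in> {y. (d, y) \<in> ?R\<^sup>*}"
    then have "(x, rot M x) \<in> ?R" "(x, opp M x) \<in> ?R" using sub by auto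
    then show "rot M x \<in> {y. (d, y) \<in> ?R\<^sup>*}" "opp M x \<in> {y. (d, y) \<in> ?R\<^sup>*}"
      using x by (auto intro: rtrancl_into_rtrancl)
  qed (use sub in auto)
  then show "(d, e) \<in> ?R\<^sup>*" using e by auto
qed

end

section \<open>Trees and cotrees\<close>

text \<open>The function is the distance to \<open>W\<close> along \<open>R\<close>. Its strict
  decrease encodes a spanning forest rooted at \<open>W\<close>, and no tree has to be
  constructed.\<close>

lemma shortest_path_step:
  fixes R :: "('a \<times> 'a) set" and W :: "'a set"
  obtains dist :: "'a \<Rightarrow> nat" where
    "\<And>a w. w \<in> W \<Longrightarrow> (a, w) \<in> R\<^sup>* \<Longrightarrow> a \<notin> W \<Longrightarrow>
       \<exists>b. (a, b) \<in> R \<and> (\<exists>w\<in>W. (b, w) \<in> R\<^sup>*) \<and> dist b < dist a"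
proof
  define dist where "dist a = (LEAST n. \<exists>w\<in>W. (a, w) \<in> R ^^ n)" for a
  fix a w assume w: "w \<in> W" "(a, w) \<in> R\<^sup>*" and a: "a \<notin> W"
  then have "\<exists>n. \<exists>w\<in>W. (a, w) \<in> R ^^ n" by (meson rtrancl_imp_relpow)
  then have "\<exists>w\<in>W. (a, w) \<in> R ^^ dist a" unfolding dist_def by (rule LeastI_ex)
  then obtain w' where w': "w' \<in> W" "(a, w') \<in> R ^^ dist a" by blast
  then obtain k where k: "dist a = Suc k" using a by (cases "dist a") auto
  then obtain b where b: "(a, b) \<in> R" "(b, w') \<in> R ^^ k"
    using w' by (metis relpow_Suc_D2)
  have "dist b \<le> k" unfolding dist_def using w' b by (intro Least_le) auto
  then show "\<exists>b. (a, b) \<in> R \<and> (\<exists>w\<in>W. (b, w) \<in> R\<^sup>*) \<and> dist b < dist a"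
    using b w' k by (auto intro!: exI[of _ b] intro: relpow_imp_rtrancl)
qed

text \<open>The part of the sphere reachable from the face of \<^term>\<open>r\<close> without crossing the edges of \<^term>\<open>C\<close>.\<close>

inductive_set region :: "('d, 'x) cmap_scheme \<Rightarrow> 'd set \<Rightarrow> 'd \<Rightarrow> 'd set"
  for M :: "('d, 'x) cmap_scheme" and C :: "'d set" and r :: 'd where
  base: "r \<in> region M C r"
| face: "d \<in> region M C r \<Longrightarrow> face_next M d \<in> region M C r"
| cross: "d \<in> region M C r \<Longrightarrow> d \<notin> C \<Longrightarrow> opp M d \<in> region M C r"

context dart_map begin

lemma region_subset: assumes "r \<in> darts M" shows "region M C r \<subseteq> darts M"
proof
  fix d assume "d \<in> region M C r"
  then show "d \<in> darts M" by induction (use assms face_next_in_iff opp_in_iff in auto)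
qed

lemma region_face:
  assumes "d \<in> region M C r" "e \<in> face_of M d" shows "e \<in> region M C r"
  using face.orbit_invariant[of e d "\<lambda>e. e \<in> region M C r"] assms region.face[of _ M C r]
  unfolding face_of_def by blast

lemma region_face_next_iff: "face_next M d \<in> region M C r \<longleftrightarrow> d \<in> region M C r"
  using region_face[of "face_next M d" C r d] face_of_self[of d] face_of_face_next[of d]
    region.face[of d M C r] by auto

text \<open>The dart \<open>par f\<close> carries the edge of a dual spanning tree through which the
  face \<open>f\<close> is left towards the face of \<open>r\<close>. The region is explored without
  crossing \<open>C\<close>, so the tree avoids \<open>C\<close>.\<close>

lemma dual_tree:
  assumes r: "r \<in> darts M" and C: "\<And>d. d \<in> C \<Longrightarrow> opp M d \<in> C" "C \<subseteq> darts M"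
  defines "K \<equiv> region M C r"
  obtains dist :: "'d set \<Rightarrow> nat" and par :: "'d set \<Rightarrow> 'd" where
    "\<And>f. f \<in> face_of M ` K \<Longrightarrow> f \<noteq> face_of M r \<Longrightarrow>
       par f \<in> f \<and> par f \<in> K - C \<and> dist (face_of M (opp M (par f))) < dist f"
proof -
  define R where "R = {(face_of M d, face_of M (opp M d)) | d. d \<in> K - C}"
  have sub: "K \<subseteq> darts M" unfolding K_def using r by (rule region_subset)
  have symR: "sym R"
  proof (rule symI)
    fix f g assume "(f, g) \<in> R"
    then obtain d where d: "d \<in> K - C" "f = face_of M d" "g = face_of M (opp M d)"
      by (auto simp: R_def)
    have "opp M d \<in> K - C" using d C(1)[of "opp M d"] sub opp_opp[of d]
      by (auto simp: K_def intro: region.cross)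
    then show "(g, f) \<in> R" using d sub opp_opp by (auto simp: R_def intro!: exI[of _ "opp M d"])
  qed
  have reach: "(face_of M r, face_of M d) \<in> R\<^sup>*" if "d \<in> K" for d
    using that[unfolded K_def]
  proof induction
    case base then show ?case by simp
  next
    case (face d) then show ?case by (simp add: face_of_face_next)
  next
    case (cross d)
    then have "(face_of M d, face_of M (opp M d)) \<in> R" by (auto simp: R_def K_def)
    then show ?case using cross by (meson rtrancl_into_rtrancl)
  qed
  obtain dist :: "'d set \<Rightarrow> nat" where dist:
    "\<And>a w. w \<in> {face_of M r} \<Longrightarrow> (a, w) \<in> R\<^sup>* \<Longrightarrow> a \<notin> {face_of M r} \<Longrightarrow>
       \<exists>b. (a, b) \<in> R \<and> (\<exists>w\<in>{face_of M r}. (b, w) \<in> R\<^sup>*) \<and> dist b < dist a"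
    using shortest_path_step[of "{face_of M r}" R] by metis
  have "\<exists>d. d \<in> f \<and> d \<in> K - C \<and> dist (face_of M (opp M d)) < dist f"
    if f: "f \<in> face_of M ` K" "f \<noteq> face_of M r" for f
  proof -
    have "(f, face_of M r) \<in> R\<^sup>*"
      using f reach sym_rtrancl[OF symR] by (auto dest: symD)
    then obtain b where "(f, b) \<in> R" "dist b < dist f" using dist f by blast
    then show ?thesis using face_of_self by (auto simp: R_def)
  qed
  then obtain par where "\<And>f. f \<in> face_of M ` K \<Longrightarrow> f \<noteq> face_of M r \<Longrightarrow>
       par f \<in> f \<and> par f \<in> K - C \<and> dist (face_of M (opp M (par f))) < dist f"
    by metis
  then show ?thesis by (rule that)
qed

text \<open>The class function \<open>cls\<close> stands for \<open>vertex_of\<close> or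
  \<open>face_of\<close>, so that one count serves trees and cotrees. If one edge were the parent
  edge of two nodes, each would be closer to the root than the other.\<close>

lemma card_tree_darts:
  assumes "finite F"
    and par: "\<And>x. x \<in> F \<Longrightarrow> par x \<in> darts M \<and> cls (par x) = x \<and> (dist (cls (opp M (par x))) :: nat) < dist x"
  shows "card (par ` F \<union> opp M ` par ` F) = 2 * card F"
proof -
  have inj: "inj_on par F" using par by (metis inj_onI)
  then have 1: "card (par ` F) = card F" by (rule card_image)
  have 2: "card (opp M ` par ` F) = card F"
    using 1 opp_inj by (metis card_image inj_onI)
  have "par ` F \<inter> opp M ` par ` F = {}"
  proof (rule ccontr)
    assume "par ` F \<inter> opp M ` par ` F \<noteq> {}"
    then obtain x y where xy: "x \<in> F" "y \<in> F" "par x = opp M (par y)" by blast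
    then have "opp M (par x) = par y" using par opp_opp by metis
    then show False using xy par[of x] par[of y] by auto
  qed
  then show ?thesis using 1 2 assms(1) by (subst card_Un_disjoint) auto
qed

text \<open>A spanning tree of the faces of the region has one edge less than there are faces, and
  its darts all lie in the region and outside \<open>C\<close>.\<close>

lemma card_region_faces:
  assumes r: "r \<in> darts M" and C: "\<And>d. d \<in> C \<Longrightarrow> opp M d \<in> C" "C \<subseteq> darts M"
  shows "2 * card (face_of M ` region M C r) \<le> card (region M C r - C) + 2"
proof -
  let ?K = "region M C r"
  let ?F = "face_of M ` ?K - {face_of M r}"
  have sub: "?K \<subseteq> darts M" using r by (rule region_subset)
  then have fin: "finite ?K" using finite_darts finite_subset by blast
  obtain dist :: "'d set \<Rightarrow> nat" and par where par: "\<And>f. f \<in> face_of M ` ?K \<Longrightarrow> f \<noteq> face_of M r \<Longrightarrow>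
       par f \<in> f \<and> par f \<in> ?K - C \<and> dist (face_of M (opp M (par f))) < dist f"
    using dual_tree[OF r C] by metis
  have "card (par ` ?F \<union> opp M ` par ` ?F) = 2 * card ?F"
  proof (rule card_tree_darts[where cls="face_of M" and dist=dist])
    show "finite ?F" using fin by simp
    fix f assume "f \<in> ?F"
    then show "par f \<in> darts M \<and> face_of M (par f) = f \<and> dist (face_of M (opp M (par f))) < dist f"
      using par[of f] sub face_of_eq by blast
  qed
  moreover have "par ` ?F \<union> opp M ` par ` ?F \<subseteq> ?K - C"
  proof -
    have "par f \<in> ?K - C" if "f \<in> ?F" for f using par that by blast
    moreover have "opp M d \<in> ?K - C" if "d \<in> ?K - C" for d
      using that C sub opp_opp by (metis Diff_iff in_mono region.cross)
    ultimately show ?thesis by blast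
  qed
  ultimately have "2 * card ?F \<le> card (?K - C)"
    using fin by (metis card_mono finite_Diff)
  moreover have "card ?F = card (face_of M ` ?K) - 1"
    using region.base[of r M C] by (subst card_Diff_singleton) auto
  ultimately show ?thesis by linarith
qed

text \<open>
  A dual spanning tree does not disconnect the vertices: the deepest tree edge leaving a set of
  vertices would be the only edge of the contour of some face to do so.
\<close>

theorem region_euler:
  assumes conn: "connected_map M" and r: "r \<in> darts M"
    and C: "\<And>d. d \<in> C \<Longrightarrow> opp M d \<in> C" "C \<subseteq> darts M"
    and U: "U \<subseteq> vertices M" "U \<noteq> vertices M" "\<And>u. u \<in> U \<Longrightarrow> u \<subseteq> region M C r - C"
  shows "2 * card U + 2 * card (face_of M ` region M C r) \<le> card (region M C r - C) + 2"
proof -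
  let ?K = "region M C r"
  let ?F = "face_of M ` ?K - {face_of M r}"
  have sub: "?K \<subseteq> darts M" using r by (rule region_subset)
  then have fin: "finite ?K" using finite_darts finite_subset by blast
  obtain dist :: "'d set \<Rightarrow> nat" and par where par: "\<And>f. f \<in> face_of M ` ?K \<Longrightarrow> f \<noteq> face_of M r \<Longrightarrow>
       par f \<in> f \<and> par f \<in> ?K - C \<and> dist (face_of M (opp M (par f))) < dist f"
    using dual_tree[OF r C] by metis
  define F where "F = ?F"
  define T where "T = par ` F \<union> opp M ` par ` F"
  have par': "par f \<in> darts M \<and> face_of M (par f) = f \<and> dist (face_of M (opp M (par f))) < dist f"
    if "f \<in> F" for f
    using par[of f] sub face_of_eq that unfolding F_def by blast
  have cT: "card T = 2 * card F"
    unfolding T_def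
    by (rule card_tree_darts[where cls="face_of M" and dist=dist]) (use fin par' in \<open>auto simp: F_def\<close>)
  have oKC: "opp M d \<in> ?K - C" if "d \<in> ?K - C" for d
    using that C sub opp_opp by (metis Diff_iff in_mono region.cross)
  have TK: "T \<subseteq> ?K - C" using par oKC unfolding T_def F_def by blast
  have Topp1: "opp M d \<in> T" if dT: "d \<in> T" for d
  proof -
    from dT obtain f where f: "f \<in> F" "d = par f \<or> d = opp M (par f)" unfolding T_def by blast
    then have "opp M d = opp M (par f) \<or> opp M d = par f" using par'[OF f(1)] opp_opp by auto
    then show ?thesis using f unfolding T_def by blast
  qed
  have Topp: "opp M d \<in> T \<longleftrightarrow> d \<in> T" if "d \<in> darts M" for d
    using Topp1[of d] Topp1[of "opp M d"] opp_opp[OF that] by metis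
  \<comment> \<open>The graph that remains on the vertices once the edges of the dual tree are
    removed. The set \<open>Z\<close> collects the vertices that \<open>W\<close> cannot be reached
    from in this graph; the aim is to show it empty.\<close>
  define R where "R = {(vertex_of M d, target_of M d) | d. d \<in> darts M - T}"
  define W where "W = vertices M - U"
  define Z where "Z = {v \<in> vertices M. \<forall>w\<in>W. (v, w) \<notin> R\<^sup>*}"
  \<comment> \<open>A vertex outside \<open>U\<close> is needed as a root of the primal
    forest.\<close>
  have Wne: "W \<noteq> {}" using U W_def by auto
  have ZW: "Z \<inter> W = {}" by (auto simp: Z_def)
  have crossT: "d \<in> T" if d: "d \<in> darts M" "vertex_of M d \<in> Z" "target_of M d \<notin> Z" for d
  proof (rule ccontr)
    assume "d \<notin> T"
    then have "(vertex_of M d, target_of M d) \<in> R" using d by (auto simp: R_def)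
    moreover obtain w where "w \<in> W" "(target_of M d, w) \<in> R\<^sup>*"
      using d target_in_vertices by (auto simp: Z_def)
    ultimately show False using d by (auto simp: Z_def dest: converse_rtrancl_into_rtrancl)
  qed
  have crossT': "d \<in> T" if d: "d \<in> darts M" "(vertex_of M d \<in> Z) \<noteq> (target_of M d \<in> Z)" for d
  proof (cases "vertex_of M d \<in> Z")
    case True then show ?thesis using crossT d by blast
  next
    case False
    then have "opp M d \<in> T" using d crossT[of "opp M d"]
      by (simp add: opp_in_iff target_of_opp) (simp add: target_of_def)
    then show ?thesis using Topp d by blast
  qed
  have Zempty: "Z = {}"
  proof (rule ccontr)
    assume "Z \<noteq> {}"
    then obtain z where z: "z \<in> Z" by blast
    then obtain d0 where d0: "d0 \<in> darts M" "vertex_of M d0 \<in> Z" by (auto simp: Z_def vertices_def)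
    have "\<exists>d\<in>darts M. vertex_of M d \<in> Z \<and> target_of M d \<notin> Z"
    proof (rule ccontr)
      assume no: "\<not> ?thesis"
      have "darts M \<subseteq> {d \<in> darts M. vertex_of M d \<in> Z}"
        by (rule connected_closed[OF conn d0(1)])
          (use d0 no in \<open>auto simp: vertex_of_rot rot_in_iff opp_in_iff target_of_def\<close>)
      then have "vertices M \<subseteq> Z" by (auto simp: vertices_def)
      then show False using Wne ZW by (auto simp: W_def)
    qed
    then obtain d where d: "d \<in> darts M" "(vertex_of M d \<in> Z) \<noteq> (target_of M d \<in> Z)" by blast
    \<comment> \<open>The tree edges between \<open>Z\<close> and its complement, indexed by the
      face whose parent edge they are. On the contour of the deepest such face \<open>f\<close> no
      other one occurs: it would be the parent edge of a still deeper face.\<close>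
    define X where "X = {f \<in> F. (vertex_of M (par f) \<in> Z) \<noteq> (target_of M (par f) \<in> Z)}"
    have inX: "(\<exists>g\<in>X. d = par g \<or> d = opp M (par g))"
      if "d \<in> darts M" "(vertex_of M d \<in> Z) \<noteq> (target_of M d \<in> Z)" for d
    proof -
      from that have "d \<in> T" by (rule crossT')
      then obtain g where g: "g \<in> F" "d = par g \<or> d = opp M (par g)" unfolding T_def by blast
      then have "g \<in> X" using that par'[of g] unfolding X_def
        by (auto simp: target_of_def opp_opp)
      then show ?thesis using g by blast
    qed
    have "finite X" "X \<noteq> {}" using fin inX[OF d] by (auto simp: X_def F_def)
    then have "Max (dist ` X) \<in> dist ` X" by (intro Max_in) auto
    then obtain f where "f \<in> X" "Max (dist ` X) = dist f" by blast
    then have f: "f \<in> X" "\<And>g. g \<in> X \<Longrightarrow> dist g \<le> dist f"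
      using \<open>finite X\<close> Max_ge[of "dist ` X"] by auto
    then have fF: "f \<in> F" by (auto simp: X_def)
    then have ff: "f \<in> faces M" using sub face_in_faces unfolding F_def by blast
    have only: "d = par f" if d: "d \<in> f" "(vertex_of M d \<in> Z) \<noteq> (target_of M d \<in> Z)" for d
    proof -
      have fd: "f = face_of M d" "d \<in> darts M"
        using in_facesD[OF ff d(1)] by auto
      then obtain g where g: "g \<in> X" "d = par g \<or> d = opp M (par g)" using inX d(2) by blast
      then have gF: "g \<in> F" by (auto simp: X_def)
      show ?thesis
      proof (cases "d = par g")
        case True then show ?thesis using fd par'[OF gF] by simp
      next
        case False
        then have "dist f < dist g" using g fd par'[OF gF] by simp
        then show ?thesis using f(2)[OF g(1)] by simp
      qed
    qed
    let ?i = "\<lambda>d. of_bool (vertex_of M d \<in> Z) :: int"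
    have fo: "f = orbit (face_next M) (par f)" using par'[OF fF] by (simp add: face_of_def)
    \<comment> \<open>Around the closed contour of \<open>f\<close> the indicator of
      \<open>Z\<close> telescopes to 0, although it changes at \<open>par f\<close> and nowhere
      else.\<close>
    have "(\<Sum>d\<in>f. ?i (face_next M d) - ?i d) = 0"
      using face.sum_orbit_shift[of ?i "par f"] fo by (simp add: sum_subtractf)
    moreover have "(\<Sum>d\<in>f. ?i (face_next M d) - ?i d) = (\<Sum>d\<in>{par f}. ?i (face_next M d) - ?i d)"
    proof (rule sum.mono_neutral_right)
      show "finite f" using fo face.finite_orbit by metis
      show "{par f} \<subseteq> f" using par fF unfolding F_def by blast
      show "\<forall>d\<in>f - {par f}. ?i (face_next M d) - ?i d = 0"
        using only by (auto simp: vertex_of_face_next)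
    qed
    ultimately show False using f by (auto simp: X_def vertex_of_face_next)
  qed
  \<comment> \<open>As \<open>Z\<close> is empty, every vertex of \<open>U\<close> has a path to
    \<open>W\<close> that avoids the dual tree. The first edges of shortest paths are the primal
    forest, disjoint from \<open>T\<close>.\<close>
  obtain dist' :: "'d set \<Rightarrow> nat" where dist': "\<And>a w. w \<in> W \<Longrightarrow> (a, w) \<in> R\<^sup>* \<Longrightarrow> a \<notin> W \<Longrightarrow>
       \<exists>b. (a, b) \<in> R \<and> (\<exists>w\<in>W. (b, w) \<in> R\<^sup>*) \<and> dist' b < dist' a"
    using shortest_path_step[of W R] by metis
  have "\<exists>d. d \<in> darts M - T \<and> vertex_of M d = u \<and> dist' (target_of M d) < dist' u" if "u \<in> U" for u
  proof -
    have "u \<in> vertices M" "u \<notin> W" "u \<notin> Z" using that U Zempty by (auto simp: W_def)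
    then obtain w where "w \<in> W" "(u, w) \<in> R\<^sup>*" by (auto simp: Z_def)
    then obtain b where "(u, b) \<in> R" "dist' b < dist' u" using dist' \<open>u \<notin> W\<close> by blast
    then show ?thesis by (auto simp: R_def)
  qed
  then obtain q where q: "\<And>u. u \<in> U \<Longrightarrow> q u \<in> darts M - T \<and> vertex_of M (q u) = u \<and> dist' (target_of M (q u)) < dist' u"
    by metis
  have finU: "finite U" using U finite_vertices finite_subset by blast
  let ?S = "q ` U \<union> opp M ` q ` U"
  have cS: "card ?S = 2 * card U"
    by (rule card_tree_darts[where cls="vertex_of M" and dist=dist'])
      (use q finU in \<open>auto simp: target_of_def\<close>)
  have qK: "q u \<in> ?K - C" if "u \<in> U" for u
    using q[OF that] U(3)[OF that] vertex_of_self[of "q u"] by auto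
  then have SK: "?S \<subseteq> ?K - C" using oKC by blast
  have ST: "?S \<inter> T = {}" using q Topp by blast
  have "2 * card U + 2 * card F = card (?S \<union> T)"
  proof -
    have "finite ?S" "finite T" using finU fin by (auto simp: T_def F_def)
    then show ?thesis using ST cS cT by (simp add: card_Un_disjoint)
  qed
  also have "\<dots> \<le> card (?K - C)" using SK TK fin by (intro card_mono) auto
  finally have "2 * card U + 2 * card F \<le> card (?K - C)" .
  moreover have "card F = card (face_of M ` ?K) - 1"
    unfolding F_def using region.base[of r M C] by (subst card_Diff_singleton) auto
  ultimately show ?thesis by linarith
qed

end

section \<open>Submaps and dual maps\<close>

text \<open>As \<open>P\<close> meets every vertex, the \<open>LEAST\<close> in
  \<open>next_in\<close> is always attained and deleting edges loses no vertex.\<close>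

locale spanning_submap = dart_map M for M :: "('d, 'x) cmap_scheme" +
  fixes P :: "'d set"
  assumes P_subset: "P \<subseteq> darts M" and P_opp: "d \<in> P \<Longrightarrow> opp M d \<in> P"
    and spanning: "v \<in> vertices M \<Longrightarrow> v \<inter> P \<noteq> {}"
begin

lemma opp_in_P_iff: "d \<in> darts M \<Longrightarrow> opp M d \<in> P \<longleftrightarrow> d \<in> P"
  using P_opp[of d] P_opp[of "opp M d"] opp_opp by auto

lemma finite_P: "finite P"
  using P_subset finite_darts finite_subset by blast

lemma rot_power_in_P:
  assumes "d \<in> darts M" shows "\<exists>k. (rot M ^^ k) d \<in> P"
proof -
  obtain e where "e \<in> vertex_of M d" "e \<in> P"
    using spanning[OF vertex_in_vertices[OF assms]] by blast
  then show ?thesis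
    using orbit_altdef_permutation[OF rot.permutation, of d] by (auto simp: vertex_of_def)
qed

lemma next_in_P: "d \<in> P \<Longrightarrow> next_in M P d = d"
  by (simp add: next_in_def Least_eq_0)

lemma next_in_step:
  assumes "d \<in> darts M" "d \<notin> P" shows "next_in M P (rot M d) = next_in M P d"
proof -
  obtain k where k: "(rot M ^^ k) d \<in> P" using rot_power_in_P[OF assms(1)] by blast
  have "(LEAST k. (rot M ^^ k) d \<in> P) = Suc (LEAST k. (rot M ^^ Suc k) d \<in> P)"
    by (rule Least_Suc[where P="\<lambda>k. (rot M ^^ k) d \<in> P", OF k]) (use assms in simp)
  then show ?thesis by (simp add: next_in_def funpow_swap1)
qed

text \<open>Induction on the number of rotations needed to reach \<open>P\<close>.\<close>

lemma next_in_induct [consumes 1, case_names base step]: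
  assumes "d \<in> darts M" "\<And>d. d \<in> P \<Longrightarrow> Q d"
    and "\<And>d. d \<in> darts M \<Longrightarrow> d \<notin> P \<Longrightarrow> Q (rot M d) \<Longrightarrow> Q d"
  shows "Q d"
proof -
  obtain k where k: "(rot M ^^ k) d \<in> P" using rot_power_in_P[OF assms(1)] by blast
  then show ?thesis using assms(1)
  proof (induction k arbitrary: d)
    case 0 then show ?case using assms(2) by simp
  next
    case (Suc k)
    have "Q (rot M d)" by (rule Suc.IH) (use Suc.prems rot_in_iff in \<open>auto simp: funpow_swap1\<close>)
    then show ?case using assms(2,3) Suc.prems(2) by blast
  qed
qed

text \<open>The opposite direction: starting just after a dart of \<open>P\<close>, every dart is
  reached by rotating through darts outside \<open>P\<close>.\<close>

lemma prev_in_induct [consumes 1, case_names base step]: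
  assumes "d \<in> darts M" "\<And>b. b \<in> P \<Longrightarrow> Q (rot M b)"
    and "\<And>d. d \<in> darts M \<Longrightarrow> d \<notin> P \<Longrightarrow> Q d \<Longrightarrow> Q (rot M d)"
  shows "Q d"
proof -
  obtain e where e: "e \<in> vertex_of M d" "e \<in> P"
    using spanning[OF vertex_in_vertices[OF assms(1)]] by blast
  then have "vertex_of M (rot M e) = vertex_of M d" using vertex_of_eq vertex_of_rot by metis
  then have "d \<in> vertex_of M (rot M e)" using vertex_of_self by metis
  then have "d \<in> darts M \<and> Q d"
    unfolding vertex_of_def
  proof (rule rot.orbit_invariant)
    show "rot M e \<in> darts M \<and> Q (rot M e)" using e P_subset rot_in_iff assms(2) by blast
    fix z assume "z \<in> darts M \<and> Q z"
    then show "rot M z \<in> darts M \<and> Q (rot M z)"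
      using assms(2)[of z] assms(3)[of z] rot_in_iff by blast
  qed
  then show ?thesis by simp
qed

lemma next_in_mem: "d \<in> darts M \<Longrightarrow> next_in M P d \<in> P \<and> next_in M P d \<in> vertex_of M d"
proof (induction rule: next_in_induct)
  case (base d) then show ?case by (simp add: next_in_P vertex_of_self)
next
  case (step d) then show ?case using next_in_step[of d] vertex_of_rot[of d] by simp
qed

text \<open>The dart \<open>b\<close> is the last one of \<open>P\<close> before \<open>d\<close>;
  together with \<open>next_in M P d\<close> it bounds the corner of the submap in which
  \<open>d\<close> lies.\<close>

lemma prev_in: "d \<in> darts M \<Longrightarrow> \<exists>b\<in>P. b \<in> vertex_of M d \<and> next_in M P (rot M b) = next_in M P d"
proof (induction rule: prev_in_induct)
  case (base b) then show ?case using vertex_of_rot[of b] vertex_of_self[of b] by auto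
next
  case (step d) then show ?case using next_in_step[of d] vertex_of_rot[of d] by auto
qed

abbreviation X where "X \<equiv> submap M P"

lemma darts_X [simp]: "darts X = P"
  by (simp add: submap_def)

lemma rot_X: "d \<in> P \<Longrightarrow> rot X d = next_in M P (rot M d)"
  by (simp add: submap_def)

lemma opp_X: "d \<in> P \<Longrightarrow> opp X d = opp M d"
  by (simp add: submap_def)

text \<open>By \<open>prev_in\<close> the map is onto \<open>P\<close>, which suffices on a finite
  set.\<close>

lemma rot_X_permutes: "rot X permutes P"
proof (rule bij_imp_permutes)
  have "rot X ` P = P"
  proof
    show "rot X ` P \<subseteq> P" using next_in_mem rot_in_iff P_subset by (auto simp: rot_X)
    show "P \<subseteq> rot X ` P"
    proof
      fix e assume e: "e \<in> P"
      then obtain b where "b \<in> P" "next_in M P (rot M b) = next_in M P e"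
        using prev_in P_subset by blast
      then show "e \<in> rot X ` P" using next_in_P[OF e] by (auto simp: rot_X intro!: image_eqI[of _ _ b])
    qed
  qed
  then show "bij_betw (rot X) P P"
    using finite_surj_inj[OF finite_P] by (auto simp: bij_betw_def)
  show "\<And>d. d \<notin> P \<Longrightarrow> rot X d = d" by (simp add: submap_def)
qed

lemma opp_X_permutes: "opp X permutes P"
proof (rule bij_imp_permutes)
  have "opp X ` P \<subseteq> P" using P_opp by (auto simp: opp_X)
  moreover have "inj_on (opp X) P" using opp_inj by (auto simp: inj_on_def opp_X)
  ultimately show "bij_betw (opp X) P P"
    using endo_inj_surj[OF finite_P] by (auto simp: bij_betw_def)
  show "\<And>d. d \<notin> P \<Longrightarrow> opp X d = d" by (simp add: submap_def)
qed

sublocale X: dart_map X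
proof
  show "finite (darts X)" using finite_P by simp
  show "rot X permutes darts X" using rot_X_permutes by simp
  show "opp X permutes darts X" using opp_X_permutes by simp
  fix d assume "d \<in> darts X"
  then show "opp X d \<noteq> d" "opp X (opp X d) = d"
    using opp_neq[of d] opp_opp[of d] P_subset P_opp by (auto simp: opp_X)
qed

text \<open>For the harder inclusion, the invariant carried along \<open>rot M\<close> is that the
  next dart of \<open>P\<close> belongs to the orbit of \<open>rot X\<close>.\<close>

lemma vertex_of_X:
  assumes "d \<in> P" shows "vertex_of X d = vertex_of M d \<inter> P"
proof
  show "vertex_of X d \<subseteq> vertex_of M d \<inter> P"
  proof
    fix e assume "e \<in> vertex_of X d"
    then have "e \<in> orbit (rot X) d" by (simp add: vertex_of_def)
    then show "e \<in> vertex_of M d \<inter> P"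
    proof (rule X.rot.orbit_invariant)
      show "d \<in> vertex_of M d \<inter> P" using assms vertex_of_self by simp
      fix z assume z: "z \<in> vertex_of M d \<inter> P"
      then have "rot M z \<in> darts M" using P_subset rot_in_iff by blast
      then show "rot X z \<in> vertex_of M d \<inter> P"
        using z next_in_mem[of "rot M z"] vertex_of_rot[of z] vertex_of_eq[of z d] by (auto simp: rot_X)
    qed
  qed
  show "vertex_of M d \<inter> P \<subseteq> vertex_of X d"
  proof
    fix e assume e: "e \<in> vertex_of M d \<inter> P"
    then have "e \<in> orbit (rot M) d" by (simp add: vertex_of_def)
    then have "e \<in> darts M \<and> next_in M P e \<in> vertex_of X d"
    proof (rule rot.orbit_invariant)
      show "d \<in> darts M \<and> next_in M P d \<in> vertex_of X d"
        using assms P_subset X.vertex_of_self by (auto simp: next_in_P)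
      fix z assume z: "z \<in> darts M \<and> next_in M P z \<in> vertex_of X d"
      show "rot M z \<in> darts M \<and> next_in M P (rot M z) \<in> vertex_of X d"
      proof (cases "z \<in> P")
        case True
        then have "z \<in> vertex_of X d" using z by (simp add: next_in_P)
        then have "rot X z \<in> vertex_of X d" unfolding vertex_of_def by (rule orbit.step)
        then show ?thesis using z True rot_in_iff by (simp add: rot_X)
      next
        case False then show ?thesis using z rot_in_iff next_in_step by simp
      qed
    qed
    then show "e \<in> vertex_of X d" using e by (simp add: next_in_P)
  qed
qed

lemma target_of_X: "d \<in> P \<Longrightarrow> target_of X d = target_of M d \<inter> P"
  using vertex_of_X P_opp by (simp add: target_of_def opp_X)

lemma vertex_inter_inj:
  assumes "v \<in> vertices M" "w \<in> vertices M" "v \<inter> P = w \<inter> P" shows "v = w"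
proof -
  obtain d where "d \<in> v" "d \<in> w" using spanning[OF assms(1)] assms(3) by blast
  then show ?thesis using in_verticesD assms(1,2) by metis
qed

lemma vertices_X: "vertices X = (\<lambda>v. v \<inter> P) ` vertices M"
proof
  show "vertices X \<subseteq> (\<lambda>v. v \<inter> P) ` vertices M"
  proof
    fix w assume "w \<in> vertices X"
    then obtain d where d: "d \<in> P" "w = vertex_of X d" by (auto simp: vertices_def)
    then have "w = vertex_of M d \<inter> P" "vertex_of M d \<in> vertices M"
      using vertex_of_X[of d] vertex_in_vertices[of d] P_subset by auto
    then show "w \<in> (\<lambda>v. v \<inter> P) ` vertices M" by blast
  qed
  show "(\<lambda>v. v \<inter> P) ` vertices M \<subseteq> vertices X"
  proof
    fix w assume "w \<in> (\<lambda>v. v \<inter> P) ` vertices M"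
    then obtain v where v: "v \<in> vertices M" "w = v \<inter> P" by blast
    then obtain d where "d \<in> v" "d \<in> P" using spanning by blast
    then show "w \<in> vertices X" using v in_verticesD[OF v(1)] vertex_of_X[of d]
      by (auto simp: vertices_def)
  qed
qed

lemma card_vertices_X: "card (vertices X) = card (vertices M)"
  unfolding vertices_X by (rule card_image, rule inj_onI, rule vertex_inter_inj)

lemma face_next_X: "d \<in> P \<Longrightarrow> face_next X d = next_in M P (face_next M d)"
  using P_opp by (simp add: face_next_def opp_X rot_X)

end

text \<open>The set of darts is unchanged, so the faces of the dual are literally the vertices of
  the map, and the results on regions apply to the dual as they stand.\<close>

definition dual :: "('d, 'x) cmap_scheme \<Rightarrow> 'd cmap" where
  "dual M = \<lparr>darts = darts M, rot = face_next M, opp = opp M\<rparr>"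

lemma dual_simps [simp]:
  "darts (dual M) = darts M" "rot (dual M) = face_next M" "opp (dual M) = opp M"
  by (simp_all add: dual_def)

context dart_map begin

lemma face_next_dual: "face_next (dual M) = rot M"
proof
  fix d
  show "face_next (dual M) d = rot M d"
    using opp_opp[of d] permutes_not_in[OF opp_permutes, of d]
    by (cases "d \<in> darts M") (simp_all add: face_next_def)
qed

lemma dart_map_dual: "dart_map (dual M)"
  by unfold_locales (use finite_darts face_next_permutes opp_permutes opp_neq opp_opp in simp_all)

lemma vertex_of_dual: "vertex_of (dual M) = face_of M"
  by (simp add: fun_eq_iff vertex_of_def face_of_def)

lemma face_of_dual: "face_of (dual M) = vertex_of M"
  by (simp add: fun_eq_iff vertex_of_def face_of_def face_next_dual)

lemma vertices_dual: "vertices (dual M) = faces M"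
  by (simp add: vertices_def faces_def vertex_of_dual)

text \<open>Since \<open>rot\<close> is \<open>face_next\<close> after \<open>opp\<close>, a set
  closed under the operations of the dual is closed under those of the map.\<close>

lemma connected_dual:
  assumes "connected_map M" shows "connected_map (dual M)"
proof (rule dart_map.connectedI[OF dart_map_dual])
  fix Z d assume d: "d \<in> darts (dual M)" "d \<in> Z" "Z \<subseteq> darts (dual M)"
    and cl: "\<And>x. x \<in> Z \<Longrightarrow> rot (dual M) x \<in> Z" "\<And>x. x \<in> Z \<Longrightarrow> opp (dual M) x \<in> Z"
  have "darts M \<subseteq> Z"
  proof (rule connected_closed[OF assms, of d])
    fix x assume "x \<in> Z" "x \<in> darts M"
    then show "rot M x \<in> Z" "opp M x \<in> Z"
      using cl(1)[of "opp M x"] cl(2)[of x] by (simp_all add: face_next_opp)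
  qed (use d in simp_all)
  then show "Z = darts (dual M)" using d by auto
qed

end

section \<open>Bipolar orientations\<close>

text \<open>The iterates of \<open>p\<close> from \<open>p e\<close> up to the first exit from
  \<open>Q\<close> exhaust \<open>Q\<close>, because any further element would need a second entry.
  The lateral paths of a face are obtained as such runs.\<close>

lemma (in finite_perm) unique_run:
  assumes e: "e \<in> orbit p x" "\<not> Q e" "Q (p e)"
    and uniq: "\<And>z. z \<in> orbit p x \<Longrightarrow> \<not> Q z \<Longrightarrow> Q (p z) \<Longrightarrow> z = e"
  obtains xs where "xs \<noteq> []" "distinct xs" "set xs = {y \<in> orbit p x. Q y}"
    "successively (\<lambda>a b. b = p a) xs" "hd xs = p e" "\<not> Q (p (last xs))"
proof -
  define a where "a = p e"
  have ox: "orbit p a = orbit p x" using e orbit_eq orbit_step a_def by metis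
  have orb: "orbit p x = {(p ^^ n) a |n. True}"
    using orbit_altdef_permutation[OF permutation, of a] ox by simp
  have "\<exists>k. \<not> Q ((p ^^ k) a)" using e orb by auto
  define k where "k = (LEAST k. \<not> Q ((p ^^ k) a))"
  have k: "\<not> Q ((p ^^ k) a)" unfolding k_def by (rule LeastI_ex) fact
  have lt: "Q ((p ^^ i) a)" if "i < k" for i using not_less_Least that unfolding k_def by blast
  have k0: "k > 0" using k e a_def by (cases k) auto
  define xs where "xs = map (\<lambda>i. (p ^^ i) a) [0..<k]"
  have sub: "set xs \<subseteq> {y \<in> orbit p x. Q y}" using lt orb by (auto simp: xs_def)
  have "distinct xs"
  proof -
    have False if ij: "i < j" "j < k" "(p ^^ i) a = (p ^^ j) a" for i j
    proof -
      have "(p ^^ (i + (j - i))) a = (p ^^ i) a" using ij by simp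
      then have "(p ^^ i) ((p ^^ (j - i)) a) = (p ^^ i) a" by (simp only: funpow_add comp_apply)
      then have "(p ^^ (j - i)) a = a" using inj_fn[OF inj, of i] by (auto dest: injD)
      \<comment> \<open>A repetition would confine the whole orbit to the run, but the orbit
        contains \<open>e\<close>, which is not in \<open>Q\<close>.\<close>
      then have "orbit p a = {(p ^^ m) a |m. m < j - i}"
        using ij by (intro orbit_altdef_bounded) auto
      then have "e \<in> {(p ^^ m) a |m. m < j - i}" using e ox by simp
      then show False using lt e ij by auto
    qed
    then show ?thesis unfolding xs_def distinct_map
      by (auto simp: inj_on_def) (metis nat_neq_iff)
  qed
  moreover have "set xs = {y \<in> orbit p x. Q y}"
  proof (rule equalityI[OF sub], rule subsetI)
    fix y assume y: "y \<in> {y \<in> orbit p x. Q y}"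
    have "orbit p ((p ^^ k) a) = orbit p x" using orb orbit_eq by blast
    then have "y \<in> orbit p ((p ^^ k) a)" using y by simp
    then have "y \<in> orbit p x \<and> (\<not> Q y \<or> y \<in> set xs)"
    proof (rule orbit_invariant)
      show "(p ^^ k) a \<in> orbit p x \<and> (\<not> Q ((p ^^ k) a) \<or> (p ^^ k) a \<in> set xs)" using k orb by blast
      fix z assume z: "z \<in> orbit p x \<and> (\<not> Q z \<or> z \<in> set xs)"
      then have pz: "p z \<in> orbit p x" using step_in_orbit_iff by blast
      show "p z \<in> orbit p x \<and> (\<not> Q (p z) \<or> p z \<in> set xs)"
      proof (cases "Q z")
        case False
        then have "Q (p z) \<Longrightarrow> p z = (p ^^ 0) a" using uniq z a_def by auto
        then show ?thesis using k0 pz by (force simp: xs_def)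
      next
        case True
        then obtain i where i: "i < k" "z = (p ^^ i) a" using z by (auto simp: xs_def)
        then have "p z = (p ^^ Suc i) a" by simp
        then show ?thesis using k pz i
          by (cases "Suc i = k") (force simp: xs_def simp del: funpow.simps)+
      qed
    qed
    then show "y \<in> set xs" using y by simp
  qed
  moreover have "xs \<noteq> []" "hd xs = p e" using k0 by (auto simp: xs_def a_def hd_map upt_conv_Cons)
  moreover have "successively (\<lambda>a b. b = p a) xs"
    by (auto simp: xs_def successively_conv_nth)
  moreover have "\<not> Q (p (last xs))"
  proof -
    have "last xs = (p ^^ (k - 1)) a" using k0 by (simp add: xs_def last_map)
    then have "p (last xs) = (p ^^ k) a" using k0 by (cases k) auto
    then show ?thesis using k by simp
  qed
  ultimately show ?thesis using that by blast
qed

definition arcs :: "('d, 'x) cmap_scheme \<Rightarrow> 'd set \<Rightarrow> ('d set \<times> 'd set) set" where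
  "arcs M Or = {(vertex_of M d, target_of M d) | d. d \<in> Or}"

text \<open>Neither planarity nor an outer face is assumed: the locale has to apply to the plain map
  of a labeling before that map is known to be planar.\<close>

locale bipolar = dart_map M for M :: "('d, 'x) cmap_scheme" +
  fixes Or :: "'d set" and S N :: "'d set"
  assumes orientation: "orientation M Or" and acyclic: "acyclic (arcs M Or)"
    and sources: "sources M Or = {S}" and sinks: "sinks M Or = {N}"
begin

lemma Or_subset: "Or \<subseteq> darts M"
  using orientation by (simp add: orientation_def)

lemma Or_iff: "d \<in> darts M \<Longrightarrow> opp M d \<in> Or \<longleftrightarrow> d \<notin> Or"
  using orientation by (auto simp: orientation_def)

lemma S_vertex: "S \<in> vertices M" and N_vertex: "N \<in> vertices M"
  using sources sinks by (auto simp: sources_def sinks_def)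

lemma not_into_S: "d \<in> Or \<Longrightarrow> target_of M d \<noteq> S"
  using sources by (auto simp: sources_def)

lemma not_from_N: "d \<in> Or \<Longrightarrow> vertex_of M d \<noteq> N"
  using sinks by (auto simp: sinks_def)

lemma out_of_S: "d \<in> S \<Longrightarrow> d \<in> Or"
  using in_verticesD[OF S_vertex, of d] not_into_S[of "opp M d"] Or_iff[of d] target_of_opp[of d]
  by auto

lemma into_N: "d \<in> N \<Longrightarrow> d \<notin> Or"
  using in_verticesD[OF N_vertex, of d] not_from_N[of d] by auto

lemma has_in:
  assumes "v \<in> vertices M" "v \<noteq> S" obtains d where "d \<in> v" "d \<in> darts M" "d \<notin> Or" "opp M d \<in> Or"
proof -
  have "v \<notin> sources M Or" using assms sources by simp
  then obtain d where d: "d \<in> Or" "target_of M d = v" using assms by (auto simp: sources_def)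
  then have "opp M d \<in> v" using vertex_of_self by (auto simp: target_of_def)
  then show ?thesis
    using that[of "opp M d"] d Or_subset Or_iff[of d] opp_opp opp_in_iff by auto
qed

lemma has_out:
  assumes "v \<in> vertices M" "v \<noteq> N" obtains d where "d \<in> v" "d \<in> darts M" "d \<in> Or"
proof -
  have "v \<notin> sinks M Or" using assms sinks by simp
  then obtain d where "d \<in> Or" "vertex_of M d = v" using assms by (auto simp: sinks_def)
  then show ?thesis using that[of d] Or_subset vertex_of_self by auto
qed

lemma S_neq_N: "S \<noteq> N"
  using out_of_S into_N vertices_nonempty[OF S_vertex] by blast

lemma finite_arcs: "finite (arcs M Or)"
proof -
  have "arcs M Or = (\<lambda>d. (vertex_of M d, target_of M d)) ` Or" by (auto simp: arcs_def)
  then show ?thesis using finite_subset[OF Or_subset finite_darts] by simp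
qed

lemma wf_arcs: "wf (arcs M Or)"
  using finite_acyclic_wf[OF finite_arcs acyclic] .

lemma wf_arcs_converse: "wf ((arcs M Or)\<inverse>)"
  using finite_acyclic_wf_converse[OF finite_arcs acyclic] .

lemma arc: "d \<in> Or \<Longrightarrow> (vertex_of M d, target_of M d) \<in> arcs M Or"
  by (auto simp: arcs_def)

lemma no_cycle: "(v, v) \<notin> (arcs M Or)\<^sup>+"
  using acyclic by (auto simp: acyclic_def)

text \<open>Reversal exchanges the poles and the two lateral paths of every face; with it each
  one-sided argument is made only once.\<close>

lemma reverse: "bipolar M (darts M - Or) N S"
proof
  show "orientation M (darts M - Or)"
    by (simp add: orientation_def Or_iff opp_in_iff)
  have opp: "d \<in> darts M - Or \<longleftrightarrow> d \<in> darts M \<and> opp M d \<in> Or" for d using Or_iff[of d] by auto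
  have "arcs M (darts M - Or) = (arcs M Or)\<inverse>"
  proof (intro equalityI subsetI)
    fix z assume "z \<in> arcs M (darts M - Or)"
    then obtain d where d: "d \<in> darts M" "opp M d \<in> Or" "z = (vertex_of M d, target_of M d)"
      using opp by (auto simp: arcs_def)
    then show "z \<in> (arcs M Or)\<inverse>" using arc[of "opp M d"] target_of_opp[of d] by (simp add: target_of_def)
  next
    fix z assume "z \<in> (arcs M Or)\<inverse>"
    then obtain d where d: "d \<in> Or" "z = (target_of M d, vertex_of M d)" by (auto simp: arcs_def)
    then have "d \<in> darts M" using Or_subset by blast
    moreover from this have "opp M d \<in> darts M - Or" using d opp_in_iff Or_iff by auto
    ultimately show "z \<in> arcs M (darts M - Or)"
      using d target_of_opp[of d] unfolding arcs_def target_of_def by force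
  qed
  then show "acyclic (arcs M (darts M - Or))" using acyclic by simp
  have out: "(\<exists>d\<in>darts M - Or. vertex_of M d = v) \<longleftrightarrow> (\<exists>d\<in>Or. target_of M d = v)" for v
  proof
    assume "\<exists>d\<in>darts M - Or. vertex_of M d = v"
    then obtain d where "d \<in> darts M" "opp M d \<in> Or" "vertex_of M d = v" using opp by auto
    then show "\<exists>d\<in>Or. target_of M d = v" using target_of_opp by auto
  next
    assume "\<exists>d\<in>Or. target_of M d = v"
    then obtain d where d: "d \<in> Or" "target_of M d = v" by blast
    then have "opp M d \<in> darts M - Or" using Or_subset opp_in_iff Or_iff by auto
    then show "\<exists>d\<in>darts M - Or. vertex_of M d = v" using d by (auto simp: target_of_def)
  qed
  have into: "(\<exists>d\<in>darts M - Or. target_of M d = v) \<longleftrightarrow> (\<exists>d\<in>Or. vertex_of M d = v)" for v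
  proof
    assume "\<exists>d\<in>darts M - Or. target_of M d = v"
    then obtain d where "d \<in> darts M" "opp M d \<in> Or" "target_of M d = v" using opp by auto
    then show "\<exists>d\<in>Or. vertex_of M d = v" by (auto simp: target_of_def)
  next
    assume "\<exists>d\<in>Or. vertex_of M d = v"
    then obtain d where d: "d \<in> Or" "vertex_of M d = v" by blast
    then have "opp M d \<in> darts M - Or" "target_of M (opp M d) = v"
      using Or_subset opp_in_iff Or_iff target_of_opp by auto
    then show "\<exists>d\<in>darts M - Or. target_of M d = v" by blast
  qed
  show "sources M (darts M - Or) = {N}" unfolding sinks[symmetric] sources_def sinks_def
    using into by auto
  show "sinks M (darts M - Or) = {S}" unfolding sources[symmetric] sources_def sinks_def
    using out by auto
qed

text \<open>Otherwise the contour, followed backwards, would be a directed cycle.\<close>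

lemma face_has_Or:
  assumes "f \<in> faces M" shows "\<exists>d\<in>f. d \<in> Or"
proof (rule ccontr)
  assume no: "\<not> ?thesis"
  obtain d where d: "d \<in> f" using faces_nonempty[OF assms] by blast
  have f: "f = orbit (face_next M) d" "d \<in> darts M" using in_facesD[OF assms d] by (auto simp: face_of_def)
  have step: "(target_of M z, vertex_of M z) \<in> arcs M Or" if "z \<in> f" for z
  proof -
    have z: "z \<in> darts M" using that in_facesD assms by blast
    then have "opp M z \<in> Or" using Or_iff no that by blast
    then show ?thesis using arc[of "opp M z"] target_of_opp[OF z] by (simp add: target_of_def)
  qed
  have "(vertex_of M y, vertex_of M d) \<in> (arcs M Or)\<^sup>+" if "y \<in> orbit (face_next M) d" for y
    using that
  proof induction
    case base
    then show ?case using step[OF d] by (simp add: vertex_of_face_next)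
  next
    case (step y)
    then have "y \<in> f" using f by simp
    then show ?case using \<open>\<And>z. z \<in> f \<Longrightarrow> _\<close> step by (metis trancl_into_trancl2 vertex_of_face_next)
  qed
  then show False using no_cycle d f by blast
qed

lemma face_has_not_Or:
  assumes "f \<in> faces M" shows "\<exists>d\<in>f. d \<notin> Or"
  using bipolar.face_has_Or[OF reverse assms] by blast

lemma vertex_change:
  assumes "v \<in> vertices M" "v \<noteq> S" "v \<noteq> N"
  shows "card {e \<in> v. e \<in> Or \<and> rot M e \<notin> Or} \<ge> 1"
proof -
  obtain d e where "d \<in> v" "d \<notin> Or" "e \<in> v" "e \<in> Or" using has_in has_out assms by metis
  moreover have "v = orbit (rot M) d" using in_verticesD[OF assms(1) \<open>d \<in> v\<close>] by (simp add: vertex_of_def)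
  ultimately have "\<exists>w\<in>v. w \<in> Or \<and> rot M w \<notin> Or"
    using rot.exists_change[of e d d "\<lambda>x. x \<in> Or"] by auto
  moreover have "finite v" using \<open>v = _\<close> rot.finite_orbit by metis
  ultimately show ?thesis by (auto simp: Suc_le_eq card_gt_0_iff)
qed

lemma face_change:
  assumes "f \<in> faces M" shows "card {d \<in> f. d \<in> Or \<and> face_next M d \<notin> Or} \<ge> 1"
proof -
  obtain d e where "d \<in> f" "d \<notin> Or" "e \<in> f" "e \<in> Or" using face_has_Or face_has_not_Or assms by metis
  moreover have "f = orbit (face_next M) d" using in_facesD[OF assms \<open>d \<in> f\<close>] by (simp add: face_of_def)
  ultimately have "\<exists>w\<in>f. w \<in> Or \<and> face_next M w \<notin> Or"
    using face.exists_change[of e d d "\<lambda>x. x \<in> Or"] by auto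
  moreover have "finite f" using \<open>f = _\<close> face.finite_orbit by metis
  ultimately show ?thesis by (auto simp: Suc_le_eq card_gt_0_iff)
qed

lemma vertex_changes_eq:
  assumes "v \<in> vertices M"
  shows "card {e \<in> v. e \<in> Or \<and> rot M e \<notin> Or} = card {e \<in> v. e \<notin> Or \<and> rot M e \<in> Or}"
proof -
  obtain d where "d \<in> darts M" "v = orbit (rot M) d" using assms by (auto simp: vertices_eq)
  then show ?thesis using rot.card_changes[of d "\<lambda>e. e \<in> Or"] by simp
qed

lemma face_changes_eq:
  assumes "f \<in> faces M"
  shows "card {d \<in> f. d \<in> Or \<and> face_next M d \<notin> Or} = card {d \<in> f. d \<notin> Or \<and> face_next M d \<in> Or}"
proof -
  obtain d where "d \<in> darts M" "f = orbit (face_next M) d" using assms by (auto simp: faces_eq)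
  then show ?thesis using face.card_changes[of d "\<lambda>e. e \<in> Or"] by simp
qed

text \<open>Every corner is either lateral (counted at its vertex) or extremal (counted in its face).\<close>

lemma corner_count:
  "card (darts M) = 2 * (\<Sum>v\<in>vertices M. card {e \<in> v. e \<in> Or \<and> rot M e \<notin> Or})
     + 2 * (\<Sum>f\<in>faces M. card {d \<in> f. d \<in> Or \<and> face_next M d \<notin> Or})"
proof -
  let ?c = "\<lambda>Q. card {e \<in> darts M. Q e}"
  have sc: "(\<Sum>e\<in>A. of_bool (Q e)) = card {e \<in> A. Q e}" if "finite A" for A and Q :: "'d \<Rightarrow> bool"
    using that by (simp add: of_bool_def sum.If_cases Int_def)
  have V: "?c Q = (\<Sum>v\<in>vertices M. card {e \<in> v. Q e})" for Q
  proof -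
    have "?c Q = (\<Sum>v\<in>vertices M. \<Sum>e\<in>v. of_bool (Q e))"
      using rot.sum_orbits[of "\<lambda>e. of_bool (Q e) :: nat"] sc finite_darts by (simp add: vertices_eq)
    also have "\<dots> = (\<Sum>v\<in>vertices M. card {e \<in> v. Q e})"
      by (intro sum.cong refl sc) (auto simp: vertices_eq rot.finite_orbit)
    finally show ?thesis .
  qed
  have F: "?c Q = (\<Sum>f\<in>faces M. card {e \<in> f. Q e})" for Q
  proof -
    have "?c Q = (\<Sum>f\<in>faces M. \<Sum>e\<in>f. of_bool (Q e))"
      using face.sum_orbits[of "\<lambda>e. of_bool (Q e) :: nat"] sc finite_darts by (simp add: faces_eq)
    also have "\<dots> = (\<Sum>f\<in>faces M. card {e \<in> f. Q e})"
      by (intro sum.cong refl sc) (auto simp: faces_eq face.finite_orbit)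
    finally show ?thesis .
  qed
  have split: "card (darts M) = ?c (\<lambda>e. e \<in> Or \<and> rot M e \<notin> Or) + ?c (\<lambda>e. e \<notin> Or \<and> rot M e \<in> Or)
      + (?c (\<lambda>e. e \<in> Or \<and> rot M e \<in> Or) + ?c (\<lambda>e. e \<notin> Or \<and> rot M e \<notin> Or))"
  proof -
    have "darts M = ({e \<in> darts M. e \<in> Or \<and> rot M e \<notin> Or} \<union> {e \<in> darts M. e \<notin> Or \<and> rot M e \<in> Or})
      \<union> ({e \<in> darts M. e \<in> Or \<and> rot M e \<in> Or} \<union> {e \<in> darts M. e \<notin> Or \<and> rot M e \<notin> Or})" by auto
    then have "card (darts M) = card (({e \<in> darts M. e \<in> Or \<and> rot M e \<notin> Or} \<union> {e \<in> darts M. e \<notin> Or \<and> rot M e \<in> Or})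
      \<union> ({e \<in> darts M. e \<in> Or \<and> rot M e \<in> Or} \<union> {e \<in> darts M. e \<notin> Or \<and> rot M e \<notin> Or}))" by simp
    also have "\<dots> = card ({e \<in> darts M. e \<in> Or \<and> rot M e \<notin> Or} \<union> {e \<in> darts M. e \<notin> Or \<and> rot M e \<in> Or})
       + card ({e \<in> darts M. e \<in> Or \<and> rot M e \<in> Or} \<union> {e \<in> darts M. e \<notin> Or \<and> rot M e \<notin> Or})"
      using finite_darts by (intro card_Un_disjoint) auto
    also have "card ({e \<in> darts M. e \<in> Or \<and> rot M e \<notin> Or} \<union> {e \<in> darts M. e \<notin> Or \<and> rot M e \<in> Or})
       = ?c (\<lambda>e. e \<in> Or \<and> rot M e \<notin> Or) + ?c (\<lambda>e. e \<notin> Or \<and> rot M e \<in> Or)"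
      using finite_darts by (intro card_Un_disjoint) auto
    also have "card ({e \<in> darts M. e \<in> Or \<and> rot M e \<in> Or} \<union> {e \<in> darts M. e \<notin> Or \<and> rot M e \<notin> Or})
       = ?c (\<lambda>e. e \<in> Or \<and> rot M e \<in> Or) + ?c (\<lambda>e. e \<notin> Or \<and> rot M e \<notin> Or)"
      using finite_darts by (intro card_Un_disjoint) auto
    finally show ?thesis .
  qed
  have oppb: "bij_betw (opp M) (darts M) (darts M)" by (rule permutes_imp_bij[OF opp_permutes])
  have shift: "?c Q = ?c (\<lambda>d. Q (opp M d))" for Q
  proof -
    have "(\<Sum>d\<in>darts M. of_bool (Q (opp M d)) :: nat) = (\<Sum>d\<in>darts M. of_bool (Q d))"
      by (rule sum.reindex_bij_betw[OF oppb])
    then show ?thesis using sc finite_darts by simp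
  qed
  \<comment> \<open>Because \<open>opp\<close> reverses membership in \<open>Or\<close>, shifting by
    it turns two neighbouring darts of equal direction at a vertex into a change of direction along
    a face.\<close>
  have 1: "?c (\<lambda>e. e \<in> Or \<and> rot M e \<in> Or) = ?c (\<lambda>d. d \<notin> Or \<and> face_next M d \<in> Or)"
    by (subst shift) (auto simp: face_next_def Or_iff intro!: arg_cong[where f=card])
  have 2: "?c (\<lambda>e. e \<notin> Or \<and> rot M e \<notin> Or) = ?c (\<lambda>d. d \<in> Or \<and> face_next M d \<notin> Or)"
    by (subst shift) (auto simp: face_next_def Or_iff intro!: arg_cong[where f=card])
  have 3: "?c (\<lambda>e. e \<notin> Or \<and> rot M e \<in> Or) = ?c (\<lambda>e. e \<in> Or \<and> rot M e \<notin> Or)"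
    unfolding V using vertex_changes_eq by (intro sum.cong) auto
  have 4: "?c (\<lambda>d. d \<notin> Or \<and> face_next M d \<in> Or) = ?c (\<lambda>d. d \<in> Or \<and> face_next M d \<notin> Or)"
    unfolding F using face_changes_eq by (intro sum.cong) auto
  show ?thesis using split 1 2 3 4 V[of "\<lambda>e. e \<in> Or \<and> rot M e \<notin> Or"]
      F[of "\<lambda>d. d \<in> Or \<and> face_next M d \<notin> Or"] by simp
qed

text \<open>All darts at a pole have the same direction, so a pole has no lateral corner.\<close>

lemma sum_vertex_changes:
  "(\<Sum>v\<in>vertices M. card {e \<in> v. e \<in> Or \<and> rot M e \<notin> Or})
     = (\<Sum>v\<in>vertices M - {S, N}. card {e \<in> v. e \<in> Or \<and> rot M e \<notin> Or})"
proof (rule sum.mono_neutral_right[OF finite_vertices])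
  have "card {e \<in> v. e \<in> Or \<and> rot M e \<notin> Or} = 0" if "v = S \<or> v = N" for v
  proof -
    have *: "{e \<in> v. e \<in> Or \<and> rot M e \<notin> Or} = {}"
      using that out_of_S into_N rot_in_vertex_iff[OF S_vertex] by blast
    show ?thesis unfolding * by simp
  qed
  then show "\<forall>v\<in>vertices M - (vertices M - {S, N}). card {e \<in> v. e \<in> Or \<and> rot M e \<notin> Or} = 0"
    by auto
qed auto

lemma card_vertices_minus: "card (vertices M - {S, N}) + 2 = card (vertices M)"
proof -
  have "card (vertices M - {S, N}) = card (vertices M) - card {S, N}"
    using S_vertex N_vertex by (intro card_Diff_subset) auto
  moreover have "card {S, N} \<le> card (vertices M)"
    using S_vertex N_vertex finite_vertices by (intro card_mono) auto
  ultimately show ?thesis using S_neq_N by simp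
qed

text \<open>Each vertex other than the poles has at least one lateral corner on either side, and
  each face at least one top and one bottom; \<open>corner_count\<close> adds these up.\<close>

lemma euler_le: "2 * card (vertices M) + 2 * card (faces M) \<le> card (darts M) + 4"
proof -
  have "(\<Sum>v\<in>vertices M - {S, N}. 1) \<le> (\<Sum>v\<in>vertices M - {S, N}. card {e \<in> v. e \<in> Or \<and> rot M e \<notin> Or})"
    using vertex_change by (intro sum_mono) auto
  moreover have "(\<Sum>f\<in>faces M. 1) \<le> (\<Sum>f\<in>faces M. card {d \<in> f. d \<in> Or \<and> face_next M d \<notin> Or})"
    using face_change by (intro sum_mono) auto
  ultimately show ?thesis
    using corner_count sum_vertex_changes card_vertices_minus by simp
qed

end

lemma card_1_ex1:
  assumes "card {x \<in> A. Q x} = 1" shows "\<exists>!x. x \<in> A \<and> Q x"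
proof -
  obtain y where y: "{x \<in> A. Q x} = {y}" using assms by (rule card_1_singletonE)
  show ?thesis
  proof (rule ex1I)
    show "y \<in> A \<and> Q y" using y by blast
    fix z assume "z \<in> A \<and> Q z"
    then have "z \<in> {x \<in> A. Q x}" by blast
    then show "z = y" unfolding y by simp
  qed
qed

section \<open>Directed paths in an acyclic orientation\<close>

lemma directed_path_nth:
  assumes "directed_path M Or u p v"
  shows "i < length p \<Longrightarrow> p ! i \<in> Or"
    and "Suc i < length p \<Longrightarrow> target_of M (p ! i) = vertex_of M (p ! Suc i)"
    and "p \<noteq> []" "vertex_of M (p ! 0) = u" "target_of M (p ! (length p - 1)) = v" "distinct p"
  using assms successively_nth[of "\<lambda>d e. target_of M d = vertex_of M e" p i]
  by (auto simp: directed_path_def hd_conv_nth last_conv_nth)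

lemma directed_path_trancl:
  assumes "directed_path M Or u p v" "i \<le> j" "j < length p"
  shows "(vertex_of M (p ! i), target_of M (p ! j)) \<in> (arcs M Or)\<^sup>+"
  using assms(2,3)
proof (induction j rule: dec_induct)
  case base
  then show ?case using directed_path_nth(1)[OF assms(1), of i] by (auto simp: arcs_def)
next
  case (step j)
  have "(target_of M (p ! j), target_of M (p ! Suc j)) \<in> arcs M Or"
    using directed_path_nth(1,2)[OF assms(1)] step.prems
    unfolding arcs_def by (auto intro!: exI[of _ "p ! Suc j"])
  then show ?case using step by (auto intro: trancl_into_trancl)
qed

context bipolar begin

lemma path_no_return:
  assumes "directed_path M Or u p v" "d \<in> set p" shows "target_of M d \<noteq> u"
proof -
  obtain i where "i < length p" "d = p ! i" using assms(2) by (auto simp: in_set_conv_nth)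
  then show ?thesis
    using directed_path_trancl[OF assms(1), of 0 i] directed_path_nth(4)[OF assms(1)] no_cycle by auto
qed

lemma path_inj_vertex:
  assumes p: "directed_path M Or u p v" shows "inj_on (vertex_of M) (set p)"
proof -
  have False if ij: "i < j" "j < length p" "vertex_of M (p ! i) = vertex_of M (p ! j)" for i j
  proof -
    have "target_of M (p ! (j - 1)) = vertex_of M (p ! j)"
      using directed_path_nth(2)[OF p, of "j - 1"] ij by simp
    moreover have "(vertex_of M (p ! i), target_of M (p ! (j - 1))) \<in> (arcs M Or)\<^sup>+"
      by (rule directed_path_trancl[OF p]) (use ij in auto)
    ultimately show False using ij(3) no_cycle[of "vertex_of M (p ! j)"] by simp
  qed
  then show ?thesis by (intro inj_onI) (metis in_set_conv_nth nat_neq_iff)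
qed

lemma path_inj_target:
  assumes p: "directed_path M Or u p v" shows "inj_on (target_of M) (set p)"
proof -
  have False if ij: "i < j" "j < length p" "target_of M (p ! i) = target_of M (p ! j)" for i j
  proof -
    have "target_of M (p ! i) = vertex_of M (p ! Suc i)"
      using directed_path_nth(2)[OF p, of i] ij by simp
    moreover have "(vertex_of M (p ! Suc i), target_of M (p ! j)) \<in> (arcs M Or)\<^sup>+"
      by (rule directed_path_trancl[OF p]) (use ij in auto)
    ultimately show False using ij(3) no_cycle[of "target_of M (p ! j)"] by simp
  qed
  then show ?thesis by (intro inj_onI) (metis in_set_conv_nth nat_neq_iff)
qed

text \<open>A nonempty set of darts closed under \<open>rot\<close> and \<open>opp\<close> contains
  the sink, because the sink can be reached from everywhere. The complement of such a set is closed
  as well, and would contain the sink too.\<close>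

lemma connected: "connected_map M"
proof (rule connectedI)
  have N_in: "N \<subseteq> Z" if Z: "d \<in> Z" "Z \<subseteq> darts M" and cl: "\<And>x. x \<in> Z \<Longrightarrow> rot M x \<in> Z" "\<And>x. x \<in> Z \<Longrightarrow> opp M x \<in> Z"
    for Z :: "'d set" and d
  proof -
    have vert: "vertex_of M x \<subseteq> Z" if "x \<in> Z" for x
    proof
      fix y assume "y \<in> vertex_of M x"
      then have "y \<in> orbit (rot M) x" by (simp add: vertex_of_def)
      then show "y \<in> Z" by induction (use cl that in auto)
    qed
    have "v \<in> vertices M \<Longrightarrow> v \<subseteq> Z \<Longrightarrow> N \<subseteq> Z" for v
    proof (induction v rule: wf_induct_rule[OF wf_arcs_converse])
      case (1 v)
      show ?case
      proof (cases "v = N")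
        case False
        obtain d where d: "d \<in> v" "d \<in> Or" "d \<in> darts M" using has_out[OF 1(2) False] by blast
        then have "(target_of M d, v) \<in> (arcs M Or)\<inverse>" using arc[of d] in_verticesD[OF 1(2)] by simp
        moreover have "target_of M d \<subseteq> Z" unfolding target_of_def using d 1(3) cl(2) by (intro vert) auto
        ultimately show ?thesis using 1(1) target_in_vertices[OF d(3)] by blast
      qed (use 1 in simp)
    qed
    then show ?thesis using vert[OF Z(1)] vertex_in_vertices Z by blast
  qed
  fix Z d assume Z: "d \<in> Z" "Z \<subseteq> darts M" and cl: "\<And>x. x \<in> Z \<Longrightarrow> rot M x \<in> Z" "\<And>x. x \<in> Z \<Longrightarrow> opp M x \<in> Z"
  show "Z = darts M"
  proof (rule ccontr)
    assume "Z \<noteq> darts M"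
    then obtain e where e: "e \<in> darts M - Z" using Z by blast
    \<comment> \<open>On a finite set, closure under a permutation implies closure under its
      inverse, hence closure of the complement.\<close>
    have stay: "g x \<notin> Z" if x: "x \<notin> Z" and g: "g permutes darts M" "\<forall>x\<in>Z. g x \<in> Z" for g x
    proof
      assume "g x \<in> Z"
      have "g ` Z = Z"
      proof (rule endo_inj_surj)
        show "finite Z" by (rule finite_subset[OF Z(2) finite_darts])
        show "g ` Z \<subseteq> Z" using g(2) by blast
        show "inj_on g Z" by (rule permutes_inj_on[OF g(1)])
      qed
      then have "g x \<in> g ` Z" using \<open>g x \<in> Z\<close> by simp
      then obtain z where "z \<in> Z" "g z = g x" by (metis imageE)
      then show False using x permutes_inj[OF g(1)] by (auto dest: injD)
    qed
    have "N \<subseteq> darts M - Z"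
    proof (rule N_in[OF e])
      fix x assume x: "x \<in> darts M - Z"
      then show "rot M x \<in> darts M - Z" using stay[OF _ rot_permutes] cl(1) rot_in_iff by blast
      show "opp M x \<in> darts M - Z" using x stay[OF _ opp_permutes] cl(2) opp_in_iff by blast
    qed simp
    then show False using N_in[OF Z cl] vertices_nonempty[OF N_vertex] by blast
  qed
qed

end

text \<open>Euler's formula is the case of equality in \<open>euler_le\<close>, in which every
  vertex and every face attains its lower bound.\<close>

locale tight_bipolar = bipolar +
  assumes euler: "2 * card (vertices M) + 2 * card (faces M) = card (darts M) + 4"
begin

lemma tight_reverse: "tight_bipolar M (darts M - Or) N S"
  using reverse euler by (simp add: tight_bipolar_def tight_bipolar_axioms_def)

text \<open>Both sums of \<open>corner_count\<close> have terms that are at least 1, and their total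
  is the number of terms.\<close>

lemma changes_eq_1:
  shows "v \<in> vertices M - {S, N} \<Longrightarrow> card {e \<in> v. e \<in> Or \<and> rot M e \<notin> Or} = 1"
    and "f \<in> faces M \<Longrightarrow> card {d \<in> f. d \<in> Or \<and> face_next M d \<notin> Or} = 1"
proof -
  let ?V = "\<lambda>v. card {e \<in> v. e \<in> Or \<and> rot M e \<notin> Or}" and ?F = "\<lambda>f. card {d \<in> f. d \<in> Or \<and> face_next M d \<notin> Or}"
  have V: "\<And>v. v \<in> vertices M - {S, N} \<Longrightarrow> 1 \<le> ?V v" using vertex_change by auto
  have F: "\<And>f. f \<in> faces M \<Longrightarrow> 1 \<le> ?F f" using face_change by auto
  have "(\<Sum>v\<in>vertices M - {S, N}. 1) \<le> (\<Sum>v\<in>vertices M - {S, N}. ?V v)" by (rule sum_mono) (rule V)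
  moreover have "(\<Sum>f\<in>faces M. 1) \<le> (\<Sum>f\<in>faces M. ?F f)" by (rule sum_mono) (rule F)
  ultimately have *: "(\<Sum>v\<in>vertices M - {S, N}. 1) = (\<Sum>v\<in>vertices M - {S, N}. ?V v)"
    "(\<Sum>f\<in>faces M. 1) = (\<Sum>f\<in>faces M. ?F f)"
    using corner_count sum_vertex_changes card_vertices_minus euler by simp_all
  show "v \<in> vertices M - {S, N} \<Longrightarrow> ?V v = 1"
    using sum_mono_inv[OF *(1) V, of v] finite_vertices by simp
  show "f \<in> faces M \<Longrightarrow> ?F f = 1"
    using sum_mono_inv[OF *(2) F, of f] finite_faces by simp
qed

lemma out_in_ex1:
  assumes "v \<in> vertices M" "v \<noteq> S" "v \<noteq> N" shows "\<exists>!e. e \<in> v \<and> e \<in> Or \<and> rot M e \<notin> Or"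
  by (rule card_1_ex1) (use changes_eq_1(1)[of v] assms in simp)

lemma in_out_ex1:
  assumes "v \<in> vertices M" "v \<noteq> S" "v \<noteq> N" shows "\<exists>!e. e \<in> v \<and> e \<notin> Or \<and> rot M e \<in> Or"
  by (rule card_1_ex1) (use changes_eq_1(1)[of v] vertex_changes_eq[of v] assms in simp)

lemma top_ex1:
  assumes "f \<in> faces M" shows "\<exists>!d. d \<in> f \<and> d \<in> Or \<and> face_next M d \<notin> Or"
  by (rule card_1_ex1) (rule changes_eq_1(2)[OF assms])

lemma bottom_ex1:
  assumes "f \<in> faces M" shows "\<exists>!d. d \<in> f \<and> d \<notin> Or \<and> face_next M d \<in> Or"
  by (rule card_1_ex1) (use changes_eq_1(2)[of f] face_changes_eq[of f] assms in simp)

lemma bottom_ex: "f \<in> faces M \<Longrightarrow> \<exists>d\<in>f. d \<notin> Or \<and> face_next M d \<in> Or"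
  using ex1_implies_ex[OF bottom_ex1] by (simp add: Bex_def)

lemma top_ex: "f \<in> faces M \<Longrightarrow> \<exists>d\<in>f. d \<in> Or \<and> face_next M d \<notin> Or"
  using ex1_implies_ex[OF top_ex1] by (simp add: Bex_def)

lemma bottom_unique:
  assumes "f \<in> faces M" "d \<in> f" "d \<notin> Or" "face_next M d \<in> Or" "e \<in> f" "e \<notin> Or" "face_next M e \<in> Or"
  shows "d = e"
  by (rule ex1E[OF bottom_ex1[OF assms(1)]]) (use assms in metis)

lemma top_unique:
  assumes "f \<in> faces M" "d \<in> f" "d \<in> Or" "face_next M d \<notin> Or" "e \<in> f" "e \<in> Or" "face_next M e \<notin> Or"
  shows "d = e"
  by (rule ex1E[OF top_ex1[OF assms(1)]]) (use assms in metis)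

lemma out_in_unique:
  assumes "v \<in> vertices M" "v \<noteq> S" "v \<noteq> N"
    and "d \<in> v" "d \<in> Or" "rot M d \<notin> Or" "e \<in> v" "e \<in> Or" "rot M e \<notin> Or"
  shows "d = e"
  by (rule ex1E[OF out_in_ex1[OF assms(1-3)]]) (use assms(4-) in metis)

lemma in_out_unique:
  assumes "v \<in> vertices M" "v \<noteq> S" "v \<noteq> N"
    and "d \<in> v" "d \<notin> Or" "rot M d \<in> Or" "e \<in> v" "e \<notin> Or" "rot M e \<in> Or"
  shows "d = e"
  by (rule ex1E[OF in_out_ex1[OF assms(1-3)]]) (use assms(4-) in metis)

text \<open>With one top and one bottom, the contour is a run of darts in \<open>Or\<close> followed
  by a run of darts outside it. The second run goes down the right path, hence \<open>opp\<close>
  and \<open>rev\<close>.\<close>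

lemma contour_paths_exist:
  assumes f: "f \<in> faces M" shows "\<exists>u v p q. contour_paths M Or f u v p q"
proof -
  obtain b where b: "b \<in> f" "b \<notin> Or" "face_next M b \<in> Or" using bottom_ex[OF f] by blast
  obtain t where t: "t \<in> f" "t \<in> Or" "face_next M t \<notin> Or" using top_ex[OF f] by blast
  have fb: "f = orbit (face_next M) b" using in_facesD[OF f b(1)] by (simp add: face_of_def)
  have buniq: "\<And>z. z \<in> orbit (face_next M) b \<Longrightarrow> z \<notin> Or \<Longrightarrow> face_next M z \<in> Or \<Longrightarrow> z = b"
    using bottom_unique[OF f _ _ _ b] fb by blast
  have tuniq: "\<And>z. z \<in> orbit (face_next M) b \<Longrightarrow> \<not> z \<notin> Or \<Longrightarrow> face_next M z \<notin> Or \<Longrightarrow> z = t"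
    using top_unique[OF f _ _ _ t] fb by blast
  obtain xs where xs: "xs \<noteq> []" "distinct xs" "set xs = {y \<in> orbit (face_next M) b. y \<in> Or}"
    "successively (\<lambda>a b. b = face_next M a) xs" "hd xs = face_next M b" "face_next M (last xs) \<notin> Or"
    by (rule face.unique_run[of b b "\<lambda>x. x \<in> Or", OF face.self_in_orbit b(2,3) buniq])
  note xs = xs(1,2) xs(3)[folded fb] xs(4-)
  have tt: "t \<in> orbit (face_next M) b" "\<not> t \<notin> Or" using t fb by auto
  obtain ys where ys: "ys \<noteq> []" "distinct ys" "set ys = {y \<in> orbit (face_next M) b. y \<notin> Or}"
    "successively (\<lambda>a b. b = face_next M a) ys" "hd ys = face_next M t" "\<not> face_next M (last ys) \<notin> Or"
    by (rule face.unique_run[of t b "\<lambda>x. x \<notin> Or", OF tt t(3) tuniq])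
  note ys = ys(1,2) ys(3)[folded fb] ys(4-5) ys(6)[unfolded not_not]
  have fd: "y \<in> darts M" if "y \<in> f" for y using in_facesD[OF f that] by simp
  have lx: "last xs \<in> f" "last xs \<in> Or" using xs last_in_set by blast+
  have ly: "last ys \<in> f" "last ys \<notin> Or" using ys last_in_set by blast+
  have "last xs = t" using lx xs(6) tuniq fb by blast
  have "last ys = b" using ly ys(6) buniq fb by blast
  have p: "directed_path M Or (vertex_of M (hd xs)) xs (target_of M (last xs))"
    unfolding directed_path_def
  proof (intro conjI)
    show "successively (\<lambda>d e. target_of M d = vertex_of M e) xs"
      by (rule successively_mono[OF xs(4)]) (simp add: vertex_of_face_next)
  qed (use xs(1-3) in auto)
  define q where "q = map (opp M) (rev ys)"
  have "directed_path M Or (vertex_of M (hd xs)) q (target_of M (last xs))"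
    unfolding directed_path_def
  proof (intro conjI)
    show "q \<noteq> []" using ys by (simp add: q_def)
    show "set q \<subseteq> Or" using ys(3) fd Or_iff by (auto simp: q_def)
    show "distinct q" using ys(2) opp_inj by (auto simp: q_def distinct_map inj_on_def)
    show "successively (\<lambda>d e. target_of M d = vertex_of M e) q"
      unfolding q_def successively_map successively_rev
    proof (rule successively_mono[OF ys(4)])
      fix x y assume "x \<in> set ys" "y \<in> set ys" "y = face_next M x"
      then show "target_of M (opp M y) = vertex_of M (opp M x)"
        using ys(3) fd target_of_opp[of y] by (auto simp: vertex_of_face_next target_of_def)
    qed
    have "hd q = opp M b" using ys(1) \<open>last ys = b\<close> by (simp add: q_def hd_map hd_rev)
    then show "vertex_of M (hd q) = vertex_of M (hd xs)"
      using xs(5) by (simp add: vertex_of_face_next target_of_def)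
    have "last q = opp M (hd ys)" using ys(1) by (simp add: q_def last_map last_rev)
    moreover have "hd ys \<in> darts M" using ys(1,3) fd hd_in_set by blast
    ultimately show "target_of M (last q) = target_of M (last xs)"
      using ys(5) \<open>last xs = t\<close> by (simp add: target_of_opp vertex_of_face_next)
  qed
  moreover have "set q = {d \<in> Or. opp M d \<in> f}"
  proof -
    have "set q = opp M ` {y \<in> f. y \<notin> Or}" using ys by (simp add: q_def)
    also have "\<dots> = {d \<in> Or. opp M d \<in> f}"
    proof (intro equalityI subsetI)
      fix d assume "d \<in> {d \<in> Or. opp M d \<in> f}"
      then show "d \<in> opp M ` {y \<in> f. y \<notin> Or}"
        using Or_subset Or_iff[of d] opp_opp[of d] by (intro image_eqI[of _ _ "opp M d"]) auto
    qed (use fd Or_iff opp_opp in auto)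
    finally show ?thesis .
  qed
  moreover have "set xs = {d \<in> Or. d \<in> f}" using xs by auto
  ultimately show ?thesis using p unfolding contour_paths_def by blast
qed

text \<open>All darts of \<open>p\<close> but the first follow another dart of \<open>p\<close> on
  the contour. Interior vertices of the path thus become lateral corners of the face, a description
  that no longer mentions \<open>p\<close>.\<close>

lemma set_tl_left:
  assumes f: "f \<in> faces M" and c: "contour_paths M Or f u v p q"
  shows "set (tl p) = face_next M ` {d \<in> f. d \<in> Or \<and> face_next M d \<in> Or}"
proof -
  have p: "directed_path M Or u p v" "set p = {d \<in> Or. d \<in> f}" using c by (auto simp: contour_paths_def)
  have pne: "p \<noteq> []" "distinct p" "vertex_of M (hd p) = u" using p by (auto simp: directed_path_def)
  then have hp: "hd p \<in> Or" "hd p \<in> f" using p(2) hd_in_set by blast+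
  \<comment> \<open>The dart before the head of \<open>p\<close>. If it were in \<open>Or\<close>,
    the path would return to its origin.\<close>
  obtain b where b: "b \<in> f" "face_next M b = hd p"
  proof -
    have "hd p \<in> orbit (face_next M) (hd p)" by (rule face.self_in_orbit)
    then have "hd p \<in> face_next M ` orbit (face_next M) (hd p)"
      using face.bij_betw_orbit bij_betw_imp_surj_on by metis
    then show ?thesis using that in_facesD[OF f hp(2)] by (auto simp: face_of_def)
  qed
  have "b \<notin> Or"
  proof
    assume "b \<in> Or"
    then have "b \<in> set p" using b p by blast
    moreover have "target_of M b = u" using b pne vertex_of_face_next by metis
    ultimately show False using path_no_return[OF p(1)] by blast
  qed
  have "set (tl p) = set p - {hd p}" using pne by (cases p) auto
  also have "\<dots> = face_next M ` {d \<in> f. d \<in> Or \<and> face_next M d \<in> Or}"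
  proof (intro equalityI subsetI)
    fix d assume d: "d \<in> set p - {hd p}"
    then have df: "d \<in> f" "d \<in> Or" using p by auto
    have "d \<in> face_next M ` orbit (face_next M) d"
      using face.bij_betw_orbit bij_betw_imp_surj_on face.self_in_orbit by metis
    then obtain e where e: "e \<in> f" "d = face_next M e" using in_facesD[OF f df(1)] by (auto simp: face_of_def)
    moreover have "e \<in> Or"
    proof (rule ccontr)
      assume "e \<notin> Or"
      then have "e = b" using bottom_unique[OF f, of e b] b e df hp \<open>b \<notin> Or\<close> by simp
      then show False using b d e by simp
    qed
    ultimately show "d \<in> face_next M ` {d \<in> f. d \<in> Or \<and> face_next M d \<in> Or}" using df by blast
  next
    fix d assume "d \<in> face_next M ` {d \<in> f. d \<in> Or \<and> face_next M d \<in> Or}"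
    then obtain e where e: "e \<in> f" "e \<in> Or" "face_next M e \<in> Or" "d = face_next M e" by blast
    then have "d \<in> set p" using p face_next_in_face_iff[OF f] by blast
    moreover have "d \<noteq> hd p" using e b \<open>b \<notin> Or\<close> face_next_inj by metis
    ultimately show "d \<in> set p - {hd p}" by blast
  qed
  finally show ?thesis .
qed

text \<open>The contour descends the right path, so the corner between \<open>d\<close> and
  \<open>face_next M d\<close> is left upwards by \<open>opp M d\<close>.\<close>

lemma set_tl_right:
  assumes f: "f \<in> faces M" and c: "contour_paths M Or f u v p q"
  shows "set (tl q) = opp M ` {d \<in> f. d \<notin> Or \<and> face_next M d \<notin> Or}"
proof -
  have q: "directed_path M Or u q v" "set q = {d \<in> Or. opp M d \<in> f}" using c by (auto simp: contour_paths_def)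
  have qne: "q \<noteq> []" "distinct q" "vertex_of M (hd q) = u" using q by (auto simp: directed_path_def)
  then have hq: "hd q \<in> Or" "opp M (hd q) \<in> f" "hd q \<in> darts M" using q(2) hd_in_set Or_subset by blast+
  have fd: "y \<in> darts M" if "y \<in> f" for y using in_facesD[OF f that] by simp
  have ohq: "opp M (hd q) \<notin> Or" using hq Or_iff by blast
  \<comment> \<open>At the bottom of the face the contour passes from the right path to the left
    one. A further descending dart would give, reversed, a dart of the right path that returns to
    its origin.\<close>
  have nhq: "face_next M (opp M (hd q)) \<in> Or"
  proof (rule ccontr)
    define e where "e = face_next M (opp M (hd q))"
    assume "face_next M (opp M (hd q)) \<notin> Or"
    then have e: "e \<notin> Or" "e \<in> f" "e \<in> darts M"
      using hq face_next_in_face_iff[OF f] fd by (auto simp: e_def)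
    then have "opp M e \<in> set q" using q(2) Or_iff opp_opp by auto
    moreover have "target_of M (opp M e) = u"
      using e target_of_opp[of e] qne hq by (simp add: e_def vertex_of_face_next target_of_opp)
    ultimately show False using path_no_return[OF q(1)] by blast
  qed
  have "set (tl q) = set q - {hd q}" using qne by (cases q) auto
  also have "\<dots> = opp M ` {d \<in> f. d \<notin> Or \<and> face_next M d \<notin> Or}"
  proof (intro equalityI subsetI)
    fix d assume d: "d \<in> set q - {hd q}"
    then have od: "opp M d \<in> f" "opp M d \<notin> Or" "d = opp M (opp M d)"
      using q(2) Or_subset Or_iff opp_opp by auto
    moreover have "face_next M (opp M d) \<notin> Or"
    proof
      assume "face_next M (opp M d) \<in> Or"
      then have "opp M d = opp M (hd q)" using bottom_unique[OF f, of "opp M d" "opp M (hd q)"] od ohq nhq hq by simp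
      then show False using d opp_inj by auto
    qed
    ultimately show "d \<in> opp M ` {d \<in> f. d \<notin> Or \<and> face_next M d \<notin> Or}" by blast
  next
    fix d assume "d \<in> opp M ` {d \<in> f. d \<notin> Or \<and> face_next M d \<notin> Or}"
    then obtain e where e: "e \<in> f" "e \<notin> Or" "face_next M e \<notin> Or" "d = opp M e" by blast
    then have "d \<in> set q" using q(2) Or_iff fd opp_opp by auto
    moreover have "d \<noteq> hd q" using e nhq fd opp_opp by metis
    ultimately show "d \<in> set q - {hd q}" by blast
  qed
  finally show ?thesis .
qed

text \<open>If the two lateral corners of \<open>x\<close> were in one face, the outgoing edges of
  \<open>x\<close> would be dual to a closed curve, with at most as many faces as edges. It does not
  separate the vertices, because \<open>p\<close> joins the poles without leaving from
  \<open>x\<close>. In the dual map, where vertices and faces exchange roles,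
  \<open>region_euler\<close> then gives one less than Euler's formula.\<close>

lemma lateral_corners_distinct:
  assumes x: "x \<in> vertices M" "x \<noteq> S" "x \<noteq> N"
    and p: "directed_path M Or S p N" "x \<notin> vertex_of M ` set p"
    and e1: "e1 \<in> x" "e1 \<notin> Or" "rot M e1 \<in> Or" and e2: "e2 \<in> x" "e2 \<in> Or" "rot M e2 \<notin> Or"
  shows "face_of M (rot M e1) \<noteq> face_of M (rot M e2)"
proof
  assume same: "face_of M (rot M e1) = face_of M (rot M e2)"
  define outs where "outs = {d \<in> x. d \<in> Or}"
  define C where "C = outs \<union> opp M ` outs"
  have od: "outs \<subseteq> darts M" using Or_subset by (auto simp: outs_def)
  have fin: "finite outs" using od finite_darts finite_subset by blast
  obtain r where r: "r \<in> S" using vertices_nonempty[OF S_vertex] by blast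
  then have rd: "r \<in> darts M" using in_verticesD[OF S_vertex] by blast
  interpret dual: dart_map "dual M" by (rule dart_map_dual)
  define K where "K = region (dual M) C r"
  have Kv: "v \<subseteq> K" if "v \<in> vertices M" "d \<in> v" "d \<in> K" for v d
    using dual.region_face[of d C r] that in_verticesD[OF that(1,2)] by (auto simp: K_def face_of_dual)
  have cross: "opp M d \<in> K" if "d \<in> K" "d \<notin> C" for d
    using region.cross[of d "dual M" C r] that by (simp add: K_def)
  have notC: "d \<notin> C" "opp M d \<notin> C" if d: "d \<in> Or" "vertex_of M d \<noteq> x" for d
  proof -
    have "d \<in> darts M" "opp M d \<notin> Or" using d Or_subset Or_iff by auto
    then show "d \<notin> C" "opp M d \<notin> C"
      using d in_verticesD[OF x(1)] od Or_iff opp_opp opp_inj by (auto simp: C_def outs_def)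
  qed
  \<comment> \<open>A vertex not strictly above \<open>x\<close> and other than the source is
    entered from a vertex of the same kind, and from one different from \<open>x\<close>, so the
    edge is not in \<open>C\<close>.\<close>
  have below: "\<not> (x, v) \<in> (arcs M Or)\<^sup>+ \<Longrightarrow> v \<in> vertices M \<Longrightarrow> v \<subseteq> K" for v
  proof (induction v rule: wf_induct_rule[OF wf_arcs])
    case (1 v)
    show ?case
    proof (cases "v = S")
      case True
      then show ?thesis using Kv[OF S_vertex r] region.base[of r "dual M" C] by (simp add: K_def)
    next
      case False
      obtain d where d: "d \<in> v" "d \<in> darts M" "opp M d \<in> Or" using has_in[OF 1(3) False] by blast
      let ?w = "target_of M d"
      have a: "(?w, v) \<in> arcs M Or"
        using arc[OF d(3)] d in_verticesD[OF 1(3) d(1)] by (simp add: target_of_opp) (simp add: target_of_def)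
      have "(x, ?w) \<notin> (arcs M Or)\<^sup>+" using a 1(2) by (auto intro: trancl_into_trancl)
      then have wK: "?w \<subseteq> K" using 1(1)[OF a] target_in_vertices[OF d(2)] by blast
      have "?w \<noteq> x" using a 1(2) by auto
      then have "opp M d \<notin> C" using notC(1)[OF d(3)] by (simp add: target_of_def)
      moreover have "opp M d \<in> K" using wK vertex_of_self by (auto simp: target_of_def)
      ultimately have "d \<in> K" using cross[of "opp M d"] opp_opp[OF d(2)] by simp
      then show ?thesis using Kv[OF 1(3) d(1)] by blast
    qed
  qed
  \<comment> \<open>The sink is above \<open>x\<close> and escapes the previous induction; the path
    \<open>p\<close> leads to it around \<open>x\<close>.\<close>
  have "N \<subseteq> K"
  proof -
    have pn: "p \<noteq> []" "vertex_of M (p ! 0) = S" "target_of M (p ! (length p - 1)) = N"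
      using directed_path_nth[OF p(1)] by auto
    have "i < length p \<Longrightarrow> target_of M (p ! i) \<subseteq> K" for i
    proof (induction i)
      case 0
      then have "p ! 0 \<in> Or" "vertex_of M (p ! 0) = S" using directed_path_nth(1)[OF p(1)] pn by auto
      moreover have "(x, S) \<notin> (arcs M Or)\<^sup>+"
        using not_into_S by (auto simp: arcs_def dest: tranclD2)
      moreover have "p ! 0 \<in> K"
        using below[OF \<open>(x, S) \<notin> (arcs M Or)\<^sup>+\<close> S_vertex] pn vertex_of_self[of "p ! 0"] by auto
      ultimately show ?case
        using notC(1)[of "p ! 0"] cross[of "p ! 0"] x(2) Kv[of "target_of M (p ! 0)" "opp M (p ! 0)"]
          target_in_vertices Or_subset vertex_of_self[of "opp M (p ! 0)"] by (auto simp: target_of_def)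
    next
      case (Suc i)
      then have s: "p ! Suc i \<in> Or" "target_of M (p ! i) = vertex_of M (p ! Suc i)"
        using directed_path_nth(1,2)[OF p(1)] by auto
      moreover have "p ! Suc i \<in> K" using Suc s vertex_of_self[of "p ! Suc i"] by auto
      moreover have "vertex_of M (p ! Suc i) \<noteq> x" using p(2) Suc.prems by auto
      ultimately show ?case
        using notC(1)[of "p ! Suc i"] cross[of "p ! Suc i"] Kv[of "target_of M (p ! Suc i)" "opp M (p ! Suc i)"]
          target_in_vertices Or_subset vertex_of_self[of "opp M (p ! Suc i)"] by (auto simp: target_of_def)
    qed
    then show ?thesis using pn(1,3) by (metis diff_less length_greater_0_conv zero_less_one)
  qed
  \<comment> \<open>The vertices above \<open>x\<close> are reached downwards from the sink, through
    edges that do not start at \<open>x\<close>.\<close>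
  have above: "(x, v) \<in> (arcs M Or)\<^sup>+ \<Longrightarrow> v \<in> vertices M \<Longrightarrow> v \<subseteq> K" for v
  proof (induction v rule: wf_induct_rule[OF wf_arcs_converse])
    case (1 v)
    show ?case
    proof (cases "v = N")
      case True then show ?thesis using \<open>N \<subseteq> K\<close> by simp
    next
      case False
      obtain d where d: "d \<in> v" "d \<in> darts M" "d \<in> Or" using has_out[OF 1(3) False] by blast
      let ?w = "target_of M d"
      have vd: "vertex_of M d = v" using in_verticesD[OF 1(3) d(1)] by simp
      have a: "(v, ?w) \<in> arcs M Or" using arc[OF d(3)] vd by simp
      have "(x, ?w) \<in> (arcs M Or)\<^sup>+" using a 1(2) by (auto intro: trancl_into_trancl)
      then have wK: "?w \<subseteq> K" using 1(1)[of ?w] a target_in_vertices[OF d(2)] by blast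
      have "v \<noteq> x" using 1(2) no_cycle by auto
      then have "opp M d \<notin> C" using notC(2)[OF d(3)] vd by simp
      moreover have "opp M d \<in> K" using wK vertex_of_self by (auto simp: target_of_def)
      ultimately have "d \<in> K" using cross[of "opp M d"] opp_opp[OF d(2)] by simp
      then show ?thesis using Kv[OF 1(3) d(1)] by blast
    qed
  qed
  have K: "K = darts M"
  proof
    show "K \<subseteq> darts M" using dual.region_subset[of r C] rd by (simp add: K_def)
    show "darts M \<subseteq> K" using below above vertex_in_vertices vertex_of_self by blast
  qed
  \<comment> \<open>The faces along the outgoing edges. Counterclockwise from
    \<open>rot M e1\<close> to \<open>e2\<close>, the left face of an outgoing edge is the right
    face of the next one; after \<open>e2\<close> it is, by assumption, that of the first one again.
    This bounds the number of faces by the number of edges.\<close>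
  define W where "W = face_of M ` outs"
  have CW: "face_of M d \<in> W" if dC: "d \<in> C" for d
  proof (cases "d \<in> outs")
    case True then show ?thesis by (simp add: W_def)
  next
    case False
    then obtain e where e: "e \<in> outs" "d = opp M e" using dC by (auto simp: C_def)
    then have fd: "face_of M d = face_of M (rot M e)" using face_of_rot od by auto
    have re: "rot M e \<in> x" using e rot_in_vertex_iff[OF x(1)] by (auto simp: outs_def)
    show ?thesis
    proof (cases "rot M e \<in> Or")
      case True then show ?thesis using fd re by (auto simp: W_def outs_def)
    next
      case False
      then have "e = e2" using out_in_unique[OF x, of e e2] e e2 by (auto simp: outs_def)
      moreover have "rot M e1 \<in> outs" using e1 rot_in_vertex_iff[OF x(1)] by (auto simp: outs_def)
      ultimately show ?thesis using fd same by (auto simp: W_def)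
    qed
  qed
  have Cd: "C \<subseteq> darts M" using od opp_in_iff by (auto simp: C_def)
  have Wf: "W \<subseteq> faces M" using od face_in_faces by (auto simp: W_def)
  have Wne: "W \<noteq> {}" using e2 by (auto simp: W_def outs_def)
  have cC: "card C = 2 * card outs"
  proof -
    have "outs \<inter> opp M ` outs = {}" using od Or_iff by (auto simp: outs_def)
    moreover have "card (opp M ` outs) = card outs" using opp_inj by (intro card_image) (auto simp: inj_on_def)
    ultimately show ?thesis using fin by (simp add: C_def card_Un_disjoint)
  qed
  have "2 * card (faces M - W) + 2 * card (face_of (dual M) ` region (dual M) C r) \<le> card (region (dual M) C r - C) + 2"
  proof (rule dual.region_euler)
    show "connected_map (dual M)" by (rule connected_dual[OF connected])
    show "r \<in> darts (dual M)" using rd by simp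
    show "\<And>d. d \<in> C \<Longrightarrow> opp (dual M) d \<in> C" using od opp_opp by (auto simp: C_def)
    show "C \<subseteq> darts (dual M)" using Cd by simp
    show "faces M - W \<subseteq> vertices (dual M)" by (auto simp: vertices_dual)
    show "faces M - W \<noteq> vertices (dual M)" using Wf Wne by (auto simp: vertices_dual)
    fix u assume u: "u \<in> faces M - W"
    have "d \<in> darts M - C" if "d \<in> u" for d using that in_facesD[of u d] u CW[of d] by auto
    then show "u \<subseteq> region (dual M) C r - C" using K by (auto simp: K_def)
  qed
  then have "2 * card (faces M - W) + 2 * card (vertices M) \<le> card (darts M - C) + 2"
    using K by (simp add: K_def face_of_dual vertices_def)
  moreover have "card (darts M - C) = card (darts M) - card C"
    using Cd finite_darts by (intro card_Diff_subset) (auto intro: finite_subset)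
  moreover have "card C \<le> card (darts M)" using Cd finite_darts by (intro card_mono)
  moreover have "card (faces M - W) = card (faces M) - card W"
    using Wf finite_faces by (intro card_Diff_subset) (auto intro: finite_subset)
  moreover have "card W \<le> card outs" unfolding W_def by (rule card_image_le[OF fin])
  ultimately show False using cC euler by linarith
qed

text \<open>The three other types of corner are excluded: a top or bottom corner because the left
  path passes through a vertex only once, the other lateral corner because it lies in another
  face.\<close>

lemma corner_at_left_path:
  assumes f: "f \<in> faces M" and d: "d \<in> f" "d \<in> Or" "face_next M d \<in> Or"
    and e: "e \<in> target_of M d" "rot M e \<in> f"
    and p: "directed_path M Or S p N" "target_of M d \<notin> vertex_of M ` set p"
  shows "e \<notin> Or \<and> rot M e \<in> Or"
proof -
  obtain u v pl pr where c: "contour_paths M Or f u v pl pr" using contour_paths_exist[OF f] by blast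
  then have pl: "directed_path M Or u pl v" "set pl = {d \<in> Or. d \<in> f}" by (auto simp: contour_paths_def)
  note injv = path_inj_vertex[OF pl(1)] and injt = path_inj_target[OF pl(1)]
  let ?x = "target_of M d"
  have dd: "d \<in> darts M" using d Or_subset by blast
  have xv: "?x \<in> vertices M" using target_in_vertices[OF dd] .
  have ed: "e \<in> darts M" "vertex_of M e = ?x" using in_verticesD[OF xv e(1)] by auto
  have fn: "face_next M (opp M e) = rot M e" "opp M e \<in> f"
    using face_next_opp[OF ed(1)] e(2) face_next_in_face_iff[OF f, of "opp M e"] by auto
  have tx: "target_of M (opp M e) = ?x" using target_of_opp[OF ed(1)] ed by simp
  have od: "opp M d \<in> ?x" "opp M d \<notin> Or" "rot M (opp M d) = face_next M d"
    using vertex_of_self[of "opp M d"] d dd Or_iff by (auto simp: target_of_def face_next_def)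
  have xSN: "?x \<noteq> S" "?x \<noteq> N"
    using not_into_S d not_from_N[OF d(3)] by (auto simp: vertex_of_face_next)
  have "opp M e \<in> Or \<longleftrightarrow> e \<notin> Or" using Or_iff[OF ed(1)] .
  show ?thesis
  proof (cases "e \<in> Or")
    case True
    show ?thesis
    proof (cases "rot M e \<in> Or")
      case True
      then have "rot M e \<in> set pl" "face_next M d \<in> set pl"
        using e pl(2) d face_next_in_face_iff[OF f] by auto
      moreover have "vertex_of M (rot M e) = vertex_of M (face_next M d)"
        using ed by (simp add: vertex_of_rot vertex_of_face_next)
      ultimately have "face_next M (opp M e) = face_next M d" using injv fn by (auto dest: inj_onD)
      then have "opp M e = d" using face_next_inj by blast
      then show ?thesis using \<open>opp M e \<in> Or \<longleftrightarrow> e \<notin> Or\<close> \<open>e \<in> Or\<close> d by simp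
    next
      case False
      have "face_of M (rot M (opp M d)) = f" "face_of M (rot M e) = f"
        using od(3) in_facesD[OF f] e d face_next_in_face_iff[OF f] by auto
      then show ?thesis
        using lateral_corners_distinct[OF xv xSN p od(1,2), of e] od(3) d e \<open>e \<in> Or\<close> False by auto
    qed
  next
    case False
    have "rot M e \<in> Or"
    proof (rule ccontr)
      assume no: "rot M e \<notin> Or"
      have "opp M e \<in> set pl" "d \<in> set pl"
        using \<open>opp M e \<in> Or \<longleftrightarrow> e \<notin> Or\<close> False fn pl(2) d by auto
      then have "opp M e = d" using injt tx by (auto dest: inj_onD)
      then show False using fn no d by simp
    qed
    then show ?thesis using False by simp
  qed
qed

end

section \<open>Dissections\<close>

lemma (in finite_perm) orbit_enum:
  shows "bij_betw (\<lambda>i. (p ^^ i) x) {..<card (orbit p x)} (orbit p x)"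
    and "(p ^^ card (orbit p x)) x = x"
proof -
  have "\<exists>n. 0 < n \<and> (p ^^ n) x = x"
    using self_in_orbit[of x] by (auto simp: orbit_altdef)
  define m where "m = (LEAST n. 0 < n \<and> (p ^^ n) x = x)"
  have m: "0 < m" "(p ^^ m) x = x" using LeastI_ex[OF \<open>\<exists>n. _ n\<close>] by (auto simp: m_def)
  have least: "(p ^^ n) x \<noteq> x" if "0 < n" "n < m" for n
    using not_less_Least[of n] that unfolding m_def by blast
  have neq: "(p ^^ i) x \<noteq> (p ^^ j) x" if ij: "i < j" "j < m" for i j
  proof
    assume "(p ^^ i) x = (p ^^ j) x"
    moreover have "(p ^^ j) x = (p ^^ (i + (j - i))) x" using ij by simp
    ultimately have "(p ^^ i) ((p ^^ (j - i)) x) = (p ^^ i) x" by (simp only: funpow_add comp_apply)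
    then have "(p ^^ (j - i)) x = x" using inj_fn[OF inj, of i] by (auto dest: injD)
    then show False using least ij by simp
  qed
  have inj: "inj_on (\<lambda>i. (p ^^ i) x) {..<m}"
    by (rule inj_onI) (metis lessThan_iff linorder_neqE_nat neq)
  have im: "(\<lambda>i. (p ^^ i) x) ` {..<m} = orbit p x"
    using orbit_altdef_bounded[OF m(2,1)] by auto
  have "card (orbit p x) = m" using card_image[OF inj] im by simp
  then show "bij_betw (\<lambda>i. (p ^^ i) x) {..<card (orbit p x)} (orbit p x)"
    "(p ^^ card (orbit p x)) x = x"
    using inj im m by (auto simp: bij_betw_def)
qed

lemma dart_map_if_planar: "planar_map M \<Longrightarrow> dart_map M"
  by (simp add: planar_map_def dart_map_def)

context dart_map begin

lemma planar_euler:
  assumes "planar_map M"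
  shows "2 * card (vertices M) + 2 * card (faces M) = card (darts M) + 4"
  using assms card_edges by (simp add: planar_map_def)

lemma planar_mapI:
  assumes "darts M \<noteq> {}" "connected_map M"
    and "2 * card (vertices M) + 2 * card (faces M) = card (darts M) + 4"
  shows "planar_map M"
  using assms card_edges finite_darts rot_permutes opp_permutes opp_neq opp_opp
  by (simp add: planar_map_def)

lemma finite_perm_inv_rot: "finite_perm (inv (rot M)) (darts M)"
  by unfold_locales (rule permutes_inv[OF rot_permutes], rule finite_darts)

lemma clockwise_enum:
  "bij_betw (\<lambda>k. (inv (rot M) ^^ k) d) {..<card (vertex_of M d)} (vertex_of M d)"
  "(inv (rot M) ^^ card (vertex_of M d)) d = d"
  using finite_perm.orbit_enum[OF finite_perm_inv_rot, of d] orbit_inv_eq[OF rot.permutation]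
  by (simp_all add: vertex_of_def)

lemma rot_inv_rot: "rot M (inv (rot M) d) = d" and inv_rot_rot: "inv (rot M) (rot M d) = d"
  using permutes_inverses[OF rot_permutes] by auto

end

lemma three_blocks:
  assumes "set xs \<subseteq> {x, y, z}"
    and "successively (\<lambda>a b. a = x \<and> (b = x \<or> b = y) \<or> a = y \<and> (b = y \<or> b = z) \<or> a = z \<and> b = z) xs"
    and "distinct [x, y, z]"
  shows "\<exists>i j k. xs = replicate i x @ replicate j y @ replicate k z"
  using assms(1,2)
proof (induction xs)
  case Nil
  then show ?case by (intro exI[of _ 0]) simp
next
  case (Cons a xs)
  then obtain i j k where xs: "xs = replicate i x @ replicate j y @ replicate k z"
    by (auto simp: successively_Cons)
  consider "a = x" | "a = y" | "a = z" using Cons.prems by auto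
  then show ?case
  proof cases
    case 1
    then show ?thesis using xs by (intro exI[of _ "Suc i"] exI[of _ j] exI[of _ k]) simp
  next
    case 2
    have "i = 0" using Cons.prems(2) 2 xs assms(3) by (cases i) (auto simp: successively_Cons)
    then show ?thesis using xs 2 by (intro exI[of _ 0] exI[of _ "Suc j"] exI[of _ k]) simp
  next
    case 3
    have "i = 0" using Cons.prems(2) 3 xs assms(3) by (cases i) (auto simp: successively_Cons)
    moreover have "j = 0" using Cons.prems(2) 3 xs assms(3) \<open>i = 0\<close> by (cases j) (auto simp: successively_Cons)
    ultimately show ?thesis using xs 3 by (intro exI[of _ 0] exI[of _ "Suc k"]) simp
  qed
qed

section \<open>The outer hexagon and the numbers of a dissection\<close>

locale dissection =
  fixes D :: "('d, 'x) dissection_scheme"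
  assumes dissection: "dissection64 D"
begin

lemma planar: "planar_map D"
  using dissection by (simp add: dissection64_def)

sublocale dart_map D
  by (rule dart_map_if_planar[OF planar])

lemma connected: "connected_map D"
  using planar by (simp add: planar_map_def)

lemma root_in: "root D \<in> darts D"
  using dissection by (simp add: dissection64_def)

text \<open>Indexed by all natural numbers with period 6, so that neighbours on the hexagon can be
  written without reduction modulo 6.\<close>

definition r :: "nat \<Rightarrow> 'd" where "r i = (face_next D ^^ i) (root D)"

definition V :: "nat \<Rightarrow> 'd set" where "V i = vertex_of D (r i)"

lemma outer_vertex_eq: "outer_vertex D i = V i"
  by (simp add: outer_vertex_def V_def r_def)

lemma r_0: "r 0 = root D"
  by (simp add: r_def)

lemma face_next_r: "face_next D (r i) = r (Suc i)"
  by (simp add: r_def)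

lemma r_in: "r i \<in> darts D"
  by (induction i) (simp_all add: r_0 root_in face_next_r[symmetric] face_next_in_iff)

lemma V_in: "V i \<in> vertices D"
  by (simp add: V_def vertex_in_vertices r_in)

lemma outer_face_in: "outer_face D \<in> faces D"
  by (simp add: outer_face_def face_in_faces root_in)

lemma card_outer: "card (outer_face D) = 6"
  using dissection by (simp add: dissection64_def)

lemma r_enum: "bij_betw r {..<6} (outer_face D)" and r_6: "r 6 = r 0"
proof -
  have r: "r = (\<lambda>i. (face_next D ^^ i) (root D))" by (simp add: r_def fun_eq_iff)
  have o: "orbit (face_next D) (root D) = outer_face D" by (simp add: outer_face_def face_of_def)
  show "bij_betw r {..<6} (outer_face D)" "r 6 = r 0"
    using face.orbit_enum[of "root D"] unfolding r o card_outer by simp_all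
qed

lemma r_in_outer: "r i \<in> outer_face D"
  by (induction i)
    (simp_all add: r_0 face_of_self outer_face_def face_next_r[symmetric]
      face_next_in_face_iff[OF face_in_faces[OF root_in]])

lemma r_period: "r (i + 6) = r i"
proof (induction i)
  case 0 then show ?case by (simp add: r_6)
next
  case (Suc i) then show ?case using face_next_r[of "i + 6"] face_next_r[of i] by simp
qed

lemma outer_faceE:
  assumes "d \<in> outer_face D" obtains i where "i < 6" "d = r i"
  using assms r_enum by (auto simp: bij_betw_def)

lemma V_eq_iff: "i < 6 \<Longrightarrow> j < 6 \<Longrightarrow> V i = V j \<longleftrightarrow> i = j"
proof -
  assume ij: "i < 6" "j < 6"
  have "inj_on (vertex_of D) (outer_face D)" using dissection by (simp add: dissection64_def)
  then have "V i = V j \<longleftrightarrow> r i = r j"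
    using inj_onD[of "vertex_of D" "outer_face D" "r i" "r j"] r_in_outer by (auto simp: V_def)
  also have "\<dots> \<longleftrightarrow> i = j"
    using ij inj_onD[OF bij_betw_imp_inj_on[OF r_enum], of i j] by auto
  finally show ?thesis .
qed

lemma target_r: "target_of D (r i) = V (Suc i)"
  by (simp add: V_def face_next_r[symmetric] vertex_of_face_next)

lemma vertex_opp_r: "vertex_of D (opp D (r i)) = V (Suc i)"
  using target_r by (simp add: target_of_def)

lemma target_opp_r: "target_of D (opp D (r i)) = V i"
  by (simp add: target_of_opp r_in V_def)

lemma V_6: "V 6 = V 0"
  by (simp add: V_def r_6)

lemma rot_opp_r: "rot D (opp D (r i)) = r (Suc i)"
  using face_next_r[of i] by (simp add: face_next_def)

lemma opp_r_in: "opp D (r i) \<in> darts D"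
  by (simp add: opp_in_iff r_in)

lemma in_V_iff: "d \<in> V i \<longleftrightarrow> vertex_of D d = V i"
  using vertex_of_eq[of d "r i"] vertex_of_self[of d] by (auto simp: V_def)

text \<open>An edge with the outer face on both sides would be followed in both directions, and its
  ends would succeed each other both ways on a simple cycle of length 6.\<close>

lemma opp_r_not_outer: "opp D (r i) \<notin> outer_face D"
proof
  assume "opp D (r i) \<in> outer_face D"
  then obtain j where j: "j < 6" "opp D (r i) = r j" by (rule outer_faceE)
  define k where "k = i mod 6"
  have rk: "r (m + 6 * n) = r m" for m n
  proof (induction n)
    case (Suc n)
    have "m + 6 * Suc n = (m + 6 * n) + 6" by simp
    then show ?case using Suc r_period[of "m + 6 * n"] by (simp only:)
  qed simp
  have ri: "r i = r k" using rk[of k "i div 6"] by (simp add: k_def)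
  have k: "k < 6" by (simp add: k_def)
  have s: "V (Suc n) = V (Suc n mod 6)" if "n < 6" for n
    using that V_6 by (cases "n = 5") auto
  have "V j = V (Suc k)" using j ri vertex_opp_r[of k] by (simp add: V_def)
  then have jk: "j = Suc k mod 6" using s[OF k] V_eq_iff j by simp
  have "opp D (r j) = r k" using j ri opp_opp[OF r_in] by metis
  then have "V k = V (Suc j)" using vertex_opp_r[of j] by (simp add: V_def)
  then have "k = Suc j mod 6" using s[OF j(1)] V_eq_iff k by simp
  then show False using jk k by presburger
qed

lemma r_neq_opp_r: "r i \<noteq> opp D (r j)"
  using r_in_outer opp_r_not_outer by metis

lemma r_eq_iff: "i < 6 \<Longrightarrow> j < 6 \<Longrightarrow> r i = r j \<longleftrightarrow> i = j"
  using r_enum by (auto simp: bij_betw_def dest: inj_onD)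

lemma inner_darts_cases:
  assumes "d \<in> darts D"
  obtains "d \<in> inner_darts D" | i where "i < 6" "d = r i" | i where "i < 6" "d = opp D (r i)"
proof (cases "d \<in> inner_darts D")
  case False
  then consider "d \<in> outer_face D" | "opp D d \<in> outer_face D" using assms by (auto simp: inner_darts_def)
  then show ?thesis
  proof cases
    case 1 then show ?thesis using outer_faceE that(2) by metis
  next
    case 2
    then obtain i where "i < 6" "opp D d = r i" by (rule outer_faceE)
    then show ?thesis using that(3)[of i] opp_opp[OF assms] by metis
  qed
qed (rule that(1))

lemma inner_dart_not_r: "d \<in> inner_darts D \<Longrightarrow> d \<noteq> r i \<and> d \<noteq> opp D (r i)"
  using r_in_outer[of i] opp_opp[OF r_in[of i]] by (auto simp: inner_darts_def)

lemma opp_inner: "d \<in> inner_darts D \<Longrightarrow> opp D d \<in> inner_darts D"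
  by (simp add: inner_darts_def opp_in_iff opp_opp)

lemma inner_darts_in: "d \<in> inner_darts D \<Longrightarrow> d \<in> darts D"
  by (simp add: inner_darts_def)

lemma vertex_cases:
  assumes "v \<in> vertices D" obtains "v \<in> inner_vertices D" | i where "i < 6" "v = V i"
proof (cases "v \<in> inner_vertices D")
  case False
  then obtain d where d: "d \<in> v" "d \<in> outer_face D" using assms by (auto simp: inner_vertices_def)
  then obtain i where "i < 6" "d = r i" by (elim outer_faceE)
  then show ?thesis using that(2)[of i] in_verticesD[OF assms d(1)] by (simp add: V_def)
qed (rule that(1))

lemma inner_vertex_in: "v \<in> inner_vertices D \<Longrightarrow> v \<in> vertices D"
  by (simp add: inner_vertices_def)

lemma V_not_inner: "V i \<notin> inner_vertices D"
  using r_in_outer vertex_of_self by (auto simp: inner_vertices_def V_def)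

lemma dart_at_inner:
  assumes "v \<in> inner_vertices D" "d \<in> v" shows "d \<in> inner_darts D"
proof -
  have d: "d \<in> darts D" "vertex_of D d = v" using in_verticesD[OF inner_vertex_in[OF assms(1)] assms(2)] by auto
  show ?thesis
  proof (rule inner_darts_cases[OF d(1)])
    fix i assume "d = r i" then show ?thesis using d(2) assms V_not_inner by (auto simp: V_def)
  next
    fix i assume "d = opp D (r i)" then show ?thesis using d(2) assms V_not_inner by (auto simp: vertex_opp_r)
  qed
qed

lemma dart_at_V:
  assumes "d \<in> V (Suc i)" "i < 6" shows "d \<in> inner_darts D \<or> d = r (Suc i) \<or> d = opp D (r i)"
proof -
  have d: "d \<in> darts D" "vertex_of D d = V (Suc i)" using in_verticesD[OF V_in assms(1)] by auto
  have s: "V (Suc n) = V (Suc n mod 6)" "r (Suc n) = r (Suc n mod 6)" if "n < 6" for n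
    using that V_6 r_6 by (cases "n = 5"; simp)+
  show ?thesis
  proof (rule inner_darts_cases[OF d(1)])
    fix j assume j: "j < 6" "d = r j"
    then have "V j = V (Suc i mod 6)" using d(2) s(1)[OF assms(2)] by (simp add: V_def)
    then have "j = Suc i mod 6" using V_eq_iff j by simp
    then show ?thesis using j s(2)[OF assms(2)] by simp
  next
    fix j assume j: "j < 6" "d = opp D (r j)"
    then have "V (Suc j mod 6) = V (Suc i mod 6)" using d(2) s(1) assms(2) by (simp add: vertex_opp_r)
    then have "Suc j mod 6 = Suc i mod 6" using V_eq_iff by simp
    then have "j = i" using j(1) assms(2) by (simp add: mod_Suc split: if_splits)
    then show ?thesis using j(2) by simp
  qed simp
qed

lemma white_alternates: "d \<in> darts D \<Longrightarrow> vertex_of D d \<in> white D \<longleftrightarrow> target_of D d \<notin> white D"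
  using dissection by (simp add: dissection64_def)

lemma white_V: "V i \<in> white D \<longleftrightarrow> even i"
proof (induction i)
  case 0 show ?case using dissection by (simp add: V_def r_0 dissection64_def)
next
  case (Suc i)
  have "V i \<in> white D \<longleftrightarrow> V (Suc i) \<notin> white D"
    using white_alternates[OF r_in[of i], unfolded target_r] unfolding V_def[of i] .
  then show ?case using Suc by simp
qed

lemma black_iff: "v \<in> vertices D \<Longrightarrow> v \<in> black D \<longleftrightarrow> v \<notin> white D"
  by (simp add: black_def)

lemma black_alternates:
  "d \<in> darts D \<Longrightarrow> target_of D d \<in> black D \<longleftrightarrow> vertex_of D d \<in> white D"
  by (simp add: black_iff target_in_vertices white_alternates)

lemma white_subset: "white D \<subseteq> vertices D"
  using dissection by (simp add: dissection64_def)

lemma inner_face_card: "f \<in> faces D \<Longrightarrow> f \<noteq> outer_face D \<Longrightarrow> card f = 4"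
  using dissection by (simp add: dissection64_def inner_faces_def)

lemma card_faces: "card (faces D) = card (inner_faces D) + 1"
  using card.remove[OF finite_faces outer_face_in] by (simp add: inner_faces_def)

text \<open>The faces partition the darts.\<close>

lemma card_darts: "card (darts D) = 4 * card (inner_faces D) + 6"
proof -
  have "card (darts D) = (\<Sum>f\<in>faces D. card f)"
    using face.sum_orbits[of "\<lambda>_. 1::nat"] by (simp add: faces_eq)
  also have "faces D = insert (outer_face D) (inner_faces D)" using outer_face_in by (auto simp: inner_faces_def)
  also have "(\<Sum>f\<in>\<dots>. card f) = card (outer_face D) + (\<Sum>f\<in>inner_faces D. card f)"
    using finite_faces by (subst sum.insert) (auto simp: inner_faces_def)
  also have "(\<Sum>f\<in>inner_faces D. card f) = (\<Sum>f\<in>inner_faces D. 4)"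
    by (rule sum.cong[OF refl]) (auto simp: inner_faces_def inner_face_card)
  finally show ?thesis using card_outer by simp
qed

text \<open>Euler's formula; it makes the size parameters of the two families agree.\<close>

lemma card_vertices: "card (vertices D) = card (inner_faces D) + 4"
  using planar_euler[OF planar] card_faces card_darts by simp

end

text \<open>The steps are given counterclockwise, the order of \<open>rot\<close>, and read off
  backwards. The list is cut at \<open>e0\<close>, the only place where red and blue are neighbours
  in that order, so it cannot wrap around.\<close>

lemma (in dart_map) clockwise_blocks:
  fixes c :: "'d \<Rightarrow> colour option"
  assumes v: "v \<in> vertices M"
    and step: "\<And>e. e \<in> v \<Longrightarrow> (c e, c (rot M e)) \<in>
        {(Some Red, Some Red), (Some Red, Some Blue), (Some Blue, Some Blue),
         (Some Blue, Some Green), (Some Green, Some Green), (Some Green, Some Red)}"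
    and e0: "e0 \<in> v" "c e0 = Some Red" "c (rot M e0) = Some Blue"
    and uniq: "\<And>e. e \<in> v \<Longrightarrow> c e = Some Red \<Longrightarrow> c (rot M e) = Some Blue \<Longrightarrow> e = e0"
    and g: "g \<in> v" "c g = Some Green"
  shows "\<exists>i>0. \<exists>j>0. \<exists>k>0. map (\<lambda>k. c ((inv (rot M) ^^ k) e0)) [0..<card (vertex_of M e0)] =
    replicate i (Some Red) @ replicate j (Some Green) @ replicate k (Some Blue)"
proof -
  have ve: "vertex_of M e0 = v" using in_verticesD[OF v e0(1)] by simp
  define m where "m = card v"
  define s where "s k = (inv (rot M) ^^ k) e0" for k
  have s: "s = (\<lambda>k. (inv (rot M) ^^ k) e0)" by (simp add: s_def fun_eq_iff)
  have bij: "bij_betw s {..<m} v" and sm: "s m = e0"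
    using clockwise_enum[of e0] unfolding s ve m_def by simp_all
  have sv: "s k \<in> v" if "k < m" for k using bij that by (auto simp: bij_betw_def)
  have rs: "rot M (s (Suc k)) = s k" for k by (simp add: s_def rot_inv_rot)
  have s0: "s 0 = e0" by (simp add: s_def)
  define xs where "xs = map (\<lambda>k. c (s k)) [0..<m]"
  have sim: "v = s ` {..<m}" using bij by (simp add: bij_betw_def)
  have setxs: "set xs = c ` v" unfolding sim by (auto simp: xs_def)
  have "\<exists>i j k. xs = replicate i (Some Red) @ replicate j (Some Green) @ replicate k (Some Blue)"
  proof (rule three_blocks)
    show "set xs \<subseteq> {Some Red, Some Green, Some Blue}" unfolding setxs using step by fastforce
    show "successively (\<lambda>a b. a = Some Red \<and> (b = Some Red \<or> b = Some Green) \<or>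
        a = Some Green \<and> (b = Some Green \<or> b = Some Blue) \<or> a = Some Blue \<and> b = Some Blue) xs"
    proof (subst successively_conv_nth, intro allI impI)
      fix k assume "Suc k < length xs"
      then have k: "Suc k < m" by (simp add: xs_def)
      have "s (Suc k) \<noteq> s 0"
        using bij_betw_imp_inj_on[OF bij] k by (auto dest!: inj_onD)
      \<comment> \<open>Only the starting dart may be red with a blue counterclockwise
        successor.\<close>
      then have "c (s (Suc k)) = Some Red \<Longrightarrow> c (s k) \<noteq> Some Blue"
        using uniq[OF sv[OF k]] rs s0 by auto
      then show "xs ! k = Some Red \<and> (xs ! Suc k = Some Red \<or> xs ! Suc k = Some Green) \<or>
        xs ! k = Some Green \<and> (xs ! Suc k = Some Green \<or> xs ! Suc k = Some Blue) \<or>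
        xs ! k = Some Blue \<and> xs ! Suc k = Some Blue"
        using step[OF sv[OF k]] rs k by (auto simp: xs_def)
    qed
    show "distinct [Some Red, Some Green, Some Blue]" by simp
  qed
  then obtain i j k where ijk: "xs = replicate i (Some Red) @ replicate j (Some Green) @ replicate k (Some Blue)"
    by blast
  have "Some Red \<in> set xs" "Some Green \<in> set xs" "Some Blue \<in> set xs"
    using e0 g rot_in_vertex_iff[OF v] unfolding setxs by (force simp: image_iff)+
  then have "i > 0" "j > 0" "k > 0" unfolding ijk by auto
  then show ?thesis using ijk unfolding xs_def s_def m_def ve by blast
qed

section \<open>Propagation along a run of a cyclic sequence\<close>

context finite_perm begin

text \<open>A run with the single entry \<open>b\<close> begins at \<open>p b\<close>, so membership
  in \<open>B\<close> can be carried along the whole of it. The backward rule starts at the single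
  exit instead.\<close>

lemma run_forward:
  assumes b: "b \<in> orbit p x" "\<not> Q b" "p b \<in> B"
    and uniq: "\<And>z. z \<in> orbit p x \<Longrightarrow> \<not> Q z \<Longrightarrow> Q (p z) \<Longrightarrow> z = b"
    and B: "\<And>z. z \<in> B \<Longrightarrow> z \<in> orbit p x \<Longrightarrow> Q (p z) \<Longrightarrow> p z \<in> B"
    and y: "y \<in> orbit p x" "Q y"
  shows "y \<in> B"
proof -
  have ob: "orbit p b = orbit p x" using b(1) orbit_eq by blast
  have "\<not> Q y \<or> y \<in> B"
  proof (rule orbit_invariant[of y b "\<lambda>y. \<not> Q y \<or> y \<in> B"])
    show "y \<in> orbit p b" using y ob by simp
    show "\<not> Q b \<or> b \<in> B" using b by simp
    fix z assume z: "z \<in> orbit p b" "\<not> Q z \<or> z \<in> B"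
    then have zo: "z \<in> orbit p x" using ob by simp
    show "\<not> Q (p z) \<or> p z \<in> B"
    proof (cases "Q z")
      case True then show ?thesis using z B[OF _ zo] by blast
    next
      case False then show ?thesis using uniq[OF zo] b(3) by blast
    qed
  qed
  then show ?thesis using y by blast
qed

lemma run_backward:
  assumes t: "t \<in> orbit p x" "t \<in> B"
    and uniq: "\<And>z. z \<in> orbit p x \<Longrightarrow> Q z \<Longrightarrow> \<not> Q (p z) \<Longrightarrow> z = t"
    and B: "\<And>z. z \<in> orbit p x \<Longrightarrow> Q z \<Longrightarrow> p z \<in> B \<Longrightarrow> z \<in> B"
    and y: "y \<in> orbit p x" "Q y"
  shows "y \<in> B"
proof (rule ccontr)
  assume "y \<notin> B"
  have oy: "orbit p y = orbit p x" using y(1) orbit_eq by blast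
  have "Q t \<and> t \<notin> B"
  proof (rule orbit_invariant[of t y "\<lambda>y. Q y \<and> y \<notin> B"])
    show "t \<in> orbit p y" using t oy by simp
    show "Q y \<and> y \<notin> B" using y \<open>y \<notin> B\<close> by simp
    fix z assume z: "z \<in> orbit p y" "Q z \<and> z \<notin> B"
    then have zo: "z \<in> orbit p x" using oy by simp
    show "Q (p z) \<and> p z \<notin> B" using z uniq[OF zo] B[OF zo] t(2) by blast
  qed
  then show False using t by simp
qed

end

section \<open>Lateral paths of the faces of a submap\<close>

context spanning_submap begin

lemma vertex_of_face_next_X: "d \<in> P \<Longrightarrow> vertex_of M (face_next X d) = target_of M d"
proof -
  assume d: "d \<in> P"
  then have "face_next M d \<in> darts M" using P_subset face_next_in_iff by blast
  then have "next_in M P (face_next M d) \<in> vertex_of M (face_next M d)" using next_in_mem by blast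
  then have "vertex_of M (next_in M P (face_next M d)) = vertex_of M (face_next M d)" by (rule vertex_of_eq)
  then show ?thesis using face_next_X[OF d] vertex_of_face_next[of d] by simp
qed

text \<open>The corners belong to the submap, the vertices to \<open>M\<close>, which is how
  \<open>ST2\<close> combines them.\<close>

lemma path_interior_left:
  assumes "tight_bipolar X Or S N" "f \<in> faces X" "contour_paths X Or f u v p q"
  shows "path_interior M p = target_of M ` {d \<in> f. d \<in> Or \<and> face_next X d \<in> Or}"
proof -
  have fP: "d \<in> P" if "d \<in> f" for d using X.in_facesD[OF assms(2) that] by simp
  show ?thesis
    unfolding path_interior_def tight_bipolar.set_tl_left[OF assms] image_image
    by (rule image_cong[OF refl]) (auto simp: fP vertex_of_face_next_X)
qed

lemma path_interior_right:
  assumes "tight_bipolar X Or S N" "f \<in> faces X" "contour_paths X Or f u v p q"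
  shows "path_interior M q = target_of M ` {d \<in> f. d \<notin> Or \<and> face_next X d \<notin> Or}"
proof -
  have fP: "d \<in> P" if "d \<in> f" for d using X.in_facesD[OF assms(2) that] by simp
  show ?thesis
    unfolding path_interior_def tight_bipolar.set_tl_right[OF assms] image_image
    by (rule image_cong[OF refl]) (auto simp: fP opp_X target_of_def)
qed

end

text \<open>The dart just before \<open>next_in M P t\<close> is \<open>t\<close> or comes after
  \<open>t\<close>, and is still outside \<open>P\<close>. Hence a corner between two darts of
  \<open>P\<close> that are consecutive in \<open>M\<close> contains no other dart.\<close>

lemma (in spanning_submap) next_in_not_rot:
  "t \<in> darts M \<Longrightarrow> t \<notin> P \<Longrightarrow> next_in M P t = rot M e \<Longrightarrow> e \<notin> P"
proof (induction rule: next_in_induct)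
  case (step d)
  show ?case
  proof (cases "rot M d \<in> P")
    case True
    then have "rot M d = rot M e" using step next_in_step[of d] by (simp add: next_in_P)
    then show ?thesis using step rot_inj by simp
  next
    case False then show ?thesis using step next_in_step[of d] by simp
  qed
qed simp

lemma (in bipolar) reverse_path:
  assumes "directed_path M Or u p v"
  shows "directed_path M (darts M - Or) v (map (opp M) (rev p)) u"
proof -
  have p: "p \<noteq> []" "set p \<subseteq> Or" "distinct p" "successively (\<lambda>d e. target_of M d = vertex_of M e) p"
    "vertex_of M (hd p) = u" "target_of M (last p) = v"
    using assms by (auto simp: directed_path_def)
  have pd: "x \<in> darts M" if "x \<in> set p" for x using p(2) Or_subset that by blast
  show ?thesis unfolding directed_path_def
  proof (intro conjI)
    show "set (map (opp M) (rev p)) \<subseteq> darts M - Or"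
    proof
      fix x assume "x \<in> set (map (opp M) (rev p))"
      then obtain d where d: "d \<in> set p" "x = opp M d" by auto
      then show "x \<in> darts M - Or" using p(2) pd[OF d(1)] opp_in_iff Or_iff by blast
    qed
    show "distinct (map (opp M) (rev p))" using p(3) opp_inj by (auto simp: distinct_map inj_on_def)
    show "successively (\<lambda>d e. target_of M d = vertex_of M e) (map (opp M) (rev p))"
      unfolding successively_map successively_rev
    proof (rule successively_mono[OF p(4)])
      fix x y assume "x \<in> set p" "y \<in> set p" "target_of M x = vertex_of M y"
      then show "target_of M (opp M y) = vertex_of M (opp M x)"
        using target_of_opp[OF pd[of y]] by (simp add: target_of_def)
    qed
    show "vertex_of M (hd (map (opp M) (rev p))) = v"
      using p(1,6) by (simp add: hd_map hd_rev target_of_def)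
    show "target_of M (last (map (opp M) (rev p))) = u"
      using p(1,5) pd[of "hd p"] by (simp add: last_map last_rev target_of_opp)
  qed (use p(1) in simp)
qed

text \<open>For a plain dart, the equation of truth values says that the edge is oriented from black
  to white, whichever of its halves \<open>d\<close> is.\<close>

definition colouring_of :: "('d, 'x) dissection_scheme \<Rightarrow> 'd set \<Rightarrow> 'd \<Rightarrow> colour option" where
  "colouring_of D Or d =
     (if d \<notin> inner_darts D then None
      else if d \<notin> plain_darts D Or then Some Green
      else if (d \<in> Or) = (vertex_of D d \<in> black D) then Some Red
      else Some Blue)"

text \<open>The outer edges have no colour. They are directed from the outer vertex at position 3 to
  the root-vertex on both sides, the only possibility for outer type (2,2) with the sink at the
  root.\<close>

definition orientation_of :: "('d, 'x) dissection_scheme \<Rightarrow> ('d \<Rightarrow> colour option) \<Rightarrow> 'd set" where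
  "orientation_of D c =
     {d \<in> inner_darts D. c d = Some Red \<and> vertex_of D d \<in> black D \<or>
        c d = Some Blue \<and> vertex_of D d \<in> white D}
     \<union> (\<lambda>i. (face_next D ^^ i) (root D)) ` {3, 4, 5}
     \<union> (\<lambda>i. opp D ((face_next D ^^ i) (root D))) ` {0, 1, 2}"

section \<open>From transverse orientations to labelings\<close>

locale transverse = dissection D for D :: "('d, 'x) dissection_scheme" +
  fixes Or S N
  assumes Or_sub: "Or \<subseteq> darts D" and Or_opp: "d \<in> Or \<Longrightarrow> opp D d \<notin> Or"
    and plain_spans: "v \<in> vertices D \<Longrightarrow> v \<inter> plain_darts D Or \<noteq> {}"
    and bip: "plane_bipolar (plain_map D Or) (plain_outer_face D Or) Or S N"
    and outer_type: "outer_type_2_2 (plain_map D Or) (plain_outer_face D Or) Or S N"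
    and N_eq: "N = vertex_of D (root D) \<inter> plain_darts D Or"
    and ST2: "ST2 D Or"
begin

abbreviation P where "P \<equiv> plain_darts D Or"

sublocale spanning_submap D P
proof
  show "P \<subseteq> darts D" using Or_sub opp_in_iff by (auto simp: plain_darts_def)
  show "\<And>d. d \<in> P \<Longrightarrow> opp D d \<in> P" using Or_sub opp_opp by (auto simp: plain_darts_def)
qed (rule plain_spans)

lemma plain_map_eq: "plain_map D Or = X"
  by (simp add: plain_map_def)

sublocale tb: tight_bipolar X Or S N
proof
  have pb: "planar_map X" "orientation X Or" "acyclic (arcs X Or)" "sources X Or = {S}" "sinks X Or = {N}"
    using bip by (simp_all add: plane_bipolar_def plain_map_eq arcs_def)
  show "orientation X Or" "acyclic (arcs X Or)" "sources X Or = {S}" "sinks X Or = {N}" by fact+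
  show "2 * card (vertices X) + 2 * card (faces X) = card (darts X) + 4"
    by (rule X.planar_euler[OF pb(1)])
qed

lemma Or_P: "d \<in> Or \<Longrightarrow> d \<in> P"
  by (simp add: plain_darts_def)

lemma Or_iff: "d \<in> P \<Longrightarrow> opp D d \<in> Or \<longleftrightarrow> d \<notin> Or"
  using tb.Or_iff[of d] by (simp add: opp_X)

lemma trans_iff: "t \<in> transversal_darts D Or \<longleftrightarrow> t \<in> darts D \<and> t \<notin> P"
  by (simp add: transversal_darts_def)

lemma trans_opp: "t \<in> transversal_darts D Or \<Longrightarrow> opp D t \<in> transversal_darts D Or"
  using opp_in_iff opp_in_P_iff by (simp add: trans_iff)

lemma plain_outer_in: "plain_outer_face D Or \<in> faces X"
  using next_in_mem[OF root_in] by (simp add: plain_outer_face_def plain_map_eq X.face_in_faces)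

lemma inner_in_faces: "f \<in> plain_inner_faces D Or \<Longrightarrow> f \<in> faces X"
  by (simp add: plain_inner_faces_def plain_map_eq)

text \<open>A corner belongs to one face only, so the face that \<open>ST2\<close> provides for
  \<open>t\<close> is \<open>f\<close>.\<close>

lemma trans_within:
  assumes "t \<in> darts D" "t \<notin> P" "next_in D P t \<in> f" "f \<in> faces X"
  shows "f \<in> plain_inner_faces D Or \<and> edge_within D P t f"
proof -
  have "\<forall>t\<in>transversal_darts D Or. \<exists>f\<in>plain_inner_faces D Or. edge_within D P t f"
    using ST2 unfolding ST2_def by (rule conjunct1)
  moreover have "t \<in> transversal_darts D Or" using assms by (simp add: trans_iff)
  ultimately obtain g where g: "g \<in> plain_inner_faces D Or" "edge_within D P t g" by blast
  then have "next_in D P t \<in> g" "g \<in> faces X" using inner_in_faces by (simp_all add: edge_within_def)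
  then have "g = f" using assms(3,4) X.in_facesD[of g "next_in D P t"] X.in_facesD[of f "next_in D P t"] by simp
  then show ?thesis using g by simp
qed

text \<open>Transversal edges stay in inner faces. Hence none is met when the outer face of the
  plain map is followed from the corner of the root, and the walk is that around the
  hexagon.\<close>

lemma r_plain: "r i \<in> P \<and> r i \<in> plain_outer_face D Or"
proof -
  have *: "d \<in> P \<and> d \<in> plain_outer_face D Or"
    if "d \<in> darts D" "next_in D P d \<in> plain_outer_face D Or" for d
  proof -
    have "d \<in> P" using trans_within[OF that(1) _ that(2) plain_outer_in] by (auto simp: plain_inner_faces_def)
    then show ?thesis using that by (simp add: next_in_P)
  qed
  show ?thesis
  proof (induction i)
    case 0
    show ?case using * r_in[of 0] X.face_of_self by (simp add: r_0 plain_outer_face_def plain_map_eq)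
  next
    case (Suc i)
    then have "face_next X (r i) \<in> plain_outer_face D Or"
      using X.face_next_in_face_iff[OF plain_outer_in] by simp
    then have "next_in D P (r (Suc i)) \<in> plain_outer_face D Or"
      using Suc by (simp add: face_next_X face_next_r)
    then show ?case using * r_in by blast
  qed
qed

lemma r_P: "r i \<in> P" and opp_r_P: "opp D (r i) \<in> P"
  using r_plain P_opp by blast+

lemma face_next_X_r: "face_next X (r i) = r (Suc i)"
  using r_P by (simp add: face_next_X face_next_r next_in_P)

lemma rot_X_opp_r: "rot X (opp D (r i)) = r (Suc i)"
  using opp_r_P r_P by (simp add: rot_X rot_opp_r next_in_P)

lemma plain_outer_eq: "plain_outer_face D Or = outer_face D"
proof
  show "outer_face D \<subseteq> plain_outer_face D Or"
  proof
    fix d assume "d \<in> outer_face D"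
    then obtain i where "d = r i" by (elim outer_faceE)
    then show "d \<in> plain_outer_face D Or" using r_plain by simp
  qed
  show "plain_outer_face D Or \<subseteq> outer_face D"
  proof
    fix d assume "d \<in> plain_outer_face D Or"
    moreover have "face_of X (r 0) = plain_outer_face D Or"
      using X.in_facesD[OF plain_outer_in conjunct2[OF r_plain[of 0]]] by (rule conjunct2)
    ultimately have "d \<in> face_of X (r 0)" by simp
    then have "d \<in> orbit (face_next X) (r 0)" unfolding face_of_def .
    then show "d \<in> outer_face D"
    proof induction
      case base show ?case by (simp add: face_next_X_r r_in_outer)
    next
      case (step y)
      obtain i where "y = r i" using step(2) by (elim outer_faceE)
      then show ?case by (simp add: face_next_X_r r_in_outer)
    qed
  qed
qed

lemma outer_in_X: "outer_face D \<in> faces X"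
  using plain_outer_in plain_outer_eq by simp

lemma inner_iff: "f \<in> plain_inner_faces D Or \<longleftrightarrow> f \<in> faces X \<and> f \<noteq> outer_face D"
  by (simp add: plain_inner_faces_def plain_outer_eq plain_map_eq)

lemma not_outer_inner: "d \<in> P \<Longrightarrow> d \<notin> outer_face D \<Longrightarrow> face_of X d \<in> plain_inner_faces D Or"
  using X.face_in_faces[of d] X.face_of_self by (auto simp: inner_iff)

lemma VX: "vertex_of X (r i) = V i \<inter> P"
  by (simp add: vertex_of_X r_P V_def)

lemma VX_eq: "i < 6 \<Longrightarrow> j < 6 \<Longrightarrow> V i \<inter> P = V j \<inter> P \<longleftrightarrow> i = j"
  using vertex_inter_inj[OF V_in V_in] V_eq_iff by blast

lemma V_mod: "i \<le> 6 \<Longrightarrow> V i = V (i mod 6)"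
  by (cases "i = 6") (auto simp: V_6)

lemma N_V0: "N = V 0 \<inter> P"
  using N_eq by (simp add: V_def r_0)

text \<open>The outer path with the outer face on its right consists of three darts
  \<open>r i\<close> and ends at the root-vertex; read backwards it must be \<open>r 5\<close>,
  \<open>r 4\<close>, \<open>r 3\<close>. The last claim chooses, for a given vertex, the outer path
  that avoids it, as \<open>lateral_corners_distinct\<close> requires.\<close>

lemma outer_orientation:
  shows "S = V 3 \<inter> P" "r 3 \<in> Or" "r 4 \<in> Or" "r 5 \<in> Or" "r 0 \<notin> Or" "r 1 \<notin> Or" "r 2 \<notin> Or"
    and "\<And>x. x \<noteq> S \<Longrightarrow> x \<noteq> N \<Longrightarrow> \<exists>p. directed_path X Or S p N \<and> x \<notin> vertex_of X ` set p \<and> x \<notin> target_of X ` set p"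
proof -
  obtain p q where pq: "contour_paths X Or (outer_face D) S N p q" "length p = 3" "length q = 3"
    using outer_type by (auto simp: outer_type_2_2_def plain_outer_eq plain_map_eq)
  then have p: "directed_path X Or S p N" "set p = {d \<in> Or. d \<in> outer_face D}"
    and q: "directed_path X Or S q N" "set q = {d \<in> Or. opp X d \<in> outer_face D}"
    by (auto simp: contour_paths_def)
  obtain a b c where abc: "p = [a, b, c]" using pq(2) by (auto simp: numeral_3_eq_3 length_Suc_conv)
  have tX: "target_of X (r i) = V (Suc i) \<inter> P" for i using r_P by (simp add: target_of_X target_r)
  \<comment> \<open>The only outer dart into \<open>V j\<close> is the one before
    \<open>r j\<close>, which is \<open>r 5\<close> for \<open>j = 0\<close>.\<close>
  have step: "d = r (if j = 0 then 5 else j - 1)"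
    if d: "d \<in> set p" "target_of X d = V j \<inter> P" "j < 6" for d j
  proof -
    have "d \<in> outer_face D" using d(1) p(2) by simp
    then obtain i where i: "i < 6" "d = r i" by (rule outer_faceE)
    then have "V (Suc i mod 6) \<inter> P = V j \<inter> P" using d(2) tX[of i] V_mod[of "Suc i"] by simp
    then have "Suc i mod 6 = j" using VX_eq[of "Suc i mod 6" j] d(3) by simp
    then show ?thesis using i by (cases "i = 5") auto
  qed
  have c: "c = r 5" using step[of c 0] p(1) N_V0 abc by (simp add: directed_path_def)
  have b: "b = r 4" using step[of b 5] p(1) abc c VX[of 5] by (simp add: directed_path_def)
  have a: "a = r 3" using step[of a 4] p(1) abc b VX[of 4] by (simp add: directed_path_def)
  show "S = V 3 \<inter> P" using p(1) abc a VX[of 3] by (simp add: directed_path_def)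
  have sp: "set p = {r 3, r 4, r 5}" using abc a b c by simp
  have memp: "r i \<in> Or \<longleftrightarrow> r i \<in> {r 3, r 4, r 5}" for i using sp p(2) r_in_outer by blast
  show "r 3 \<in> Or" "r 4 \<in> Or" "r 5 \<in> Or" "r 0 \<notin> Or" "r 1 \<notin> Or" "r 2 \<notin> Or"
    unfolding memp by (simp_all add: r_eq_iff)
  fix x assume x: "x \<noteq> S" "x \<noteq> N"
  show "\<exists>p. directed_path X Or S p N \<and> x \<notin> vertex_of X ` set p \<and> x \<notin> target_of X ` set p"
  proof (cases "x \<in> vertex_of X ` set p \<or> x \<in> target_of X ` set p")
    case False then show ?thesis using p by blast
  next
    case True
    then have "x \<in> {V 3 \<inter> P, V 4 \<inter> P, V 5 \<inter> P, V 6 \<inter> P}"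
      unfolding sp using VX[of 3] VX[of 4] VX[of 5] tX[of 3] tX[of 4] tX[of 5] by auto
    then have x45: "x = V 4 \<inter> P \<or> x = V 5 \<inter> P" using x \<open>S = V 3 \<inter> P\<close> N_V0 V_6 by auto
    have sq: "d \<in> opp D ` {r 0, r 1, r 2}" if "d \<in> set q" for d
    proof -
      have d: "d \<in> Or" "opp D d \<in> outer_face D" using that q(2) Or_P by (auto simp: opp_X)
      then obtain i where i: "i < 6" "opp D d = r i" by (elim outer_faceE)
      have "opp D d \<notin> Or" using d Or_opp by blast
      then have "i \<notin> {3, 4, 5}" using i \<open>r 3 \<in> Or\<close> \<open>r 4 \<in> Or\<close> \<open>r 5 \<in> Or\<close> by auto
      then have "i = 0 \<or> i = 1 \<or> i = 2" using i by auto
      then show ?thesis using i opp_opp[of d] d Or_sub by (metis image_eqI insertCI in_mono)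
    qed
    have vt: "vertex_of X (opp D (r i)) = V (Suc i) \<inter> P \<and> target_of X (opp D (r i)) = V i \<inter> P" for i
      using opp_r_P by (simp add: vertex_of_X target_of_X vertex_opp_r target_opp_r)
    have "vertex_of X ` set q \<union> target_of X ` set q
        \<subseteq> vertex_of X ` opp D ` {r 0, r 1, r 2} \<union> target_of X ` opp D ` {r 0, r 1, r 2}"
      using sq by blast
    also have "\<dots> = {V 0 \<inter> P, V 1 \<inter> P, V 2 \<inter> P, V 3 \<inter> P}"
      using vt[of 0] vt[of 1] vt[of 2] by (auto simp: eval_nat_numeral)
    finally have sub: "vertex_of X ` set q \<union> target_of X ` set q \<subseteq> {V 0 \<inter> P, V 1 \<inter> P, V 2 \<inter> P, V 3 \<inter> P}" .
    have "x \<noteq> V i \<inter> P" if "i < 4" for i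
      using VX_eq[of 4 i] VX_eq[of 5 i] x45 that by auto
    then have "x \<notin> {V 0 \<inter> P, V 1 \<inter> P, V 2 \<inter> P, V 3 \<inter> P}" by simp
    then show ?thesis using q sub by blast
  qed
qed

lemma opp_r_Or: "opp D (r 0) \<in> Or" "opp D (r 1) \<in> Or" "opp D (r 2) \<in> Or"
  "opp D (r 3) \<notin> Or" "opp D (r 4) \<notin> Or" "opp D (r 5) \<notin> Or"
  using outer_orientation(2-7) Or_iff[OF r_P] by simp_all

lemma orientation_of_colouring_of: "orientation_of D (colouring_of D Or) = Or"
proof -
  have r: "(face_next D ^^ i) (root D) = r i" for i by (simp add: r_def)
  have inner: "d \<in> inner_darts D \<Longrightarrow> d \<in> orientation_of D (colouring_of D Or) \<longleftrightarrow> d \<in> Or" for d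
  proof -
    assume d: "d \<in> inner_darts D"
    then have "vertex_of D d \<in> vertices D" using inner_darts_in vertex_in_vertices by blast
    then show ?thesis using d inner_dart_not_r[OF d] Or_P black_iff
      unfolding orientation_of_def r by (auto simp: colouring_of_def)
  qed
  show ?thesis
  proof (intro set_eqI iffI)
    fix d assume d: "d \<in> orientation_of D (colouring_of D Or)"
    then have "d \<in> inner_darts D \<or> d \<in> r ` {3,4,5} \<or> d \<in> (\<lambda>i. opp D (r i)) ` {0,1,2}"
      unfolding orientation_of_def r by auto
    then show "d \<in> Or" using inner d outer_orientation(2-4) opp_r_Or(1-3) by auto
  next
    fix d assume d: "d \<in> Or"
    then have "d \<in> darts D" using Or_sub by blast
    then show "d \<in> orientation_of D (colouring_of D Or)"
    proof (rule inner_darts_cases)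
      fix i assume i: "i < 6" "d = r i"
      then have "i \<in> {3, 4, 5}" using d outer_orientation(5-7)
        by (auto simp: numeral_eq_Suc less_Suc_eq)
      then show ?thesis using i unfolding orientation_of_def r by auto
    next
      fix i assume i: "i < 6" "d = opp D (r i)"
      then have "i \<in> {0, 1, 2}" using d opp_r_Or(4-6)
        by (auto simp: numeral_eq_Suc less_Suc_eq)
      then show ?thesis using i unfolding orientation_of_def r by auto
    qed (use inner d in blast)
  qed
qed

section \<open>Lateral corners and the transversal edges in them\<close>

definition L where "L f = {d \<in> f. d \<in> Or \<and> face_next X d \<in> Or}"
text \<open>As in \<open>L\<close>, a lateral corner is represented by the dart of the contour that
  arrives there; the contour descends the right path, hence the two negations.\<close>

definition R where "R f = {d \<in> f. d \<notin> Or \<and> face_next X d \<notin> Or}"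

text \<open>A form of \<open>ST2\<close> from which the existentially quantified lateral paths have
  disappeared.\<close>

lemma ST2_face:
  assumes f: "f \<in> plain_inner_faces D Or"
  shows "\<And>t. t \<in> transversal_darts D Or \<Longrightarrow> edge_within D P t f \<Longrightarrow> vertex_of D t \<in> black D \<Longrightarrow>
      vertex_of D t \<in> target_of D ` L f \<and> target_of D t \<in> target_of D ` R f"
    and "\<And>x. x \<in> black D \<Longrightarrow> x \<in> target_of D ` L f \<Longrightarrow>
      \<exists>t\<in>transversal_darts D Or. edge_within D P t f \<and> vertex_of D t = x"
    and "\<And>x. x \<in> white D \<Longrightarrow> x \<in> target_of D ` R f \<Longrightarrow>
      \<exists>t\<in>transversal_darts D Or. edge_within D P t f \<and> vertex_of D t = x"
proof -
  have fX: "f \<in> faces X" using inner_in_faces[OF f] .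
  obtain u v p q where c: "contour_paths X Or f u v p q"
    and st: "\<forall>t\<in>transversal_darts D Or. edge_within D P t f \<longrightarrow>
           (\<exists>x y. {vertex_of D t, target_of D t} = {x, y} \<and> x \<in> black D \<and> x \<in> path_interior D p \<and>
              y \<in> white D \<and> y \<in> path_interior D q)"
    and ex: "\<forall>x\<in>(black D \<inter> path_interior D p) \<union> (white D \<inter> path_interior D q).
           \<exists>t\<in>transversal_darts D Or. edge_within D P t f \<and> vertex_of D t = x"
    using bspec[OF conjunct2[OF ST2[unfolded ST2_def plain_map_eq]] f] by (elim exE conjE)
  have pL: "path_interior D p = target_of D ` L f"
    using path_interior_left[OF tb.tight_bipolar_axioms fX c] by (simp add: L_def)
  have pR: "path_interior D q = target_of D ` R f"
    using path_interior_right[OF tb.tight_bipolar_axioms fX c] by (simp add: R_def)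
  show "\<And>x. x \<in> black D \<Longrightarrow> x \<in> target_of D ` L f \<Longrightarrow>
      \<exists>t\<in>transversal_darts D Or. edge_within D P t f \<and> vertex_of D t = x"
    using ex pL by blast
  show "\<And>x. x \<in> white D \<Longrightarrow> x \<in> target_of D ` R f \<Longrightarrow>
      \<exists>t\<in>transversal_darts D Or. edge_within D P t f \<and> vertex_of D t = x"
    using ex pR by blast
  fix t assume t: "t \<in> transversal_darts D Or" "edge_within D P t f" "vertex_of D t \<in> black D"
  obtain x y where xy: "{vertex_of D t, target_of D t} = {x, y}" "x \<in> black D" "x \<in> path_interior D p"
      "y \<in> white D" "y \<in> path_interior D q"
    using mp[OF bspec[OF st t(1)] t(2)] by (elim exE conjE)
  have "vertex_of D t \<notin> white D" using t(3) by (simp add: black_def)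
  then have "vertex_of D t = x" "target_of D t = y" using xy by (auto simp: doubleton_eq_iff)
  then show "vertex_of D t \<in> target_of D ` L f \<and> target_of D t \<in> target_of D ` R f"
    using xy pL pR by simp
qed

text \<open>The black end is at a lateral corner of the left path of some face. The corner of
  \<open>t\<close> is in the same face at the same vertex, hence of the same kind by
  \<open>corner_at_left_path\<close>, with an outer path as the avoiding path.\<close>

lemma trans_black_corner:
  assumes t: "t \<in> transversal_darts D Or" "vertex_of D t \<in> black D"
    and b: "b \<in> P" "b \<in> vertex_of D t" "rot X b = next_in D P t"
  shows "b \<notin> Or \<and> next_in D P t \<in> Or"
proof -
  have td: "t \<in> darts D" "t \<notin> P" using t by (auto simp: trans_iff)
  define f where "f = face_of X (next_in D P t)"
  have NP: "next_in D P t \<in> P" using next_in_mem td by blast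
  then have f: "f \<in> faces X" "next_in D P t \<in> f" using X.face_in_faces X.face_of_self by (auto simp: f_def)
  then have fi: "f \<in> plain_inner_faces D Or" "edge_within D P t f" using trans_within td by auto
  obtain d where d: "d \<in> f" "d \<in> Or" "face_next X d \<in> Or" "vertex_of D t = target_of D d"
    using ST2_face(1)[OF fi(1) t(1) fi(2) t(2)] by (auto simp: L_def)
  have bt: "b \<in> target_of X d" using b d Or_P by (simp add: target_of_X)
  have "target_of X d \<noteq> S" using tb.not_into_S d by blast
  moreover have "target_of X d \<noteq> N" using tb.not_from_N[OF d(3)] by (simp add: X.vertex_of_face_next)
  ultimately have "\<exists>p. directed_path X Or S p N \<and> target_of X d \<notin> vertex_of X ` set p
      \<and> target_of X d \<notin> target_of X ` set p" by (intro outer_orientation(8))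
  then obtain p where "directed_path X Or S p N" "target_of X d \<notin> vertex_of X ` set p"
    by (elim exE conjE)
  then show ?thesis
    using tb.corner_at_left_path[OF f(1) d(1-3) bt] b(3) f(2) by simp
qed

text \<open>The previous argument for the reversed orientation. The avoiding path is reversed as
  well, which is why \<open>outer_orientation\<close> speaks of targets too.\<close>

lemma trans_white_corner:
  assumes t: "t \<in> transversal_darts D Or" "vertex_of D t \<in> white D"
    and b: "b \<in> P" "b \<in> vertex_of D t" "rot X b = next_in D P t"
  shows "b \<in> Or \<and> next_in D P t \<notin> Or"
proof -
  have td: "t \<in> darts D" "t \<notin> P" using t by (auto simp: trans_iff)
  define f where "f = face_of X (next_in D P t)"
  have NP: "next_in D P t \<in> P" using next_in_mem td by blast
  then have f: "f \<in> faces X" "next_in D P t \<in> f" using X.face_in_faces X.face_of_self by (auto simp: f_def)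
  then have fi: "f \<in> plain_inner_faces D Or" "edge_within D P t f" using trans_within td by auto
  have ob: "vertex_of D (opp D t) \<in> black D"
    using black_alternates[OF td(1)] t(2) by (simp add: target_of_def)
  have "edge_within D P (opp D t) f" using fi(2) opp_opp[OF td(1)] by (auto simp: edge_within_def)
  then obtain d where d: "d \<in> f" "d \<notin> Or" "face_next X d \<notin> Or" "vertex_of D t = target_of D d"
    using ST2_face(1)[OF fi(1) trans_opp[OF t(1)] _ ob] target_of_opp[OF td(1)] by (auto simp: R_def)
  have dP: "d \<in> P" "face_next X d \<in> P"
    using X.in_facesD[OF f(1)] d(1) X.face_next_in_face_iff[OF f(1)] by auto
  interpret rev: tight_bipolar X "darts X - Or" N S by (rule tb.tight_reverse)
  have bt: "b \<in> target_of X d" using b d dP by (simp add: target_of_X)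
  have dd: "d \<in> darts X - Or" "face_next X d \<in> darts X - Or" using d dP by auto
  have "target_of X d \<noteq> N" using rev.not_into_S dd by blast
  moreover have "target_of X d \<noteq> S" using rev.not_from_N[OF dd(2)] by (simp add: X.vertex_of_face_next)
  ultimately have "\<exists>p. directed_path X Or S p N \<and> target_of X d \<notin> vertex_of X ` set p
      \<and> target_of X d \<notin> target_of X ` set p" by (intro outer_orientation(8))
  then obtain p where p: "directed_path X Or S p N" "target_of X d \<notin> target_of X ` set p"
    by (elim exE conjE)
  have "directed_path X (darts X - Or) N (map (opp X) (rev p)) S" by (rule tb.reverse_path[OF p(1)])
  moreover have "target_of X d \<notin> vertex_of X ` set (map (opp X) (rev p))"
    using p(2) by (simp add: image_image target_of_def)
  ultimately show ?thesis
    using rev.corner_at_left_path[OF f(1) d(1) dd bt] b f(2) NP by simp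
qed

text \<open>A transversal edge has a black end on the left path and a white end on the right one.
  Without such an edge the face is a quadrangle of the dissection, with only white vertices inside
  its left path and only black ones inside its right path. For lengths 1 and 3 two adjacent vertices
  would have equal colours; for lengths 2 and 2 two opposite vertices would have different
  ones.\<close>

lemma inner_face_has:
  assumes g: "g \<in> plain_inner_faces D Or"
  shows "\<exists>d\<in>L g. target_of D d \<in> black D" and "\<exists>d\<in>R g. target_of D d \<in> white D"
proof -
  have gX: "g \<in> faces X" "g \<noteq> outer_face D" using g inner_iff by auto
  have gP: "d \<in> P" if "d \<in> g" for d using X.in_facesD[OF gX(1) that] by simp
  have trans: "(\<exists>d\<in>L g. target_of D d \<in> black D) \<and> (\<exists>d\<in>R g. target_of D d \<in> white D)"
    if t: "t \<in> transversal_darts D Or" "edge_within D P t g" for t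
  proof -
    have td: "t \<in> darts D" using t by (simp add: trans_iff)
    have *: "(\<exists>d\<in>L g. target_of D d \<in> black D) \<and> (\<exists>d\<in>R g. target_of D d \<in> white D)"
      if s: "s \<in> transversal_darts D Or" "edge_within D P s g" "vertex_of D s \<in> black D" for s
    proof -
      have sd: "s \<in> darts D" using s by (simp add: trans_iff)
      have "target_of D s \<in> white D"
        using black_alternates[OF sd] s(3) black_iff target_in_vertices[OF sd] vertex_in_vertices[OF sd] by blast
      then show ?thesis using ST2_face(1)[OF g s] s(3) by auto
    qed
    show ?thesis
    proof (cases "vertex_of D t \<in> black D")
      case False
      then have "vertex_of D (opp D t) \<in> black D"
        using black_alternates[OF td] black_iff[OF vertex_in_vertices[OF td]] by (simp add: target_of_def)
      then show ?thesis using *[OF trans_opp[OF t(1)]] t(2) opp_opp[OF td] by (simp add: edge_within_def)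
    qed (rule *[OF t])
  qed
  have "\<exists>t\<in>transversal_darts D Or. edge_within D P t g"
  proof (rule ccontr)
    assume none: "\<not> ?thesis"
    have nL: "target_of D d \<notin> black D" if "d \<in> L g" for d
      using ST2_face(2)[OF g, of "target_of D d"] that none by blast
    have nR: "target_of D d \<notin> white D" if "d \<in> R g" for d
      using ST2_face(3)[OF g, of "target_of D d"] that none by blast
    have fn: "face_next X d = face_next D d" if "d \<in> g" for d
    proof (rule ccontr)
      assume "face_next X d \<noteq> face_next D d"
      then have n: "face_next D d \<notin> P" "face_next D d \<in> darts D"
        using face_next_X[OF gP[OF that]] next_in_P[of "face_next D d"] gP[OF that] P_subset face_next_in_iff by auto
      moreover have "next_in D P (face_next D d) \<in> g"
        using face_next_X[OF gP[OF that]] X.face_next_in_face_iff[OF gX(1)] that by metis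
      ultimately show False using trans_within[OF n(2,1) _ gX(1)] none by (auto simp: trans_iff)
    qed
    obtain b where b: "b \<in> g" "b \<notin> Or" "face_next X b \<in> Or" using tb.bottom_ex[OF gX(1)] by blast
    \<comment> \<open>The contour from the bottom of the face on, so that the darts in
      \<open>Or\<close> come first and \<open>s 3\<close> is the dart returning to the
      bottom.\<close>
    define s where "s i = (face_next D ^^ i) (face_next D b)" for i
    have s_Suc: "face_next D (s i) = s (Suc i)" for i by (simp add: s_def)
    have sg: "s i \<in> g" for i
    proof (induction i)
      case 0 then show ?case using b fn[OF b(1)] X.face_next_in_face_iff[OF gX(1), of b] by (simp add: s_def)
    next
      case (Suc i) then show ?case
        using fn[of "s i"] X.face_next_in_face_iff[OF gX(1), of "s i"] by (simp add: s_Suc)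
    qed
    have sd: "s i \<in> darts D" for i using gP[OF sg] P_subset by blast
    have fs: "face_of D (s 0) = g"
    proof
      show "face_of D (s 0) \<subseteq> g"
      proof
        fix d assume "d \<in> face_of D (s 0)"
        then have "d \<in> orbit (face_next D) (s 0)" by (simp add: face_of_def)
        then obtain i where "d = (face_next D ^^ i) (s 0)" by (auto simp: orbit_altdef)
        then show "d \<in> g" using sg[of i] by (simp add: s_def)
      qed
      show "g \<subseteq> face_of D (s 0)"
      proof
        fix d assume "d \<in> g"
        then have "d \<in> orbit (face_next X) (s 0)"
          using X.in_facesD[OF gX(1) sg[of 0]] by (simp add: face_of_def)
        then have "d \<in> face_of D (s 0) \<and> d \<in> g"
        proof (rule X.face.orbit_invariant)
          show "s 0 \<in> face_of D (s 0) \<and> s 0 \<in> g" using face_of_self sg by simp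
          fix z assume z: "z \<in> face_of D (s 0) \<and> z \<in> g"
          then show "face_next X z \<in> face_of D (s 0) \<and> face_next X z \<in> g"
            using fn[of z] X.face_next_in_face_iff[OF gX(1), of z]
              face_next_in_face_iff[OF face_in_faces[OF sd[of 0]], of z] by simp
        qed
        then show "d \<in> face_of D (s 0)" by simp
      qed
    qed
    then have c4: "card (orbit (face_next D) (s 0)) = 4"
      using inner_face_card[OF face_in_faces[OF sd[of 0]]] gX(2) by (simp add: face_of_def)
    have s4: "s 4 = s 0" using face.orbit_enum(2)[of "s 0"] c4 by (simp add: s_def)
    have "inj_on s {..<4}"
      using bij_betw_imp_inj_on[OF face.orbit_enum(1)[of "s 0"]] c4 by (simp add: s_def[abs_def])
    then have ne: "s i \<noteq> s j" if "i < 4" "j < 4" "i \<noteq> j" for i j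
      using that by (auto dest: inj_onD)
    have "face_next D (s 3) = face_next D b" using s_Suc[of 3] s4 by (simp add: s_def eval_nat_numeral)
    then have s3: "s 3 = b" using face_next_inj by blast
    have Or03: "s 0 \<in> Or" "s 3 \<notin> Or" using b s3 fn[OF b(1)] by (simp_all add: s_def)
    have tw: "target_of D (s i) = vertex_of D (s (Suc i))" for i
      using vertex_of_face_next[of "s i"] s_Suc[of i] by simp
    have alt: "vertex_of D (s (Suc i)) \<in> white D \<longleftrightarrow> vertex_of D (s i) \<notin> white D" for i
      using white_alternates[OF sd[of i]] tw[of i] by simp
    have Li: "vertex_of D (s (Suc i)) \<in> white D" if "s i \<in> Or" "s (Suc i) \<in> Or" for i
    proof -
      have "s i \<in> L g" using that sg[of i] fn[OF sg[of i]] s_Suc[of i] by (simp add: L_def)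
      then show ?thesis using nL[of "s i"] tw[of i] black_iff[OF vertex_in_vertices[OF sd]] by simp
    qed
    have Ri: "vertex_of D (s (Suc i)) \<notin> white D" if "s i \<notin> Or" "s (Suc i) \<notin> Or" for i
    proof -
      have "s i \<in> R g" using that sg[of i] fn[OF sg[of i]] s_Suc[of i] by (simp add: R_def)
      then show ?thesis using nR[of "s i"] tw[of i] by simp
    qed
    have bot: "s (Suc i) \<notin> Or \<or> s i \<in> Or" if "i < 3" for i
    proof (rule ccontr)
      assume "\<not> ?thesis"
      then have "s i = b" using tb.bottom_unique[OF gX(1) sg[of i] _ _ b] fn[OF sg[of i]] s_Suc[of i] by simp
      then show False using ne[of i 3] that s3 by simp
    qed
    show False
      using Li[of 0] Li[of 1] Ri[of 1] Ri[of 2] bot[of 1] alt[of 1] alt[of 2] Or03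
      by (simp add: eval_nat_numeral) blast
  qed
  then show "\<exists>d\<in>L g. target_of D d \<in> black D" and "\<exists>d\<in>R g. target_of D d \<in> white D"
    using trans by blast+
qed

end

section \<open>Runs around a vertex and along a face\<close>

context dart_map begin

lemma vertex_run_forward:
  assumes v: "v \<in> vertices M" and b: "b \<in> v" "\<not> Q b" "rot M b \<in> A"
    and uniq: "\<And>z. z \<in> v \<Longrightarrow> \<not> Q z \<Longrightarrow> Q (rot M z) \<Longrightarrow> z = b"
    and A: "\<And>z. z \<in> A \<Longrightarrow> z \<in> v \<Longrightarrow> Q (rot M z) \<Longrightarrow> rot M z \<in> A"
    and y: "y \<in> v" "Q y"
  shows "y \<in> A"
proof -
  have "v = orbit (rot M) b" using in_verticesD[OF v b(1)] by (simp add: vertex_of_def)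
  then show ?thesis
    using rot.run_forward[where b=b and x=b and Q=Q and B=A and y=y] b uniq A y by blast
qed

lemma vertex_run_backward:
  assumes v: "v \<in> vertices M" and t: "t \<in> v" "t \<in> A"
    and uniq: "\<And>z. z \<in> v \<Longrightarrow> Q z \<Longrightarrow> \<not> Q (rot M z) \<Longrightarrow> z = t"
    and A: "\<And>z. z \<in> v \<Longrightarrow> Q z \<Longrightarrow> rot M z \<in> A \<Longrightarrow> z \<in> A"
    and y: "y \<in> v" "Q y"
  shows "y \<in> A"
proof -
  have "v = orbit (rot M) t" using in_verticesD[OF v t(1)] by (simp add: vertex_of_def)
  then show ?thesis
    using rot.run_backward[where t=t and x=t and Q=Q and B=A and y=y] t uniq A y by blast
qed

lemma face_run_forward:
  assumes f: "f \<in> faces M" and b: "b \<in> f" "\<not> Q b" "face_next M b \<in> A"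
    and uniq: "\<And>z. z \<in> f \<Longrightarrow> \<not> Q z \<Longrightarrow> Q (face_next M z) \<Longrightarrow> z = b"
    and A: "\<And>z. z \<in> A \<Longrightarrow> z \<in> f \<Longrightarrow> Q (face_next M z) \<Longrightarrow> face_next M z \<in> A"
    and y: "y \<in> f" "Q y"
  shows "y \<in> A"
proof -
  have "f = orbit (face_next M) b" using in_facesD[OF f b(1)] by (simp add: face_of_def)
  then show ?thesis
    using face.run_forward[where b=b and x=b and Q=Q and B=A and y=y] b uniq A y by blast
qed

lemma face_run_backward:
  assumes f: "f \<in> faces M" and t: "t \<in> f" "t \<in> A"
    and uniq: "\<And>z. z \<in> f \<Longrightarrow> Q z \<Longrightarrow> \<not> Q (face_next M z) \<Longrightarrow> z = t"
    and A: "\<And>z. z \<in> f \<Longrightarrow> Q z \<Longrightarrow> face_next M z \<in> A \<Longrightarrow> z \<in> A"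
    and y: "y \<in> f" "Q y"
  shows "y \<in> A"
proof -
  have "f = orbit (face_next M) t" using in_facesD[OF f t(1)] by (simp add: face_of_def)
  then show ?thesis
    using face.run_backward[where t=t and x=t and Q=Q and B=A and y=y] t uniq A y by blast
qed

end

section \<open>Plain and transversal edges at the outer vertices\<close>

context transverse begin

lemma VX_in: "V i \<inter> P \<in> vertices X"
  using V_in by (auto simp: vertices_X)

lemma VX_not: "V i \<inter> P \<noteq> S" "V i \<inter> P \<noteq> N" if "i \<in> {1, 2, 4, 5}"
  using that VX_eq[of i 3] VX_eq[of i 0] outer_orientation(1) N_V0 by auto

lemma opp_r_in_V: "opp D (r i) \<in> V (Suc i) \<inter> P" and r_in_V: "r i \<in> V i \<inter> P"
  using opp_r_P[of i] r_P[of i] in_V_iff[of "opp D (r i)" "Suc i"] in_V_iff[of "r i" i]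
  by (simp_all add: vertex_opp_r V_def)

lemma opp_r_inner_face: "face_of X (opp D (r i)) \<in> plain_inner_faces D Or"
  by (rule not_outer_inner[OF opp_r_P opp_r_not_outer])

lemma face_next_X_opp_r: "face_next X (opp D (r i)) = rot X (r i)"
  using opp_opp[OF r_in] opp_r_P by (simp add: face_next_def opp_X)

lemma into: "z \<in> P \<Longrightarrow> target_of X z = target_of D z \<inter> P" "z \<in> P \<Longrightarrow> opp D z \<in> target_of D z \<inter> P"
  using P_opp[of z] vertex_of_self[of "opp D z"] target_of_X[of z] by (simp_all add: target_of_def)

lemma target_X_eq:
  assumes "z \<in> P" "face_next X z = opp D (r i)" shows "opp D z \<in> V (Suc i) \<inter> P" "target_of X z = V (Suc i) \<inter> P"
proof -
  have "vertex_of D (face_next X z) = target_of D z" by (rule vertex_of_face_next_X[OF assms(1)])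
  then have "target_of D z = V (Suc i)" using assms(2) vertex_opp_r by simp
  then show "opp D z \<in> V (Suc i) \<inter> P" "target_of X z = V (Suc i) \<inter> P" using into[OF assms(1)] by simp_all
qed

text \<open>
  The two halves of the hexagon, from each pole \<^term>\<open>V j\<close>, are exchanged by rotation, which
  reverses the orientation.
\<close>

definition up :: "nat \<Rightarrow> 'd \<Rightarrow> bool" where "up j d \<longleftrightarrow> (d \<in> Or \<longleftrightarrow> j = 0)"

lemma up_r:
  assumes "j = 0 \<or> j = 3" "i = j \<or> i = Suc j \<or> i = Suc (Suc j)"
  shows "\<not> up j (r i)" "up j (opp D (r i))"
proof -
  have "\<not> up j (r i) \<and> up j (opp D (r i))"
    using assms outer_orientation(2-7) opp_r_Or by (auto simp: up_def eval_nat_numeral)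
  then show "\<not> up j (r i)" "up j (opp D (r i))" by blast+
qed

lemma up_face_exit_unique:
  assumes "f \<in> faces X" "d \<in> f" "up j d" "\<not> up j (face_next X d)" "e \<in> f" "up j e" "\<not> up j (face_next X e)"
  shows "d = e"
  using assms tb.top_unique[OF assms(1,2) _ _ assms(5)] tb.bottom_unique[OF assms(1,2) _ _ assms(5)]
  by (cases "j = 0") (simp_all add: up_def)

lemma up_face_entry_unique:
  assumes "f \<in> faces X" "d \<in> f" "\<not> up j d" "up j (face_next X d)" "e \<in> f" "\<not> up j e" "up j (face_next X e)"
  shows "d = e"
  using assms tb.top_unique[OF assms(1,2) _ _ assms(5)] tb.bottom_unique[OF assms(1,2) _ _ assms(5)]
  by (cases "j = 0") (simp_all add: up_def)

lemma up_vertex_exit_unique: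
  assumes "v \<in> vertices X" "v \<noteq> S" "v \<noteq> N"
    and "d \<in> v" "up j d" "\<not> up j (rot X d)" "e \<in> v" "up j e" "\<not> up j (rot X e)"
  shows "d = e"
  using assms tb.out_in_unique[OF assms(1-4) _ _ assms(7)] tb.in_out_unique[OF assms(1-4) _ _ assms(7)]
  by (cases "j = 0") (simp_all add: up_def)

lemma not_up_at_pole:
  assumes "j = 0 \<or> j = 3" "z \<in> V j \<inter> P" shows "\<not> up j z"
  using assms tb.into_N[of z] tb.out_of_S[of z] N_V0 outer_orientation(1) by (auto simp: up_def)

text \<open>The pole opposite to \<open>V j\<close> is the source of the orientation
  \<open>up j\<close>.\<close>

lemma not_up_into_pole:
  assumes j: "j = 0 \<or> j = 3" and z: "z \<in> P" "up j z" shows "target_of X z \<noteq> V (Suc (Suc (Suc j))) \<inter> P"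
proof
  assume t: "target_of X z = V (Suc (Suc (Suc j))) \<inter> P"
  from j show False
  proof
    assume "j = 0"
    then show False using t z tb.not_into_S[of z] outer_orientation(1) by (simp add: up_def eval_nat_numeral)
  next
    assume "j = 3"
    then have "opp D z \<in> N" "opp D z \<in> Or"
      using t z into[OF z(1)] V_6 N_V0 Or_iff[OF z(1)] by (auto simp: up_def)
    then show False using tb.into_N by blast
  qed
qed

text \<open>For \<open>j = 3\<close> the left path is replaced by the right one, which also
  exchanges black and white.\<close>

lemma up_inner_face:
  assumes "g \<in> plain_inner_faces D Or"
  obtains d where "d \<in> g" "up j d" "up j (face_next X d)" "target_of D d \<in> black D \<longleftrightarrow> j = 0"
proof (cases "j = 0")
  case True
  obtain d where "d \<in> L g" "target_of D d \<in> black D" using inner_face_has(1)[OF assms] by blast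
  then show ?thesis using that[of d] True by (simp add: L_def up_def)
next
  case False
  obtain d where "d \<in> R g" "target_of D d \<in> white D" using inner_face_has(2)[OF assms] by blast
  then show ?thesis using that[of d] False by (simp add: R_def up_def black_def)
qed

lemma half_not_pole:
  assumes "j = 0 \<or> j = 3" "i = Suc j \<or> i = Suc (Suc j)"
  shows "V i \<inter> P \<in> vertices X" "V i \<inter> P \<noteq> S" "V i \<inter> P \<noteq> N"
  using assms VX_in[of i] VX_not[of i] by (auto simp: eval_nat_numeral)

text \<open>At this vertex the darts that are not up form one run, and counterclockwise it begins
  right after the up dart \<open>opp D (r i)\<close>, at \<open>r (Suc i)\<close>. By assumption it
  also ends there.\<close>

lemma not_up_run:
  assumes j: "j = 0 \<or> j = 3" and i: "i = j \<or> i = Suc j" and up: "up j (rot X (r (Suc i)))"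
    and y: "y \<in> V (Suc i) \<inter> P" "\<not> up j y"
  shows "y = r (Suc i)"
proof -
  have v: "V (Suc i) \<inter> P \<in> vertices X" "V (Suc i) \<inter> P \<noteq> S" "V (Suc i) \<inter> P \<noteq> N"
    using half_not_pole[OF j, of "Suc i"] i by auto
  have e: "up j (opp D (r i))" "\<not> up j (r (Suc i))" using up_r[OF j] i by auto
  have "y \<in> {r (Suc i)}"
  proof (rule X.vertex_run_forward[OF v(1) opp_r_in_V, where Q="\<lambda>z. \<not> up j z"])
    fix z
    show "z = opp D (r i)" if "z \<in> V (Suc i) \<inter> P" "\<not> \<not> up j z" "\<not> up j (rot X z)"
      using up_vertex_exit_unique[OF v that(1) _ that(3) opp_r_in_V e(1)] that(2) e(2) rot_X_opp_r by simp
    show "rot X z \<in> {r (Suc i)}" if "z \<in> {r (Suc i)}" "\<not> up j (rot X z)" using that up by simp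
  qed (use y e rot_X_opp_r in simp_all)
  then show ?thesis by simp
qed

text \<open>Otherwise the inner face along the last outer edge of the half turns down right after
  that edge. As the edge starts at the source of \<open>up j\<close>, it would be the whole run of
  up darts of the face, which then has no interior vertex, contrary to
  \<open>up_inner_face\<close>.\<close>

lemma at_far_vertex:
  assumes j: "j = 0 \<or> j = 3" and y: "y \<in> V (Suc (Suc j)) \<inter> P" "\<not> up j y"
  shows "y = r (Suc (Suc j))"
proof (rule not_up_run[OF j _ _ y])
  let ?i = "Suc (Suc j)"
  define g where "g = face_of X (opp D (r ?i))"
  have g: "g \<in> plain_inner_faces D Or" "g \<in> faces X" "opp D (r ?i) \<in> g"
    using opp_r_inner_face inner_in_faces X.face_of_self by (auto simp: g_def)
  have gP: "z \<in> P" if "z \<in> g" for z using X.in_facesD[OF g(2) that] by simp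
  show "up j (rot X (r ?i))"
  proof (rule ccontr)
    assume no: "\<not> up j (rot X (r ?i))"
    have all: "z \<in> {opp D (r ?i)}" if "z \<in> g" "up j z" for z
    proof (rule X.face_run_backward[OF g(2,3), where Q="up j"])
      fix z assume z: "z \<in> g" "up j z" "face_next X z \<in> {opp D (r ?i)}"
      then show "z \<in> {opp D (r ?i)}"
        using target_X_eq(2)[of z ?i] not_up_into_pole[OF j gP[OF z(1)] z(2)] gP by simp
    next
      fix z assume "z \<in> g" "up j z" "\<not> up j (face_next X z)"
      then show "z = opp D (r ?i)"
        using up_face_exit_unique[OF g(2) _ _ _ g(3)] up_r(2)[OF j] no face_next_X_opp_r by simp
    qed (use that in simp_all)
    obtain d where "d \<in> g" "up j d" "up j (face_next X d)" using up_inner_face[OF g(1)] by metis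
    then show False using all[of d] no face_next_X_opp_r by simp
  qed
qed simp

text \<open>The inner face along \<open>opp D (r j)\<close> has its top at \<open>V j\<close>. If
  the dart just before \<open>opp D (r j)\<close> in the rotation were up, this edge would also
  start at the bottom of the face and be a whole lateral path. So the run of up darts at the vertex
  is \<open>opp D (r j)\<close> alone.\<close>

lemma at_near_vertex_up:
  assumes j: "j = 0 \<or> j = 3" and y: "y \<in> V (Suc j) \<inter> P" "up j y"
  shows "y = opp D (r j)"
proof -
  define g where "g = face_of X (opp D (r j))"
  have g: "g \<in> plain_inner_faces D Or" "g \<in> faces X" "opp D (r j) \<in> g"
    using opp_r_inner_face inner_in_faces X.face_of_self by (auto simp: g_def)
  have v: "V (Suc j) \<inter> P \<in> vertices X" "V (Suc j) \<inter> P \<noteq> S" "V (Suc j) \<inter> P \<noteq> N"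
    using half_not_pole[OF j, of "Suc j"] by auto
  have e: "up j (opp D (r j))" "\<not> up j (r (Suc j))" using up_r[OF j] by auto
  have fr: "\<not> up j (face_next X (opp D (r j)))"
    using not_up_at_pole[OF j] X.rot_in_vertex_iff[OF VX_in[of j], of "r j"] r_in_V[of j] face_next_X_opp_r by simp
  have pre: "\<not> up j z" if z: "z \<in> V (Suc j) \<inter> P" "rot X z = opp D (r j)" for z
  proof
    assume zO: "up j z"
    have zP: "z \<in> P" "opp D z \<in> P" using z P_opp by auto
    have n: "face_next X (opp D z) = opp D (r j)"
      using z zP opp_opp[of z] P_subset by (auto simp: face_next_def opp_X)
    have oz: "opp D z \<in> g" "\<not> up j (opp D z)"
      using X.face_next_in_face_iff[OF g(2), of "opp D z"] n g(3) zO Or_iff[OF zP(1)] by (auto simp: up_def)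
    have all: "y \<in> {opp D (r j)}" if "y \<in> g" "up j y" for y
    proof (rule X.face_run_forward[OF g(2) oz(1), where Q="up j"])
      fix y assume "y \<in> g" "\<not> up j y" "up j (face_next X y)"
      then show "y = opp D z" using up_face_entry_unique[OF g(2) _ _ _ oz] n e(1) by simp
    next
      fix y assume "y \<in> {opp D (r j)}" "up j (face_next X y)"
      then show "face_next X y \<in> {opp D (r j)}" using fr by simp
    qed (use that n oz in simp_all)
    obtain d where "d \<in> g" "up j d" "up j (face_next X d)" using up_inner_face[OF g(1)] by metis
    then show False using all[of d] fr by simp
  qed
  have "y \<in> {opp D (r j)}"
  proof (rule X.vertex_run_backward[OF v(1) opp_r_in_V, where Q="up j"])
    fix z
    show "z = opp D (r j)" if "z \<in> V (Suc j) \<inter> P" "up j z" "\<not> up j (rot X z)"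
      using up_vertex_exit_unique[OF v that opp_r_in_V e(1)] e(2) rot_X_opp_r by simp
    show "z \<in> {opp D (r j)}" if "z \<in> V (Suc j) \<inter> P" "up j z" "rot X z \<in> {opp D (r j)}"
      using pre[of z] that by simp
  qed (use y in simp_all)
  then show ?thesis by simp
qed

text \<open>Otherwise the run of up darts in the inner face along \<open>opp D (r (Suc j))\<close>
  consists of that edge and, by \<open>at_far_vertex\<close>, at most the outer edge before it. Its
  only possible interior vertex, \<open>V (Suc (Suc j))\<close>, has the wrong colour for
  \<open>up_inner_face\<close>.\<close>

lemma at_near_vertex_not_up:
  assumes j: "j = 0 \<or> j = 3" and y: "y \<in> V (Suc j) \<inter> P" "\<not> up j y"
  shows "y = r (Suc j)"
proof (rule not_up_run[OF j _ _ y])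
  let ?i = "Suc j" and ?k = "Suc (Suc j)"
  define g where "g = face_of X (opp D (r ?i))"
  have g: "g \<in> plain_inner_faces D Or" "g \<in> faces X" "opp D (r ?i) \<in> g"
    using opp_r_inner_face inner_in_faces X.face_of_self by (auto simp: g_def)
  have gP: "z \<in> P" if "z \<in> g" for z using X.in_facesD[OF g(2) that] by simp
  show "up j (rot X (r ?i))"
  proof (rule ccontr)
    assume no: "\<not> up j (rot X (r ?i))"
    have all: "z \<in> {opp D (r ?i), opp D (r ?k)}" if "z \<in> g" "up j z" for z
    proof (rule X.face_run_backward[OF g(2,3), where Q="up j"])
      fix z assume z: "z \<in> g" "up j z" "face_next X z \<in> {opp D (r ?i), opp D (r ?k)}"
      then consider "face_next X z = opp D (r ?i)" | "face_next X z = opp D (r ?k)" by blast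
      then show "z \<in> {opp D (r ?i), opp D (r ?k)}"
      proof cases
        case 1
        have "\<not> up j (opp D z)" using z(2) Or_iff[OF gP[OF z(1)]] by (auto simp: up_def)
        then have "opp D z = r ?k"
          using at_far_vertex[OF j, of "opp D z"] target_X_eq(1)[OF gP[OF z(1)] 1] by simp
        then have "z = opp D (r ?k)" using opp_opp[of z] gP[OF z(1)] P_subset by (metis in_mono)
        then show ?thesis by simp
      next
        case 2
        then show ?thesis
          using target_X_eq(2)[of z ?k] not_up_into_pole[OF j gP[OF z(1)] z(2)] gP[OF z(1)] by simp
      qed
    next
      fix z assume "z \<in> g" "up j z" "\<not> up j (face_next X z)"
      then show "z = opp D (r ?i)"
        using up_face_exit_unique[OF g(2) _ _ _ g(3)] up_r(2)[OF j] no face_next_X_opp_r by simp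
    qed (use that in simp_all)
    obtain d where d: "d \<in> g" "up j d" "up j (face_next X d)" "target_of D d \<in> black D \<longleftrightarrow> j = 0"
      by (rule up_inner_face[OF g(1)])
    then have "d = opp D (r ?k)" using all[of d] no face_next_X_opp_r by auto
    then show False using d(4) target_opp_r[of ?k] white_V[of ?k] black_iff[OF V_in[of ?k]] j by auto
  qed
qed simp

text \<open>The darts that will become the red ones.\<close>

definition red_like :: "'d \<Rightarrow> bool" where
  "red_like d \<longleftrightarrow> (d \<in> Or \<longleftrightarrow> vertex_of D d \<in> black D)"

text \<open>Through \<open>red_like\<close>, the rules for black and for white vertices become one:
  counterclockwise, transversal edges come after blue and before red.\<close>

lemma trans_corner:
  assumes t: "t \<in> darts D" "t \<notin> P" and b: "b \<in> P" "b \<in> vertex_of D t" "rot X b = next_in D P t"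
  shows "\<not> red_like b \<and> red_like (next_in D P t)"
proof -
  have tt: "t \<in> transversal_darts D Or" using t by (simp add: trans_iff)
  have v: "vertex_of D b = vertex_of D t" "vertex_of D (next_in D P t) = vertex_of D t"
    using vertex_of_eq[OF b(2)] next_in_mem[OF t(1)] vertex_of_eq by auto
  show ?thesis
  proof (cases "vertex_of D t \<in> black D")
    case True
    then show ?thesis using trans_black_corner[OF tt True b] v by (simp add: red_like_def)
  next
    case False
    then have "vertex_of D t \<in> white D" using black_iff vertex_in_vertices[OF t(1)] by blast
    then show ?thesis using trans_white_corner[OF tt _ b] False v by (simp add: red_like_def)
  qed
qed

text \<open>Such a corner is a lateral one of the left path at a black vertex and of the right path
  at a white vertex, where \<open>ST2\<close> demands a transversal edge.\<close>

lemma trans_exists: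
  assumes v: "v \<in> vertices D" and e: "e \<in> v" "e \<in> P" "\<not> red_like e" "red_like (rot X e)"
    and ne: "rot X e \<notin> outer_face D"
  shows "\<exists>t\<in>v. t \<notin> P"
proof -
  have ed: "e \<in> darts D" "vertex_of D e = v" using in_verticesD[OF v e(1)] by auto
  have rP: "rot X e \<in> P" using X.rot_in_iff[of e] e by simp
  have "rot X e \<in> vertex_of D e"
    using next_in_mem[of "rot D e"] rot_in_iff ed e(2) by (simp add: rot_X vertex_of_rot)
  then have vr: "vertex_of D (rot X e) = v" using vertex_of_eq ed by blast
  define g where "g = face_of X (rot X e)"
  have g: "g \<in> plain_inner_faces D Or" "g \<in> faces X" "rot X e \<in> g"
    using not_outer_inner[OF rP ne] inner_in_faces X.face_of_self by (auto simp: g_def)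
  have oe: "opp D e \<in> P" using e P_opp by blast
  have n: "face_next X (opp D e) = rot X e"
    using opp_opp[OF ed(1)] oe by (simp add: face_next_def opp_X)
  have og: "opp D e \<in> g" using X.face_next_in_face_iff[OF g(2), of "opp D e"] n g(3) by simp
  have te: "target_of D (opp D e) = v" using target_of_opp[OF ed(1)] ed by simp
  have O: "opp D e \<in> Or \<longleftrightarrow> e \<notin> Or" by (rule Or_iff[OF e(2)])
  have "\<exists>t\<in>transversal_darts D Or. edge_within D P t g \<and> vertex_of D t = v"
  proof (cases "v \<in> black D")
    case True
    then have "opp D e \<in> L g" using e ed vr O og n by (simp add: L_def red_like_def)
    then show ?thesis using ST2_face(2)[OF g(1) True] te by (metis imageI)
  next
    case False
    then have w: "v \<in> white D" using black_iff[OF v] by blast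
    have "opp D e \<in> R g" using False e ed vr O og n by (simp add: R_def red_like_def)
    then show ?thesis using ST2_face(3)[OF g(1) w] te by (metis imageI)
  qed
  then show ?thesis using vertex_of_self by (auto simp: trans_iff)
qed

text \<open>A vertex other than the poles has only one corner from blue to red, and here it is in
  the outer face, which contains no transversal edge.\<close>

lemma no_trans_at_outer_corner:
  assumes v: "v \<in> vertices D" "v \<inter> P \<noteq> S" "v \<inter> P \<noteq> N" and t: "t \<in> v" "t \<notin> P"
    and e: "e \<in> v" "e \<in> P" "\<not> red_like e" "red_like (rot X e)" "rot X e \<in> outer_face D"
  shows False
proof -
  have td: "t \<in> darts D" "vertex_of D t = v" using in_verticesD[OF v(1) t(1)] by auto
  have vX: "v \<inter> P \<in> vertices X" using v by (auto simp: vertices_X)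
  obtain b where b: "b \<in> P" "b \<in> vertex_of D t" "next_in D P (rot D b) = next_in D P t"
    using prev_in[OF td(1)] by blast
  then have rb: "rot X b = next_in D P t" by (simp add: rot_X)
  note c = trans_corner[OF td(1) t(2) b(1,2) rb]
  have be: "b \<in> v \<inter> P" "e \<in> v \<inter> P" using b td e by auto
  have vv: "vertex_of D z = v" if "z \<in> v" for z using in_verticesD[OF v(1) that] by simp
  have re: "rot X b \<in> v" "rot X e \<in> v"
    using X.rot_in_vertex_iff[OF vX, of b] X.rot_in_vertex_iff[OF vX, of e] be by auto
  have "b = e"
  proof (cases "v \<in> black D")
    case True
    then show ?thesis
      using tb.in_out_unique[OF vX v(2,3) be(1) _ _ be(2)] c e rb be re vv by (simp add: red_like_def)
  next
    case False
    then show ?thesis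
      using tb.out_in_unique[OF vX v(2,3) be(1) _ _ be(2)] c e rb be re vv by (simp add: red_like_def)
  qed
  then have "next_in D P t \<in> outer_face D" using e rb by simp
  then show False using trans_within[OF td(1) t(2) _ outer_in_X] inner_iff by blast
qed

text \<open>Black and white alternate along the hexagon, and the parity of \<open>j\<close>
  compensates for the reversal of the orientation in the second half.\<close>

lemma red_like_V:
  assumes "j = 0 \<or> j = 3" "d \<in> V i"
  shows "i = j \<or> i = Suc (Suc j) \<Longrightarrow> red_like d \<longleftrightarrow> \<not> up j d" and "i = Suc j \<Longrightarrow> red_like d \<longleftrightarrow> up j d"
proof -
  have "vertex_of D d = V i" using in_verticesD[OF V_in assms(2)] by simp
  moreover have "V i \<in> black D \<longleftrightarrow> odd i" using black_iff[OF V_in] white_V by blast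
  ultimately have "red_like d \<longleftrightarrow> (d \<in> Or \<longleftrightarrow> odd i)" by (simp add: red_like_def)
  then show "i = j \<or> i = Suc (Suc j) \<Longrightarrow> red_like d \<longleftrightarrow> \<not> up j d" "i = Suc j \<Longrightarrow> red_like d \<longleftrightarrow> up j d"
    using assms(1) by (auto simp: up_def)
qed

text \<open>All plain darts at a pole are red-like, so no corner there begins with a blue
  one.\<close>

lemma no_trans_at_pole:
  assumes j: "j = 0 \<or> j = 3" and t: "t \<in> V j" shows "t \<in> P"
proof (rule ccontr)
  assume n: "t \<notin> P"
  have td: "t \<in> darts D" "vertex_of D t = V j" using in_verticesD[OF V_in t] by auto
  obtain b where b: "b \<in> P" "b \<in> vertex_of D t" "next_in D P (rot D b) = next_in D P t"
    using prev_in[OF td(1)] by blast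
  then have rb: "rot X b = next_in D P t" by (simp add: rot_X)
  have bv: "b \<in> V j \<inter> P" using b td by simp
  then have "rot X b \<in> V j \<inter> P" using X.rot_in_vertex_iff[OF VX_in, of b] by simp
  then have "red_like b" using red_like_V(1)[OF j, of b j] not_up_at_pole[OF j bv] bv by simp
  then show False using trans_corner[OF td(1) n b(1,2) rb] by simp
qed

section \<open>The colours at outer and inner vertices\<close>

lemma colouring_of_eq:
  "d \<in> inner_darts D \<Longrightarrow> colouring_of D Or d =
    Some (if d \<notin> P then Green else if red_like d then Red else Blue)"
  by (simp add: colouring_of_def red_like_def)

text \<open>In the half that begins at \<open>V j\<close>, the first vertex has no corner from blue
  to red, the second has no plain edges but the outer ones, and the third has its corner from blue
  to red in the outer face.\<close>

lemma outer_labels: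
  assumes d: "d \<in> V i" "d \<in> inner_darts D" "i < 6"
  shows "colouring_of D Or d = Some (outer_label i)"
proof -
  have dP: "d \<in> V i \<inter> P" if "d \<in> P" using d that by simp
  have nr: "d \<noteq> r k" "d \<noteq> opp D (r k)" for k using inner_dart_not_r[OF d(2)] by auto
  note cl = colouring_of_eq[OF d(2)]
  have "i = 0 \<or> i = 1 \<or> i = 2 \<or> i = 3 \<or> i = 4 \<or> i = 5" using d(3) by linarith
  \<comment> \<open>Each outer vertex is among the first three of one of the two halves.\<close>
  then obtain j where j: "j = 0 \<or> j = 3" "i = j \<or> i = Suc j \<or> i = Suc (Suc j)"
    by (elim disjE) (auto simp: eval_nat_numeral)
  from j(2) show ?thesis
  proof (elim disjE)
    assume i: "i = j"
    then have p: "d \<in> P" using no_trans_at_pole[OF j(1)] d(1) by simp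
    then have "red_like d" using red_like_V(1)[OF j(1) d(1)] not_up_at_pole[OF j(1), of d] i dP by simp
    then show ?thesis using cl p i j(1) by (auto simp: outer_label_def)
  next
    assume i: "i = Suc j"
    then have "d \<notin> P"
      using at_near_vertex_up[OF j(1), of d] at_near_vertex_not_up[OF j(1), of d] dP nr by auto
    then show ?thesis using cl i j(1) by (auto simp: outer_label_def)
  next
    assume i: "i = Suc (Suc j)"
    let ?e = "opp D (r (Suc j))"
    have e: "?e \<in> V i" "?e \<in> P" "r i \<in> V i" "rot X ?e = r i"
      using opp_r_in_V[of "Suc j"] r_in_V[of i] rot_X_opp_r[of "Suc j"] i by simp_all
    have "\<not> red_like ?e" "red_like (r i)"
      using red_like_V(1)[OF j(1) e(1)] red_like_V(1)[OF j(1) e(3)] up_r[OF j(1)] i by auto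
    then have p: "d \<in> P"
      using no_trans_at_outer_corner[OF V_in[of i] _ _ d(1) _ e(1,2)] half_not_pole(2,3)[OF j(1), of i]
        e(4) r_in_outer[of i] i by auto
    then have "up j d" using at_far_vertex[OF j(1), of d] dP nr i by auto
    then show ?thesis using cl p i j(1) red_like_V(1)[OF j(1) d(1)] by (auto simp: outer_label_def)
  qed
qed

text \<open>The plain edges at this vertex are the two outer ones. Their corner inside the hexagon
  goes from blue to red, and so receives a transversal edge.\<close>

lemma not_isolated:
  assumes j: "j = 0 \<or> j = 3" shows "\<not> isolated D (V (Suc j))"
proof -
  let ?a = "r (Suc j)" and ?b = "opp D (r j)"
  have v: "rot X ?a \<in> V (Suc j) \<inter> P"
    using X.rot_in_vertex_iff[OF VX_in[of "Suc j"], of ?a] r_in_V[of "Suc j"] by simp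
  have "up j (rot X ?a)"
  proof (rule ccontr)
    assume "\<not> up j (rot X ?a)"
    then have "rot X ?a = rot X ?b" using at_near_vertex_not_up[OF j v] rot_X_opp_r[of j] by simp
    then show False using X.rot_inj r_neq_opp_r by blast
  qed
  then have ra: "rot X ?a = ?b" using at_near_vertex_up[OF j v] by simp
  have ab: "?a \<in> V (Suc j) \<inter> P" "?b \<in> V (Suc j) \<inter> P" using r_in_V opp_r_in_V by auto
  then have "\<not> red_like ?a" "red_like ?b"
    using red_like_V(2)[OF j, of ?a] red_like_V(2)[OF j, of ?b] up_r[OF j] by auto
  then obtain t where t: "t \<in> V (Suc j)" "t \<notin> P"
    using trans_exists[OF V_in[of "Suc j"], of ?a] ab ra opp_r_not_outer by auto
  have "card {?a, ?b, t} \<le> card (V (Suc j))"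
    using ab t by (intro card_mono) (auto simp: V_def finite_vertex_of)
  moreover have "?a \<noteq> ?b" "t \<noteq> ?a" "t \<noteq> ?b" using ab t r_neq_opp_r by blast+
  then have "card {?a, ?b, t} = 3" by simp
  ultimately show ?thesis by (simp add: isolated_def)
qed

text \<open>Among the plain darts, red and blue form one run each; the transversal darts fill the
  corner from blue to red and no other.\<close>

lemma inner_vertex_colours:
  assumes v: "v \<in> inner_vertices D"
  shows "\<exists>d\<in>v. \<exists>i>0. \<exists>j>0. \<exists>k>0. clockwise_colours D (colouring_of D Or) d =
          replicate i (Some Red) @ replicate j (Some Green) @ replicate k (Some Blue)"
proof -
  let ?c = "colouring_of D Or"
  have vD: "v \<in> vertices D" using inner_vertex_in[OF v] .
  have vX: "v \<inter> P \<in> vertices X" using vD by (auto simp: vertices_X)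
  have vd: "d \<in> darts D" "vertex_of D d = v" if "d \<in> v" for d using in_verticesD[OF vD that] by auto
  have vS: "v \<inter> P \<noteq> S" "v \<inter> P \<noteq> N"
    using vertex_inter_inj[OF vD V_in] V_not_inner v outer_orientation(1) N_V0 by metis+
  have col: "?c d = Some (if d \<notin> P then Green else if red_like d then Red else Blue)" if "d \<in> v" for d
    by (rule colouring_of_eq[OF dart_at_inner[OF v that]])
  have rv: "rot D d \<in> v" if "d \<in> v" for d using that rot_in_vertex_iff[OF vD] by blast
  have rX: "rot X d \<in> v \<inter> P" if "d \<in> v" "d \<in> P" for d
    using that X.rot_in_vertex_iff[OF vX, of d] by simp
  have rXP: "rot X d = rot D d" if "d \<in> P" "rot D d \<in> P" for d
    using that by (simp add: rot_X next_in_P)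
  have corner: "\<not> red_like b \<and> red_like (next_in D P t)"
    if "t \<in> v" "t \<notin> P" "b \<in> v" "b \<in> P" "rot X b = next_in D P t" for t b
    using trans_corner[of t b] that vd by auto
  have out_in: "\<exists>!e. e \<in> v \<inter> P \<and> e \<in> Or \<and> rot X e \<notin> Or" by (rule tb.out_in_ex1[OF vX vS])
  have in_out: "\<exists>!e. e \<in> v \<inter> P \<and> e \<notin> Or \<and> rot X e \<in> Or" by (rule tb.in_out_ex1[OF vX vS])
  have rl: "red_like e \<longleftrightarrow> (e \<in> Or \<longleftrightarrow> v \<in> black D)" if "e \<in> v" for e using vd[OF that] by (simp add: red_like_def)
  have RB: "\<exists>!e. e \<in> v \<inter> P \<and> red_like e \<and> \<not> red_like (rot X e)"
  proof (cases "v \<in> black D")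
    case True
    have "(e \<in> v \<inter> P \<and> red_like e \<and> \<not> red_like (rot X e)) = (e \<in> v \<inter> P \<and> e \<in> Or \<and> rot X e \<notin> Or)" for e
      using rl[of e] rl[of "rot X e"] rX[of e] True by auto
    then show ?thesis using out_in by simp
  next
    case False
    have "(e \<in> v \<inter> P \<and> red_like e \<and> \<not> red_like (rot X e)) = (e \<in> v \<inter> P \<and> e \<notin> Or \<and> rot X e \<in> Or)" for e
      using rl[of e] rl[of "rot X e"] rX[of e] False by auto
    then show ?thesis using in_out by simp
  qed
  have BR: "\<exists>!e. e \<in> v \<inter> P \<and> \<not> red_like e \<and> red_like (rot X e)"
  proof (cases "v \<in> black D")
    case True
    have "(e \<in> v \<inter> P \<and> \<not> red_like e \<and> red_like (rot X e)) = (e \<in> v \<inter> P \<and> e \<notin> Or \<and> rot X e \<in> Or)" for e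
      using rl[of e] rl[of "rot X e"] rX[of e] True by auto
    then show ?thesis using in_out by simp
  next
    case False
    have "(e \<in> v \<inter> P \<and> \<not> red_like e \<and> red_like (rot X e)) = (e \<in> v \<inter> P \<and> e \<in> Or \<and> rot X e \<notin> Or)" for e
      using rl[of e] rl[of "rot X e"] rX[of e] False by auto
    then show ?thesis using out_in by simp
  qed
  obtain a where a: "a \<in> v" "a \<in> P" "\<not> red_like a" "red_like (rot X a)" using ex1_implies_ex[OF BR] by auto
  have "rot X a \<notin> outer_face D"
    using rX[OF a(1,2)] v by (auto simp: inner_vertices_def)
  then obtain g where g: "g \<in> v" "g \<notin> P" using trans_exists[OF vD a] by blast
  obtain e0 where e0: "e0 \<in> v" "e0 \<in> P" "red_like e0" "\<not> red_like (rot X e0)" using ex1_implies_ex[OF RB] by auto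
  have e0P: "rot D e0 \<in> P"
  proof (rule ccontr)
    assume n: "rot D e0 \<notin> P"
    have "rot X e0 = next_in D P (rot D e0)" using e0 by (simp add: rot_X)
    then show False using corner[OF rv[OF e0(1)] n e0(1,2)] e0(3) by simp
  qed
  \<comment> \<open>The only corner from blue to red contains \<open>g\<close>, so its two sides are
    not consecutive in \<open>D\<close>.\<close>
  have BRP: "\<not> red_like (rot D e)" if e: "e \<in> v" "e \<in> P" "\<not> red_like e" "rot D e \<in> P" for e
  proof
    assume "red_like (rot D e)"
    then have re: "red_like (rot X e)" using rXP e by simp
    obtain b where b: "b \<in> P" "b \<in> vertex_of D g" "next_in D P (rot D b) = next_in D P g"
      using prev_in vd(1)[OF g(1)] by blast
    then have rb: "rot X b = next_in D P g" "b \<in> v" using vd(2)[OF g(1)] by (simp_all add: rot_X)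
    then have "\<not> red_like b \<and> red_like (rot X b)" using corner[OF g rb(2) b(1) rb(1)] by simp
    then have "b = e" using BR e re b(1) rb(2) by blast
    then have "next_in D P g = rot D e" using rb rXP e by simp
    then show False using next_in_not_rot[OF vd(1)[OF g(1)] g(2)] e by blast
  qed
  show ?thesis
    unfolding clockwise_colours_def
  proof (rule bexI[OF _ e0(1)], rule clockwise_blocks[OF vD _ e0(1)])
    fix e assume e: "e \<in> v"
    note ce = col[OF e] col[OF rv[OF e]]
    consider "e \<notin> P" "rot D e \<notin> P" | "e \<notin> P" "rot D e \<in> P" | "e \<in> P" "rot D e \<notin> P" | "e \<in> P" "rot D e \<in> P" by blast
    then show "(?c e, ?c (rot D e)) \<in>
        {(Some Red, Some Red), (Some Red, Some Blue), (Some Blue, Some Blue),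
         (Some Blue, Some Green), (Some Green, Some Green), (Some Green, Some Red)}"
    proof cases
      case 1 then show ?thesis using ce by simp
    next
      case 2
      obtain b where b: "b \<in> P" "b \<in> vertex_of D e" "next_in D P (rot D b) = next_in D P e"
        using prev_in vd(1)[OF e] by blast
      then have "red_like (next_in D P e)"
        using corner[OF e 2(1), of b] vd(2)[OF e] by (simp add: rot_X)
      moreover have "next_in D P e = rot D e"
        using next_in_step[OF vd(1)[OF e] 2(1)] 2(2) by (simp add: next_in_P)
      ultimately show ?thesis using ce 2 by simp
    next
      case 3
      have "rot X e = next_in D P (rot D e)" using 3 by (simp add: rot_X)
      then have "\<not> red_like e" using corner[OF rv[OF e] 3(2) e 3(1)] by simp
      then show ?thesis using ce 3 by simp
    next
      case 4
      then show ?thesis using ce BRP[OF e 4(1) _ 4(2)] by auto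
    qed
  next
    show "?c e0 = Some Red" using col[OF e0(1)] e0 by simp
    show "?c (rot D e0) = Some Blue" using col[OF rv[OF e0(1)]] e0 e0P rXP by simp
    show "g \<in> v" by (rule g)
    show "?c g = Some Green" using col[OF g(1)] g by simp
    fix e assume e: "e \<in> v" "?c e = Some Red" "?c (rot D e) = Some Blue"
    then have eP: "e \<in> P" "red_like e" "rot D e \<in> P" "\<not> red_like (rot D e)"
      using col[OF e(1)] col[OF rv[OF e(1)]] by (auto split: if_splits)
    then have "e \<in> v \<inter> P \<and> red_like e \<and> \<not> red_like (rot X e)" using rXP e by simp
    then show "e = e0" using RB e0 by blast
  qed
qed

theorem schnyder: "schnyder_labeling D (colouring_of D Or)"
  unfolding schnyder_labeling_def
proof (intro conjI)
  let ?c = "colouring_of D Or"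
  show "dissection64 D" by (rule dissection)
  show "dom ?c = inner_darts D" by (auto simp: dom_def colouring_of_def)
  show "\<forall>d\<in>inner_darts D. ?c (opp D d) = ?c d"
  proof
    fix d assume d: "d \<in> inner_darts D"
    then have dd: "d \<in> darts D" by (rule inner_darts_in)
    have "red_like (opp D d) \<longleftrightarrow> red_like d" if "d \<in> P"
    proof -
      have "target_of D d \<in> black D \<longleftrightarrow> vertex_of D d \<notin> black D"
        using black_alternates[OF dd] black_iff[OF vertex_in_vertices[OF dd]] by blast
      then show ?thesis using Or_iff[OF that] by (auto simp: red_like_def target_of_def)
    qed
    then show "?c (opp D d) = ?c d"
      using colouring_of_eq[OF d] colouring_of_eq[OF opp_inner[OF d]] opp_in_P_iff[OF dd] by simp
  qed
  show "\<forall>i<6. \<forall>d\<in>outer_vertex D i \<inter> inner_darts D. ?c d = Some (outer_label i)"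
    using outer_labels by (simp add: outer_vertex_eq)
  show "\<forall>v\<in>inner_vertices D. \<exists>d\<in>v. \<exists>i>0. \<exists>j>0. \<exists>k>0. clockwise_colours D ?c d =
          replicate i (Some Red) @ replicate j (Some Green) @ replicate k (Some Blue)"
    using inner_vertex_colours by blast
qed

end

section \<open>From labelings to transverse orientations\<close>

text \<open>A nonempty invariant subset of least cardinality equals its image. For a choice of
  successors on a finite set of vertices this isolates vertices on which the choice is a
  permutation, that is, disjoint directed cycles.\<close>

lemma finite_invariant_subset:
  assumes "finite Z" "Z \<noteq> {}" "g ` Z \<subseteq> Z"
  obtains Y where "Y \<subseteq> Z" "Y \<noteq> {}" "g ` Y = Y"
proof -
  let ?P = "\<lambda>Y. Y \<subseteq> Z \<and> Y \<noteq> {} \<and> g ` Y \<subseteq> Y"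
  have "?P Z" using assms by simp
  then obtain Y where Y: "?P Y" and min: "\<And>Y'. ?P Y' \<Longrightarrow> card Y \<le> card Y'"
    using ex_has_least_nat[of ?P Z card] by blast
  have "?P (g ` Y)" using Y by blast
  then have "card Y \<le> card (g ` Y)" by (rule min)
  moreover have "finite Y" using Y assms(1) finite_subset by blast
  ultimately have "g ` Y = Y" using Y by (intro card_seteq) auto
  then show ?thesis using that Y by blast
qed

lemma sum_lt_6: "(\<Sum>i<6. F i) = F 0 + F 1 + F 2 + F 3 + F 4 + (F 5 :: nat)" for F :: "nat \<Rightarrow> nat"
  by (simp add: eval_nat_numeral)

locale labeling = dissection D for D :: "('d, 'x) dissection_scheme" +
  fixes c :: "'d \<Rightarrow> colour option"
  assumes labeling: "schnyder_labeling D c"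
    and nonisolated: "\<not> isolated D (V 1)" "\<not> isolated D (V 4)"
begin

lemma c_dom: "c d \<noteq> None \<longleftrightarrow> d \<in> inner_darts D"
proof -
  have "dom c = inner_darts D" using labeling by (simp add: schnyder_labeling_def)
  moreover have "c d \<noteq> None \<longleftrightarrow> d \<in> dom c" by (simp add: dom_def)
  ultimately show ?thesis by simp
qed

lemma c_opp: "d \<in> inner_darts D \<Longrightarrow> c (opp D d) = c d"
  using labeling by (simp add: schnyder_labeling_def)

lemma c_outer: "i < 6 \<Longrightarrow> d \<in> V i \<Longrightarrow> d \<in> inner_darts D \<Longrightarrow> c d = Some (outer_label i)"
  using labeling by (simp add: schnyder_labeling_def outer_vertex_eq)

text \<open>The enumeration is a function on all natural numbers with
  \<open>s (i + j + k) = s 0\<close>, so that the corner after the last dart has the same form as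
  the others.\<close>

lemma inner_enum:
  assumes v: "v \<in> inner_vertices D"
  obtains s i j k where "0 < i" "0 < j" "0 < k" "bij_betw s {..<i + j + k} v" "s (i + j + k) = s 0"
    "\<And>n. inv (rot D) (s n) = s (Suc n)"
    "\<And>n. n < i + j + k \<Longrightarrow> c (s n) = Some (if n < i then Red else if n < i + j then Green else Blue)"
proof -
  have "\<forall>v\<in>inner_vertices D. \<exists>d\<in>v. \<exists>i>0. \<exists>j>0. \<exists>k>0. clockwise_colours D c d =
      replicate i (Some Red) @ replicate j (Some Green) @ replicate k (Some Blue)"
    using labeling by (simp add: schnyder_labeling_def)
  then obtain d i j k where d: "d \<in> v" "0 < i" "0 < j" "0 < k" and
    cc: "clockwise_colours D c d = replicate i (Some Red) @ replicate j (Some Green) @ replicate k (Some Blue)"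
    using v by blast
  define s where "s n = (inv (rot D) ^^ n) d" for n
  have vd: "vertex_of D d = v" using in_verticesD[OF inner_vertex_in[OF v] d(1)] by simp
  have m: "card v = i + j + k"
    using arg_cong[OF cc, of length] by (simp add: clockwise_colours_def vd)
  show ?thesis
  proof (rule that[of i j k s])
    have "s = (\<lambda>n. (inv (rot D) ^^ n) d)" by (simp add: s_def fun_eq_iff)
    then show "bij_betw s {..<i + j + k} v" "s (i + j + k) = s 0"
      using clockwise_enum[of d] unfolding vd m by simp_all
    show "inv (rot D) (s n) = s (Suc n)" for n by (simp add: s_def)
    fix n assume n: "n < i + j + k"
    have "c (s n) = clockwise_colours D c d ! n" using n by (simp add: clockwise_colours_def vd m s_def)
    also have "\<dots> = Some (if n < i then Red else if n < i + j then Green else Blue)"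
      using n unfolding cc by (auto simp: nth_append)
    finally show "c (s n) = Some (if n < i then Red else if n < i + j then Green else Blue)" .
  qed (use d in simp_all)
qed

text \<open>Half-edges carry colours: those at an outer vertex, including the outer ones, that of its label.\<close>

definition h :: "'d \<Rightarrow> colour" where
  "h d = (if vertex_of D d \<in> inner_vertices D then the (c d)
     else outer_label (THE i. i < 6 \<and> vertex_of D d = V i))"

lemma h_outer: "i < 6 \<Longrightarrow> vertex_of D d = V i \<Longrightarrow> h d = outer_label i"
  using V_eq_iff by (auto simp: h_def V_not_inner intro!: arg_cong[where f=outer_label] the_equality)

lemma c_h:
  assumes d: "d \<in> inner_darts D" shows "c d = Some (h d)"
proof -
  have "vertex_of D d \<in> vertices D" using d inner_darts_in vertex_in_vertices by blast
  then show ?thesis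
  proof (rule vertex_cases)
    assume "vertex_of D d \<in> inner_vertices D"
    then show ?thesis using c_dom[of d] d by (auto simp: h_def)
  next
    fix i assume i: "i < 6" "vertex_of D d = V i"
    then show ?thesis using c_outer[OF i(1) _ d] h_outer[OF i] vertex_of_self[of d] by simp
  qed
qed

lemma h_opp: "d \<in> inner_darts D \<Longrightarrow> h (opp D d) = h d"
  using c_h[of d] c_h[of "opp D d"] c_opp[of d] opp_inner[of d] by simp

lemma outer_h:
  assumes "i < 6"
  shows "h (opp D (r i)) = outer_label (Suc i mod 6)" "h (face_next D (opp D (r i))) = outer_label i"
proof -
  show "h (opp D (r i)) = outer_label (Suc i mod 6)"
  proof (rule h_outer)
    have "V (Suc i) = V (Suc i mod 6)" using assms V_6 by (cases "i = 5") auto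
    then show "vertex_of D (opp D (r i)) = V (Suc i mod 6)" using vertex_opp_r by simp
  qed simp
  show "h (face_next D (opp D (r i))) = outer_label i"
    by (rule h_outer[OF assms]) (simp add: vertex_of_face_next target_opp_r)
qed

text \<open>Seen from inside, an outer edge runs against the order of the labels. This gives the
  same cyclic order of changes as counterclockwise around an inner vertex, so outer and inner
  changes can be counted together.\<close>

lemma h_step_outer:
  assumes "i < 6"
  shows "(h (opp D (r i)), h (face_next D (opp D (r i)))) \<in> {(Green, Red), (Red, Blue), (Blue, Green)}"
proof -
  have "i = 0 \<or> i = 1 \<or> i = 2 \<or> i = 3 \<or> i = 4 \<or> i = 5" using assms by linarith
  then show ?thesis unfolding outer_h[OF assms] by (auto simp: outer_label_def)
qed

text \<open>The dart \<open>inv (rot D) d\<close> follows \<open>d\<close> clockwise; after the last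
  dart, a blue one, comes the first, a red one.\<close>

lemma h_corner:
  assumes d: "d \<in> darts D"
  shows "(h (inv (rot D) d), h d) \<in> {(Green, Red), (Red, Blue), (Blue, Green)} \<or> h (inv (rot D) d) = h d"
proof -
  have vi: "vertex_of D (inv (rot D) d) = vertex_of D d"
    using vertex_of_rot[of "inv (rot D) d"] rot_inv_rot by simp
  show ?thesis
  proof (rule vertex_cases[OF vertex_in_vertices[OF d]])
    fix i assume "i < 6" "vertex_of D d = V i"
    then show ?thesis using h_outer vi by simp
  next
    assume v: "vertex_of D d \<in> inner_vertices D"
    obtain s i j k where s: "0 < i" "0 < j" "0 < k" "bij_betw s {..<i + j + k} (vertex_of D d)"
      "s (i + j + k) = s 0" "\<And>n. inv (rot D) (s n) = s (Suc n)"
      "\<And>n. n < i + j + k \<Longrightarrow> c (s n) = Some (if n < i then Red else if n < i + j then Green else Blue)"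
      by (rule inner_enum[OF v]) metis
    have hs: "h (s n) = (if n < i then Red else if n < i + j then Green else Blue)" if "n < i + j + k" for n
    proof -
      have "s n \<in> vertex_of D d" using s(4) that by (auto simp: bij_betw_def)
      then show ?thesis using c_h[OF dart_at_inner[OF v]] s(7)[OF that] by simp
    qed
    obtain n where n: "n < i + j + k" "d = s n"
      using s(4) vertex_of_self[of d] by (auto simp: bij_betw_def)
    have "h (s (Suc n)) = (if Suc n = i + j + k then Red else if Suc n < i then Red else if Suc n < i + j then Green else Blue)"
      using hs[of "Suc n"] hs[of 0] s(1,5) n by auto
    then show ?thesis using hs[OF n(1)] s(1-3) s(6)[of n] n by auto
  qed
qed

lemma inv_rot_face_next: "inv (rot D) (face_next D d) = opp D d"
  by (simp add: face_next_def inv_rot_rot)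

text \<open>A step of the contour passes to the other half of the edge, which has the same colour
  inside, and then turns counterclockwise at the target.\<close>

lemma h_step:
  assumes d: "d \<in> darts D" "d \<notin> outer_face D"
  shows "(h d, h (face_next D d)) \<in> {(Green, Red), (Red, Blue), (Blue, Green)} \<or> h d = h (face_next D d)"
proof (rule inner_darts_cases[OF d(1)])
  assume i: "d \<in> inner_darts D"
  then show ?thesis
    using h_corner[of "face_next D d"] face_next_in_iff[of d] d(1) h_opp[OF i] by (simp add: inv_rot_face_next)
next
  fix i assume "i < 6" "d = r i" then show ?thesis using d r_in_outer by simp
next
  fix i assume "i < 6" "d = opp D (r i)" then show ?thesis using h_step_outer by blast
qed

section \<open>Counting colour changes\<close>

lemma finite_inner_vertices: "finite (inner_vertices D)"
  using finite_vertices by (simp add: inner_vertices_def)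

lemma vertices_eq_Un: "vertices D = inner_vertices D \<union> V ` {..<6}"
  using vertex_cases V_in inner_vertex_in by blast

lemma card_inner_vertices: "card (vertices D) = card (inner_vertices D) + 6"
proof -
  have "card (vertices D) = card (inner_vertices D) + card (V ` {..<6})"
    unfolding vertices_eq_Un
    by (rule card_Un_disjoint) (use finite_inner_vertices V_not_inner in auto)
  moreover have "card (V ` {..<6}) = 6"
    using V_eq_iff by (subst card_image) (auto simp: inj_on_def)
  ultimately show ?thesis by simp
qed

text \<open>A contour step is an edge followed by a corner at its target. Colours of half-edges
  agree along inner edges and around outer vertices, so only outer edges (first sum) and corners at
  inner vertices (second sum) contribute.\<close>

lemma sum_changes:
  fixes w :: "colour \<Rightarrow> colour \<Rightarrow> nat"
  assumes w: "\<And>x. w x x = 0"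
    and K: "K \<subseteq> darts D" "\<And>d. face_next D d \<in> K \<longleftrightarrow> d \<in> K" "outer_face D \<subseteq> K" "opp D ` outer_face D \<subseteq> K"
  shows "(\<Sum>d\<in>K - outer_face D. w (h d) (h (face_next D d))) =
    (\<Sum>i<6. w (outer_label (Suc i mod 6)) (outer_label i)) +
    (\<Sum>v\<in>inner_vertices D. \<Sum>d\<in>v \<inter> K. w (h (inv (rot D) d)) (h d))"
proof -
  let ?g = "\<lambda>d. w (h d) (h (face_next D d))" and ?c = "\<lambda>d. w (h (inv (rot D) d)) (h d)"
  have finK: "finite K" using K(1) finite_darts finite_subset by blast
  have oE: "opp D ` outer_face D = (\<lambda>i. opp D (r i)) ` {..<6}"
    using r_enum by (auto simp: bij_betw_def image_image[symmetric])
  have inj: "inj_on (\<lambda>i. opp D (r i)) {..<6}" using opp_inj r_eq_iff by (auto simp: inj_on_def)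
  have split: "K - outer_face D = opp D ` outer_face D \<union> (K \<inter> inner_darts D)"
  proof (intro equalityI subsetI)
    fix d assume d: "d \<in> K - outer_face D"
    then have "d \<in> darts D" using K(1) by blast
    then show "d \<in> opp D ` outer_face D \<union> (K \<inter> inner_darts D)"
    proof (rule inner_darts_cases)
      fix i assume "d = r i" then show ?thesis using d r_in_outer by blast
    next
      fix i assume "d = opp D (r i)" then show ?thesis using r_in_outer by blast
    qed (use d in blast)
  next
    fix d assume "d \<in> opp D ` outer_face D \<union> (K \<inter> inner_darts D)"
    then show "d \<in> K - outer_face D"
    proof
      assume "d \<in> opp D ` outer_face D"
      then show ?thesis using K(4) oE opp_r_not_outer by auto
    qed (auto simp: inner_darts_def)
  qed
  have "(\<Sum>d\<in>K - outer_face D. ?g d) = (\<Sum>d\<in>opp D ` outer_face D. ?g d) + (\<Sum>d\<in>K \<inter> inner_darts D. ?g d)"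
    unfolding split
  proof (rule sum.union_disjoint)
    show "finite (opp D ` outer_face D)" unfolding oE by simp
    show "opp D ` outer_face D \<inter> (K \<inter> inner_darts D) = {}" unfolding oE using inner_dart_not_r by auto
  qed (use finK in simp)
  moreover have "(\<Sum>d\<in>opp D ` outer_face D. ?g d) = (\<Sum>i<6. w (outer_label (Suc i mod 6)) (outer_label i))"
    unfolding oE sum.reindex[OF inj] by (rule sum.cong) (auto simp: outer_h)
  moreover have "(\<Sum>d\<in>K \<inter> inner_darts D. ?g d) = (\<Sum>v\<in>inner_vertices D. \<Sum>d\<in>v \<inter> K. ?c d)"
  proof -
    \<comment> \<open>For the remaining inner darts the target is an outer vertex, and both colours
      equal its label.\<close>
    let ?A = "{d \<in> K \<inter> inner_darts D. target_of D d \<in> inner_vertices D}"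
    have "(\<Sum>d\<in>K \<inter> inner_darts D. ?g d) = (\<Sum>d\<in>?A. ?g d)"
    proof (rule sum.mono_neutral_right)
      show "\<forall>d\<in>K \<inter> inner_darts D - ?A. ?g d = 0"
      proof
        fix d assume d: "d \<in> K \<inter> inner_darts D - ?A"
        then have di: "d \<in> inner_darts D" by blast
        have "target_of D d \<in> vertices D" "target_of D d \<notin> inner_vertices D"
          using d target_in_vertices inner_darts_in by auto
        then obtain i where i: "i < 6" "target_of D d = V i" using vertex_cases by blast
        have "h (opp D d) = outer_label i" using i by (intro h_outer) (simp_all add: target_of_def)
        moreover have "h (face_next D d) = outer_label i"
          using i by (intro h_outer) (simp_all add: vertex_of_face_next)
        ultimately show "?g d = 0" using h_opp[OF di] w by simp
      qed
    qed (use finK in auto)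
    also have "\<dots> = (\<Sum>d\<in>face_next D ` ?A. ?c d)"
    proof (subst sum.reindex)
      show "inj_on (face_next D) ?A" using face_next_inj by (auto simp: inj_on_def)
      show "(\<Sum>d\<in>?A. ?g d) = sum (?c \<circ> face_next D) ?A"
        by (rule sum.cong) (auto simp: inv_rot_face_next h_opp)
    qed
    also have "face_next D ` ?A = \<Union> ((\<lambda>v. v \<inter> K) ` inner_vertices D)"
    proof (intro equalityI subsetI)
      fix e assume "e \<in> face_next D ` ?A"
      then obtain d where d: "d \<in> K" "target_of D d \<in> inner_vertices D" "e = face_next D d" by blast
      then have "e \<in> target_of D d" "e \<in> K" using vertex_of_self[of e] vertex_of_face_next[of d] K(2) by auto
      then show "e \<in> \<Union> ((\<lambda>v. v \<inter> K) ` inner_vertices D)" using d by blast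
    next
      fix e assume "e \<in> \<Union> ((\<lambda>v. v \<inter> K) ` inner_vertices D)"
      then obtain v where v: "v \<in> inner_vertices D" "e \<in> v" "e \<in> K" by blast
      have ev: "e \<in> darts D" "vertex_of D e = v" using in_verticesD[OF inner_vertex_in[OF v(1)] v(2)] by auto
      define a where "a = inv (rot D) e"
      have a: "rot D a = e" "a \<in> darts D" "a \<in> v"
        using rot_inv_rot[of e] rot_in_iff[of a] ev rot_in_vertex_iff[OF inner_vertex_in[OF v(1)], of a] v
        by (auto simp: a_def)
      have fn: "face_next D (opp D a) = e" using face_next_opp[OF a(2)] a(1) by simp
      have oa: "opp D a \<in> ?A"
        using fn K(2)[of "opp D a"] v opp_inner[OF dart_at_inner[OF v(1) a(3)]]
          target_of_opp[OF a(2)] in_verticesD[OF inner_vertex_in[OF v(1)] a(3)] by simp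
      show "e \<in> face_next D ` ?A" using imageI[OF oa, of "face_next D"] fn by simp
    qed
    also have "(\<Sum>d\<in>\<dots>. ?c d) = (\<Sum>v\<in>inner_vertices D. \<Sum>d\<in>v \<inter> K. ?c d)"
    proof (subst sum.UNION_disjoint)
      show "\<forall>v\<in>inner_vertices D. \<forall>u\<in>inner_vertices D. v \<noteq> u \<longrightarrow> v \<inter> K \<inter> (u \<inter> K) = {}"
      proof (intro ballI impI)
        fix v u assume vu: "v \<in> inner_vertices D" "u \<in> inner_vertices D" "v \<noteq> u"
        have "x \<notin> u" if "x \<in> v" for x
          using in_verticesD[OF inner_vertex_in[OF vu(1)] that] in_verticesD[OF inner_vertex_in[OF vu(2)], of x] vu(3) by auto
        then show "v \<inter> K \<inter> (u \<inter> K) = {}" by blast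
      qed
    qed (use finite_inner_vertices finK in auto)
    finally show ?thesis .
  qed
  ultimately show ?thesis by simp
qed

text \<open>The direct change between red and blue and the detour through green have the same weight
  2. Therefore a directed path through a vertex, which uses a red and a blue dart, has weight 2 on
  either side.\<close>

definition weight :: "colour \<Rightarrow> colour \<Rightarrow> nat" where
  "weight x y = (if x = y then 0 else if x = Red \<and> y = Blue then 2 else 1)"

text \<open>In the enumeration by blocks the changes are at the positions \<open>i - 1\<close>,
  \<open>i + j - 1\<close> and \<open>m - 1\<close>, the last one, back to red, with weight 2. An
  interval from a red to a blue position contains the first two, its complement only the
  last.\<close>

lemma vertex_weights:
  assumes v: "v \<in> inner_vertices D"
  obtains s m where "bij_betw s {..<m} v" "s m = s 0" "\<And>n. inv (rot D) (s n) = s (Suc n)"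
    "\<And>n. n < m \<Longrightarrow> c (s n) = Some (h (s n))"
    "\<And>A. A \<subseteq> {..<m} \<Longrightarrow> (\<Sum>n\<in>A. of_bool (h (s (Suc n)) = Red \<and> h (s n) = Blue) :: nat) = of_bool (m - 1 \<in> A)"
    "(\<Sum>d\<in>v. weight (h (inv (rot D) d)) (h d)) = 4"
    "\<And>a b. a < m \<Longrightarrow> b < m \<Longrightarrow> h (s a) = Red \<Longrightarrow> h (s b) = Blue \<Longrightarrow>
       a < b \<and> (\<Sum>n\<in>{a..<b}. weight (h (s (Suc n))) (h (s n))) = 2 \<and>
       (\<Sum>n\<in>{..<m} - {a..<b}. weight (h (s (Suc n))) (h (s n))) = 2"
    "m > 0" "\<exists>d\<in>v. c d = Some Red" "\<exists>d\<in>v. c d = Some Green" "\<exists>d\<in>v. c d = Some Blue"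
proof -
  obtain s i j k where s: "0 < i" "0 < j" "0 < k" "bij_betw s {..<i + j + k} v"
      "s (i + j + k) = s 0" "\<And>n. inv (rot D) (s n) = s (Suc n)"
      "\<And>n. n < i + j + k \<Longrightarrow> c (s n) = Some (if n < i then Red else if n < i + j then Green else Blue)"
    by (rule inner_enum[OF v]) metis
  define m where "m = i + j + k"
  note s = s(1-3) s(4-5)[folded m_def] s(6) s(7)[folded m_def]
  have sv: "s n \<in> v" if "n < m" for n using s(4) that by (auto simp: bij_betw_def)
  have csh: "c (s n) = Some (h (s n))" if "n < m" for n using c_h[OF dart_at_inner[OF v sv[OF that]]] .
  have hs: "h (s n) = (if n < i then Red else if n < i + j then Green else Blue)" if "n < m" for n
    using s(7)[OF that] csh[OF that] by simp
  have hS: "h (s (Suc n)) = (if Suc n = m then Red else if Suc n < i then Red else if Suc n < i + j then Green else Blue)"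
    if "n < m" for n
    using hs[of "Suc n"] hs[of 0] s(1,5) that m_def by auto
  define g where "g n = (of_bool (n = i - 1) + of_bool (n = i + j - 1) + 2 * of_bool (n = m - 1) :: nat)" for n
  have wg: "weight (h (s (Suc n))) (h (s n)) = g n" if "n < m" for n
    unfolding hS[OF that] hs[OF that] g_def weight_def using s(1-3) that m_def by auto
  have sumg: "(\<Sum>n\<in>A. weight (h (s (Suc n))) (h (s n))) =
      of_bool (i - 1 \<in> A) + of_bool (i + j - 1 \<in> A) + 2 * of_bool (m - 1 \<in> A)" if A: "A \<subseteq> {..<m}" for A
  proof -
    have fA: "finite A" using A finite_subset by blast
    have one: "(\<Sum>n\<in>A. of_bool (n = a) :: nat) = of_bool (a \<in> A)" for a
      using fA by (simp add: of_bool_def)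
    have "(\<Sum>n\<in>A. weight (h (s (Suc n))) (h (s n))) = (\<Sum>n\<in>A. g n)"
      by (rule sum.cong[OF refl]) (use A wg in auto)
    also have "\<dots> = of_bool (i - 1 \<in> A) + of_bool (i + j - 1 \<in> A) + 2 * of_bool (m - 1 \<in> A)"
      unfolding g_def sum.distrib sum_distrib_left[symmetric] one ..
    finally show ?thesis .
  qed
  have colours: "\<exists>d\<in>v. c d = Some Red" "\<exists>d\<in>v. c d = Some Green" "\<exists>d\<in>v. c d = Some Blue"
  proof -
    have "s 0 \<in> v" "s i \<in> v" "s (i + j) \<in> v" using sv s(1-3) by (auto simp: m_def)
    moreover have "c (s 0) = Some Red" "c (s i) = Some Green" "c (s (i + j)) = Some Blue"
      using s(1-3) s(7)[of 0] s(7)[of i] s(7)[of "i + j"] by (auto simp: m_def)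
    ultimately show "\<exists>d\<in>v. c d = Some Red" "\<exists>d\<in>v. c d = Some Green" "\<exists>d\<in>v. c d = Some Blue" by blast+
  qed
  show ?thesis
  proof (rule that[OF s(4,5,6) csh])
    fix A assume A: "A \<subseteq> {..<m}"
    have fA: "finite A" using A finite_subset by blast
    have "(\<Sum>n\<in>A. of_bool (h (s (Suc n)) = Red \<and> h (s n) = Blue) :: nat) = (\<Sum>n\<in>A. of_bool (n = m - 1))"
    proof (rule sum.cong[OF refl])
      fix n assume "n \<in> A"
      then have "n < m" using A by blast
      then show "(of_bool (h (s (Suc n)) = Red \<and> h (s n) = Blue) :: nat) = of_bool (n = m - 1)"
        unfolding hS[OF \<open>n < m\<close>] hs[OF \<open>n < m\<close>] using s(1-3) m_def by auto
    qed
    also have "\<dots> = of_bool (m - 1 \<in> A)" using fA by (simp add: of_bool_def)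
    finally show "(\<Sum>n\<in>A. of_bool (h (s (Suc n)) = Red \<and> h (s n) = Blue) :: nat) = of_bool (m - 1 \<in> A)" .
  next
    have "(\<Sum>d\<in>v. weight (h (inv (rot D) d)) (h d)) = (\<Sum>n\<in>{..<m}. weight (h (inv (rot D) (s n))) (h (s n)))"
      by (rule sum.reindex_bij_betw[OF s(4), symmetric])
    also have "\<dots> = 4" unfolding s(6) sumg[OF subset_refl] using s(1-3) by (auto simp: m_def)
    finally show "(\<Sum>d\<in>v. weight (h (inv (rot D) d)) (h d)) = 4" .
  next
    fix a b assume ab: "a < m" "b < m" "h (s a) = Red" "h (s b) = Blue"
    then have lt: "a < i" "i + j \<le> b" using hs[of a] hs[of b] by (auto split: if_splits)
    have "{a..<b} \<subseteq> {..<m}" "{..<m} - {a..<b} \<subseteq> {..<m}" using ab by auto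
    note sums = sumg[OF this(1)] sumg[OF this(2)]
    have "i - 1 \<in> {a..<b}" "i + j - 1 \<in> {a..<b}" "m - 1 \<notin> {a..<b}" "m - 1 < m"
      using lt ab(1,2) s(1-3) by (auto simp: m_def)
    then show "a < b \<and> (\<Sum>n\<in>{a..<b}. weight (h (s (Suc n))) (h (s n))) = 2 \<and>
       (\<Sum>n\<in>{..<m} - {a..<b}. weight (h (s (Suc n))) (h (s n))) = 2"
      unfolding sums using lt s(1-3) by simp
  qed (use s(1) colours in \<open>simp_all add: m_def\<close>)
qed

text \<open>
  A face of degree 4 has room for at most one round of changes, and there are as many rounds in
  total as inner faces.
\<close>

lemma inner_face_changes:
  assumes f: "f \<in> inner_faces D"
  shows "card {d \<in> f. h d = Red \<and> h (face_next D d) = Blue} = 1"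
    and "card {d \<in> f. h d = Green \<and> h (face_next D d) = Red} = 1"
    and "card {d \<in> f. h d = Blue \<and> h (face_next D d) = Green} = 1"
proof -
  let ?n = "\<lambda>x y f. card {d \<in> f. h d = x \<and> h (face_next D d) = y}"
  have eqs: "?n Green Red f = ?n Red Blue f \<and> ?n Blue Green f = ?n Red Blue f \<and> ?n Red Blue f \<le> 1"
    if f: "f \<in> inner_faces D" for f
  proof -
    have fF: "f \<in> faces D" "f \<noteq> outer_face D" using f by (auto simp: inner_faces_def)
    obtain x where x: "x \<in> darts D" "f = orbit (face_next D) x" using fF by (auto simp: faces_eq)
    have step: "(h d, h (face_next D d)) \<in> {(Green, Red), (Red, Blue), (Blue, Green)} \<or> h d = h (face_next D d)"
      if "d \<in> f" for d
    proof (rule h_step)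
      show "d \<in> darts D" using in_facesD[OF fF(1) that] by simp
      show "d \<notin> outer_face D" using in_facesD[OF fF(1) that] in_facesD[OF outer_face_in] fF(2) by blast
    qed
    have "{d \<in> f. h d = Red \<and> h (face_next D d) \<noteq> Red} = {d \<in> f. h d = Red \<and> h (face_next D d) = Blue}"
      "{d \<in> f. h d \<noteq> Red \<and> h (face_next D d) = Red} = {d \<in> f. h d = Green \<and> h (face_next D d) = Red}"
      "{d \<in> f. h d = Blue \<and> h (face_next D d) \<noteq> Blue} = {d \<in> f. h d = Blue \<and> h (face_next D d) = Green}"
      "{d \<in> f. h d \<noteq> Blue \<and> h (face_next D d) = Blue} = {d \<in> f. h d = Red \<and> h (face_next D d) = Blue}"
      using step by fastforce+
    then have 1: "?n Red Blue f = ?n Green Red f" "?n Blue Green f = ?n Red Blue f"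
      using face.card_changes[of x "\<lambda>d. h d = Red"] face.card_changes[of x "\<lambda>d. h d = Blue"] x(2) by simp_all
    have fin: "finite f" using x face.finite_orbit by blast
    have "?n Red Blue f + (?n Green Red f + ?n Blue Green f) \<le> card f"
    proof -
      define A1 A2 A3 where "A1 = {d \<in> f. h d = Red \<and> h (face_next D d) = Blue}"
        and "A2 = {d \<in> f. h d = Green \<and> h (face_next D d) = Red}"
        and "A3 = {d \<in> f. h d = Blue \<and> h (face_next D d) = Green}"
      have sub: "A1 \<subseteq> f" "A2 \<subseteq> f" "A3 \<subseteq> f" by (auto simp: A1_def A2_def A3_def)
      then have fA: "finite A1" "finite A2" "finite A3" using fin finite_subset by blast+
      have "A2 \<inter> A3 = {}" "A1 \<inter> (A2 \<union> A3) = {}" by (auto simp: A1_def A2_def A3_def)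
      then have "card (A1 \<union> (A2 \<union> A3)) = card A1 + (card A2 + card A3)"
        using fA by (simp add: card_Un_disjoint)
      moreover have "card (A1 \<union> (A2 \<union> A3)) \<le> card f" using fin sub by (intro card_mono) auto
      ultimately show ?thesis unfolding A1_def A2_def A3_def by simp
    qed
    \<comment> \<open>Three equal numbers with sum at most 4 are at most 1.\<close>
    then show ?thesis using 1 inner_face_card[OF fF] by simp
  qed
  let ?b = "\<lambda>x y. of_bool (x = Red \<and> y = Blue) :: nat"
  have sub: "inner_faces D \<subseteq> orbit (face_next D) ` darts D" by (auto simp: inner_faces_def faces_eq)
  have Un: "\<Union> (inner_faces D) = darts D - outer_face D"
  proof (intro equalityI subsetI)
    fix d assume "d \<in> \<Union> (inner_faces D)"
    then show "d \<in> darts D - outer_face D"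
      using in_facesD in_facesD[OF outer_face_in] by (auto simp: inner_faces_def)
  next
    fix d assume "d \<in> darts D - outer_face D"
    then show "d \<in> \<Union> (inner_faces D)"
      using face_of_self[of d] face_in_faces[of d] by (auto simp: inner_faces_def)
  qed
  have "(\<Sum>f\<in>inner_faces D. ?n Red Blue f) = (\<Sum>f\<in>inner_faces D. \<Sum>d\<in>f. ?b (h d) (h (face_next D d)))"
  proof (rule sum.cong[OF refl])
    fix f assume "f \<in> inner_faces D"
    then have "finite f" using sub face.finite_orbit by auto
    then show "?n Red Blue f = (\<Sum>d\<in>f. ?b (h d) (h (face_next D d)))"
      by (simp add: of_bool_def sum.If_cases Int_def)
  qed
  also have "\<dots> = (\<Sum>d\<in>darts D - outer_face D. ?b (h d) (h (face_next D d)))"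
    using face.sum_Union_orbits[OF sub, symmetric] unfolding Un .
  also have "\<dots> = (\<Sum>i<6. ?b (outer_label (Suc i mod 6)) (outer_label i)) +
      (\<Sum>v\<in>inner_vertices D. \<Sum>d\<in>v \<inter> darts D. ?b (h (inv (rot D) d)) (h d))"
  proof (rule sum_changes)
    show "outer_face D \<subseteq> darts D" using in_facesD[OF outer_face_in] by blast
    then show "opp D ` outer_face D \<subseteq> darts D" using opp_in_iff by blast
  qed (auto simp: face_next_in_iff)
  \<comment> \<open>Each label occurs twice on the hexagon.\<close>
  also have "(\<Sum>i<6. ?b (outer_label (Suc i mod 6)) (outer_label i)) = 2"
    unfolding sum_lt_6 outer_label_def by simp
  also have "(\<Sum>v\<in>inner_vertices D. \<Sum>d\<in>v \<inter> darts D. ?b (h (inv (rot D) d)) (h d)) = (\<Sum>v\<in>inner_vertices D. 1)"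
  proof (rule sum.cong[OF refl])
    fix v assume v: "v \<in> inner_vertices D"
    have "v \<subseteq> darts D" using in_verticesD[OF inner_vertex_in[OF v]] by blast
    then have "v \<inter> darts D = v" by blast
    obtain s m where s: "bij_betw s {..<m} v" "\<And>n. inv (rot D) (s n) = s (Suc n)"
      "\<And>A. A \<subseteq> {..<m} \<Longrightarrow> (\<Sum>n\<in>A. ?b (h (s (Suc n))) (h (s n))) = of_bool (m - 1 \<in> A)" "m > 0"
      by (rule vertex_weights[OF v]) (rule that; assumption)
    have "(\<Sum>d\<in>v. ?b (h (inv (rot D) d)) (h d)) = (\<Sum>n\<in>{..<m}. ?b (h (inv (rot D) (s n))) (h (s n)))"
      by (rule sum.reindex_bij_betw[OF s(1), symmetric])
    also have "\<dots> = 1" unfolding s(2) s(3)[OF subset_refl] using s(4) by simp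
    finally show "(\<Sum>d\<in>v \<inter> darts D. ?b (h (inv (rot D) d)) (h d)) = 1" unfolding \<open>v \<inter> darts D = v\<close> .
  qed
  \<comment> \<open>The inner vertices are two fewer than the inner faces, and the hexagon makes up
    for the difference. With at most one round per face, each face has exactly one.\<close>
  finally have eq: "(\<Sum>f\<in>inner_faces D. ?n Red Blue f) = (\<Sum>f\<in>inner_faces D. 1)"
    using card_inner_vertices card_vertices by simp
  have le: "?n Red Blue f \<le> 1" if "f \<in> inner_faces D" for f using eqs[OF that] by blast
  have "finite (inner_faces D)" using finite_faces by (simp add: inner_faces_def)
  then have "?n Red Blue f = 1" using sum_mono_inv[OF eq le, of f] f by simp
  then show "?n Red Blue f = 1" "?n Green Red f = 1" "?n Blue Green f = 1" using eqs[OF f] by simp_all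
qed

lemma inner_face_weight:
  assumes f: "f \<in> inner_faces D"
  shows "(\<Sum>d\<in>f. weight (h d) (h (face_next D d))) = 4"
proof -
  have fF: "f \<in> faces D" "f \<noteq> outer_face D" using f by (auto simp: inner_faces_def)
  have fin: "finite f" using fF face.finite_orbit by (auto simp: faces_eq)
  have "(\<Sum>d\<in>f. weight (h d) (h (face_next D d))) =
    (\<Sum>d\<in>f. 2 * of_bool (h d = Red \<and> h (face_next D d) = Blue) + of_bool (h d = Green \<and> h (face_next D d) = Red)
       + of_bool (h d = Blue \<and> h (face_next D d) = Green))"
  proof (rule sum.cong[OF refl])
    fix d assume d: "d \<in> f"
    have "(h d, h (face_next D d)) \<in> {(Green, Red), (Red, Blue), (Blue, Green)} \<or> h d = h (face_next D d)"
    proof (rule h_step)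
      show "d \<in> darts D" using in_facesD[OF fF(1) d] by simp
      show "d \<notin> outer_face D" using in_facesD[OF fF(1) d] in_facesD[OF outer_face_in] fF(2) by blast
    qed
    then show "weight (h d) (h (face_next D d)) =
      2 * of_bool (h d = Red \<and> h (face_next D d) = Blue) + of_bool (h d = Green \<and> h (face_next D d) = Red)
       + of_bool (h d = Blue \<and> h (face_next D d) = Green)"
      by (auto simp: weight_def)
  qed
  also have "\<dots> = 4"
  proof -
    have sc: "(\<Sum>d\<in>f. of_bool (Q d) :: nat) = card {d \<in> f. Q d}" for Q
      using fin by (simp add: of_bool_def sum.If_cases Int_def)
    show ?thesis unfolding sum.distrib sum_distrib_left[symmetric] sc inner_face_changes[OF f] by simp
  qed
  finally show ?thesis .
qed

end

section \<open>The orientation given by a labeling, and its acyclicity\<close>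

context labeling begin

definition Or :: "'d set" where "Or = orientation_of D c"

abbreviation P where "P \<equiv> plain_darts D Or"

lemma Or_inner_iff:
  assumes d: "d \<in> inner_darts D"
  shows "d \<in> Or \<longleftrightarrow> c d = Some Red \<and> vertex_of D d \<in> black D \<or> c d = Some Blue \<and> vertex_of D d \<notin> black D"
proof -
  have "vertex_of D d \<in> white D \<longleftrightarrow> vertex_of D d \<notin> black D"
    using black_iff[OF vertex_in_vertices[OF inner_darts_in[OF d]]] by blast
  then show ?thesis using d inner_dart_not_r[OF d] by (auto simp: Or_def orientation_of_def r_def[symmetric])
qed

lemma Or_r: "i < 6 \<Longrightarrow> r i \<in> Or \<longleftrightarrow> i = 3 \<or> i = 4 \<or> i = 5"
  and Or_opp_r: "i < 6 \<Longrightarrow> opp D (r i) \<in> Or \<longleftrightarrow> i = 0 \<or> i = 1 \<or> i = 2"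
proof -
  assume i: "i < 6"
  have e: "r i = r j \<longleftrightarrow> i = j" if "j < 6" for j using r_eq_iff[OF i that] .
  have n: "r i \<notin> inner_darts D" "opp D (r i) \<notin> inner_darts D" using inner_dart_not_r by blast+
  have ne: "r i \<noteq> opp D (r j)" "opp D (r i) \<noteq> r j" for j using r_neq_opp_r by metis+
  show "r i \<in> Or \<longleftrightarrow> i = 3 \<or> i = 4 \<or> i = 5"
    using n ne e[of 3] e[of 4] e[of 5] by (auto simp: Or_def orientation_of_def r_def[symmetric])
  show "opp D (r i) \<in> Or \<longleftrightarrow> i = 0 \<or> i = 1 \<or> i = 2"
    using n ne e[of 0] e[of 1] e[of 2] opp_inj by (auto simp: Or_def orientation_of_def r_def[symmetric])
qed

lemma Or_cases:
  assumes "d \<in> Or"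
  obtains "d \<in> inner_darts D" | i where "i = 3 \<or> i = 4 \<or> i = 5" "d = r i"
    | i where "i = 0 \<or> i = 1 \<or> i = 2" "d = opp D (r i)"
  using assms by (auto simp: Or_def orientation_of_def r_def[symmetric])

lemma Or_sub: "Or \<subseteq> darts D"
proof
  fix d assume "d \<in> Or"
  then show "d \<in> darts D" by (rule Or_cases) (use inner_darts_in r_in opp_r_in in simp_all)
qed

lemma Or_opp_inner_iff:
  assumes d: "d \<in> inner_darts D"
  shows "opp D d \<in> Or \<longleftrightarrow> c d = Some Blue \<and> vertex_of D d \<in> black D \<or> c d = Some Red \<and> vertex_of D d \<notin> black D"
proof -
  have "vertex_of D (opp D d) \<in> black D \<longleftrightarrow> vertex_of D d \<notin> black D"
    using black_alternates[OF inner_darts_in[OF d]] black_iff[OF vertex_in_vertices[OF inner_darts_in[OF d]]]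
    by (auto simp: target_of_def)
  then show ?thesis using Or_inner_iff[OF opp_inner[OF d]] c_opp[OF d] by auto
qed

lemma Or_opp_not: "d \<in> darts D \<Longrightarrow> d \<in> Or \<Longrightarrow> opp D d \<notin> Or"
proof -
  assume d: "d \<in> darts D" "d \<in> Or"
  show "opp D d \<notin> Or"
  proof (rule inner_darts_cases[OF d(1)])
    assume "d \<in> inner_darts D"
    then show ?thesis using d(2) Or_inner_iff Or_opp_inner_iff by auto
  next
    fix i assume "i < 6" "d = r i"
    then show ?thesis using d(2) Or_r[of i] Or_opp_r[of i] by auto
  next
    fix i assume "i < 6" "d = opp D (r i)"
    then show ?thesis using d(2) Or_r[of i] Or_opp_r[of i] opp_opp[OF r_in[of i]] by auto
  qed
qed

lemma P_iff: "d \<in> darts D \<Longrightarrow> d \<in> P \<longleftrightarrow> d \<in> Or \<or> opp D d \<in> Or"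
proof -
  assume d: "d \<in> darts D"
  show "d \<in> P \<longleftrightarrow> d \<in> Or \<or> opp D d \<in> Or"
  proof
    assume "d \<in> P"
    then consider "d \<in> Or" | e where "e \<in> Or" "d = opp D e" by (auto simp: plain_darts_def)
    then show "d \<in> Or \<or> opp D d \<in> Or"
    proof cases
      case 2
      then have "opp D d = e" using opp_opp[of e] Or_sub by auto
      then show ?thesis using 2 by simp
    qed simp
  next
    assume "d \<in> Or \<or> opp D d \<in> Or"
    then show "d \<in> P"
    proof
      assume "opp D d \<in> Or"
      then have "opp D (opp D d) \<in> opp D ` Or" by (rule imageI)
      then show ?thesis using opp_opp[OF d] by (simp add: plain_darts_def)
    qed (simp add: plain_darts_def)
  qed
qed

lemma P_inner_iff:
  assumes d: "d \<in> inner_darts D" shows "d \<in> P \<longleftrightarrow> c d \<noteq> Some Green"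
proof -
  have "c d = Some (h d)" by (rule c_h[OF d])
  then show ?thesis
    using P_iff[OF inner_darts_in[OF d]] Or_inner_iff[OF d] Or_opp_inner_iff[OF d] by (cases "h d") auto
qed

lemma r_P: "r i \<in> P" and opp_r_P: "opp D (r i) \<in> P"
proof -
  have *: "r j \<in> P \<and> opp D (r j) \<in> P" if "j < 6" for j
    using that Or_r[of j] Or_opp_r[of j] P_iff[OF r_in[of j]] P_iff[OF opp_r_in[of j]] opp_opp[OF r_in[of j]]
    by auto
  obtain j where "j < 6" "r i = r j" using r_in_outer by (rule outer_faceE)
  then show "r i \<in> P" "opp D (r i) \<in> P" using * by auto
qed

lemma Or_iff: "d \<in> darts D \<Longrightarrow> d \<in> P \<Longrightarrow> opp D d \<in> Or \<longleftrightarrow> d \<notin> Or"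
  using P_iff[of d] Or_opp_not[of d] Or_opp_not[of "opp D d"] opp_opp[of d] opp_in_iff[of d] by auto

lemma at_V_label:
  assumes "d \<in> inner_darts D" "vertex_of D d = V i" "i < 6"
  shows "c d = Some (outer_label i)"
  using c_outer[OF assms(3) _ assms(1)] assms(2) vertex_of_self[of d] by simp

lemma black_V: "V i \<in> black D \<longleftrightarrow> odd i"
  using black_iff[OF V_in] white_V by blast

lemma not_from_V0: "d \<in> Or \<Longrightarrow> vertex_of D d \<noteq> V 0"
proof
  assume d: "d \<in> Or" "vertex_of D d = V 0"
  from d(1) show False
  proof (rule Or_cases)
    assume i: "d \<in> inner_darts D"
    show False using at_V_label[OF i d(2)] Or_inner_iff[OF i] d black_V[of 0] by (simp add: outer_label_def)
  next
    fix i :: nat assume "i = 3 \<or> i = 4 \<or> i = 5" "d = r i"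
    then show False using d(2) V_eq_iff[of i 0] by (auto simp: V_def)
  next
    fix i :: nat assume "i = 0 \<or> i = 1 \<or> i = 2" "d = opp D (r i)"
    then show False using d(2) V_eq_iff[of "Suc i" 0] vertex_opp_r[of i] by auto
  qed
qed

lemma target_opp_inner: "d \<in> inner_darts D \<Longrightarrow> target_of D d = V i \<Longrightarrow> i < 6 \<Longrightarrow> c d = Some (outer_label i)"
  using at_V_label[of "opp D d" i] opp_inner c_opp by (simp add: target_of_def)

lemma Or_into_inner_iff:
  assumes "d \<in> inner_darts D"
  shows "d \<in> Or \<longleftrightarrow> c d = Some Red \<and> target_of D d \<notin> black D \<or> c d = Some Blue \<and> target_of D d \<in> black D"
  using Or_inner_iff[OF assms] black_alternates[OF inner_darts_in[OF assms]]
    black_iff[OF vertex_in_vertices[OF inner_darts_in[OF assms]]] by auto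

lemma target_r_mod: "i < 6 \<Longrightarrow> target_of D (r i) = V (Suc i mod 6)"
  using target_r[of i] V_6 by (cases "i = 5") auto

text \<open>By their labels and their colours in the bipartition, these outer vertices are entered
  by no inner edge. Together with \<open>not_from_V0\<close> and \<open>from_V5\<close> this keeps
  directed cycles away from the hexagon.\<close>

lemma into_V:
  assumes d: "d \<in> Or" "target_of D d = V i" and i: "i < 5" "i \<noteq> 0"
  shows "i \<noteq> 3" and "i = 2 \<Longrightarrow> vertex_of D d = V 3" and "i = 1 \<Longrightarrow> vertex_of D d = V 2"
    and "i = 4 \<Longrightarrow> vertex_of D d = V 3"
proof -
  have "i \<noteq> 3 \<and> (i = 2 \<longrightarrow> vertex_of D d = V 3) \<and> (i = 1 \<longrightarrow> vertex_of D d = V 2) \<and> (i = 4 \<longrightarrow> vertex_of D d = V 3)"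
    using d(1)
  proof (rule Or_cases)
    assume n: "d \<in> inner_darts D"
    have "c d = Some (outer_label i)" using target_opp_inner[OF n d(2)] i by simp
    moreover have "c d = Some Red \<and> odd i = False \<or> c d = Some Blue \<and> odd i"
      using Or_into_inner_iff[OF n] d black_V[of i] by auto
    moreover have "i = 1 \<or> i = 2 \<or> i = 3 \<or> i = 4" using i by linarith
    ultimately have False by (elim disjE) (simp_all add: outer_label_def)
    then show ?thesis ..
  next
    fix j :: nat assume j: "j = 3 \<or> j = 4 \<or> j = 5" "d = r j"
    have "j < 6" using j(1) by linarith
    then have "V (Suc j mod 6) = V i" using target_r_mod[of j] d(2) j(2) by simp
    then have ji: "Suc j mod 6 = i" using V_eq_iff[of "Suc j mod 6" i] i by simp
    have vj: "vertex_of D d = V j" using j(2) by (simp add: V_def)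
    have "j = 3 \<Longrightarrow> i = 4" "j = 4 \<Longrightarrow> i = 5" "j = 5 \<Longrightarrow> i = 0" using ji by simp_all
    then have "j = 3" "i = 4" using j(1) i by auto
    then show ?thesis using vj by simp
  next
    fix j :: nat assume j: "j = 0 \<or> j = 1 \<or> j = 2" "d = opp D (r j)"
    then have "V j = V i" using target_opp_r[of j] d(2) by simp
    then have ji: "j = i" using V_eq_iff[of j i] j(1) i by auto
    have vj: "vertex_of D d = V (Suc i)" using j(2) ji vertex_opp_r[of j] by simp
    have "i = 2 \<Longrightarrow> V (Suc i) = V 3" "i = 1 \<Longrightarrow> V (Suc i) = V 2" by (simp_all add: eval_nat_numeral)
    then show ?thesis using vj j(1) ji i by auto
  qed
  then show "i \<noteq> 3" "i = 2 \<Longrightarrow> vertex_of D d = V 3" "i = 1 \<Longrightarrow> vertex_of D d = V 2"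
    "i = 4 \<Longrightarrow> vertex_of D d = V 3" by blast+
qed

lemma from_V5: "d \<in> Or \<Longrightarrow> vertex_of D d = V 5 \<Longrightarrow> target_of D d = V 0"
proof -
  assume d: "d \<in> Or" "vertex_of D d = V 5"
  from d(1) show "target_of D d = V 0"
  proof (rule Or_cases)
    assume i: "d \<in> inner_darts D"
    have False using at_V_label[OF i d(2)] Or_inner_iff[OF i] d black_V[of 5] by (simp add: outer_label_def)
    then show ?thesis ..
  next
    fix i :: nat assume i: "i = 3 \<or> i = 4 \<or> i = 5" "d = r i"
    then have "i = 5" using d(2) V_eq_iff[of i 5] by (auto simp: V_def)
    then show ?thesis using i target_r[of 5] V_6 by simp
  next
    fix i :: nat assume i: "i = 0 \<or> i = 1 \<or> i = 2" "d = opp D (r i)"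
    then have False using d(2) V_eq_iff[of "Suc i" 5] vertex_opp_r[of i] by auto
    then show ?thesis ..
  qed
qed

text \<open>
  Discharging: if the region of the outer face cut out by a directed cycle had the local colour
  changes of a labeling, its Euler characteristic would be 2 instead of at most 1.
\<close>

lemma acyclic_arcs: "acyclic (arcs D Or)"
proof (rule ccontr)
  assume "\<not> acyclic (arcs D Or)"
  then obtain x where x: "(x, x) \<in> (arcs D Or)\<^sup>+" by (auto simp: acyclic_def)
  \<comment> \<open>The vertices on closed directed walks. A choice of outgoing arcs within
    \<open>Z\<close>, restricted to a set that it permutes, leaves disjoint simple cycles.\<close>
  define Z where "Z = {y. (y, y) \<in> (arcs D Or)\<^sup>+}"
  have arcsV: "arcs D Or \<subseteq> vertices D \<times> vertices D"
    using Or_sub vertex_in_vertices target_in_vertices by (auto simp: arcs_def)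
  have ZV: "Z \<subseteq> vertices D" using trancl_subset_Sigma[OF arcsV] by (auto simp: Z_def)
  have "\<exists>d\<in>Or. vertex_of D d = z \<and> target_of D d \<in> Z" if z: "z \<in> Z" for z
  proof -
    have "(z, z) \<in> (arcs D Or)\<^sup>+" using z by (simp add: Z_def)
    then obtain y where y: "(z, y) \<in> arcs D Or" "(y, z) \<in> (arcs D Or)\<^sup>*" by (meson tranclD)
    then have "(y, y) \<in> (arcs D Or)\<^sup>+" by (meson rtrancl_into_trancl1)
    then show ?thesis using y(1) by (auto simp: arcs_def Z_def)
  qed
  then obtain o' where o': "\<And>z. z \<in> Z \<Longrightarrow> o' z \<in> Or \<and> vertex_of D (o' z) = z \<and> target_of D (o' z) \<in> Z"
    by metis
  define g where "g z = target_of D (o' z)" for z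
  have "finite Z" using ZV finite_vertices finite_subset by blast
  moreover have "Z \<noteq> {}" using x by (auto simp: Z_def)
  moreover have "g ` Z \<subseteq> Z" using o' by (auto simp: g_def)
  ultimately obtain Y where Y: "Y \<subseteq> Z" "Y \<noteq> {}" "g ` Y = Y" by (rule finite_invariant_subset)
  have finY: "finite Y" using Y(1) \<open>finite Z\<close> finite_subset by blast
  have injg: "inj_on g Y" using finY Y(3) by (simp add: eq_card_imp_inj_on)
  have oY: "o' z \<in> Or" "vertex_of D (o' z) = z" "target_of D (o' z) \<in> Y" if z: "z \<in> Y" for z
  proof -
    have "z \<in> Z" using z Y(1) by blast
    then show "o' z \<in> Or" "vertex_of D (o' z) = z" using o' by blast+
    have "g z \<in> Y" using Y(3) z by blast
    then show "target_of D (o' z) \<in> Y" by (simp add: g_def)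
  qed
  have pre: "\<exists>y\<in>Y. target_of D (o' y) = z" if z: "z \<in> Y" for z
  proof -
    have "z \<in> g ` Y" using Y(3) z by simp
    then show ?thesis by (auto simp: g_def)
  qed
  \<comment> \<open>The outer vertices are excluded one after the other, starting from the
    poles.\<close>
  have n0: "V 0 \<notin> Y"
  proof
    assume "V 0 \<in> Y"
    then show False using oY(1,2)[of "V 0"] not_from_V0[of "o' (V 0)"] by simp
  qed
  have n3: "V 3 \<notin> Y"
  proof
    assume "V 3 \<in> Y"
    then obtain y where "y \<in> Y" "target_of D (o' y) = V 3" using pre by blast
    then show False using into_V(1)[of "o' y" 3] oY(1) by simp
  qed
  have n2: "V 2 \<notin> Y"
  proof
    assume "V 2 \<in> Y"
    then obtain y where y: "y \<in> Y" "target_of D (o' y) = V 2" using pre by blast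
    then show False using into_V(2)[of "o' y" 2] oY(1,2)[OF y(1)] n3 by simp
  qed
  have n1: "V 1 \<notin> Y"
  proof
    assume "V 1 \<in> Y"
    then obtain y where y: "y \<in> Y" "target_of D (o' y) = V 1" using pre by blast
    then show False using into_V(3)[of "o' y" 1] oY(1,2)[OF y(1)] n2 by simp
  qed
  have n4: "V 4 \<notin> Y"
  proof
    assume "V 4 \<in> Y"
    then obtain y where y: "y \<in> Y" "target_of D (o' y) = V 4" using pre by blast
    then show False using into_V(4)[of "o' y" 4] oY(1,2)[OF y(1)] n3 by simp
  qed
  have n5: "V 5 \<notin> Y"
  proof
    assume "V 5 \<in> Y"
    then show False using from_V5[of "o' (V 5)"] oY[of "V 5"] n0 by simp
  qed
  have inn: "z \<in> inner_vertices D" if z: "z \<in> Y" for z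
  proof -
    have "z \<in> vertices D" using z Y(1) ZV by blast
    then show ?thesis
    proof (rule vertex_cases)
      fix i assume i: "i < 6" "z = V i"
      then have "i = 0 \<or> i = 1 \<or> i = 2 \<or> i = 3 \<or> i = 4 \<or> i = 5" by linarith
      then have False using n0 n1 n2 n3 n4 n5 i(2) z by auto
      then show ?thesis ..
    qed
  qed
  define C where "C = o' ` Y \<union> opp D ` o' ` Y"
  have oinn: "o' z \<in> inner_darts D" if z: "z \<in> Y" for z
    using dart_at_inner[OF inn[OF z]] oY(2)[OF z] vertex_of_self[of "o' z"] by simp
  have Cinn: "C \<subseteq> inner_darts D" using oinn opp_inner by (auto simp: C_def)
  then have Cd: "C \<subseteq> darts D" using inner_darts_in by blast
  have Copp: "opp D d \<in> C" if d: "d \<in> C" for d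
  proof -
    from d consider z where "z \<in> Y" "d = o' z" | z where "z \<in> Y" "d = opp D (o' z)" by (auto simp: C_def)
    then show ?thesis
    proof cases
      case 1 then show ?thesis by (simp add: C_def)
    next
      case 2
      then have "opp D d = o' z" using opp_opp[OF inner_darts_in[OF oinn]] by simp
      then show ?thesis using 2 by (simp add: C_def)
    qed
  qed
  have Cvert: "vertex_of D d \<in> Y" if d: "d \<in> C" for d
    using d oY by (auto simp: C_def target_of_def)
  define K where "K = region D C (root D)"
  have K_sub: "K \<subseteq> darts D" unfolding K_def by (rule region_subset[OF root_in])
  have finK: "finite K" using K_sub finite_darts finite_subset by blast
  have K_face: "face_next D d \<in> K \<longleftrightarrow> d \<in> K" for d unfolding K_def by (rule region_face_next_iff)
  have K_cross: "opp D d \<in> K \<longleftrightarrow> d \<in> K" if d: "d \<in> darts D" "d \<notin> C" for d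
  proof
    assume "d \<in> K" then show "opp D d \<in> K" using d(2) unfolding K_def by (rule region.cross)
  next
    assume o: "opp D d \<in> K"
    have "opp D d \<notin> C" using Copp[of "opp D d"] opp_opp[OF d(1)] d(2) by auto
    then have "opp D (opp D d) \<in> region D C (root D)" using o unfolding K_def by (rule region.cross[rotated])
    then show "d \<in> K" unfolding opp_opp[OF d(1)] K_def .
  qed
  have K_outer: "outer_face D \<subseteq> K"
  proof
    fix e assume "e \<in> outer_face D"
    then show "e \<in> K" unfolding K_def outer_face_def by (rule region_face[OF region.base])
  qed
  have r_notC: "r i \<notin> C" "opp D (r i) \<notin> C" for i using Cinn inner_dart_not_r by blast+
  have K_opp_outer: "opp D ` outer_face D \<subseteq> K"
  proof
    fix e assume "e \<in> opp D ` outer_face D"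
    then obtain d where "d \<in> outer_face D" "e = opp D d" by blast
    then obtain i where "e = opp D (r i)" by (metis outer_faceE)
    moreover have "r i \<in> K" using K_outer r_in_outer by blast
    ultimately show "e \<in> K" using K_cross[OF r_in r_notC(1), of i] by simp
  qed
  have K_cw: "inv (rot D) d \<in> K \<longleftrightarrow> d \<in> K" if d: "inv (rot D) d \<notin> C" "d \<in> darts D" for d
  proof -
    have i: "inv (rot D) d \<in> darts D" using rot_in_iff[of "inv (rot D) d"] rot_inv_rot d(2) by simp
    have "face_next D (opp D (inv (rot D) d)) = d" using face_next_opp[OF i] rot_inv_rot by simp
    then have "d \<in> K \<longleftrightarrow> opp D (inv (rot D) d) \<in> K" using K_face by metis
    also have "\<dots> \<longleftrightarrow> inv (rot D) d \<in> K" using K_cross[OF i d(1)] .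
    finally show ?thesis by simp
  qed
  let ?cor = "\<lambda>d. weight (h (inv (rot D) d)) (h d)"
  \<comment> \<open>The vertices of the region off the cycles. At a vertex off the cycles no edge of
    \<open>C\<close> is met, so it lies in the region with all its darts or with none.\<close>
  define U where "U = {v \<in> vertices D. v \<subseteq> K \<and> v \<inter> C = {}}"
  have no_cycle: "v \<inter> C = {}" if v: "v \<in> vertices D" "v \<notin> Y" for v
    using Cvert in_verticesD[OF v(1)] v(2) by blast
  have all_or_none: "v \<subseteq> K" if v: "v \<in> vertices D" "v \<notin> Y" and e: "e \<in> v" "e \<in> K" for v e
  proof
    fix d assume "d \<in> v"
    then have "d \<in> orbit (rot D) e" using in_verticesD[OF v(1) e(1)] by (simp add: vertex_of_def)
    then have "d \<in> v \<and> d \<in> K"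
    proof (rule rot.orbit_invariant)
      fix z assume z: "z \<in> v \<and> z \<in> K"
      then have rz: "rot D z \<in> v" using rot_in_vertex_iff[OF v(1)] by blast
      have "z \<notin> C" using z no_cycle[OF v] by blast
      then show "rot D z \<in> v \<and> rot D z \<in> K"
        using K_cw[of "rot D z"] inv_rot_rot[of z] in_verticesD[OF v(1) rz] z rz by simp
    qed (use e in simp)
    then show "d \<in> K" by simp
  qed
  have V_U: "V i \<in> U" if i: "i < 6" for i
  proof -
    have "V i \<notin> Y" using inn V_not_inner by blast
    moreover have "r i \<in> V i" by (simp add: V_def vertex_of_self)
    ultimately show ?thesis
      using all_or_none[OF V_in, of i "r i"] no_cycle[OF V_in] K_outer r_in_outer V_in by (auto simp: U_def)
  qed
  \<comment> \<open>At a vertex of a cycle the incoming and the outgoing dart are red and blue in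
    some order. They bound two sectors of weight 2, and each sector is in the region exactly when
    the dart it begins with is.\<close>
  have sum_cycle: "(\<Sum>d\<in>v \<inter> K. ?cor d) = 2 * card (v \<inter> C \<inter> K)" if v: "v \<in> Y" for v
  proof -
    have vi: "v \<in> inner_vertices D" using inn[OF v] .
    have vd: "d \<in> darts D" "vertex_of D d = v" if "d \<in> v" for d
      using in_verticesD[OF inner_vertex_in[OF vi] that] by auto
    obtain y where y: "y \<in> Y" "target_of D (o' y) = v" using pre[OF v] by blast
    define oo ii where "oo = o' v" and "ii = opp D (o' y)"
    have ov: "oo \<in> v" using oY(2)[OF v] vertex_of_self[of "o' v"] by (simp add: oo_def)
    have iv: "ii \<in> v" using y(2) vertex_of_self[of "opp D (o' y)"] by (simp add: ii_def target_of_def)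
    have vC: "v \<inter> C = {oo, ii}"
    proof (intro equalityI subsetI)
      fix d assume d: "d \<in> v \<inter> C"
      then consider z where "z \<in> Y" "d = o' z" | z where "z \<in> Y" "d = opp D (o' z)" by (auto simp: C_def)
      then show "d \<in> {oo, ii}"
      proof cases
        case 1
        then have "z = v" using vd(2)[of d] oY(2)[of z] d by auto
        then show ?thesis using 1 by (simp add: oo_def)
      next
        case 2
        then have "target_of D (o' z) = v" using vd(2)[of d] d by (simp add: target_of_def)
        then have "z = y" using inj_onD[OF injg, of z y] y 2 by (simp add: g_def)
        then show ?thesis using 2 by (simp add: ii_def)
      qed
    qed (use ov iv v y in \<open>auto simp: C_def oo_def ii_def\<close>)
    have oOr: "oo \<in> Or" "oo \<in> inner_darts D" using oY(1)[OF v] oinn[OF v] by (simp_all add: oo_def)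
    have iOr: "opp D ii \<in> Or" "ii \<in> inner_darts D"
      using oY(1)[OF y(1)] opp_opp[OF inner_darts_in[OF oinn[OF y(1)]]] opp_inner[OF oinn[OF y(1)]]
      by (simp_all add: ii_def)
    have "c oo = Some Red \<and> v \<in> black D \<or> c oo = Some Blue \<and> v \<notin> black D"
      using Or_inner_iff[OF oOr(2)] oOr(1) vd(2)[OF ov] by simp
    moreover have "c ii = Some Blue \<and> v \<in> black D \<or> c ii = Some Red \<and> v \<notin> black D"
      using Or_opp_inner_iff[OF iOr(2)] iOr(1) vd(2)[OF iv] by simp
    ultimately have cols: "(h oo = Red \<and> h ii = Blue) \<or> (h oo = Blue \<and> h ii = Red)"
      using c_h[OF oOr(2)] c_h[OF iOr(2)] by (elim disjE conjE) simp_all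
    obtain s m where s: "bij_betw s {..<m} v" "s m = s 0" "\<And>n. inv (rot D) (s n) = s (Suc n)"
      "\<And>a b. a < m \<Longrightarrow> b < m \<Longrightarrow> h (s a) = Red \<Longrightarrow> h (s b) = Blue \<Longrightarrow>
         a < b \<and> (\<Sum>n\<in>{a..<b}. weight (h (s (Suc n))) (h (s n))) = 2 \<and>
         (\<Sum>n\<in>{..<m} - {a..<b}. weight (h (s (Suc n))) (h (s n))) = 2"
      by (rule vertex_weights[OF vi]) (rule that; assumption)
    have sv: "s n \<in> v" if "n < m" for n using s(1) that by (auto simp: bij_betw_def)
    have sinj: "s a = s b \<longleftrightarrow> a = b" if "a < m" "b < m" for a b
      using bij_betw_imp_inj_on[OF s(1)] that by (auto dest: inj_onD)
    \<comment> \<open>Which of the two darts is red depends on whether the vertex is black;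
      \<open>a\<close> is the position of the red one.\<close>
    have "\<exists>a b. a < m \<and> b < m \<and> {s a, s b} = {oo, ii} \<and> h (s a) = Red \<and> h (s b) = Blue"
    proof -
      have "v = s ` {..<m}" using s(1) by (simp add: bij_betw_def)
      then obtain p q where "p < m" "oo = s p" "q < m" "ii = s q" using ov iv by auto
      note pq = this
      show ?thesis
      proof (cases "h oo = Red")
        case True
        then show ?thesis using cols pq by (intro exI[of _ p] exI[of _ q]) auto
      next
        case False
        then show ?thesis using cols pq by (intro exI[of _ q] exI[of _ p]) (auto simp: insert_commute)
      qed
    qed
    then obtain a b where ab: "a < m" "b < m" "{s a, s b} = {oo, ii}" "h (s a) = Red" "h (s b) = Blue" by blast
    note S = s(4)[OF ab(1,2,4,5)]
    have inC: "s n \<in> C \<longleftrightarrow> n = a \<or> n = b" if n: "n < m" for n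
    proof -
      have "s n \<in> C \<longleftrightarrow> s n \<in> {s a, s b}" using vC sv[OF n] ab(3) by blast
      then show ?thesis using sinj[OF n ab(1)] sinj[OF n ab(2)] by simp
    qed
    have KS: "s (Suc n) \<in> K \<longleftrightarrow> s n \<in> K" if "n < m" "s (Suc n) \<notin> C" for n
      using K_cw[of "s n"] s(3)[of n] vd(1)[OF sv[OF that(1)]] that(2) by simp
    have KA: "s n \<in> K \<longleftrightarrow> s a \<in> K" if "a \<le> n" "n < b" for n
      using that
    proof (induction n rule: dec_induct)
      case (step n)
      then show ?case using KS[of n] inC[of "Suc n"] ab(2) by auto
    qed simp
    have KB: "s n \<in> K \<longleftrightarrow> s b \<in> K" if "b \<le> n" "n < m" for n
      using that
    proof (induction n rule: dec_induct)
      case (step n)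
      then show ?case using KS[of n] inC[of "Suc n"] S by auto
    qed simp
    \<comment> \<open>The second sector passes over the end of the enumeration, from
      \<open>m - 1\<close> to 0.\<close>
    have KB0: "s n \<in> K \<longleftrightarrow> s b \<in> K" if "n < a" for n
      using that
    proof (induction n)
      case 0
      have "s (Suc (m - 1)) = s 0" using s(2) ab(1) by simp
      moreover have "s 0 \<notin> C" using inC[of 0] 0 S ab(1) by auto
      ultimately show ?case using KS[of "m - 1"] KB[of "m - 1"] ab by simp
    next
      case (Suc n)
      then show ?case using KS[of n] inC[of "Suc n"] S ab(1) by auto
    qed
    have "(\<Sum>d\<in>v \<inter> K. ?cor d) = (\<Sum>d\<in>v. if d \<in> K then ?cor d else 0)"
      using finite_vertex_of[of oo] vd(2)[OF ov] by (simp add: sum.If_cases Int_def)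
    also have "\<dots> = (\<Sum>n\<in>{..<m}. if s n \<in> K then ?cor (s n) else 0)"
      by (rule sum.reindex_bij_betw[OF s(1), symmetric])
    also have "\<dots> = (\<Sum>n\<in>{a..<b}. if s n \<in> K then ?cor (s n) else 0) + (\<Sum>n\<in>{..<m} - {a..<b}. if s n \<in> K then ?cor (s n) else 0)"
    proof -
      have "{a..<b} \<subseteq> {..<m}" using ab(2) by auto
      then show ?thesis using sum.subset_diff[of "{a..<b}" "{..<m}"] by (simp add: add.commute)
    qed
    also have "(\<Sum>n\<in>{a..<b}. if s n \<in> K then ?cor (s n) else 0) = (if s a \<in> K then (\<Sum>n\<in>{a..<b}. weight (h (s (Suc n))) (h (s n))) else 0)"
    proof -
      have "(\<Sum>n\<in>{a..<b}. if s n \<in> K then ?cor (s n) else 0) = (\<Sum>n\<in>{a..<b}. if s a \<in> K then weight (h (s (Suc n))) (h (s n)) else 0)"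
      proof (rule sum.cong[OF refl])
        fix n assume "n \<in> {a..<b}"
        then have e: "s n \<in> K \<longleftrightarrow> s a \<in> K" by (intro KA) auto
        show "(if s n \<in> K then ?cor (s n) else 0) = (if s a \<in> K then weight (h (s (Suc n))) (h (s n)) else 0)"
          unfolding e s(3) ..
      qed
      then show ?thesis by (cases "s a \<in> K") simp_all
    qed
    also have "(\<Sum>n\<in>{..<m} - {a..<b}. if s n \<in> K then ?cor (s n) else 0) = (if s b \<in> K then (\<Sum>n\<in>{..<m} - {a..<b}. weight (h (s (Suc n))) (h (s n))) else 0)"
    proof -
      have *: "s n \<in> K \<longleftrightarrow> s b \<in> K" if "n \<in> {..<m} - {a..<b}" for n
        using that KB[of n] KB0[of n] by (cases "n < a") auto
      have "(\<Sum>n\<in>{..<m} - {a..<b}. if s n \<in> K then ?cor (s n) else 0) = (\<Sum>n\<in>{..<m} - {a..<b}. if s b \<in> K then weight (h (s (Suc n))) (h (s n)) else 0)"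
      proof (rule sum.cong[OF refl])
        fix n assume "n \<in> {..<m} - {a..<b}"
        then have e: "s n \<in> K \<longleftrightarrow> s b \<in> K" by (rule *)
        show "(if s n \<in> K then ?cor (s n) else 0) = (if s b \<in> K then weight (h (s (Suc n))) (h (s n)) else 0)"
          unfolding e s(3) ..
      qed
      then show ?thesis by (cases "s b \<in> K") simp_all
    qed
    also have "(if s a \<in> K then (\<Sum>n\<in>{a..<b}. weight (h (s (Suc n))) (h (s n))) else 0) +
        (if s b \<in> K then (\<Sum>n\<in>{..<m} - {a..<b}. weight (h (s (Suc n))) (h (s n))) else 0)
        = 2 * card ({s a, s b} \<inter> K)"
    proof -
      have "s a \<noteq> s b" using S sinj[OF ab(1,2)] by simp
      then show ?thesis
        unfolding S[THEN conjunct2, THEN conjunct1] S[THEN conjunct2, THEN conjunct2]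
        by (simp add: Int_insert_left)
    qed
    also have "{s a, s b} \<inter> K = v \<inter> C \<inter> K" using vC ab(3) by simp
    finally show ?thesis .
  qed
  have sum_other: "(\<Sum>d\<in>v \<inter> K. ?cor d) = (if v \<in> U then 4 else 0)"
    if v: "v \<in> inner_vertices D" "v \<notin> Y" for v
  proof (cases "v \<inter> K = {}")
    case True
    then have "v \<notin> U" using vertices_nonempty[OF inner_vertex_in[OF v(1)]] by (auto simp: U_def)
    then show ?thesis using True by simp
  next
    case False
    then have "v \<subseteq> K" using all_or_none[OF inner_vertex_in[OF v(1)] v(2)] by blast
    moreover have "(\<Sum>d\<in>v. ?cor d) = 4" by (rule vertex_weights[OF v(1)])
    moreover from \<open>v \<subseteq> K\<close> have "v \<in> U" using no_cycle[OF inner_vertex_in[OF v(1)] v(2)] inner_vertex_in[OF v(1)] by (simp add: U_def)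
    ultimately show ?thesis by (simp add: Int_absorb2)
  qed
  have YU: "Y \<inter> U = {}"
  proof -
    have "o' z \<in> z \<inter> C" if "z \<in> Y" for z
      using oY(2)[OF that] vertex_of_self[of "o' z"] that by (simp add: C_def)
    then show ?thesis by (auto simp: U_def)
  qed
  have UV: "U \<subseteq> vertices D" by (auto simp: U_def)
  have finU: "finite U" using UV finite_vertices finite_subset by blast
  have cardU: "card U = card (U \<inter> inner_vertices D) + 6"
  proof -
    have "U = (U \<inter> inner_vertices D) \<union> V ` {..<6}" using UV vertices_eq_Un V_U by auto
    moreover have "card ((U \<inter> inner_vertices D) \<union> V ` {..<6}) = card (U \<inter> inner_vertices D) + card (V ` {..<6})"
      using finU V_not_inner by (intro card_Un_disjoint) auto
    moreover have "card (V ` {..<6}) = 6" using V_eq_iff by (subst card_image) (auto simp: inj_on_def)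
    ultimately show ?thesis by simp
  qed
  have total: "(\<Sum>v\<in>inner_vertices D. \<Sum>d\<in>v \<inter> K. ?cor d) = 4 * card (U \<inter> inner_vertices D) + 2 * card (C \<inter> K)"
  proof -
    have "(\<Sum>v\<in>inner_vertices D. \<Sum>d\<in>v \<inter> K. ?cor d) =
       (\<Sum>v\<in>inner_vertices D - Y. \<Sum>d\<in>v \<inter> K. ?cor d) + (\<Sum>v\<in>Y. \<Sum>d\<in>v \<inter> K. ?cor d)"
      by (rule sum.subset_diff) (use inn finite_inner_vertices in auto)
    also have "(\<Sum>v\<in>inner_vertices D - Y. \<Sum>d\<in>v \<inter> K. ?cor d) = (\<Sum>v\<in>inner_vertices D - Y. if v \<in> U then 4 else 0)"
      by (rule sum.cong) (use sum_other in auto)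
    also have "\<dots> = 4 * card ((inner_vertices D - Y) \<inter> U)"
      using finite_inner_vertices by (simp add: sum.If_cases Int_def)
    also have "(inner_vertices D - Y) \<inter> U = U \<inter> inner_vertices D" using YU by blast
    also have "(\<Sum>v\<in>Y. \<Sum>d\<in>v \<inter> K. ?cor d) = (\<Sum>v\<in>Y. 2 * card (v \<inter> C \<inter> K))"
      by (rule sum.cong[OF refl sum_cycle])
    also have "\<dots> = 2 * card (\<Union>v\<in>Y. v \<inter> C \<inter> K)"
    proof (subst card_UN_disjoint)
      show "\<forall>i\<in>Y. \<forall>j\<in>Y. i \<noteq> j \<longrightarrow> i \<inter> C \<inter> K \<inter> (j \<inter> C \<inter> K) = {}"
      proof (intro ballI impI)
        fix i j assume ij: "i \<in> Y" "j \<in> Y" "i \<noteq> j"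
        have "x \<notin> j" if "x \<in> i" for x
          using in_verticesD[OF inner_vertex_in[OF inn[OF ij(1)]] that] in_verticesD[OF inner_vertex_in[OF inn[OF ij(2)]], of x] ij(3) by auto
        then show "i \<inter> C \<inter> K \<inter> (j \<inter> C \<inter> K) = {}" by blast
      qed
    qed (use finY finK in \<open>auto simp: sum_distrib_left\<close>)
    also have "(\<Union>v\<in>Y. v \<inter> C \<inter> K) = C \<inter> K"
      using Cvert vertex_of_self by blast
    finally show ?thesis .
  qed
  define B where "B = face_of D ` K"
  have oB: "outer_face D \<in> B" using region.base[of "root D" D C] by (simp add: B_def K_def outer_face_def)
  have BF: "B \<subseteq> faces D" using K_sub by (auto simp: B_def faces_def)
  have finB: "finite B" using finK by (simp add: B_def)
  have UB: "\<Union> B = K"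
  proof
    show "\<Union> B \<subseteq> K" unfolding B_def K_def using region_face by blast
    show "K \<subseteq> \<Union> B" unfolding B_def using face_of_self by blast
  qed
  have Bi: "B - {outer_face D} \<subseteq> inner_faces D" using BF by (auto simp: inner_faces_def)
  have subO: "B - {outer_face D} \<subseteq> orbit (face_next D) ` darts D" using BF by (auto simp: faces_eq)
  have UBi: "\<Union> (B - {outer_face D}) = K - outer_face D"
  proof -
    have "f \<inter> outer_face D = {}" if "f \<in> B" "f \<noteq> outer_face D" for f
      using in_facesD[of f] in_facesD[OF outer_face_in] that BF by blast
    then show ?thesis using UB oB by blast
  qed
  have "card (K - outer_face D) = (\<Sum>f\<in>B - {outer_face D}. card f)"
    using face.sum_Union_orbits[OF subO, of "\<lambda>_. 1::nat"] unfolding UBi by simp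
  also have "\<dots> = 4 * card (B - {outer_face D})"
    using Bi inner_face_card by (simp add: inner_faces_def subset_iff)
  finally have cK: "card (K - outer_face D) = 4 * card (B - {outer_face D})" .
  have cB: "card B = card (B - {outer_face D}) + 1" using card.remove[OF finB oB] by simp
  have cK': "card K = card (K - outer_face D) + 6"
  proof -
    have "finite (outer_face D)" using K_outer finK finite_subset by blast
    then have "card (K - outer_face D) = card K - 6" using K_outer card_outer by (simp add: card_Diff_subset)
    moreover have "6 \<le> card K" using card_mono[OF finK K_outer] card_outer by simp
    ultimately show ?thesis by simp
  qed
  have "4 * card (B - {outer_face D}) = (\<Sum>f\<in>B - {outer_face D}. \<Sum>d\<in>f. weight (h d) (h (face_next D d)))"
    using Bi inner_face_weight by (simp add: subset_iff)
  also have "\<dots> = (\<Sum>d\<in>K - outer_face D. weight (h d) (h (face_next D d)))"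
    using face.sum_Union_orbits[OF subO, symmetric] unfolding UBi .
  also have "\<dots> = (\<Sum>i<6. weight (outer_label (Suc i mod 6)) (outer_label i)) + (\<Sum>v\<in>inner_vertices D. \<Sum>d\<in>v \<inter> K. ?cor d)"
    by (rule sum_changes[OF _ K_sub K_face K_outer K_opp_outer]) (simp add: weight_def)
  \<comment> \<open>Two rounds of weight 4.\<close>
  also have "(\<Sum>i<6. weight (outer_label (Suc i mod 6)) (outer_label i)) = 8"
    unfolding sum_lt_6 outer_label_def weight_def by simp
  finally have E1: "4 * card (B - {outer_face D}) = 8 + (4 * card (U \<inter> inner_vertices D) + 2 * card (C \<inter> K))"
    unfolding total .
  have "2 * card U + 2 * card (face_of D ` region D C (root D)) \<le> card (region D C (root D) - C) + 2"
  proof (rule region_euler[OF connected root_in Copp Cd UV])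
    show "U \<noteq> vertices D" using Y(1,2) ZV YU by blast
    show "\<And>u. u \<in> U \<Longrightarrow> u \<subseteq> region D C (root D) - C" by (auto simp: U_def K_def)
  qed
  then have E2: "2 * card U + 2 * card B \<le> card (K - C) + 2" by (simp add: B_def K_def)
  have E3: "card K = card (K - C) + card (C \<inter> K)"
  proof -
    have "card K = card ((K - C) \<union> (C \<inter> K))" by (rule arg_cong[where f=card]) blast
    also have "\<dots> = card (K - C) + card (C \<inter> K)" using finK by (intro card_Un_disjoint) auto
    finally show ?thesis .
  qed
  \<comment> \<open>For \<open>f\<close> inner faces and \<open>u\<close> inner vertices of
    \<open>U\<close> in the region and \<open>k\<close> darts in \<open>C \<inter> K\<close>, the
    equation \<open>E1\<close> says \<open>2f = 4 + 2u + k\<close>, while \<open>E2\<close> with the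
    sizes of \<open>K\<close> gives \<open>2f \<ge> 6 + 2u + k\<close>.\<close>
  show False using E1 E2 E3 cK cK' cB cardU by linarith
qed

end

section \<open>Regions and faces of a submap\<close>

context spanning_submap begin

text \<open>Deleting edges merges faces: the faces of the submap refine the regions cut out by its edges.\<close>

lemma region_trans:
  assumes "e \<in> region M P d" "f \<in> region M P e" shows "f \<in> region M P d"
  using assms(2) by induction (use assms(1) in \<open>auto intro: region.intros\<close>)

lemma region_sym:
  assumes d: "d \<in> darts M" and e: "e \<in> region M P d" shows "d \<in> region M P e"
  using e
proof induction
  case base show ?case by (rule region.base)
next
  case (face y)
  have "y \<in> region M P (face_next M y)"
    using region_face_next_iff[of y P "face_next M y"] region.base[of "face_next M y" M P] by simp
  then show ?case using face.IH by (rule region_trans)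
next
  case (cross y)
  have y: "y \<in> darts M" using cross.hyps(1) region_subset[OF d] by blast
  have "opp M y \<notin> P" using cross.hyps(2) opp_in_P_iff[OF y] by simp
  then have "opp M (opp M y) \<in> region M P (opp M y)" by (intro region.cross region.base)
  then have "y \<in> region M P (opp M y)" using opp_opp[OF y] by simp
  then show ?case using cross.IH by (rule region_trans)
qed

lemma region_eq:
  assumes "d \<in> darts M" "e \<in> region M P d" shows "region M P e = region M P d"
  using region_trans region_sym[OF assms] assms(2) by blast

lemma next_in_region: "d \<in> darts M \<Longrightarrow> next_in M P d \<in> region M P d"
proof (induction rule: next_in_induct)
  case (base d) then show ?case by (simp add: next_in_P region.base)
next
  case (step d)
  have "face_next M (opp M d) \<in> region M P d"
    using step(2) by (intro region.face region.cross region.base)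
  then have "rot M d \<in> region M P d" using face_next_opp[OF step(1)] by simp
  then show ?case using region_trans[OF _ step(3)] next_in_step[OF step(1,2)] by simp
qed

lemma face_of_X_region:
  assumes "e \<in> P" "e' \<in> face_of X e" shows "e' \<in> region M P e"
proof -
  have "e' \<in> orbit (face_next X) e" using assms(2) by (simp add: face_of_def)
  then have "e' \<in> P \<and> e' \<in> region M P e"
  proof (rule X.face.orbit_invariant)
    show "e \<in> P \<and> e \<in> region M P e" using assms(1) region.base[of e M P] by blast
    fix z assume z: "z \<in> P \<and> z \<in> region M P e"
    then have n: "face_next M z \<in> darts M" using P_subset face_next_in_iff by blast
    have "face_next M z \<in> region M P e" using z by (intro region.face) simp
    then have "next_in M P (face_next M z) \<in> region M P e"
      using next_in_region[OF n] by (rule region_trans)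
    then show "face_next X z \<in> P \<and> face_next X z \<in> region M P e"
      using z next_in_mem[OF n] by (simp add: face_next_X)
  qed
  then show ?thesis by simp
qed

text \<open>The choice of the dart is immaterial. A priori several faces of the submap may share a
  region; to exclude this is the point of \<open>euler_X\<close>.\<close>

definition face_region :: "'d set \<Rightarrow> 'd set" where
  "face_region f = region M P (SOME e. e \<in> f)"

lemma face_region:
  assumes "f \<in> faces X" "e \<in> f" shows "face_region f = region M P e"
proof -
  have some: "(SOME e. e \<in> f) \<in> f" using assms(2) by (rule someI)
  have "e \<in> P" "face_of X e = f" using X.in_facesD[OF assms] by simp_all
  then have "(SOME e. e \<in> f) \<in> region M P e" using face_of_X_region[of e] some by simp
  then show ?thesis unfolding face_region_def
    using region_eq[of e] \<open>e \<in> P\<close> P_subset by blast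
qed

lemma regions_eq: "region M P ` darts M = face_region ` faces X"
proof (intro equalityI subsetI)
  fix K assume "K \<in> region M P ` darts M"
  then obtain d where d: "d \<in> darts M" "K = region M P d" by blast
  let ?e = "next_in M P d"
  have e: "?e \<in> P" "?e \<in> region M P d" using next_in_mem[OF d(1)] next_in_region[OF d(1)] by auto
  then have "face_of X ?e \<in> faces X" "?e \<in> face_of X ?e" using X.face_in_faces X.face_of_self by auto
  then show "K \<in> face_region ` faces X" using face_region region_eq[OF d(1) e(2)] d(2) by (metis imageI)
next
  fix K assume "K \<in> face_region ` faces X"
  then obtain f where f: "f \<in> faces X" "K = face_region f" by blast
  obtain e where e: "e \<in> f" using X.faces_nonempty[OF f(1)] by blast
  have "e \<in> darts M" using X.in_facesD[OF f(1) e] P_subset by auto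
  then show "K \<in> region M P ` darts M" using face_region[OF f(1) e] f(2) by blast
qed

text \<open>Within each region the faces are joined by a dual tree of deleted edges, as counted in
  \<open>card_region_faces\<close>, and the regions are disjoint.\<close>

lemma card_faces_le: "2 * card (faces M) \<le> card (darts M - P) + 2 * card (region M P ` darts M)"
proof -
  let ?K = "region M P ` darts M"
  have fin: "finite ?K" using finite_darts by simp
  have "faces M \<subseteq> (\<Union>K\<in>?K. face_of M ` K)"
  proof
    fix f assume "f \<in> faces M"
    then obtain d where "d \<in> darts M" "f = face_of M d" by (auto simp: faces_def)
    then show "f \<in> (\<Union>K\<in>?K. face_of M ` K)" using region.base[of d M P] by blast
  qed
  moreover have finK: "finite K" "K \<subseteq> darts M" if "K \<in> ?K" for K
    using that region_subset finite_subset[OF _ finite_darts] by blast+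
  moreover have "finite (\<Union>K\<in>?K. face_of M ` K)"
    by (rule finite_UN_I[OF fin]) (use finK in blast)
  ultimately have "card (faces M) \<le> card (\<Union>K\<in>?K. face_of M ` K)" by (intro card_mono)
  also have "\<dots> \<le> (\<Sum>K\<in>?K. card (face_of M ` K))" by (rule card_UN_le[OF fin])
  finally have "2 * card (faces M) \<le> (\<Sum>K\<in>?K. 2 * card (face_of M ` K))" by (simp add: sum_distrib_left[symmetric])
  also have "\<dots> \<le> (\<Sum>K\<in>?K. card (K - P) + 2)"
  proof (rule sum_mono)
    fix K assume "K \<in> ?K"
    then obtain d where "d \<in> darts M" "K = region M P d" by blast
    then show "2 * card (face_of M ` K) \<le> card (K - P) + 2"
      using card_region_faces[of d P] P_opp P_subset by blast
  qed
  also have "\<dots> = (\<Sum>K\<in>?K. card (K - P)) + 2 * card ?K" by (simp only: sum.distrib sum_constant) simp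
  also have "(\<Sum>K\<in>?K. card (K - P)) = card (\<Union>K\<in>?K. K - P)"
  proof (rule card_UN_disjoint[OF fin, symmetric])
    show "\<forall>K\<in>?K. finite (K - P)" using finK by blast
    show "\<forall>K\<in>?K. \<forall>L\<in>?K. K \<noteq> L \<longrightarrow> (K - P) \<inter> (L - P) = {}"
    proof (intro ballI impI)
      fix K L assume "K \<in> ?K" "L \<in> ?K" "K \<noteq> L"
      then obtain d e where de: "d \<in> darts M" "e \<in> darts M" "K = region M P d" "L = region M P e" by blast
      then show "(K - P) \<inter> (L - P) = {}" using region_eq[of d] region_eq[of e] \<open>K \<noteq> L\<close> by blast
    qed
  qed
  also have "\<dots> \<le> card (darts M - P)"
    using finK(2) finite_darts by (intro card_mono) auto
  finally show ?thesis by simp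
qed

end

section \<open>The plain edges form a planar bipolar orientation\<close>

context labeling begin

lemma some_colours:
  assumes "v \<in> inner_vertices D"
  obtains a b where "a \<in> v" "b \<in> v" "c a = Some Red" "c b = Some Blue"
  by (rule vertex_weights[OF assms]) blast

lemma r_at_V: "r i \<in> V i"
  by (simp add: V_def vertex_of_self)

sublocale spanning_submap D P
proof
  show "P \<subseteq> darts D" using Or_sub opp_in_iff by (auto simp: plain_darts_def)
  show Po: "opp D d \<in> P" if d: "d \<in> P" for d
  proof -
    have dd: "d \<in> darts D" using d Or_sub opp_in_iff by (auto simp: plain_darts_def)
    then show ?thesis using d P_iff[OF dd] P_iff[of "opp D d"] opp_in_iff[of d] opp_opp[OF dd] by auto
  qed
  fix v assume "v \<in> vertices D"
  then show "v \<inter> P \<noteq> {}"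
  proof (rule vertex_cases)
    assume v: "v \<in> inner_vertices D"
    obtain a where a: "a \<in> v" "c a = Some Red" using some_colours[OF v] by blast
    have "a \<in> P" using P_inner_iff[OF dart_at_inner[OF v a(1)]] a(2) by simp
    then show ?thesis using a by blast
  next
    fix i assume "i < 6" "v = V i"
    then show ?thesis using r_at_V r_P by blast
  qed
qed

lemma plain_map_eq: "plain_map D Or = X"
  by (simp add: plain_map_def)

lemma Or_P: "d \<in> Or \<Longrightarrow> d \<in> P"
  by (simp add: plain_darts_def)

lemma Or_iff': "d \<in> P \<Longrightarrow> opp D d \<in> Or \<longleftrightarrow> d \<notin> Or"
  using Or_iff P_subset by blast

definition S where "S = V 3 \<inter> P"
definition N where "N = V 0 \<inter> P"

lemma target_X: "d \<in> P \<Longrightarrow> target_of X d = target_of D d \<inter> P" and vertex_X: "d \<in> P \<Longrightarrow> vertex_of X d = vertex_of D d \<inter> P"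
  by (simp_all add: target_of_X vertex_of_X)

text \<open>At an inner vertex a red and a blue edge have opposite directions, and both colours
  occur; at an outer vertex the hexagon provides the arcs.\<close>

lemma has_arc:
  assumes "v \<in> vertices D"
  shows "v \<noteq> V 3 \<Longrightarrow> \<exists>d\<in>Or. target_of D d = v" and "v \<noteq> V 0 \<Longrightarrow> \<exists>d\<in>Or. vertex_of D d = v"
proof -
  have "(v \<noteq> V 3 \<longrightarrow> (\<exists>d\<in>Or. target_of D d = v)) \<and> (v \<noteq> V 0 \<longrightarrow> (\<exists>d\<in>Or. vertex_of D d = v))"
    using assms
  proof (rule vertex_cases)
    assume v: "v \<in> inner_vertices D"
    obtain a b where ab: "a \<in> v" "b \<in> v" "c a = Some Red" "c b = Some Blue" using some_colours[OF v] by blast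
    have ai: "a \<in> inner_darts D" and bi: "b \<in> inner_darts D" using dart_at_inner[OF v] ab by auto
    have vv: "vertex_of D a = v" "vertex_of D b = v" using in_verticesD[OF assms] ab by auto
    have t: "target_of D (opp D a) = v" "target_of D (opp D b) = v"
      using target_of_opp inner_darts_in ai bi vv by auto
    show ?thesis
    proof (cases "v \<in> black D")
      case True
      then have "a \<in> Or" "opp D b \<in> Or" using Or_inner_iff[OF ai] Or_opp_inner_iff[OF bi] ab vv by auto
      then show ?thesis using vv t by blast
    next
      case False
      then have "b \<in> Or" "opp D a \<in> Or" using Or_inner_iff[OF bi] Or_opp_inner_iff[OF ai] ab vv by auto
      then show ?thesis using vv t by blast
    qed
  next
    fix i assume i: "i < 6" "v = V i"
    have O: "opp D (r 0) \<in> Or" "opp D (r 1) \<in> Or" "opp D (r 2) \<in> Or" "r 3 \<in> Or" "r 4 \<in> Or" "r 5 \<in> Or"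
      using Or_r Or_opp_r by simp_all
    have T: "target_of D (opp D (r 0)) = V 0" "target_of D (opp D (r 1)) = V 1" "target_of D (opp D (r 2)) = V 2"
      "target_of D (r 3) = V 4" "target_of D (r 4) = V 5"
      using target_opp_r target_r[of 3] target_r[of 4] by simp_all
    have W: "vertex_of D (opp D (r 0)) = V 1" "vertex_of D (opp D (r 1)) = V 2"
      "vertex_of D (r 3) = V 3" "vertex_of D (r 4) = V 4" "vertex_of D (r 5) = V 5"
      using vertex_opp_r[of 0] vertex_opp_r[of 1] by (simp_all add: V_def eval_nat_numeral)
    have "i = 0 \<or> i = 1 \<or> i = 2 \<or> i = 3 \<or> i = 4 \<or> i = 5" using i(1) by linarith
    then show ?thesis unfolding i(2) by (elim disjE) (use O T W in blast)+
  qed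
  then show "v \<noteq> V 3 \<Longrightarrow> \<exists>d\<in>Or. target_of D d = v" "v \<noteq> V 0 \<Longrightarrow> \<exists>d\<in>Or. vertex_of D d = v" by blast+
qed

sublocale b: bipolar X Or S N
proof
  show "orientation X Or"
    unfolding orientation_def using Or_P Or_iff' by (simp add: opp_X) blast
  \<comment> \<open>Recovers a vertex of \<open>D\<close> from its plain darts, which transfers
    acyclicity from \<open>D\<close> to \<open>X\<close>.\<close>
  define f where "f w = vertex_of D (SOME d. d \<in> w)" for w :: "'d set"
  have fv: "f (vertex_of X d) = vertex_of D d" if d: "d \<in> P" for d
  proof -
    have "(SOME e. e \<in> vertex_of X d) \<in> vertex_of X d" using X.vertex_of_self by (rule someI)
    then have "(SOME e. e \<in> vertex_of X d) \<in> vertex_of D d" using vertex_X[OF d] by simp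
    then show ?thesis unfolding f_def by (rule vertex_of_eq)
  qed
  have "finite (arcs D Or)"
  proof -
    have "arcs D Or = (\<lambda>d. (vertex_of D d, target_of D d)) ` Or" by (auto simp: arcs_def)
    then show ?thesis using finite_subset[OF Or_sub finite_darts] by simp
  qed
  then have "wf (arcs D Or)" using acyclic_arcs by (rule finite_acyclic_wf)
  then have "wf (inv_image (arcs D Or) f)" by (rule wf_inv_image)
  moreover have "arcs X Or \<subseteq> inv_image (arcs D Or) f"
  proof
    fix x assume "x \<in> arcs X Or"
    then obtain d where d: "d \<in> Or" "x = (vertex_of X d, target_of X d)" by (auto simp: arcs_def)
    have dP: "d \<in> P" "opp D d \<in> P" using d Or_P P_opp by auto
    have "f (target_of X d) = target_of D d" using fv[OF dP(2)] dP(1) by (simp add: target_of_def opp_X)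
    then show "x \<in> inv_image (arcs D Or) f" using d fv[OF dP(1)] by (auto simp: arcs_def)
  qed
  ultimately have "wf (arcs X Or)" by (rule wf_subset)
  then show "acyclic (arcs X Or)" by (rule wf_acyclic)
  have src: "(\<forall>d\<in>Or. target_of X d \<noteq> v \<inter> P) \<longleftrightarrow> v = V 3" if v: "v \<in> vertices D" for v
  proof
    assume no: "\<forall>d\<in>Or. target_of X d \<noteq> v \<inter> P"
    show "v = V 3"
    proof (rule ccontr)
      assume "v \<noteq> V 3"
      then obtain d where "d \<in> Or" "target_of D d = v" using has_arc(1)[OF v] by blast
      then show False using no target_X[of d] Or_P by auto
    qed
  next
    assume v3: "v = V 3"
    show "\<forall>d\<in>Or. target_of X d \<noteq> v \<inter> P"
    proof (intro ballI notI)
      fix d assume d: "d \<in> Or" "target_of X d = v \<inter> P"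
      then have "target_of D d \<inter> P = V 3 \<inter> P" using target_X[of d] Or_P v3 by auto
      then have "target_of D d = V 3"
        using vertex_inter_inj[OF target_in_vertices V_in] d(1) Or_sub by blast
      then show False using into_V(1)[OF d(1), of 3] by simp
    qed
  qed
  have snk: "(\<forall>d\<in>Or. vertex_of X d \<noteq> v \<inter> P) \<longleftrightarrow> v = V 0" if v: "v \<in> vertices D" for v
  proof
    assume no: "\<forall>d\<in>Or. vertex_of X d \<noteq> v \<inter> P"
    show "v = V 0"
    proof (rule ccontr)
      assume "v \<noteq> V 0"
      then obtain d where "d \<in> Or" "vertex_of D d = v" using has_arc(2)[OF v] by blast
      then show False using no vertex_X[of d] Or_P by auto
    qed
  next
    assume v0: "v = V 0"
    show "\<forall>d\<in>Or. vertex_of X d \<noteq> v \<inter> P"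
    proof (intro ballI notI)
      fix d assume d: "d \<in> Or" "vertex_of X d = v \<inter> P"
      then have "vertex_of D d \<inter> P = V 0 \<inter> P" using vertex_X[of d] Or_P v0 by auto
      then have "vertex_of D d = V 0"
        using vertex_inter_inj[OF vertex_in_vertices V_in] d(1) Or_sub by blast
      then show False using not_from_V0[OF d(1)] by simp
    qed
  qed
  show "sources X Or = {S}"
  proof (intro set_eqI iffI)
    fix w assume "w \<in> sources X Or"
    then have w: "w \<in> vertices X" "\<forall>d\<in>Or. target_of X d \<noteq> w" by (auto simp: sources_def)
    then obtain v where v: "v \<in> vertices D" "w = v \<inter> P" by (auto simp: vertices_X)
    then show "w \<in> {S}" using src[OF v(1)] w(2) by (simp add: S_def)
  next
    fix w assume "w \<in> {S}"
    then show "w \<in> sources X Or" using src[OF V_in[of 3]] V_in[of 3] by (auto simp: sources_def S_def vertices_X)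
  qed
  show "sinks X Or = {N}"
  proof (intro set_eqI iffI)
    fix w assume "w \<in> sinks X Or"
    then have w: "w \<in> vertices X" "\<forall>d\<in>Or. vertex_of X d \<noteq> w" by (auto simp: sinks_def)
    then obtain v where v: "v \<in> vertices D" "w = v \<inter> P" by (auto simp: vertices_X)
    then show "w \<in> {N}" using snk[OF v(1)] w(2) by (simp add: N_def)
  next
    fix w assume "w \<in> {N}"
    then show "w \<in> sinks X Or" using snk[OF V_in[of 0]] V_in[of 0] by (auto simp: sinks_def N_def vertices_X)
  qed
qed

lemma card_darts_P: "card (darts D) = card P + card (darts D - P)"
proof -
  have "card (darts D - P) = card (darts D) - card P"
    using P_subset finite_P by (intro card_Diff_subset)
  moreover have "card P \<le> card (darts D)" using P_subset finite_darts by (intro card_mono)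
  ultimately show ?thesis by simp
qed

text \<open>The bipolar bound for \<open>X\<close>, Euler's formula for \<open>D\<close> and the
  count of faces by regions leave no slack when combined. The first becomes Euler's formula for
  \<open>X\<close>, and there are as many regions as faces of \<open>X\<close>.\<close>

lemma euler_X:
  shows "2 * card (vertices X) + 2 * card (faces X) = card (darts X) + 4"
    and "inj_on face_region (faces X)"
proof -
  have 1: "2 * card (vertices D) + 2 * card (faces X) \<le> card P + 4" using b.euler_le by (simp add: card_vertices_X)
  have 2: "2 * card (vertices D) + 2 * card (faces D) = card (darts D) + 4" by (rule planar_euler[OF planar])
  have 3: "2 * card (faces D) \<le> card (darts D - P) + 2 * card (face_region ` faces X)"
    using card_faces_le by (simp add: regions_eq)
  have 4: "card (face_region ` faces X) \<le> card (faces X)" by (rule card_image_le[OF X.finite_faces])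
  have "card (face_region ` faces X) = card (faces X)" using 1 2 3 4 card_darts_P by linarith
  then show "inj_on face_region (faces X)" by (rule eq_card_imp_inj_on[OF X.finite_faces])
  show "2 * card (vertices X) + 2 * card (faces X) = card (darts X) + 4"
    using 1 2 3 4 card_darts_P by (simp add: card_vertices_X)
qed

sublocale tb: tight_bipolar X Or S N
  by unfold_locales (rule euler_X(1))

text \<open>Both corners are in the region of \<open>t\<close>, as the edge may be crossed, and a
  region belongs to only one face of \<open>X\<close>.\<close>

lemma same_face:
  assumes t: "t \<in> darts D" "t \<notin> P"
  shows "face_of X (next_in D P t) = face_of X (next_in D P (opp D t))"
proof (rule inj_onD[OF euler_X(2)])
  let ?a = "next_in D P t" and ?b = "next_in D P (opp D t)"
  have ot: "opp D t \<in> darts D" using t opp_in_iff by blast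
  have P: "?a \<in> P" "?b \<in> P" using next_in_mem t(1) ot by auto
  then show F: "face_of X ?a \<in> faces X" "face_of X ?b \<in> faces X" using X.face_in_faces by auto
  have "region D P ?a = region D P t" using region_eq[OF t(1)] next_in_region[OF t(1)] by blast
  moreover have "region D P ?b = region D P (opp D t)" using region_eq[OF ot] next_in_region[OF ot] by blast
  moreover have "region D P (opp D t) = region D P t"
    using region_eq[OF t(1)] region.cross[OF region.base t(2)] by blast
  ultimately show "face_region (face_of X ?a) = face_region (face_of X ?b)"
    using face_region[OF F(1) X.face_of_self] face_region[OF F(2) X.face_of_self] by simp
qed

lemma face_next_X_r: "face_next X (r i) = r (Suc i)"
  using r_P by (simp add: face_next_X face_next_r next_in_P)

lemma plain_outer_eq: "plain_outer_face D Or = outer_face D"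
proof -
  have e: "plain_outer_face D Or = orbit (face_next X) (r 0)"
    using r_P[of 0] by (simp add: plain_outer_face_def plain_map_eq next_in_P r_0 face_of_def)
  show ?thesis unfolding e
  proof (intro equalityI subsetI)
    fix d assume "d \<in> orbit (face_next X) (r 0)"
    then show "d \<in> outer_face D"
    proof induction
      case base show ?case by (simp add: face_next_X_r r_in_outer)
    next
      case (step y)
      obtain i where "y = r i" using step(2) by (elim outer_faceE)
      then show ?case by (simp add: face_next_X_r r_in_outer)
    qed
  next
    fix d assume "d \<in> outer_face D"
    then obtain i where i: "d = r i" by (elim outer_faceE)
    have "r i \<in> orbit (face_next X) (r 0)" for i
    proof (induction i)
      case 0 show ?case by (rule X.face.self_in_orbit)
    next
      case (Suc i) then show ?case using orbit.step[OF Suc] by (simp add: face_next_X_r)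
    qed
    then show "d \<in> orbit (face_next X) (r 0)" using i by simp
  qed
qed

lemma outer_in_X: "outer_face D \<in> faces X"
  using X.face_in_faces[of "r 0"] r_P[of 0] plain_outer_eq
  by (simp add: plain_outer_face_def plain_map_eq next_in_P r_0)

lemma inner_iff: "f \<in> plain_inner_faces D Or \<longleftrightarrow> f \<in> faces X \<and> f \<noteq> outer_face D"
  by (simp add: plain_inner_faces_def plain_outer_eq plain_map_eq)

lemma ST1: "ST1 D Or"
  unfolding ST1_def
proof (intro conjI exI)
  show "\<forall>v\<in>vertices D. v \<inter> P \<noteq> {}" using spanning by blast
  have planarX: "planar_map X"
    by (rule X.planar_mapI[OF _ b.connected euler_X(1)]) (use r_P in auto)
  have VX: "vertex_of X (r i) = V i \<inter> P" for i using r_P by (simp add: vertex_X V_def)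
  have TX: "target_of X (r i) = V (Suc i) \<inter> P" for i using r_P by (simp add: target_X target_r)
  have VoX: "vertex_of X (opp D (r i)) = V (Suc i) \<inter> P" for i using opp_r_P by (simp add: vertex_X vertex_opp_r)
  have ToX: "target_of X (opp D (r i)) = V i \<inter> P" for i using opp_r_P by (simp add: target_X target_opp_r)
  have O: "opp D (r 0) \<in> Or" "opp D (r 1) \<in> Or" "opp D (r 2) \<in> Or" "r 3 \<in> Or" "r 4 \<in> Or" "r 5 \<in> Or"
    using Or_r Or_opp_r by simp_all
  show "plane_bipolar (plain_map D Or) (plain_outer_face D Or) Or S N"
    unfolding plane_bipolar_def plain_map_eq plain_outer_eq
  proof (intro conjI)
    show "acyclic {(vertex_of X d, target_of X d) |d. d \<in> Or}" using b.acyclic by (simp add: arcs_def)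
    show "S \<in> vertex_of X ` outer_face D" using VX[of 3] r_in_outer[of 3] by (auto simp: S_def intro!: image_eqI[of _ _ "r 3"])
    show "N \<in> vertex_of X ` outer_face D" using VX[of 0] r_in_outer[of 0] by (auto simp: N_def intro!: image_eqI[of _ _ "r 0"])
  qed (rule planarX outer_in_X b.orientation b.sources b.sinks)+
  show "outer_type_2_2 (plain_map D Or) (plain_outer_face D Or) Or S N"
    unfolding outer_type_2_2_def contour_paths_def plain_map_eq plain_outer_eq
  proof (intro exI conjI)
    show "directed_path X Or S [r 3, r 4, r 5] N"
      unfolding directed_path_def S_def N_def
      using O VX[of 3] VX[of 4] VX[of 5] TX[of 3] TX[of 4] TX[of 5] V_6 r_eq_iff[of 3 4] r_eq_iff[of 3 5] r_eq_iff[of 4 5]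
      by simp
    show "directed_path X Or S [opp D (r 2), opp D (r 1), opp D (r 0)] N"
      unfolding directed_path_def S_def N_def
      using O VoX[of 0] VoX[of 1] VoX[of 2] ToX[of 0] ToX[of 1] ToX[of 2] r_eq_iff[of 2 1] r_eq_iff[of 2 0] r_eq_iff[of 1 0]
      by (simp add: opp_inj eval_nat_numeral)
    show "set [r 3, r 4, r 5] = {d \<in> Or. d \<in> outer_face D}"
    proof (intro equalityI subsetI)
      fix d assume d: "d \<in> {d \<in> Or. d \<in> outer_face D}"
      then obtain i where "i < 6" "d = r i" by (auto elim: outer_faceE)
      then show "d \<in> set [r 3, r 4, r 5]" using d Or_r[of i] by auto
    qed (use O r_in_outer in auto)
    show "set [opp D (r 2), opp D (r 1), opp D (r 0)] = {d \<in> Or. opp X d \<in> outer_face D}"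
    proof (intro equalityI subsetI)
      fix d assume d: "d \<in> {d \<in> Or. opp X d \<in> outer_face D}"
      then have dd: "opp D d \<in> outer_face D" "d \<in> Or" "d \<in> darts D" using Or_P Or_sub by (auto simp: opp_X)
      then obtain i where i: "i < 6" "opp D d = r i" by (elim outer_faceE)
      then have "d = opp D (r i)" using opp_opp[OF dd(3)] by simp
      then show "d \<in> set [opp D (r 2), opp D (r 1), opp D (r 0)]" using dd(2) Or_opp_r[OF i(1)] by auto
    next
      fix d assume "d \<in> set [opp D (r 2), opp D (r 1), opp D (r 0)]"
      then obtain i where "d = opp D (r i)" "d \<in> Or" using O by auto
      then show "d \<in> {d \<in> Or. opp X d \<in> outer_face D}"
        using opp_X[OF opp_r_P] opp_opp[OF r_in] r_in_outer by simp
    qed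
  qed simp_all
  show "N = vertex_of D (root D) \<inter> P" by (simp add: N_def V_def r_0)
  have "face_of X (opp D (r 0)) \<in> faces X" using opp_r_P by (simp add: X.face_in_faces)
  moreover have "face_of X (opp D (r 0)) \<noteq> outer_face D" using X.face_of_self opp_r_not_outer by metis
  ultimately show "plain_inner_faces D Or \<noteq> {}" using inner_iff by blast
qed

section \<open>Green edges in the lateral corners\<close>

definition red_like :: "'d \<Rightarrow> bool" where
  "red_like d \<longleftrightarrow> (d \<in> Or \<longleftrightarrow> vertex_of D d \<in> black D)"

lemma red_like_inner:
  assumes "d \<in> inner_darts D" "d \<in> P" shows "red_like d \<longleftrightarrow> c d = Some Red" and "\<not> red_like d \<longleftrightarrow> c d = Some Blue"
proof -
  have "c d = Some Red \<or> c d = Some Blue"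
    using P_inner_iff[OF assms(1)] assms(2) c_h[OF assms(1)] by (cases "h d") auto
  then show "red_like d \<longleftrightarrow> c d = Some Red" "\<not> red_like d \<longleftrightarrow> c d = Some Blue"
    using Or_inner_iff[OF assms(1)] by (auto simp: red_like_def)
qed

lemma h_rot:
  assumes "d \<in> darts D"
  shows "(h d, h (rot D d)) \<in> {(Green, Red), (Red, Blue), (Blue, Green)} \<or> h d = h (rot D d)"
  using h_corner[of "rot D d"] rot_in_iff[of d] assms by (simp add: inv_rot_rot)

lemma P_inner_h:
  assumes "vertex_of D d \<in> inner_vertices D" shows "d \<in> inner_darts D" "d \<in> P \<longleftrightarrow> h d \<noteq> Green" "c d = Some (h d)"
proof -
  show i: "d \<in> inner_darts D" using dart_at_inner[OF assms vertex_of_self] .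
  show "c d = Some (h d)" by (rule c_h[OF i])
  then show "d \<in> P \<longleftrightarrow> h d \<noteq> Green" using P_inner_iff[OF i] by simp
qed

text \<open>Counterclockwise, green can only be followed by green or red.\<close>

lemma next_red:
  assumes "t \<in> darts D" "vertex_of D t \<in> inner_vertices D" "h t = Green \<or> h t = Red"
  shows "h (next_in D P t) = Red"
  using assms
proof (induction rule: next_in_induct)
  case (base d)
  then show ?case using P_inner_h(2)[of d] by (auto simp: next_in_P)
next
  case (step d)
  have "h d = Green" using P_inner_h(2)[OF step(4)] step(2) by simp
  then have "h (rot D d) = Green \<or> h (rot D d) = Red" using h_rot[OF step(1)] by auto
  then show ?case using step(3) step(4) vertex_of_rot[of d] next_in_step[OF step(1,2)] by simp
qed

text \<open>Counterclockwise, green can only be preceded by green or blue.\<close>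

lemma prev_blue:
  assumes "t \<in> darts D" "vertex_of D t \<in> inner_vertices D"
  shows "\<exists>b\<in>P. b \<in> vertex_of D t \<and> next_in D P (rot D b) = next_in D P t \<and> (t \<notin> P \<longrightarrow> h b = Blue)"
  using assms
proof (induction rule: prev_in_induct)
  case (base b)
  have v: "vertex_of D b \<in> inner_vertices D" "vertex_of D (rot D b) = vertex_of D b"
    using base(2) vertex_of_rot[of b] by auto
  have "h b = Blue" if n: "rot D b \<notin> P"
  proof -
    have "h (rot D b) = Green" using P_inner_h(2)[OF base(2)] n by simp
    moreover have "h b \<noteq> Green" using P_inner_h(2)[OF v(1)] base(1) by simp
    ultimately show ?thesis using h_rot[of b] P_subset base(1) by auto
  qed
  then show ?case using base(1) v(2) vertex_of_self[of b] by (intro bexI[of _ b]) auto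
next
  case (step d)
  have v: "vertex_of D d \<in> inner_vertices D" "vertex_of D (rot D d) = vertex_of D d"
    using step(4) vertex_of_rot[of d] by auto
  obtain b where b: "b \<in> P" "b \<in> vertex_of D d" "next_in D P (rot D b) = next_in D P d" "h b = Blue"
    using step(3)[OF v(1)] step(2) by blast
  then show ?case using v(2) next_in_step[OF step(1,2)] by (intro bexI[of _ b]) auto
qed

lemma P_at_V1: "d \<in> V 1 \<Longrightarrow> d \<in> P \<Longrightarrow> d = r 1 \<or> d = opp D (r 0)"
  and P_at_V4: "d \<in> V 4 \<Longrightarrow> d \<in> P \<Longrightarrow> d = r 4 \<or> d = opp D (r 3)"
proof -
  show "d = r 1 \<or> d = opp D (r 0)" if d: "d \<in> V 1" "d \<in> P"
  proof -
    have "d \<notin> inner_darts D" using P_inner_iff[of d] c_outer[of 1 d] d by (auto simp: outer_label_def)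
    then show ?thesis using dart_at_V[of d 0] d by simp
  qed
  show "d = r 4 \<or> d = opp D (r 3)" if d: "d \<in> V 4" "d \<in> P"
  proof -
    have "d \<notin> inner_darts D" using P_inner_iff[of d] c_outer[of 4 d] d by (auto simp: outer_label_def)
    then show ?thesis using dart_at_V[of d 3] d by (simp add: eval_nat_numeral)
  qed
qed

lemma red_like_r: "\<not> red_like (r 1)" "red_like (opp D (r 0))" "\<not> red_like (r 4)" "red_like (opp D (r 3))"
proof -
  have "vertex_of D (r 1) = V 1" "vertex_of D (opp D (r 0)) = V 1" "vertex_of D (r 4) = V 4" "vertex_of D (opp D (r 3)) = V 4"
    using vertex_opp_r[of 0] vertex_opp_r[of 3] by (simp_all add: V_def eval_nat_numeral)
  then show "\<not> red_like (r 1)" "red_like (opp D (r 0))" "\<not> red_like (r 4)" "red_like (opp D (r 3))"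
    using black_V[of 1] black_V[of 4] Or_r[of 1] Or_r[of 4] Or_opp_r[of 0] Or_opp_r[of 3]
    by (simp_all add: red_like_def)
qed

text \<open>The two plain darts bound two corners. The one in the outer face, from
  \<open>opp D (r j)\<close> to \<open>r (Suc j)\<close>, contains no dart, so \<open>t\<close> is
  in the other one.\<close>

lemma green_corner_outer:
  assumes t: "t \<in> darts D" "t \<notin> P" "vertex_of D t = V (Suc j)"
    and P: "\<And>d. d \<in> V (Suc j) \<Longrightarrow> d \<in> P \<Longrightarrow> d = r (Suc j) \<or> d = opp D (r j)"
    and rl: "\<not> red_like (r (Suc j))" "red_like (opp D (r j))"
  shows "\<exists>b\<in>P. b \<in> vertex_of D t \<and> rot X b = next_in D P t \<and> \<not> red_like b \<and> red_like (next_in D P t)"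
proof -
  obtain b where b: "b \<in> P" "b \<in> vertex_of D t" "next_in D P (rot D b) = next_in D P t"
    using prev_in[OF t(1)] by blast
  have rb: "rot X b = next_in D P t" using b by (simp add: rot_X)
  have "next_in D P t \<noteq> r (Suc j)"
    using next_in_not_rot[OF t(1,2), of "opp D (r j)"] rot_opp_r[of j] opp_r_P[of j] by auto
  then have n: "next_in D P t = opp D (r j)" using P next_in_mem[OF t(1)] t(3) by blast
  have "rot X (opp D (r j)) = r (Suc j)" using opp_r_P r_P by (simp add: rot_X rot_opp_r next_in_P)
  then have "b \<noteq> opp D (r j)" using rb n r_neq_opp_r by metis
  then have "b = r (Suc j)" using P b t(3) by blast
  then show ?thesis using b rb n rl by auto
qed

text \<open>The corner rule of transverse orientations, here read off the colours.\<close>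

lemma green_corner:
  assumes t: "t \<in> darts D" "t \<notin> P"
  shows "\<exists>b\<in>P. b \<in> vertex_of D t \<and> rot X b = next_in D P t \<and> \<not> red_like b \<and> red_like (next_in D P t)"
proof (rule vertex_cases[OF vertex_in_vertices[OF t(1)]])
  assume v: "vertex_of D t \<in> inner_vertices D"
  obtain b where b: "b \<in> P" "b \<in> vertex_of D t" "next_in D P (rot D b) = next_in D P t" "h b = Blue"
    using prev_blue[OF t(1) v] t(2) by blast
  have "h t = Green" using P_inner_h(2)[OF v] t(2) by simp
  then have n: "h (next_in D P t) = Red" using next_red[OF t(1) v] by simp
  have vb: "vertex_of D b = vertex_of D t" "vertex_of D (next_in D P t) = vertex_of D t"
    using vertex_of_eq b(2) next_in_mem[OF t(1)] by auto
  then have i: "b \<in> inner_darts D" "c b = Some Blue" "next_in D P t \<in> inner_darts D" "c (next_in D P t) = Some Red"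
    using P_inner_h[of b] P_inner_h[of "next_in D P t"] v b(4) n by auto
  have "\<not> red_like b" "red_like (next_in D P t)"
    using red_like_inner[OF i(1) b(1)] red_like_inner[OF i(3)] next_in_mem[OF t(1)] i by auto
  then show ?thesis using b by (auto simp: rot_X)
next
  fix i assume i: "i < 6" "vertex_of D t = V i"
  have ti: "t \<in> inner_darts D"
    by (rule inner_darts_cases[OF t(1)]) (use t(2) r_P opp_r_P in auto)
  then have "outer_label i = Green"
    using at_V_label[OF ti i(2,1)] P_inner_iff[OF ti] t(2) by simp
  moreover have "i = 0 \<or> i = 1 \<or> i = 2 \<or> i = 3 \<or> i = 4 \<or> i = 5" using i(1) by linarith
  ultimately have "i = 1 \<or> i = 4" by (elim disjE) (simp_all add: outer_label_def)
  then show ?thesis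
  proof
    assume "i = 1"
    then have v: "vertex_of D t = V (Suc 0)" using i(2) by simp
    show ?thesis by (rule green_corner_outer[OF t v]) (use P_at_V1 red_like_r in simp_all)
  next
    assume "i = 4"
    then have v: "vertex_of D t = V (Suc 3)" using i(2) by simp
    show ?thesis by (rule green_corner_outer[OF t v]) (use P_at_V4 red_like_r in \<open>simp_all add: eval_nat_numeral\<close>)
  qed
qed

text \<open>Blue is never followed directly by red counterclockwise at an inner vertex. At an outer
  vertex the label leaves room for such a corner off the outer face only if it is green; without a
  green edge the two outer edges would then be its only edges, against
  \<open>nonisolated\<close>.\<close>

lemma corner_has_green:
  assumes v: "v \<in> vertices D" and b: "b \<in> v" "b \<in> P" "\<not> red_like b" "red_like (rot X b)" "rot X b \<notin> outer_face D"
  shows "rot D b \<notin> P"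
proof
  assume n: "rot D b \<in> P"
  then have e: "rot X b = rot D b" using b(2) by (simp add: rot_X next_in_P)
  have bd: "b \<in> darts D" "vertex_of D b = v" using in_verticesD[OF v b(1)] by auto
  have vr: "vertex_of D (rot D b) = v" using vertex_of_rot[of b] bd by simp
  from v show False
  proof (rule vertex_cases)
    assume vi: "v \<in> inner_vertices D"
    have "c b = Some Blue" using red_like_inner(2)[OF _ b(2)] P_inner_h(1)[of b] bd vi b(3) by simp
    then have "h b = Blue" using P_inner_h(3)[of b] bd vi by simp
    moreover have "c (rot D b) = Some Red"
      using red_like_inner(1)[OF _ n] P_inner_h(1)[of "rot D b"] vr vi b(4) e by simp
    then have "h (rot D b) = Red" using P_inner_h(3)[of "rot D b"] vr vi by simp
    ultimately show False using h_rot[OF bd(1)] by auto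
  next
    fix i assume i: "i < 6" "v = V i"
    have rl: "red_like d \<longleftrightarrow> (d \<in> Or \<longleftrightarrow> odd i)" if "vertex_of D d = v" for d
      using that i black_V by (simp add: red_like_def)
    have isol: "isolated D (V (Suc j))" if j: "rot D (r (Suc j)) = opp D (r j)" for j
    proof -
      have ro: "rot D (opp D (r j)) = r (Suc j)" by (rule rot_opp_r)
      have "V (Suc j) = {r (Suc j), opp D (r j)}"
      proof (intro equalityI subsetI)
        fix d assume "d \<in> V (Suc j)"
        then have "d \<in> orbit (rot D) (r (Suc j))" by (simp add: V_def vertex_of_def)
        then show "d \<in> {r (Suc j), opp D (r j)}" by induction (use j ro in auto)
      next
        fix d assume "d \<in> {r (Suc j), opp D (r j)}"
        then show "d \<in> V (Suc j)" using r_at_V[of "Suc j"] in_V_iff[of "opp D (r j)" "Suc j"] vertex_opp_r[of j] by auto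
      qed
      then show ?thesis using r_neq_opp_r[of "Suc j" j] by (simp add: isolated_def)
    qed
    have "i = 0 \<or> i = 1 \<or> i = 2 \<or> i = 3 \<or> i = 4 \<or> i = 5" using i(1) by linarith
    then show False
    proof (elim disjE)
      assume "i = 0"
      then have "b \<in> Or" using rl[OF bd(2)] b(3) by simp
      then show False using not_from_V0 bd i \<open>i = 0\<close> by blast
    next
      assume i1: "i = 1"
      then have "b = r 1" using P_at_V1[of b] b i red_like_r by auto
      moreover have "rot D b = opp D (r 0)"
        using P_at_V1[of "rot D b"] n vr i i1 vertex_of_self[of "rot D b"] red_like_r b(4) e by auto
      ultimately show False using isol[of 0] nonisolated(1) by simp
    next
      assume i2: "i = 2"
      have ne: "rot D b \<notin> Or" using rl[OF vr] b(4) e i2 by simp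
      have ro: "rot D b \<in> V (Suc 1)" using vr i i2 vertex_of_self[of "rot D b"] by (simp add: eval_nat_numeral)
      have "rot D b \<notin> inner_darts D"
      proof
        assume ri: "rot D b \<in> inner_darts D"
        have "c (rot D b) = Some (outer_label 2)" using at_V_label[OF ri _ _] vr i i2 by simp
        then show False using ne Or_inner_iff[OF ri] vr i i2 black_V[of 2] by (simp add: outer_label_def)
      qed
      then have "rot D b = r (Suc 1) \<or> rot D b = opp D (r 1)" using dart_at_V[OF ro] by auto
      then show False using ne Or_opp_r[of 1] b(5) e r_in_outer[of "Suc 1"] by auto
    next
      assume i3: "i = 3"
      then have "b \<notin> Or" using rl[OF bd(2)] b(3) by simp
      then have "opp D b \<in> Or" using Or_iff'[OF b(2)] by simp
      moreover have "target_of D (opp D b) = V 3" using target_of_opp[OF bd(1)] bd i i3 by simp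
      ultimately show False using into_V(1)[of "opp D b" 3] by simp
    next
      assume i4: "i = 4"
      then have "b = r 4" using P_at_V4[of b] b i red_like_r by auto
      moreover have "rot D b = opp D (r 3)"
        using P_at_V4[of "rot D b"] n vr i i4 vertex_of_self[of "rot D b"] red_like_r b(4) e by auto
      ultimately show False using isol[of 3] nonisolated(2) by (simp add: eval_nat_numeral)
    next
      assume i5: "i = 5"
      have ne: "rot D b \<in> Or" using rl[OF vr] b(4) e i5 by simp
      have ro: "rot D b \<in> V (Suc 4)" using vr i i5 vertex_of_self[of "rot D b"] by (simp add: eval_nat_numeral)
      have "rot D b \<notin> inner_darts D"
      proof
        assume ri: "rot D b \<in> inner_darts D"
        have "c (rot D b) = Some (outer_label 5)" using at_V_label[OF ri _ _] vr i i5 by simp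
        then show False using ne Or_inner_iff[OF ri] vr i i5 black_V[of 5] by (simp add: outer_label_def)
      qed
      then have "rot D b = r (Suc 4) \<or> rot D b = opp D (r 4)" using dart_at_V[OF ro] by auto
      then show False using ne Or_opp_r[of 4] b(5) e r_in_outer[of "Suc 4"] by auto
    qed
  qed
qed

text \<open>A corner from blue to red is one of the left path at a black vertex and one of the right
  path at a white vertex.\<close>

lemma trans_in_face:
  assumes t: "t \<in> darts D" "t \<notin> P" and f: "f \<in> faces X" "next_in D P t \<in> f"
  shows "vertex_of D t \<in> black D \<Longrightarrow> vertex_of D t \<in> target_of D ` {d \<in> f. d \<in> Or \<and> face_next X d \<in> Or}"
    and "vertex_of D t \<in> white D \<Longrightarrow> vertex_of D t \<in> target_of D ` {d \<in> f. d \<notin> Or \<and> face_next X d \<notin> Or}"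
proof -
  obtain b where b: "b \<in> P" "b \<in> vertex_of D t" "rot X b = next_in D P t" "\<not> red_like b" "red_like (next_in D P t)"
    using green_corner[OF t] by blast
  have bd: "b \<in> darts D" "vertex_of D b = vertex_of D t" using b P_subset vertex_of_eq by auto
  have nv: "vertex_of D (next_in D P t) = vertex_of D t" using next_in_mem[OF t(1)] vertex_of_eq by blast
  have ob: "opp D b \<in> P" using b P_opp by blast
  have fn: "face_next X (opp D b) = next_in D P t"
    using b(3) ob opp_opp[OF bd(1)] by (simp add: face_next_def opp_X)
  have of: "opp D b \<in> f" using X.face_next_in_face_iff[OF f(1), of "opp D b"] fn f(2) by simp
  have tb: "target_of D (opp D b) = vertex_of D t" using target_of_opp[OF bd(1)] bd by simp
  have oO: "opp D b \<in> Or \<longleftrightarrow> b \<notin> Or" by (rule Or_iff'[OF b(1)])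
  show "vertex_of D t \<in> target_of D ` {d \<in> f. d \<in> Or \<and> face_next X d \<in> Or}" if "vertex_of D t \<in> black D"
  proof (rule image_eqI[of _ _ "opp D b"])
    show "opp D b \<in> {d \<in> f. d \<in> Or \<and> face_next X d \<in> Or}"
      using of fn oO b(4,5) bd(2) nv that by (simp add: red_like_def)
  qed (simp add: tb)
  show "vertex_of D t \<in> target_of D ` {d \<in> f. d \<notin> Or \<and> face_next X d \<notin> Or}" if "vertex_of D t \<in> white D"
  proof (rule image_eqI[of _ _ "opp D b"])
    have "vertex_of D t \<notin> black D" using that by (simp add: black_def)
    then show "opp D b \<in> {d \<in> f. d \<notin> Or \<and> face_next X d \<notin> Or}"
      using of fn oO b(4,5) bd(2) nv by (simp add: red_like_def)
  qed (simp add: tb)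
qed

lemma edge_within_face:
  assumes t: "t \<in> darts D" "t \<notin> P" "f \<in> faces X" "next_in D P t \<in> f"
  shows "edge_within D P t f"
proof -
  have "face_of X (next_in D P t) = f" using X.in_facesD[OF t(3,4)] by simp
  then have "next_in D P (opp D t) \<in> f" using same_face[OF t(1,2)] X.face_of_self by metis
  then show ?thesis using t(4) by (simp add: edge_within_def)
qed

lemma ST2: "ST2 D Or"
  unfolding ST2_def
proof (intro conjI ballI)
  fix t assume "t \<in> transversal_darts D Or"
  then have t: "t \<in> darts D" "t \<notin> P" by (auto simp: transversal_darts_def)
  let ?f = "face_of X (next_in D P t)"
  have nP: "next_in D P t \<in> P" using next_in_mem[OF t(1)] by blast
  then have f: "?f \<in> faces X" "next_in D P t \<in> ?f" using X.face_in_faces X.face_of_self by auto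
  \<comment> \<open>The dart before \<open>r i\<close> in the rotation is plain: it is the reverse
    of the preceding outer dart, written \<open>r (i + 5)\<close> to avoid a subtraction.\<close>
  have "?f \<noteq> outer_face D"
  proof
    assume "?f = outer_face D"
    then have "next_in D P t \<in> outer_face D" using f(2) by simp
    then obtain i where i: "next_in D P t = r i" by (elim outer_faceE)
    have "r i = rot D (opp D (r (i + 5)))" using rot_opp_r[of "i + 5"] r_period[of i] by (simp add: eval_nat_numeral)
    then show False using next_in_not_rot[OF t, of "opp D (r (i + 5))"] i opp_r_P by simp
  qed
  then have "?f \<in> plain_inner_faces D Or" using f inner_iff by blast
  then show "\<exists>f\<in>plain_inner_faces D Or. edge_within D P t f" using edge_within_face[OF t f] by blast
next
  fix f assume "f \<in> plain_inner_faces D Or"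
  then have f: "f \<in> faces X" "f \<noteq> outer_face D" using inner_iff by auto
  have fP: "d \<in> P" if "d \<in> f" for d using X.in_facesD[OF f(1) that] by simp
  obtain u v p q where c: "contour_paths X Or f u v p q" using tb.contour_paths_exist[OF f(1)] by blast
  have L: "path_interior D p = target_of D ` {d \<in> f. d \<in> Or \<and> face_next X d \<in> Or}"
    by (rule path_interior_left[OF tb.tight_bipolar_axioms f(1) c])
  have R: "path_interior D q = target_of D ` {d \<in> f. d \<notin> Or \<and> face_next X d \<notin> Or}"
    by (rule path_interior_right[OF tb.tight_bipolar_axioms f(1) c])
  show "\<exists>u v p q. contour_paths (plain_map D Or) Or f u v p q \<and>
        (\<forall>t\<in>transversal_darts D Or. edge_within D P t f \<longrightarrow>
           (\<exists>x y. {vertex_of D t, target_of D t} = {x, y} \<and>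
              x \<in> black D \<and> x \<in> path_interior D p \<and> y \<in> white D \<and> y \<in> path_interior D q)) \<and>
        (\<forall>x \<in> (black D \<inter> path_interior D p) \<union> (white D \<inter> path_interior D q).
           \<exists>t\<in>transversal_darts D Or. edge_within D P t f \<and> vertex_of D t = x)"
  proof (rule exI[of _ u], rule exI[of _ v], rule exI[of _ p], rule exI[of _ q], intro conjI ballI impI)
    show "contour_paths (plain_map D Or) Or f u v p q" using c by (simp add: plain_map_eq)
    fix t assume tt: "t \<in> transversal_darts D Or" and w: "edge_within D P t f"
    then have t: "t \<in> darts D" "t \<notin> P" by (auto simp: transversal_darts_def)
    have ot: "opp D t \<in> darts D" "opp D t \<notin> P" using t opp_in_iff opp_in_P_iff by auto
    have n: "next_in D P t \<in> f" "next_in D P (opp D t) \<in> f" using w by (auto simp: edge_within_def)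
    have v: "vertex_of D t \<in> vertices D" "target_of D t \<in> vertices D"
      using t(1) vertex_in_vertices target_in_vertices by auto
    have vo: "vertex_of D (opp D t) = target_of D t" by (simp add: target_of_def)
    show "\<exists>x y. {vertex_of D t, target_of D t} = {x, y} \<and>
              x \<in> black D \<and> x \<in> path_interior D p \<and> y \<in> white D \<and> y \<in> path_interior D q"
    proof (cases "vertex_of D t \<in> black D")
      case True
      then have "target_of D t \<in> white D" using black_alternates[OF t(1)] black_iff[OF v(1)] black_iff[OF v(2)] by blast
      then show ?thesis
        using True trans_in_face(1)[OF t f(1) n(1)] trans_in_face(2)[OF ot f(1) n(2)] vo L R by auto
    next
      case False
      then have "vertex_of D t \<in> white D" "target_of D t \<in> black D"
        using black_alternates[OF t(1)] black_iff[OF v(1)] by auto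
      then show ?thesis
        using trans_in_face(2)[OF t f(1) n(1)] trans_in_face(1)[OF ot f(1) n(2)] vo L R
        by (intro exI[of _ "target_of D t"] exI[of _ "vertex_of D t"]) auto
    qed
  next
    fix x assume x: "x \<in> (black D \<inter> path_interior D p) \<union> (white D \<inter> path_interior D q)"
    have "\<exists>d\<in>f. target_of D d = x \<and> \<not> red_like (opp D d) \<and> red_like (face_next X d)"
    proof -
      have vt: "vertex_of D (opp D d) = target_of D d" "vertex_of D (face_next X d) = target_of D d" if "d \<in> f" for d
        using vertex_of_face_next_X[OF fP[OF that]] by (simp_all add: target_of_def)
      from x show ?thesis
      proof
        assume "x \<in> black D \<inter> path_interior D p"
        then obtain d where d: "d \<in> f" "d \<in> Or" "face_next X d \<in> Or" "target_of D d = x" "x \<in> black D"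
          unfolding L by blast
        then show ?thesis using vt[OF d(1)] Or_iff'[OF fP[OF d(1)]] by (intro bexI[of _ d]) (auto simp: red_like_def)
      next
        assume "x \<in> white D \<inter> path_interior D q"
        then obtain d where d: "d \<in> f" "d \<notin> Or" "face_next X d \<notin> Or" "target_of D d = x" "x \<notin> black D"
          unfolding R by (auto simp: black_def)
        then show ?thesis using vt[OF d(1)] Or_iff'[OF fP[OF d(1)]] by (intro bexI[of _ d]) (auto simp: red_like_def)
      qed
    qed
    then obtain d where d: "d \<in> f" "target_of D d = x" "\<not> red_like (opp D d)" "red_like (face_next X d)" by blast
    \<comment> \<open>The transversal dart wanted is the one right after \<open>b\<close>;
      \<open>corner_has_green\<close> guarantees that it is not plain.\<close>
    define b where "b = opp D d"
    have dP: "d \<in> P" "d \<in> darts D" using fP d P_subset by auto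
    have b: "b \<in> P" "b \<in> x" "x \<in> vertices D"
      using dP P_opp d(2) vertex_of_self[of "opp D d"] target_in_vertices by (auto simp: b_def target_of_def)
    have rb: "rot X b = face_next X d" using dP by (simp add: b_def face_next_def opp_X)
    have rf: "rot X b \<in> f" using rb d(1) X.face_next_in_face_iff[OF f(1)] by simp
    have "rot X b \<notin> outer_face D"
      using X.in_facesD[OF f(1) rf] X.in_facesD[OF outer_in_X, of "rot X b"] f(2) by auto
    then have n: "rot D b \<notin> P" using corner_has_green[OF b(3,2,1)] d rb by (simp add: b_def)
    let ?t = "rot D b"
    have td: "?t \<in> darts D" using rot_in_iff b(1) P_subset by blast
    have "next_in D P ?t \<in> f" using rf b(1) by (simp add: rot_X)
    then have "edge_within D P ?t f" by (rule edge_within_face[OF td n f(1)])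
    moreover have "vertex_of D ?t = x" using vertex_of_rot[of b] in_verticesD[OF b(3,2)] by simp
    ultimately show "\<exists>t\<in>transversal_darts D Or. edge_within D P t f \<and> vertex_of D t = x"
      using td n by (auto simp: transversal_darts_def)
  qed
qed

theorem s_transverse: "s_transverse D Or"
  unfolding s_transverse_def using dissection Or_sub Or_opp_not ST1 ST2 by blast

lemma colouring_of_Or: "colouring_of D Or = c"
proof
  fix d
  show "colouring_of D Or d = c d"
  proof (cases "d \<in> inner_darts D")
    case False
    then show ?thesis using c_dom[of d] by (simp add: colouring_of_def)
  next
    case True
    show ?thesis
    proof (cases "d \<in> P")
      case False
      then show ?thesis using True P_inner_iff[OF True] by (simp add: colouring_of_def)
    next
      case dP: True
      then show ?thesis using True red_like_inner[OF True dP]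
        by (auto simp: colouring_of_def red_like_def)
    qed
  qed
qed

end

section \<open>Isomorphism classes\<close>

text \<open>The isomorphism relations relate valid structures only, hence reflexivity just on
  \<open>A\<close> and \<open>B\<close>. Classes need not be contained in \<open>A\<close>:
  representatives in \<open>A\<close> are chosen, and \<open>F_iff\<close> makes the choice
  immaterial.\<close>

lemma bij_betw_quotients:
  assumes F: "bij_betw F A B"
    and reflR: "\<And>x. x \<in> A \<Longrightarrow> (x, x) \<in> R" and symR: "sym R" and transR: "trans R"
    and reflT: "\<And>y. y \<in> B \<Longrightarrow> (y, y) \<in> T" and symT: "sym T" and transT: "trans T"
    and F_iff: "\<And>x y. x \<in> A \<Longrightarrow> y \<in> A \<Longrightarrow> (x, y) \<in> R \<longleftrightarrow> (F x, F y) \<in> T"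
  shows "\<exists>\<Phi>. bij_betw \<Phi> (A // R) (B // T)"
proof -
  have cls: "Q `` {x} = Q `` {y} \<longleftrightarrow> (x, y) \<in> Q" if "sym Q" "trans Q" "(y, y) \<in> Q" for Q :: "('c \<times> 'c) set" and x y
  proof
    assume "Q `` {x} = Q `` {y}"
    then have "y \<in> Q `` {x}" using that(3) by simp
    then show "(x, y) \<in> Q" by simp
  next
    assume xy: "(x, y) \<in> Q"
    then have yx: "(y, x) \<in> Q" using that(1) by (rule symD[rotated])
    show "Q `` {x} = Q `` {y}"
      using transD[OF that(2) xy] transD[OF that(2) yx] by blast
  qed
  define rep where "rep C = (SOME x. x \<in> A \<and> C = R `` {x})" for C
  have rep: "rep C \<in> A \<and> C = R `` {rep C}" if "C \<in> A // R" for C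
    unfolding rep_def by (rule someI_ex) (use that in \<open>auto elim!: quotientE\<close>)
  have FB: "F x \<in> B" if "x \<in> A" for x using F that by (auto simp: bij_betw_def)
  have "bij_betw (\<lambda>C. T `` {F (rep C)}) (A // R) (B // T)"
  proof (rule bij_betw_imageI)
    show "inj_on (\<lambda>C. T `` {F (rep C)}) (A // R)"
    proof (rule inj_onI)
      fix C C' assume C: "C \<in> A // R" "C' \<in> A // R" "T `` {F (rep C)} = T `` {F (rep C')}"
      then have "(F (rep C), F (rep C')) \<in> T" using cls[OF symT transT reflT] FB rep by blast
      then have "(rep C, rep C') \<in> R" using F_iff rep C by blast
      then have "R `` {rep C} = R `` {rep C'}" using cls[OF symR transR reflR] rep C by blast
      then show "C = C'" using rep C by metis
    qed
    show "(\<lambda>C. T `` {F (rep C)}) ` (A // R) = B // T"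
    proof (intro equalityI subsetI)
      fix E assume "E \<in> (\<lambda>C. T `` {F (rep C)}) ` (A // R)"
      then obtain C where "C \<in> A // R" "E = T `` {F (rep C)}" by blast
      then show "E \<in> B // T" using FB rep by (auto intro: quotientI)
    next
      fix E assume "E \<in> B // T"
      then obtain y where y: "y \<in> B" "E = T `` {y}" by (auto elim: quotientE)
      then obtain x where x: "x \<in> A" "y = F x" using F by (auto simp: bij_betw_def)
      let ?C = "R `` {x}"
      have C: "?C \<in> A // R" using x(1) by (rule quotientI)
      have "R `` {x} = R `` {rep ?C}" using rep[OF C] by blast
      then have "(x, rep ?C) \<in> R" using cls[OF symR transR reflR] rep[OF C] by blast
      then have "(F x, F (rep ?C)) \<in> T" using F_iff x(1) rep[OF C] by blast
      then have "T `` {F x} = T `` {F (rep ?C)}" using cls[OF symT transT reflT] FB rep[OF C] by blast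
      then show "E \<in> (\<lambda>C. T `` {F (rep C)}) ` (A // R)" using C x y by blast
    qed
  qed
  then show ?thesis by blast
qed

section \<open>Transport along isomorphisms of dissections\<close>

locale dissection_pair = D: dissection D + E: dissection E
  for D :: "'d dissection" and E :: "'e dissection" +
  fixes f :: "'d \<Rightarrow> 'e"
  assumes iso: "dissection_iso f D E"
begin

lemma bij: "bij_betw f (darts D) (darts E)"
  and rot: "d \<in> darts D \<Longrightarrow> f (rot D d) = rot E (f d)"
  and opp: "d \<in> darts D \<Longrightarrow> f (opp D d) = opp E (f d)"
  and root: "f (root D) = root E"
  and white: "(\<lambda>v. f ` v) ` white D = white E"
  using iso by (auto simp: dissection_iso_def)

lemma inj: "inj_on f (darts D)"
  using bij by (simp add: bij_betw_def)

lemma f_in: "d \<in> darts D \<Longrightarrow> f d \<in> darts E"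
  using bij by (auto simp: bij_betw_def)

lemma f_eq_iff: "d \<in> darts D \<Longrightarrow> e \<in> darts D \<Longrightarrow> f d = f e \<longleftrightarrow> d = e"
  using inj by (auto dest: inj_onD)

lemma darts_E: "darts E = f ` darts D"
  using bij by (simp add: bij_betw_def)

lemma face_next: "d \<in> darts D \<Longrightarrow> f (face_next D d) = face_next E (f d)"
  using rot[of "opp D d"] opp[of d] by (simp add: face_next_def D.opp_in_iff)

lemma vertex_of:
  assumes "d \<in> darts D" shows "vertex_of E (f d) = f ` vertex_of D d"
  unfolding vertex_of_def
proof (rule orbit_inverse[symmetric])
  show "d \<in> orbit (rot D) d" by (rule D.rot.self_in_orbit)
  fix x assume "x \<in> orbit (rot D) d"
  then have "x \<in> darts D" using D.vertex_of_subset[OF assms] by (auto simp: vertex_of_def)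
  then show "rot E (f x) = f (rot D x)" using rot by simp
qed

lemma face_of:
  assumes "d \<in> darts D" shows "face_of E (f d) = f ` face_of D d"
  unfolding face_of_def
proof (rule orbit_inverse[symmetric])
  show "d \<in> orbit (face_next D) d" by (rule D.face.self_in_orbit)
  fix x assume "x \<in> orbit (face_next D) d"
  then have "x \<in> darts D" using D.face_of_subset[OF assms] by (auto simp: face_of_def)
  then show "face_next E (f x) = f (face_next D x)" using face_next by simp
qed

lemma f_r: "f (D.r i) = E.r i"
proof (induction i)
  case 0 show ?case by (simp add: D.r_0 E.r_0 root)
next
  case (Suc i)
  then show ?case using face_next[OF D.r_in[of i]] by (simp add: D.face_next_r E.face_next_r)
qed

lemma f_opp_r: "f (opp D (D.r i)) = opp E (E.r i)"
  using opp[OF D.r_in] by (simp add: f_r)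

lemma image_mem_iff: "X \<subseteq> darts D \<Longrightarrow> d \<in> darts D \<Longrightarrow> f d \<in> f ` X \<longleftrightarrow> d \<in> X"
  using f_eq_iff by (auto simp: image_iff subset_iff)

lemma outer_iff:
  assumes d: "d \<in> darts D" shows "f d \<in> outer_face E \<longleftrightarrow> d \<in> outer_face D"
proof -
  have "outer_face E = f ` outer_face D" using face_of[OF D.root_in] root by (simp add: outer_face_def)
  then show ?thesis using image_mem_iff[OF _ d, of "outer_face D"] D.face_of_subset[OF D.root_in]
    by (simp add: outer_face_def)
qed

lemma inner_darts_iff: "d \<in> darts D \<Longrightarrow> f d \<in> inner_darts E \<longleftrightarrow> d \<in> inner_darts D"
  using outer_iff[of d] outer_iff[of "opp D d"] opp[of d] f_in[of d]
  by (simp add: inner_darts_def D.opp_in_iff)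

lemma white_iff:
  assumes d: "d \<in> darts D" shows "vertex_of E (f d) \<in> white E \<longleftrightarrow> vertex_of D d \<in> white D"
proof
  assume "vertex_of D d \<in> white D"
  then show "vertex_of E (f d) \<in> white E" using white vertex_of[OF d] by blast
next
  assume "vertex_of E (f d) \<in> white E"
  then obtain v where v: "v \<in> white D" "f ` vertex_of D d = f ` v" using white vertex_of[OF d] by (metis imageE)
  have "v \<subseteq> darts D" using v(1) D.white_subset D.in_verticesD by blast
  then have "vertex_of D d = v"
    using v(2) inj_on_image_eq_iff[OF inj D.vertex_of_subset[OF d]] by blast
  then show "vertex_of D d \<in> white D" using v by simp
qed

lemma black_iff': "d \<in> darts D \<Longrightarrow> vertex_of E (f d) \<in> black E \<longleftrightarrow> vertex_of D d \<in> black D"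
  using white_iff[of d] D.vertex_in_vertices[of d] E.vertex_in_vertices[of "f d"] f_in[of d]
  by (simp add: D.black_iff E.black_iff)

text \<open>The orientation is built from the root, the bicoloring, the colours and the dart
  operations, all of which an isomorphism preserves.\<close>

lemma orientation_of_iso:
  assumes c: "\<And>d. d \<in> darts D \<Longrightarrow> c' (f d) = c d"
  shows "f ` orientation_of D c = orientation_of E c'"
proof -
  have rr: "(face_next D ^^ i) (root D) = D.r i" "(face_next E ^^ i) (root E) = E.r i" for i
    by (simp_all add: D.r_def E.r_def)
  have sub: "orientation_of D c \<subseteq> darts D" "orientation_of E c' \<subseteq> darts E"
    unfolding orientation_of_def rr
    using D.inner_darts_in E.inner_darts_in D.r_in E.r_in D.opp_r_in E.opp_r_in by auto
  have mem: "f d \<in> orientation_of E c' \<longleftrightarrow> d \<in> orientation_of D c" if d: "d \<in> darts D" for d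
  proof -
    have "f d = E.r i \<longleftrightarrow> d = D.r i" "f d = opp E (E.r i) \<longleftrightarrow> d = opp D (D.r i)" for i
      using f_eq_iff[OF d D.r_in[of i]] f_eq_iff[OF d D.opp_r_in[of i]] by (simp_all add: f_r f_opp_r)
    then show ?thesis
      unfolding orientation_of_def rr
      using inner_darts_iff[OF d] white_iff[OF d] black_iff'[OF d] c[OF d] by (simp add: image_iff)
  qed
  show ?thesis
  proof (intro equalityI subsetI)
    fix e assume "e \<in> f ` orientation_of D c"
    then show "e \<in> orientation_of E c'" using mem sub(1) by blast
  next
    fix e assume e: "e \<in> orientation_of E c'"
    then obtain d where "d \<in> darts D" "e = f d" using sub(2) darts_E by blast
    then show "e \<in> f ` orientation_of D c" using mem e by blast
  qed
qed

text \<open>Gives the converse for classes: an isomorphism of orientations also carries one labeling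
  to the other.\<close>

lemma colouring_of_iso:
  assumes Or: "Or \<subseteq> darts D" and d: "d \<in> darts D"
  shows "colouring_of E (f ` Or) (f d) = colouring_of D Or d"
proof -
  have "plain_darts E (f ` Or) = f ` plain_darts D Or"
  proof -
    have "opp E ` f ` Or = f ` opp D ` Or"
      unfolding image_image by (rule image_cong[OF refl]) (use Or opp in auto)
    then show ?thesis by (simp add: plain_darts_def image_Un)
  qed
  moreover have "plain_darts D Or \<subseteq> darts D" using Or D.opp_in_iff by (auto simp: plain_darts_def)
  ultimately have "f d \<in> plain_darts E (f ` Or) \<longleftrightarrow> d \<in> plain_darts D Or" using image_mem_iff d by simp
  then show ?thesis
    using image_mem_iff[OF Or d] inner_darts_iff[OF d] black_iff'[OF d] by (simp add: colouring_of_def)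
qed

lemma iso_inv: "dissection_iso (inv_into (darts D) f) E D"
proof -
  let ?g = "inv_into (darts D) f"
  have gf: "?g (f d) = d" if "d \<in> darts D" for d using inv_into_f_f[OF inj that] .
  have w: "v \<subseteq> darts D" if "v \<in> white D" for v using that D.white_subset D.in_verticesD by blast
  show ?thesis unfolding dissection_iso_def
  proof (intro conjI ballI)
    show "bij_betw ?g (darts E) (darts D)" by (rule bij_betw_inv_into[OF bij])
    fix e assume "e \<in> darts E"
    then obtain d where d: "d \<in> darts D" "e = f d" using darts_E by blast
    show "?g (rot E e) = rot D (?g e)"
      using d gf[OF d(1)] rot[OF d(1)] gf[of "rot D d"] D.rot_in_iff by simp
    show "?g (opp E e) = opp D (?g e)"
      using d gf[OF d(1)] opp[OF d(1)] gf[of "opp D d"] D.opp_in_iff by simp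
  next
    show "?g (root E) = root D" using gf[OF D.root_in] root by simp
    have "(\<lambda>v. ?g ` v) ` white E = (\<lambda>v. ?g ` f ` v) ` white D" unfolding white[symmetric] image_image ..
    also have "\<dots> = (\<lambda>v. v) ` white D"
    proof (rule image_cong[OF refl])
      fix v assume "v \<in> white D"
      then show "?g ` f ` v = v" using inv_into_image_cancel[OF inj w] by blast
    qed
    finally show "(\<lambda>v. ?g ` v) ` white E = white D" by simp
  qed
qed

end

lemma dissection_iso_comp:
  assumes "dissection_iso f D E" "dissection_iso g E G"
  shows "dissection_iso (g \<circ> f) D G"
proof -
  have f: "bij_betw f (darts D) (darts E)" and g: "bij_betw g (darts E) (darts G)"
    using assms by (auto simp: dissection_iso_def)
  have fE: "f d \<in> darts E" if "d \<in> darts D" for d using f that by (auto simp: bij_betw_def)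
  have "(\<lambda>v. (g \<circ> f) ` v) ` white D = (\<lambda>v. g ` v) ` (\<lambda>v. f ` v) ` white D" by (simp add: image_image image_comp)
  then show ?thesis
    using assms fE bij_betw_trans[OF f g] unfolding dissection_iso_def by simp
qed

lemma dissection_iso_id: "dissection_iso id D D"
  by (simp add: dissection_iso_def)

lemma dissection_pairI:
  "dissection64 D \<Longrightarrow> dissection64 E \<Longrightarrow> dissection_iso f D E \<Longrightarrow> dissection_pair D E f"
  by (simp add: dissection_pair_def dissection_pair_axioms_def dissection_def)

lemma schnyder_dissection: "schnyder_labeling D c \<Longrightarrow> dissection64 D"
  by (simp add: schnyder_labeling_def)

lemma transverse_dissection: "s_transverse D Or \<Longrightarrow> dissection64 D"
  by (simp add: s_transverse_def)

lemma sym_schnyder_iso_rel: "sym schnyder_iso_rel"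
proof (rule symI)
  fix x y :: "'a dissection \<times> ('a \<Rightarrow> colour option)" assume "(x, y) \<in> schnyder_iso_rel"
  then obtain D c E c' f where xy: "x = (D, c)" "y = (E, c')" "schnyder_labeling D c" "schnyder_labeling E c'"
    "dissection_iso f D E" "\<forall>d\<in>darts D. c' (f d) = c d" by (auto simp: schnyder_iso_rel_def)
  interpret dissection_pair D E f
    by (rule dissection_pairI) (use xy schnyder_dissection in auto)
  have "\<forall>e\<in>darts E. c (inv_into (darts D) f e) = c' e"
    unfolding darts_E using xy(6) inv_into_f_f[OF inj] by auto
  then show "(y, x) \<in> schnyder_iso_rel" using xy iso_inv by (auto simp: schnyder_iso_rel_def)
qed

lemma trans_schnyder_iso_rel: "trans schnyder_iso_rel"
proof (rule transI)
  fix x y z :: "'a dissection \<times> ('a \<Rightarrow> colour option)"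
  assume "(x, y) \<in> schnyder_iso_rel" "(y, z) \<in> schnyder_iso_rel"
  then obtain D c E c' G c'' f g where xyz: "x = (D, c)" "y = (E, c')" "z = (G, c'')" "schnyder_labeling D c"
    "schnyder_labeling G c''" "dissection_iso f D E" "\<forall>d\<in>darts D. c' (f d) = c d"
    "dissection_iso g E G" "\<forall>d\<in>darts E. c'' (g d) = c' d" by (auto simp: schnyder_iso_rel_def)
  have "f d \<in> darts E" if "d \<in> darts D" for d
    using xyz(6) that by (auto simp: dissection_iso_def bij_betw_def)
  then have "\<forall>d\<in>darts D. c'' ((g \<circ> f) d) = c d" using xyz by simp
  then show "(x, z) \<in> schnyder_iso_rel"
    using xyz dissection_iso_comp[OF xyz(6,8)] unfolding schnyder_iso_rel_def by blast
qed

lemma sym_s_transverse_iso_rel: "sym s_transverse_iso_rel"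
proof (rule symI)
  fix x y :: "'a dissection \<times> 'a set" assume "(x, y) \<in> s_transverse_iso_rel"
  then obtain D A E f where xy: "x = (D, A)" "y = (E, f ` A)" "s_transverse D A" "s_transverse E (f ` A)"
    "dissection_iso f D E" by (auto simp: s_transverse_iso_rel_def)
  interpret dissection_pair D E f
    by (rule dissection_pairI) (use xy transverse_dissection in auto)
  have "A \<subseteq> darts D" using xy(3) by (simp add: s_transverse_def)
  then have "inv_into (darts D) f ` f ` A = A" by (rule inv_into_image_cancel[OF inj])
  then show "(y, x) \<in> s_transverse_iso_rel" using xy iso_inv by (auto simp: s_transverse_iso_rel_def)
qed

lemma trans_s_transverse_iso_rel: "trans s_transverse_iso_rel"
proof (rule transI)
  fix x y z :: "'a dissection \<times> 'a set"
  assume "(x, y) \<in> s_transverse_iso_rel" "(y, z) \<in> s_transverse_iso_rel"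
  then obtain D A E B G C f g where xyz: "x = (D, A)" "y = (E, B)" "z = (G, C)" "s_transverse D A"
    "s_transverse G C" "dissection_iso f D E" "f ` A = B" "dissection_iso g E G" "g ` B = C"
    by (auto simp: s_transverse_iso_rel_def)
  have "(g \<circ> f) ` A = C" unfolding image_comp[symmetric] using xyz(7,9) by simp
  then show "(x, z) \<in> s_transverse_iso_rel"
    using xyz dissection_iso_comp[OF xyz(6,8)] unfolding s_transverse_iso_rel_def by blast
qed

section \<open>The bijection on isomorphism classes\<close>

lemma labelingI:
  assumes "schnyder_labeling D c"
    and "\<forall>i<6. outer_label i = Green \<longrightarrow> \<not> isolated D (outer_vertex D i)"
  shows "labeling D c"
proof -
  interpret dissection D using schnyder_dissection[OF assms(1)] by unfold_locales
  show ?thesis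
    using assms(1) assms(2)[rule_format, of 1] assms(2)[rule_format, of 4]
    by unfold_locales (simp_all add: outer_vertex_eq outer_label_def)
qed

lemma transverse_ex:
  assumes "s_transverse D Or" shows "\<exists>S N. transverse D Or S N"
proof -
  interpret dissection D using transverse_dissection[OF assms] by unfold_locales
  have st: "Or \<subseteq> darts D" "\<forall>d\<in>Or. opp D d \<notin> Or" "ST1 D Or" "ST2 D Or"
    using assms by (simp_all add: s_transverse_def)
  then obtain S N where "plane_bipolar (plain_map D Or) (plain_outer_face D Or) Or S N"
      "outer_type_2_2 (plain_map D Or) (plain_outer_face D Or) Or S N"
      "N = vertex_of D (root D) \<inter> plain_darts D Or" "\<forall>v\<in>vertices D. v \<inter> plain_darts D Or \<noteq> {}"
    unfolding ST1_def by blast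
  then have "transverse D Or S N" using st by unfold_locales blast+
  then show ?thesis by blast
qed

lemma orientation_of_s_transverse:
  assumes "schnyder_labeling D c" "\<forall>i<6. outer_label i = Green \<longrightarrow> \<not> isolated D (outer_vertex D i)"
  shows "s_transverse D (orientation_of D c)" "colouring_of D (orientation_of D c) = c"
proof -
  interpret labeling D c by (rule labelingI[OF assms])
  show "s_transverse D (orientation_of D c)" "colouring_of D (orientation_of D c) = c"
    using s_transverse colouring_of_Or by (simp_all add: Or_def)
qed

lemma colouring_of_schnyder:
  assumes "s_transverse D Or"
  shows "schnyder_labeling D (colouring_of D Or)" "orientation_of D (colouring_of D Or) = Or"
    and "\<forall>i<6. outer_label i = Green \<longrightarrow> \<not> isolated D (outer_vertex D i)"
proof -
  obtain S N where "transverse D Or S N" using transverse_ex[OF assms] by blast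
  then interpret transverse D Or S N .
  show "schnyder_labeling D (colouring_of D Or)" "orientation_of D (colouring_of D Or) = Or"
    by (rule schnyder orientation_of_colouring_of)+
  have "i = 1 \<or> i = 4" if "i < 6" "outer_label i = Green" for i
  proof -
    have "i = 0 \<or> i = 1 \<or> i = 2 \<or> i = 3 \<or> i = 4 \<or> i = 5" using that(1) by linarith
    then show ?thesis using that(2) by (elim disjE) (simp_all add: outer_label_def)
  qed
  then show "\<forall>i<6. outer_label i = Green \<longrightarrow> \<not> isolated D (outer_vertex D i)"
    using not_isolated[of 0] not_isolated[of 3] by (auto simp: outer_vertex_eq)
qed

theorem proposition8:
  fixes n a b :: nat
  assumes "n \<ge> 1" and "a + b = n"
  shows "\<exists>\<Phi>. bij_betw \<Phi> (schnyder_labelings n (a + 2) (b + 2))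
                     (s_transverse_orientations (n + 4) (a + 2) (b + 2))"
proof -
  let ?A = "{(D :: nat dissection, c). schnyder_labeling D c \<and> card (inner_faces D) = n \<and>
        card (white D) = a + 2 \<and> card (black D) = b + 2 \<and>
        (\<forall>i<6. outer_label i = Green \<longrightarrow> \<not> isolated D (outer_vertex D i))}"
  let ?B = "{(D :: nat dissection, Or). s_transverse D Or \<and> card (vertices D) = n + 4 \<and>
        card (white D) = a + 2 \<and> card (black D) = b + 2}"
  let ?F = "\<lambda>(D :: nat dissection, c). (D, orientation_of D c)"
  let ?G = "\<lambda>(D :: nat dissection, Or). (D, colouring_of D Or)"
  have card: "card (vertices D) = card (inner_faces D) + 4" if "dissection64 D" for D :: "nat dissection"
  proof -
    interpret dissection D using that by unfold_locales
    show ?thesis by (rule card_vertices)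
  qed
  have "\<exists>\<Phi>. bij_betw \<Phi> (?A // schnyder_iso_rel) (?B // s_transverse_iso_rel)"
  proof (rule bij_betw_quotients)
    \<comment> \<open>The dissection is kept, so the two constructions are mutually inverse already
      before passing to classes.\<close>
    show "bij_betw ?F ?A ?B"
    proof (rule bij_betw_byWitness[where f'="?G"])
      show "\<forall>x\<in>?A. ?G (?F x) = x" using orientation_of_s_transverse(2) by auto
      show "\<forall>y\<in>?B. ?F (?G y) = y" using colouring_of_schnyder(2) by auto
      show "?F ` ?A \<subseteq> ?B"
        using orientation_of_s_transverse(1) card[OF schnyder_dissection] by auto
      show "?G ` ?B \<subseteq> ?A"
      proof
        fix x assume "x \<in> ?G ` ?B"
        then obtain D Or where D: "x = (D, colouring_of D Or)" "s_transverse D Or" "card (vertices D) = n + 4"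
          "card (white D) = a + 2" "card (black D) = b + 2" by auto
        then show "x \<in> ?A"
          using colouring_of_schnyder(1,3)[OF D(2)] card[OF transverse_dissection[OF D(2)]] by simp
      qed
    qed
    show "sym schnyder_iso_rel" "trans schnyder_iso_rel" "sym s_transverse_iso_rel" "trans s_transverse_iso_rel"
      by (rule sym_schnyder_iso_rel trans_schnyder_iso_rel sym_s_transverse_iso_rel trans_s_transverse_iso_rel)+
    show "(x, x) \<in> schnyder_iso_rel" if "x \<in> ?A" for x
      using that dissection_iso_id by (force simp: schnyder_iso_rel_def)
    show "(y, y) \<in> s_transverse_iso_rel" if "y \<in> ?B" for y
      using that dissection_iso_id by (force simp: s_transverse_iso_rel_def)
    fix x y assume x: "x \<in> ?A" and y: "y \<in> ?A"
    obtain D c where xD: "x = (D, c)" "schnyder_labeling D c"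
      "\<forall>i<6. outer_label i = Green \<longrightarrow> \<not> isolated D (outer_vertex D i)" using x by auto
    obtain E c' where yE: "y = (E, c')" "schnyder_labeling E c'"
      "\<forall>i<6. outer_label i = Green \<longrightarrow> \<not> isolated E (outer_vertex E i)" using y by auto
    note D = orientation_of_s_transverse[OF xD(2,3)] and E = orientation_of_s_transverse[OF yE(2,3)]
    have pair: "dissection_pair D E f" if "dissection_iso f D E" for f
      using dissection_pairI schnyder_dissection xD(2) yE(2) that by blast
    show "(x, y) \<in> schnyder_iso_rel \<longleftrightarrow> (?F x, ?F y) \<in> s_transverse_iso_rel"
    proof
      assume "(x, y) \<in> schnyder_iso_rel"
      then obtain f where f: "dissection_iso f D E" "\<forall>d\<in>darts D. c' (f d) = c d"
        using xD yE by (auto simp: schnyder_iso_rel_def)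
      have "f ` orientation_of D c = orientation_of E c'"
        by (rule dissection_pair.orientation_of_iso[OF pair[OF f(1)]]) (use f(2) in blast)
      then show "(?F x, ?F y) \<in> s_transverse_iso_rel"
        using D E f xD(1) yE(1) by (auto simp: s_transverse_iso_rel_def)
    next
      assume "(?F x, ?F y) \<in> s_transverse_iso_rel"
      then obtain f where f: "dissection_iso f D E" "f ` orientation_of D c = orientation_of E c'"
        using xD(1) yE(1) by (auto simp: s_transverse_iso_rel_def)
      have "orientation_of D c \<subseteq> darts D" using D(1) by (simp add: s_transverse_def)
      then have "c' (f d) = c d" if "d \<in> darts D" for d
        using dissection_pair.colouring_of_iso[OF pair[OF f(1)] _ that] D(2) E(2) f(2) by metis
      then show "(x, y) \<in> schnyder_iso_rel"
        using f(1) xD yE by (auto simp: schnyder_iso_rel_def)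
    qed
  qed
  then show ?thesis unfolding schnyder_labelings_def s_transverse_orientations_def .
qed

end
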